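(* Let the data satisfy $u^0\in D(A^2)$, $v^0\in D(A^{3/2})$, $f(0)\in D(A)$, $f_t(0)\in D(A^{1/2})$, $f_{tt}(0)\in L^2(\Omega)$, $f,f_t,f_{tt},f_{ttt}\in L^2(0,T;L^2(\Omega))$, so that the weak solution $u$ of the biharmonic wave problem has $u,u_t,u_{tt}\in L^\infty(0,T;H^{2+\gamma_0}(\Omega))$ and $u_{tt},u_{ttt},u_{tttt}\in L^\infty(0,T;L^2(\Omega))$. Let $U^0,\dots,U^N\in V_h$ be given by the implicit scheme $U^0=\mathcal R_hu^0$, $$2k^{-1}(\bar\partial_tU^{1/2},v_h)+a_h(U^{1/2},v_h)=(f^{1/2}+2k^{-1}v^0,v_h)\quad\text{for all }v_h\in V_h,$$ $$(\bar\partial_t^2U^n,v_h)+a_h(U^{n,1/4},v_h)=(f^{n,1/4},v_h)\quad\text{for all }v_h\in V_h,\ n=1,\dots,N-1 .$$ Then there is a constant $C>0$, independent of $h$ and $k$, such that for $1\le m\le N-1$ $$\|u^{m+1}-U^{m+1}\|\le C\big(h^{2\gamma_0}L_{(f,u)}+k^2M_{(u)}\big),$$ where $$L_{(f,u)}=\|f\|_{L^\infty(L^2)}+\|f_t\|_{L^2(L^2)}+\|u\|_{L^\infty(H^{2+\gamma_0})}+\|u_t\|_{L^\infty(H^{2+\gamma_0})}+\|u_{tt}\|_{L^\infty(L^2)}+\|u_{tt}\|_{L^2(H^{2+\gamma_0})}+\|u_{ttt}\|_{L^2(L^2)},$$ $$M_{(u)}=\|u_{ttt}\|_{L^\infty(L^2)}+\|u_{tttt}\|_{L^2(L^2)}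 .$$
   Context: Time grid: $N$ is a positive integer, $k=T/N$, $t_n=nk$. For a function of time $\phi$ (or a sequence $\phi^n$): $\phi^n=\phi(t_n)$, $\phi^{n+1/2}=\frac12(\phi^{n+1}+\phi^n)$, $\phi^{n,1/4}=\frac14(\phi^{n+1}+2\phi^n+\phi^{n-1})$, $\bar\partial_t\phi^{n+1/2}=(\phi^{n+1}-\phi^n)/k$, $\bar\partial_t^2\phi^n=(\phi^{n+1}-2\phi^n+\phi^{n-1})/k^2$. $\Omega\subset\mathbb R^2$ is a bounded polygonal Lipschitz domain, $T>0$; $(\cdot,\cdot)$ and $\|\cdot\|$ are the $L^2(\Omega)$ inner product and norm; $a(w,v)=\int_\Omega D^2w:D^2v\,dx$; $L^p(X)$ abbreviates $L^p(0,T;X)$ with $X=L^2(\Omega)$ or $H^{2+\gamma_0}(\Omega)$. The weak solution $u\in C^0([0,T];H^2_0(\Omega))\cap C^1([0,T];L^2(\Omega))$ satisfies $(u_{tt},v)+a(u,v)=(f,v)$ for all $v\in H^2_0(\Omega)$, $u(0)=u^0$, $u_t(0)=v^0$. $A\psi=\Delta^2\psi$ with $D(A)=\{\psi\in H^2_0(\Omega):\Delta^2\psi\in L^2(\Omega)\}$, and $D(A^r)=\{w\in L^2(\Omega):\sum_n\lambda_n^{2r}|(w,\psi_n)|^2<\infty\}$, where $(\lambda_n,\psi_n)$ are the eigenpairs of $A$, with $\{\psi_n\}$ an orthonormal basis of $L^2(\Omega)$. $\gamma_0\in(1/2,1]$ is the elliptic regularity index of the clamped biharmonic operator; $D(A)\subset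 H^{2+\gamma_0}(\Omega)$ continuously. Mesh: $\mathcal T$ is a shape-regular triangulation of $\overline\Omega$ (not necessarily quasi-uniform) with mesh-size $h=\max_{K\in\mathcal T}\mathrm{diam}(K)$, edges $\mathcal E$, vertices $\mathcal V$; $\mathcal V(e)$ is the set of endpoints of edge $e$ and $h_e$ its length; $[\![\cdot]\!]$ is the jump across an interior edge and the trace on a boundary edge; $\{\!\{\cdot\}\!\}$ is the average across an interior edge; $H^m(\mathcal T)$ is the space of piecewise $H^m$ functions; $P_r(\mathcal T)$ is the space of piecewise polynomials of degree at most $r$. Discrete space and form: $\mathrm M(\mathcal T)\subset P_2(\mathcal T)$ is the Morley space: piecewise quadratics continuous at interior vertices, with normal derivatives continuous at midpoints of interior edges, vanishing at boundary vertices and with normal derivatives vanishing at midpoints of boundary edges. $V_h\subset H^2(\mathcal T)$ is a finite-dimensional subspace; on $H^2_0(\Omega)+V_h$ one uses $$\|v\|_h^2=\sum_{K\in\mathcal T}|v|_{H^2(K)}^2+\sum_{e\in\mathcal E}\sum_{z\in\mathcal V(e)}h_e^{-2}\big|[\![v]\!](z)\big|^2+\sum_{e\in\mathcal E}\Big|\frac1{h_e}\int_e\Big[\!\Big[\frac{\partial v}{\partial n}\Big]\!\Big]ds\Big|^2 ,$$ and $a_h$ is a symmetric bilinear form on $V_h+\mathrm M(\mathcal T)$ such that, for all $w_h,v_h\in V_h$, $\alpha\|w_h\|_h^2\le a_h(w_h,w_h)$ and $a_h(w_h,v_h)\le\beta\|w_h\|_h\|v_h\|_h$ with constants $\alpha,\beta>0$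 independent of $h$. (The Morley, quadratic discontinuous Galerkin and quadratic $C^0$ interior penalty methods are instances.) Smoother: $I_{\mathrm M}:H^2(\mathcal T)\to\mathrm M(\mathcal T)$ is the extended Morley interpolation: at each interior vertex $z$, $(I_{\mathrm M}v)(z)$ is the average of the values $(v|_K)(z)$ over the triangles $K$ containing $z$, and on each interior edge $\int_e\partial_n(I_{\mathrm M}v)\,ds=\int_e\{\!\{\partial_nv\}\!\}\,ds$ (boundary degrees of freedom vanish). $J:\mathrm M(\mathcal T)\to H^2_0(\Omega)$ is a fixed linear companion operator, with values in the sum of the Hsieh–Clough–Tocher space and $P_8(\mathcal T)$, such that for $w\in\mathrm M(\mathcal T)$: $Jw=w$ at all vertices, $\nabla(Jw)(z)$ is the average of $(\nabla w|_K)(z)$ over the triangles $K$ containing $z$ at every interior vertex $z$, and $\int_e\partial_n(Jw)\,ds=\int_e\partial_nw\,ds$ for every edge $e$. $Q:=J I_{\mathrm M}:V_h\to H^2_0(\Omega)$ satisfies, with $C_1>0$ independent of $h$, $$\|v_h-Qv_h\|_{H^s(\mathcal T)}\le C_1h^{2-s}\min_{v\in H^2_0(\Omega)}\|v-v_h\|_h,\qquad v_h\in V_h,\ 0\le s\le2 .$$ Modified Ritz projection $\mathcal R_h:H^2_0(\Omega)\to V_h$: $a_h(\mathcal R_hw,v_h)=a(w,Qv_h)$ for all $v_h\in V_h$. It satisfies, with $C_2>0$ independent of $h$, $\|v-\mathcal R_hv\|+h^{\gamma_0}\|v-\mathcal R_hv\|_h\le C_2h^{2\gamma_0}\|v\|_{H^{2+\gamma_0}(\Omega)}$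 for all $v\in H^2_0(\Omega)\cap H^{2+\gamma_0}(\Omega)$. The constant $C$ of the claim may depend on $\Omega,\gamma_0,\alpha,\beta,T,C_1,C_2$. *)

theory Defs
  imports "HOL-Analysis.Analysis" "HOL-Probability.Essential_Supremum"
begin

text \<open>
  Elements of function spaces over a set \<open>S\<close> are represented by total functions, which count as
  equal if they agree almost everywhere on \<open>S\<close>. All definitions below are invariant under
  changing such a representative.
\<close>

type_synonym fn = "real^2 \<Rightarrow> real"

definition aeq :: "'a::euclidean_space set \<Rightarrow> ('a \<Rightarrow> real) \<Rightarrow> ('a \<Rightarrow> real) \<Rightarrow> bool" where
  "aeq S v w \<longleftrightarrow> (AE x in lebesgue_on S. v x = w x)"


section \<open>Domains\<close>

definition lipschitz_domain :: "(real^2) set \<Rightarrow> bool" where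
  "lipschitz_domain \<Omega> \<longleftrightarrow> open \<Omega> \<and> connected \<Omega> \<and> bounded \<Omega> \<and> \<Omega> \<noteq> {} \<and>
     (\<forall>x\<in>frontier \<Omega>. \<exists>a b r L. \<exists>g::real \<Rightarrow> real.
        norm a = 1 \<and> norm b = 1 \<and> a \<bullet> b = 0 \<and> r > 0 \<and> L-lipschitz_on UNIV g \<and>
        \<Omega> \<inter> ball x r = {y \<in> ball x r. y \<bullet> b > g (y \<bullet> a)})"

definition polygonal :: "(real^2) set \<Rightarrow> bool" where
  "polygonal \<Omega> \<longleftrightarrow> (\<exists>\<S>. finite \<S> \<and> (\<forall>s\<in>\<S>. \<exists>p q. s = closed_segment p q) \<and> frontier \<Omega> = \<Union>\<S>)"


section \<open>Lebesgue and Sobolev spaces\<close>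

definition L2 :: "'a::euclidean_space set \<Rightarrow> ('a \<Rightarrow> real) set" where
  "L2 S = {v \<in> borel_measurable (lebesgue_on S). integrable (lebesgue_on S) (\<lambda>x. (v x)\<^sup>2)}"

definition ip :: "'a::euclidean_space set \<Rightarrow> ('a \<Rightarrow> real) \<Rightarrow> ('a \<Rightarrow> real) \<Rightarrow> real" where
  "ip S v w = (LINT x|lebesgue_on S. v x * w x)"

definition l2norm :: "'a::euclidean_space set \<Rightarrow> ('a \<Rightarrow> real) \<Rightarrow> real" where
  "l2norm S v = sqrt (ip S v v)"

definition ddir :: "'a::euclidean_space \<Rightarrow> ('a \<Rightarrow> real) \<Rightarrow> 'a \<Rightarrow> real" where
  "ddir b \<phi> = (\<lambda>x. frechet_derivative \<phi> (at x) b)"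

definition smooth :: "('a::euclidean_space \<Rightarrow> real) \<Rightarrow> bool" where
  "smooth \<phi> \<longleftrightarrow> (\<forall>bs. set bs \<subseteq> Basis \<longrightarrow> foldr ddir bs \<phi> differentiable_on UNIV)"

text \<open>\<open>C\<^sub>c\<^sup>\<infinity>(S)\<close>, extended by zero\<close>

definition test_fun :: "'a::euclidean_space set \<Rightarrow> ('a \<Rightarrow> real) set" where
  "test_fun S = {\<phi>. smooth \<phi> \<and> compact (closure {x. \<phi> x \<noteq> 0}) \<and> closure {x. \<phi> x \<noteq> 0} \<subseteq> S}"

definition pderiv2 :: "nat \<times> nat \<Rightarrow> fn \<Rightarrow> fn" where
  "pderiv2 \<mu> \<phi> = (ddir (axis 1 1) ^^ fst \<mu>) ((ddir (axis 2 1) ^^ snd \<mu>) \<phi>)"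

definition loc_integrable :: "(real^2) set \<Rightarrow> fn \<Rightarrow> bool" where
  "loc_integrable S v \<longleftrightarrow> (\<forall>K. compact K \<and> K \<subseteq> S \<longrightarrow> integrable (lebesgue_on K) v)"

definition is_wderiv :: "(real^2) set \<Rightarrow> nat \<times> nat \<Rightarrow> fn \<Rightarrow> fn \<Rightarrow> bool" where
  "is_wderiv S \<mu> v g \<longleftrightarrow> loc_integrable S v \<and> loc_integrable S g \<and>
     (\<forall>\<phi>\<in>test_fun S. ip S v (pderiv2 \<mu> \<phi>) = (- 1) ^ (fst \<mu> + snd \<mu>) * ip S g \<phi>)"

definition wderiv :: "(real^2) set \<Rightarrow> nat \<times> nat \<Rightarrow> fn \<Rightarrow> fn" where
  "wderiv S \<mu> v = (SOME g. is_wderiv S \<mu> v g)"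

definition Hm :: "nat \<Rightarrow> (real^2) set \<Rightarrow> fn set" where
  "Hm m S = {v \<in> L2 S. \<forall>\<mu>. fst \<mu> + snd \<mu> \<le> m \<longrightarrow> (\<exists>g\<in>L2 S. is_wderiv S \<mu> v g)}"

definition slobodeckij_quot :: "real \<Rightarrow> fn \<Rightarrow> (real^2) \<times> (real^2) \<Rightarrow> real" where
  "slobodeckij_quot \<sigma> g = (\<lambda>(x, y). (g x - g y)\<^sup>2 / norm (x - y) powr (2 + 2 * \<sigma>))"

definition Hs :: "real \<Rightarrow> (real^2) set \<Rightarrow> fn set" where
  "Hs s S = {v \<in> Hm (nat \<lfloor>s\<rfloor>) S. frac s \<noteq> 0 \<longrightarrow>
      (\<forall>\<mu>. fst \<mu> + snd \<mu> = nat \<lfloor>s\<rfloor> \<longrightarrow>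
         integrable (lebesgue_on S \<Otimes>\<^sub>M lebesgue_on S) (slobodeckij_quot (frac s) (wderiv S \<mu> v)))}"

text \<open>
  Sobolev-Slobodeckij norm. The factor \<open>1 - frac s\<close> only changes the norm to an equivalent one
  for each fixed \<open>s\<close>. Without it the seminorm blows up as \<open>s\<close> increases to an integer, and no
  estimate in \<open>H\<^sup>s\<close> could hold with one constant for all \<open>s\<close> in \<open>[0,2]\<close>.
\<close>

definition Hs_norm :: "real \<Rightarrow> (real^2) set \<Rightarrow> fn \<Rightarrow> real" where
  "Hs_norm s S v = sqrt
     ((\<Sum>\<mu> | fst \<mu> + snd \<mu> \<le> nat \<lfloor>s\<rfloor>. (l2norm S (wderiv S \<mu> v))\<^sup>2) +
      (if frac s = 0 then 0 else (1 - frac s) * (\<Sum>\<mu> | fst \<mu> + snd \<mu> = nat \<lfloor>s\<rfloor>.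
         (LINT p|(lebesgue_on S \<Otimes>\<^sub>M lebesgue_on S). slobodeckij_quot (frac s) (wderiv S \<mu> v) p))))"

definition H20 :: "(real^2) set \<Rightarrow> fn set" where
  "H20 \<Omega> = {v \<in> Hm 2 \<Omega>. \<forall>\<epsilon>>0. \<exists>\<phi>\<in>test_fun \<Omega>. Hs_norm 2 \<Omega> (\<lambda>x. v x - \<phi> x) < \<epsilon>}"

text \<open>\<open>\<integral>\<^sub>S D\<^sup>2w : D\<^sup>2v dx\<close>\<close>

definition hess_form :: "(real^2) set \<Rightarrow> fn \<Rightarrow> fn \<Rightarrow> real" where
  "hess_form S w v = ip S (wderiv S (2,0) w) (wderiv S (2,0) v)
     + 2 * ip S (wderiv S (1,1) w) (wderiv S (1,1) v)
     + ip S (wderiv S (0,2) w) (wderiv S (0,2) v)"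


section \<open>The clamped biharmonic operator\<close>

definition laplacian :: "fn \<Rightarrow> fn" where
  "laplacian \<phi> = (\<lambda>x. pderiv2 (2,0) \<phi> x + pderiv2 (0,2) \<phi> x)"

text \<open>\<open>\<Delta>\<^sup>2\<psi> = g\<close> in the sense of distributions on \<open>\<Omega>\<close>, with \<open>g\<close> square integrable\<close>

definition is_bilaplacian :: "(real^2) set \<Rightarrow> fn \<Rightarrow> fn \<Rightarrow> bool" where
  "is_bilaplacian \<Omega> \<psi> g \<longleftrightarrow> g \<in> L2 \<Omega> \<and>
     (\<forall>\<phi>\<in>test_fun \<Omega>. ip \<Omega> \<psi> (laplacian (laplacian \<phi>)) = ip \<Omega> g \<phi>)"

definition DA :: "(real^2) set \<Rightarrow> fn set" where
  "DA \<Omega> = {\<psi> \<in> H20 \<Omega>. \<exists>g. is_bilaplacian \<Omega> \<psi> g}"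

definition eigenbasis :: "(real^2) set \<Rightarrow> (nat \<Rightarrow> real) \<Rightarrow> (nat \<Rightarrow> fn) \<Rightarrow> bool" where
  "eigenbasis \<Omega> lam \<psi> \<longleftrightarrow>
     (\<forall>n. \<psi> n \<in> DA \<Omega> \<and> is_bilaplacian \<Omega> (\<psi> n) (\<lambda>x. lam n * \<psi> n x)) \<and>
     (\<forall>m n. ip \<Omega> (\<psi> m) (\<psi> n) = (if m = n then 1 else 0)) \<and>
     (\<forall>w\<in>L2 \<Omega>. (\<lambda>n. l2norm \<Omega> (\<lambda>x. w x - (\<Sum>i<n. ip \<Omega> w (\<psi> i) * \<psi> i x))) \<longlonglongrightarrow> 0)"

definition DAr :: "(real^2) set \<Rightarrow> (nat \<Rightarrow> real) \<Rightarrow> (nat \<Rightarrow> fn) \<Rightarrow> real \<Rightarrow> fn set" where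
  "DAr \<Omega> lam \<psi> r = {w \<in> L2 \<Omega>. summable (\<lambda>n. lam n powr (2 * r) * (ip \<Omega> w (\<psi> n))\<^sup>2)}"

text \<open>Continuity of the embedding of \<open>D(A)\<close>, with the graph norm, into \<open>H\<^sup>2\<^sup>+\<^sup>\<gamma>(\<Omega>)\<close>\<close>

definition elliptic_regularity :: "(real^2) set \<Rightarrow> real \<Rightarrow> bool" where
  "elliptic_regularity \<Omega> \<gamma> \<longleftrightarrow> (\<exists>c. \<forall>\<psi>\<in>H20 \<Omega>. \<forall>g. is_bilaplacian \<Omega> \<psi> g \<longrightarrow>
     \<psi> \<in> Hs (2 + \<gamma>) \<Omega> \<and> Hs_norm (2 + \<gamma>) \<Omega> \<psi> \<le> c * (l2norm \<Omega> \<psi> + l2norm \<Omega> g))"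


section \<open>Functions of time with values in a function space\<close>

text \<open>
  A space is given by its carrier \<open>X\<close> and norm \<open>nrm\<close>.
\<close>

definition time_cont :: "real \<Rightarrow> fn set \<Rightarrow> (fn \<Rightarrow> real) \<Rightarrow> (real \<Rightarrow> fn) \<Rightarrow> bool" where
  "time_cont T X nrm w \<longleftrightarrow> (\<forall>t\<in>{0..T}. w t \<in> X) \<and>
     (\<forall>t\<in>{0..T}. ((\<lambda>s. nrm (\<lambda>x. w s x - w t x)) \<longlongrightarrow> 0) (at t within {0..T}))"

definition time_deriv :: "real \<Rightarrow> (fn \<Rightarrow> real) \<Rightarrow> (real \<Rightarrow> fn) \<Rightarrow> (real \<Rightarrow> fn) \<Rightarrow> bool" where
  "time_deriv T nrm w w' \<longleftrightarrow> (\<forall>t\<in>{0..T}.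
     ((\<lambda>s. nrm (\<lambda>x. (w s x - w t x) / (s - t) - w' t x)) \<longlongrightarrow> 0) (at t within {0..T}))"

definition strongly_measurable :: "real \<Rightarrow> fn set \<Rightarrow> (fn \<Rightarrow> real) \<Rightarrow> (real \<Rightarrow> fn) \<Rightarrow> bool" where
  "strongly_measurable T X nrm w \<longleftrightarrow> (\<exists>s.
     (\<forall>n::nat. simple_function (lebesgue_on {0..T}) (s n) \<and> (\<forall>t\<in>{0..T}. s n t \<in> X)) \<and>
     (AE t in lebesgue_on {0..T}. w t \<in> X \<and> (\<lambda>n. nrm (\<lambda>x. w t x - s n t x)) \<longlonglongrightarrow> 0))"

definition Linf_norm :: "real \<Rightarrow> (fn \<Rightarrow> real) \<Rightarrow> (real \<Rightarrow> fn) \<Rightarrow> real" where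
  "Linf_norm T nrm w = real_of_ereal (esssup (lebesgue_on {0..T}) (\<lambda>t. ereal (nrm (w t))))"

definition Linf_time :: "real \<Rightarrow> fn set \<Rightarrow> (fn \<Rightarrow> real) \<Rightarrow> (real \<Rightarrow> fn) set" where
  "Linf_time T X nrm = {w. strongly_measurable T X nrm w \<and>
     esssup (lebesgue_on {0..T}) (\<lambda>t. ereal (nrm (w t))) < \<infinity>}"

definition L2_time_norm :: "real \<Rightarrow> (fn \<Rightarrow> real) \<Rightarrow> (real \<Rightarrow> fn) \<Rightarrow> real" where
  "L2_time_norm T nrm w = sqrt (LINT t|lebesgue_on {0..T}. (nrm (w t))\<^sup>2)"

definition L2_time :: "real \<Rightarrow> fn set \<Rightarrow> (fn \<Rightarrow> real) \<Rightarrow> (real \<Rightarrow> fn) set" where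
  "L2_time T X nrm = {w. strongly_measurable T X nrm w \<and>
     integrable (lebesgue_on {0..T}) (\<lambda>t. (nrm (w t))\<^sup>2)}"

text \<open>
  Weak time derivative of an \<open>L\<^sup>2(\<Omega>)\<close>-valued function: the identity
  \<open>\<integral> \<phi>' w dt = - \<integral> \<phi> w' dt\<close> of Bochner integrals, tested against the elements of \<open>L\<^sup>2(\<Omega>)\<close>.
\<close>

definition weak_time_deriv :: "(real^2) set \<Rightarrow> real \<Rightarrow> (real \<Rightarrow> fn) \<Rightarrow> (real \<Rightarrow> fn) \<Rightarrow> bool" where
  "weak_time_deriv \<Omega> T w w' \<longleftrightarrow> (\<forall>v\<in>L2 \<Omega>. \<forall>\<phi>\<in>test_fun {0<..<T}.
     (LINT t|lebesgue_on {0..T}. deriv \<phi> t * ip \<Omega> (w t) v)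
       = - (LINT t|lebesgue_on {0..T}. \<phi> t * ip \<Omega> (w' t) v))"

text \<open>
  The term \<open>(u\<^sub>t\<^sub>t, v)\<close> of the weak formulation is the distributional derivative on \<open>(0,T)\<close> of the
  continuous function \<open>t \<mapsto> (u\<^sub>t(t), v)\<close>.
\<close>

definition weak_solution ::
  "(real^2) set \<Rightarrow> real \<Rightarrow> (real \<Rightarrow> fn) \<Rightarrow> fn \<Rightarrow> fn \<Rightarrow> (real \<Rightarrow> fn) \<Rightarrow> (real \<Rightarrow> fn) \<Rightarrow> bool" where
  "weak_solution \<Omega> T f u0 v0 u ut \<longleftrightarrow>
     time_cont T (H20 \<Omega>) (Hs_norm 2 \<Omega>) u \<and>
     time_cont T (L2 \<Omega>) (l2norm \<Omega>) ut \<and> time_deriv T (l2norm \<Omega>) u ut \<and>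
     (\<forall>v\<in>H20 \<Omega>. \<forall>\<phi>\<in>test_fun {0<..<T}.
        - (LINT t|lebesgue_on {0..T}. deriv \<phi> t * ip \<Omega> (ut t) v)
          + (LINT t|lebesgue_on {0..T}. \<phi> t * hess_form \<Omega> (u t) v)
        = (LINT t|lebesgue_on {0..T}. \<phi> t * ip \<Omega> (f t) v)) \<and>
     aeq \<Omega> (u 0) u0 \<and> aeq \<Omega> (ut 0) v0"


section \<open>Meshes\<close>

type_synonym mesh = "(real^2) set set"

definition mesh_of :: "(real^2) set \<Rightarrow> mesh \<Rightarrow> bool" where
  "mesh_of \<Omega> \<T> \<longleftrightarrow> triangulation \<T> \<and> (\<forall>K\<in>\<T>. 2 simplex K) \<and> \<Union>\<T> = closure \<Omega>"

definition shape_regular :: "real \<Rightarrow> mesh \<Rightarrow> bool" where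
  "shape_regular \<kappa> \<T> \<longleftrightarrow> (\<forall>K\<in>\<T>. \<exists>x. cball x (diameter K / \<kappa>) \<subseteq> K)"

definition mesh_size :: "mesh \<Rightarrow> real" where
  "mesh_size \<T> = Max (diameter ` \<T>)"

definition verts :: "(real^2) set \<Rightarrow> (real^2) set" where
  "verts S = {z. z extreme_point_of S}"

definition mesh_verts :: "mesh \<Rightarrow> (real^2) set" where
  "mesh_verts \<T> = (\<Union>K\<in>\<T>. verts K)"

definition mesh_edges :: "mesh \<Rightarrow> (real^2) set set" where
  "mesh_edges \<T> = {e. \<exists>K\<in>\<T>. e facet_of K}"

definition edge_tris :: "mesh \<Rightarrow> (real^2) set \<Rightarrow> (real^2) set set" where
  "edge_tris \<T> e = {K\<in>\<T>. e facet_of K}"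

definition vert_tris :: "mesh \<Rightarrow> real^2 \<Rightarrow> (real^2) set set" where
  "vert_tris \<T> z = {K\<in>\<T>. z \<in> K}"

text \<open>An edge is interior if it is shared by two triangles and lies on the boundary otherwise.\<close>

definition interior_edge :: "mesh \<Rightarrow> (real^2) set \<Rightarrow> bool" where
  "interior_edge \<T> e \<longleftrightarrow> e \<in> mesh_edges \<T> \<and> card (edge_tris \<T> e) = 2"

definition edge_param :: "(real^2) set \<Rightarrow> real \<Rightarrow> real^2" where
  "edge_param e = (SOME \<gamma>. \<exists>p q. e = closed_segment p q \<and> \<gamma> = linepath p q)"

definition edge_mid :: "(real^2) set \<Rightarrow> real^2" where
  "edge_mid e = edge_param e (1/2)"

definition edge_normal :: "(real^2) set \<Rightarrow> real^2" where
  "edge_normal e = (SOME n. norm n = 1 \<and> (\<forall>x\<in>e. \<forall>y\<in>e. n \<bullet> (x - y) = 0))"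

definition edge_int :: "(real^2) set \<Rightarrow> fn \<Rightarrow> real" where
  "edge_int e g = diameter e * (LINT t|lebesgue_on {0..1}. g (edge_param e t))"

text \<open>Value at \<open>z\<close> of the continuous representative of \<open>v\<close> on the closed set \<open>S\<close>\<close>

definition pt_val :: "(real^2) set \<Rightarrow> fn \<Rightarrow> real^2 \<Rightarrow> real" where
  "pt_val S v z = (THE c. \<exists>g. continuous_on S g \<and> aeq (interior S) g v \<and> g z = c)"

text \<open>\<open>g\<close> is the trace on the edge \<open>e\<close> of the function \<open>w \<in> H\<^sup>1(K)\<close>\<close>

definition is_trace :: "(real^2) set \<Rightarrow> (real^2) set \<Rightarrow> fn \<Rightarrow> fn \<Rightarrow> bool" where
  "is_trace K e w g \<longleftrightarrow> (g \<circ> edge_param e) \<in> L2 {0..1} \<and>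
     (\<exists>\<phi>. (\<forall>n::nat. smooth (\<phi> n)) \<and>
        (\<lambda>n. Hs_norm 1 (interior K) (\<lambda>x. w x - \<phi> n x)) \<longlonglongrightarrow> 0 \<and>
        (\<lambda>n. edge_int e (\<lambda>x. (g x - \<phi> n x)\<^sup>2)) \<longlonglongrightarrow> 0)"

definition edge_trace :: "(real^2) set \<Rightarrow> (real^2) set \<Rightarrow> fn \<Rightarrow> fn" where
  "edge_trace K e w = (SOME g. is_trace K e w g)"

definition normal_trace :: "(real^2) set \<Rightarrow> (real^2) set \<Rightarrow> fn \<Rightarrow> fn" where
  "normal_trace K e v = (\<lambda>x.
     edge_normal e $ 1 * edge_trace K e (wderiv (interior K) (1,0) v) x +
     edge_normal e $ 2 * edge_trace K e (wderiv (interior K) (0,1) v) x)"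

definition normal_deriv_at :: "(real^2) set \<Rightarrow> (real^2) set \<Rightarrow> fn \<Rightarrow> real^2 \<Rightarrow> real" where
  "normal_deriv_at K e v z =
     edge_normal e $ 1 * pt_val K (wderiv (interior K) (1,0) v) z +
     edge_normal e $ 2 * pt_val K (wderiv (interior K) (0,1) v) z"

text \<open>
  Jump and average of a quantity with one-sided values \<open>F K\<close>. The sign of the jump depends on a
  choice of the order of the two triangles; only absolute values of jumps are used.
\<close>

definition edge_jump :: "mesh \<Rightarrow> (real^2) set \<Rightarrow> ((real^2) set \<Rightarrow> real) \<Rightarrow> real" where
  "edge_jump \<T> e F = (if interior_edge \<T> e
     then (case (SOME (K, K'). K \<noteq> K' \<and> edge_tris \<T> e = {K, K'}) of (K, K') \<Rightarrow> F K - F K')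
     else F (THE K. edge_tris \<T> e = {K}))"

definition edge_avg :: "mesh \<Rightarrow> (real^2) set \<Rightarrow> ((real^2) set \<Rightarrow> real) \<Rightarrow> real" where
  "edge_avg \<T> e F = (\<Sum>K\<in>edge_tris \<T> e. F K) / 2"

definition vert_avg :: "mesh \<Rightarrow> real^2 \<Rightarrow> ((real^2) set \<Rightarrow> real) \<Rightarrow> real" where
  "vert_avg \<T> z F = (\<Sum>K\<in>vert_tris \<T> z. F K) / real (card (vert_tris \<T> z))"


section \<open>Piecewise function spaces\<close>

definition H2_mesh :: "mesh \<Rightarrow> fn set" where
  "H2_mesh \<T> = {v. \<forall>K\<in>\<T>. v \<in> Hm 2 (interior K)}"

definition Hs_mesh_norm :: "real \<Rightarrow> mesh \<Rightarrow> fn \<Rightarrow> real" where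
  "Hs_mesh_norm s \<T> v = sqrt (\<Sum>K\<in>\<T>. (Hs_norm s (interior K) v)\<^sup>2)"

definition h_norm :: "mesh \<Rightarrow> fn \<Rightarrow> real" where
  "h_norm \<T> v = sqrt
     ((\<Sum>K\<in>\<T>. hess_form (interior K) v v)
      + (\<Sum>e\<in>mesh_edges \<T>. \<Sum>z\<in>verts e. (edge_jump \<T> e (\<lambda>K. pt_val K v z))\<^sup>2 / (diameter e)\<^sup>2)
      + (\<Sum>e\<in>mesh_edges \<T>.
           (1 / diameter e * edge_int e (\<lambda>x. edge_jump \<T> e (\<lambda>K. normal_trace K e v x)))\<^sup>2))"

definition is_poly_on :: "nat \<Rightarrow> (real^2) set \<Rightarrow> fn \<Rightarrow> bool" where
  "is_poly_on r S v \<longleftrightarrow> (\<exists>c::nat \<times> nat \<Rightarrow> real.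
     aeq S v (\<lambda>x. \<Sum>\<mu> | fst \<mu> + snd \<mu> \<le> r. c \<mu> * (x $ 1) ^ fst \<mu> * (x $ 2) ^ snd \<mu>))"

definition Pr_mesh :: "nat \<Rightarrow> mesh \<Rightarrow> fn set" where
  "Pr_mesh r \<T> = {v. \<forall>K\<in>\<T>. is_poly_on r (interior K) v}"

definition Morley :: "(real^2) set \<Rightarrow> mesh \<Rightarrow> fn set" where
  "Morley \<Omega> \<T> = {v \<in> Pr_mesh 2 \<T>.
     (\<forall>z\<in>mesh_verts \<T> \<inter> \<Omega>. \<forall>K\<in>vert_tris \<T> z. \<forall>K'\<in>vert_tris \<T> z. pt_val K v z = pt_val K' v z) \<and>
     (\<forall>z\<in>mesh_verts \<T> - \<Omega>. \<forall>K\<in>vert_tris \<T> z. pt_val K v z = 0) \<and>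
     (\<forall>e\<in>mesh_edges \<T>. interior_edge \<T> e \<longrightarrow> (\<forall>K\<in>edge_tris \<T> e. \<forall>K'\<in>edge_tris \<T> e.
        normal_deriv_at K e v (edge_mid e) = normal_deriv_at K' e v (edge_mid e))) \<and>
     (\<forall>e\<in>mesh_edges \<T>. \<not> interior_edge \<T> e \<longrightarrow> (\<forall>K\<in>edge_tris \<T> e.
        normal_deriv_at K e v (edge_mid e) = 0))}"

text \<open>
  Hsieh-Clough-Tocher space with clamped boundary conditions: piecewise cubics with respect to the
  subdivision of each triangle through its centroid. The \<open>C\<^sup>1\<close> condition is contained in \<open>H\<^sup>2\<close>.
\<close>

definition HCT :: "(real^2) set \<Rightarrow> mesh \<Rightarrow> fn set" where
  "HCT \<Omega> \<T> = {v \<in> H20 \<Omega>. \<forall>K\<in>\<T>. \<forall>e. e facet_of K \<longrightarrow>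
     is_poly_on 3 (interior (convex hull (insert ((1/3) *\<^sub>R (\<Sum>z\<in>verts K. z)) e))) v}"

definition fn_sum :: "fn set \<Rightarrow> fn set \<Rightarrow> fn set" where
  "fn_sum V W = {(\<lambda>x. v x + w x) | v w. v \<in> V \<and> w \<in> W}"

definition fin_dim_subspace :: "fn set \<Rightarrow> bool" where
  "fin_dim_subspace V \<longleftrightarrow> (\<exists>B. finite B \<and> V = {v. \<exists>c. v = (\<lambda>x. \<Sum>b\<in>B. c b * b x)})"


section \<open>Discrete form, smoother and Ritz projection\<close>

definition sym_bilinear_on :: "(real^2) set \<Rightarrow> fn set \<Rightarrow> (fn \<Rightarrow> fn \<Rightarrow> real) \<Rightarrow> bool" where
  "sym_bilinear_on \<Omega> W b \<longleftrightarrow>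
     (\<forall>v\<in>W. \<forall>w\<in>W. b v w = b w v) \<and>
     (\<forall>v\<in>W. \<forall>w\<in>W. \<forall>z\<in>W. \<forall>r s. b (\<lambda>x. r * v x + s * w x) z = r * b v z + s * b w z) \<and>
     (\<forall>v\<in>W. \<forall>v'\<in>W. \<forall>w\<in>W. aeq \<Omega> v v' \<longrightarrow> b v w = b v' w)"

definition discrete_form ::
  "(real^2) set \<Rightarrow> mesh \<Rightarrow> real \<Rightarrow> real \<Rightarrow> fn set \<Rightarrow> (fn \<Rightarrow> fn \<Rightarrow> real) \<Rightarrow> bool" where
  "discrete_form \<Omega> \<T> \<alpha> \<beta> Vh ah \<longleftrightarrow>
     sym_bilinear_on \<Omega> (fn_sum Vh (Morley \<Omega> \<T>)) ah \<and>
     (\<forall>w\<in>Vh. \<alpha> * (h_norm \<T> w)\<^sup>2 \<le> ah w w) \<and>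
     (\<forall>w\<in>Vh. \<forall>v\<in>Vh. ah w v \<le> \<beta> * h_norm \<T> w * h_norm \<T> v)"

definition morley_interpolation :: "(real^2) set \<Rightarrow> mesh \<Rightarrow> (fn \<Rightarrow> fn) \<Rightarrow> bool" where
  "morley_interpolation \<Omega> \<T> IM \<longleftrightarrow> (\<forall>v\<in>H2_mesh \<T>. IM v \<in> Morley \<Omega> \<T> \<and>
     (\<forall>z\<in>mesh_verts \<T> \<inter> \<Omega>. \<forall>K\<in>vert_tris \<T> z.
        pt_val K (IM v) z = vert_avg \<T> z (\<lambda>K'. pt_val K' v z)) \<and>
     (\<forall>e\<in>mesh_edges \<T>. interior_edge \<T> e \<longrightarrow> (\<forall>K\<in>edge_tris \<T> e.
        edge_int e (normal_trace K e (IM v))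
          = edge_int e (\<lambda>x. edge_avg \<T> e (\<lambda>K'. normal_trace K' e v x)))))"

definition companion :: "(real^2) set \<Rightarrow> mesh \<Rightarrow> (fn \<Rightarrow> fn) \<Rightarrow> bool" where
  "companion \<Omega> \<T> J \<longleftrightarrow>
     (\<forall>v\<in>Morley \<Omega> \<T>. \<forall>w\<in>Morley \<Omega> \<T>. aeq \<Omega> v w \<longrightarrow> aeq \<Omega> (J v) (J w)) \<and>
     (\<forall>v\<in>Morley \<Omega> \<T>. \<forall>w\<in>Morley \<Omega> \<T>. \<forall>r s.
        aeq \<Omega> (J (\<lambda>x. r * v x + s * w x)) (\<lambda>x. r * J v x + s * J w x)) \<and>
     (\<forall>w\<in>Morley \<Omega> \<T>. J w \<in> H20 \<Omega> \<and> J w \<in> fn_sum (HCT \<Omega> \<T>) (Pr_mesh 8 \<T>) \<and>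
        (\<forall>z\<in>mesh_verts \<T>. \<forall>K\<in>vert_tris \<T> z. pt_val (closure \<Omega>) (J w) z = pt_val K w z) \<and>
        (\<forall>z\<in>mesh_verts \<T> \<inter> \<Omega>. \<forall>\<mu>\<in>{(1,0), (0,1)}.
           pt_val (closure \<Omega>) (wderiv \<Omega> \<mu> (J w)) z
             = vert_avg \<T> z (\<lambda>K. pt_val K (wderiv (interior K) \<mu> w) z)) \<and>
        (\<forall>e\<in>mesh_edges \<T>. \<forall>K\<in>edge_tris \<T> e.
           edge_int e (normal_trace K e (J w)) = edge_int e (normal_trace K e w)))"

definition smoother_estimate ::
  "(real^2) set \<Rightarrow> mesh \<Rightarrow> real \<Rightarrow> fn set \<Rightarrow> (fn \<Rightarrow> fn) \<Rightarrow> bool" where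
  "smoother_estimate \<Omega> \<T> C1 Vh Q \<longleftrightarrow> (\<forall>vh\<in>Vh. \<forall>s\<in>{0..2}.
     Hs_mesh_norm s \<T> (\<lambda>x. vh x - Q vh x)
       \<le> C1 * mesh_size \<T> powr (2 - s) * (INF v\<in>H20 \<Omega>. h_norm \<T> (\<lambda>x. v x - vh x)))"

definition ritz_projection ::
  "(real^2) set \<Rightarrow> fn set \<Rightarrow> (fn \<Rightarrow> fn \<Rightarrow> real) \<Rightarrow> (fn \<Rightarrow> fn) \<Rightarrow> (fn \<Rightarrow> fn) \<Rightarrow> bool" where
  "ritz_projection \<Omega> Vh ah Q Rh \<longleftrightarrow> (\<forall>w\<in>H20 \<Omega>. Rh w \<in> Vh \<and>
     (\<forall>vh\<in>Vh. ah (Rh w) vh = hess_form \<Omega> w (Q vh)))"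

definition ritz_estimate ::
  "(real^2) set \<Rightarrow> mesh \<Rightarrow> real \<Rightarrow> real \<Rightarrow> (fn \<Rightarrow> fn) \<Rightarrow> bool" where
  "ritz_estimate \<Omega> \<T> \<gamma> C2 Rh \<longleftrightarrow> (\<forall>v\<in>H20 \<Omega> \<inter> Hs (2 + \<gamma>) \<Omega>.
     l2norm \<Omega> (\<lambda>x. v x - Rh v x) + mesh_size \<T> powr \<gamma> * h_norm \<T> (\<lambda>x. v x - Rh v x)
       \<le> C2 * mesh_size \<T> powr (2 * \<gamma>) * Hs_norm (2 + \<gamma>) \<Omega> v)"


section \<open>The implicit scheme\<close>

text \<open>\<open>\<phi>\<^sup>n\<^sup>+\<^sup>1\<^sup>/\<^sup>2\<close>, \<open>\<phi>\<^sup>n\<^sup>,\<^sup>1\<^sup>/\<^sup>4\<close> and the difference quotients at \<open>t\<^sub>n\<^sub>+\<^sub>1\<^sub>/\<^sub>2\<close> and \<open>t\<^sub>n\<close>\<close>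

definition half_avg :: "(nat \<Rightarrow> fn) \<Rightarrow> nat \<Rightarrow> fn" where
  "half_avg \<phi> n = (\<lambda>x. (\<phi> (n + 1) x + \<phi> n x) / 2)"

definition quarter_avg :: "(nat \<Rightarrow> fn) \<Rightarrow> nat \<Rightarrow> fn" where
  "quarter_avg \<phi> n = (\<lambda>x. (\<phi> (n + 1) x + 2 * \<phi> n x + \<phi> (n - 1) x) / 4)"

definition dt_half :: "real \<Rightarrow> (nat \<Rightarrow> fn) \<Rightarrow> nat \<Rightarrow> fn" where
  "dt_half k \<phi> n = (\<lambda>x. (\<phi> (n + 1) x - \<phi> n x) / k)"

definition dtt :: "real \<Rightarrow> (nat \<Rightarrow> fn) \<Rightarrow> nat \<Rightarrow> fn" where
  "dtt k \<phi> n = (\<lambda>x. (\<phi> (n + 1) x - 2 * \<phi> n x + \<phi> (n - 1) x) / k\<^sup>2)"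

definition implicit_scheme ::
  "(real^2) set \<Rightarrow> real \<Rightarrow> nat \<Rightarrow> fn set \<Rightarrow> (fn \<Rightarrow> fn \<Rightarrow> real) \<Rightarrow> (fn \<Rightarrow> fn) \<Rightarrow>
   fn \<Rightarrow> fn \<Rightarrow> (real \<Rightarrow> fn) \<Rightarrow> (nat \<Rightarrow> fn) \<Rightarrow> bool" where
  "implicit_scheme \<Omega> k N Vh ah Rh u0 v0 f U \<longleftrightarrow>
     (let fg = (\<lambda>n. f (real n * k)) in
     (\<forall>n\<le>N. U n \<in> Vh) \<and> aeq \<Omega> (U 0) (Rh u0) \<and>
     (\<forall>vh\<in>Vh. 2 / k * ip \<Omega> (dt_half k U 0) vh + ah (half_avg U 0) vh
        = ip \<Omega> (\<lambda>x. half_avg fg 0 x + 2 / k * v0 x) vh) \<and>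
     (\<forall>n\<in>{1..N - 1}. \<forall>vh\<in>Vh.
        ip \<Omega> (dtt k U n) vh + ah (quarter_avg U n) vh = ip \<Omega> (quarter_avg fg n) vh))"


section \<open>Regularity and the quantities in the error bound\<close>

definition data_regular ::
  "(real^2) set \<Rightarrow> real \<Rightarrow> (nat \<Rightarrow> real) \<Rightarrow> (nat \<Rightarrow> fn) \<Rightarrow> fn \<Rightarrow> fn \<Rightarrow>
   (real \<Rightarrow> fn) \<Rightarrow> (real \<Rightarrow> fn) \<Rightarrow> (real \<Rightarrow> fn) \<Rightarrow> (real \<Rightarrow> fn) \<Rightarrow> bool" where
  "data_regular \<Omega> T lam \<psi> u0 v0 f ft ftt fttt \<longleftrightarrow>
     u0 \<in> DAr \<Omega> lam \<psi> 2 \<and> v0 \<in> DAr \<Omega> lam \<psi> (3/2) \<and>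
     f 0 \<in> DA \<Omega> \<and> ft 0 \<in> DAr \<Omega> lam \<psi> (1/2) \<and> ftt 0 \<in> L2 \<Omega> \<and>
     {f, ft, ftt, fttt} \<subseteq> L2_time T (L2 \<Omega>) (l2norm \<Omega>) \<and>
     weak_time_deriv \<Omega> T f ft \<and> weak_time_deriv \<Omega> T ft ftt \<and> weak_time_deriv \<Omega> T ftt fttt \<and>
     \<comment> \<open>\<open>f\<close>, \<open>ft\<close>, \<open>ftt\<close> denote the continuous representatives, which gives meaning to point values\<close>
     (\<forall>g\<in>{f, ft, ftt}. time_cont T (L2 \<Omega>) (l2norm \<Omega>) g)"

definition solution_regular ::
  "(real^2) set \<Rightarrow> real \<Rightarrow> real \<Rightarrow>
   (real \<Rightarrow> fn) \<Rightarrow> (real \<Rightarrow> fn) \<Rightarrow> (real \<Rightarrow> fn) \<Rightarrow> (real \<Rightarrow> fn) \<Rightarrow> (real \<Rightarrow> fn) \<Rightarrow> bool" where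
  "solution_regular \<Omega> T \<gamma> u ut utt uttt utttt \<longleftrightarrow>
     weak_time_deriv \<Omega> T ut utt \<and> weak_time_deriv \<Omega> T utt uttt \<and> weak_time_deriv \<Omega> T uttt utttt \<and>
     {u, ut, utt} \<subseteq> Linf_time T (Hs (2 + \<gamma>) \<Omega>) (Hs_norm (2 + \<gamma>) \<Omega>) \<and>
     {utt, uttt, utttt} \<subseteq> Linf_time T (L2 \<Omega>) (l2norm \<Omega>)"

definition L_bound ::
  "(real^2) set \<Rightarrow> real \<Rightarrow> real \<Rightarrow> (real \<Rightarrow> fn) \<Rightarrow> (real \<Rightarrow> fn) \<Rightarrow>
   (real \<Rightarrow> fn) \<Rightarrow> (real \<Rightarrow> fn) \<Rightarrow> (real \<Rightarrow> fn) \<Rightarrow> (real \<Rightarrow> fn) \<Rightarrow> real" where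
  "L_bound \<Omega> T \<gamma> f ft u ut utt uttt =
     Linf_norm T (l2norm \<Omega>) f + L2_time_norm T (l2norm \<Omega>) ft
     + Linf_norm T (Hs_norm (2 + \<gamma>) \<Omega>) u + Linf_norm T (Hs_norm (2 + \<gamma>) \<Omega>) ut
     + Linf_norm T (l2norm \<Omega>) utt + L2_time_norm T (Hs_norm (2 + \<gamma>) \<Omega>) utt
     + L2_time_norm T (l2norm \<Omega>) uttt"

definition M_bound :: "(real^2) set \<Rightarrow> real \<Rightarrow> (real \<Rightarrow> fn) \<Rightarrow> (real \<Rightarrow> fn) \<Rightarrow> real" where
  "M_bound \<Omega> T uttt utttt = Linf_norm T (l2norm \<Omega>) uttt + L2_time_norm T (l2norm \<Omega>) utttt"

end

theory Submission
  imports Defs "HOL-Library.Function_Algebras"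
begin

text \<open>
  In the eigenbasis the wave equation decouples into oscillators \<open>w'' + l w = F\<close>. Energy estimates
  for these, square summable over the modes, produce continuous derivatives of \<open>u\<close> up to order four,
  and elliptic regularity upgrades the first three functions \<open>u, u\<^sub>t, u\<^sub>t\<^sub>t\<close> to \<open>H\<^sup>2\<^sup>+\<^sup>\<gamma>\<close>.

  For the error, let \<open>Z\<^sup>n\<close> be the modified Ritz projection of \<open>u(t\<^sub>n)\<close> and \<open>g = f - u\<^sub>t\<^sub>t\<close>. Since
  \<open>a\<^sub>h(Z\<^sup>n, v) = a(u(t\<^sub>n), Q v) = (g(t\<^sub>n), Q v)\<close>, the difference \<open>\<theta> = Z - U\<close> satisfies the scheme with
  two kinds of right-hand sides: an \<open>L\<^sup>2\<close> residual, made of the truncation error and of the Ritz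
  error of a difference quotient, and the defect \<open>v \<mapsto> (g, Q v - v)\<close>, which the smoother bounds by
  \<open>C h\<^sup>2\<close> times the energy norm of \<open>v\<close>. Testing with \<open>\<theta>\<^sup>n\<^sup>+\<^sup>1 - \<theta>\<^sup>n\<^sup>-\<^sup>1\<close> telescopes the discrete energy; the
  defect is summed by parts in time, which moves the difference quotient from \<open>\<theta>\<close> to \<open>g\<close> and thus only
  costs \<open>f\<^sub>t\<close> and \<open>u\<^sub>t\<^sub>t\<^sub>t\<close>.
\<close>

section \<open>Curves in semi-inner product spaces\<close>

text \<open>Functions count as equal when they agree almost everywhere, so every norm is only a
  seminorm on a set of representatives. The abstract layer is therefore a semi-inner product on a
  subspace, instantiated with \<open>L2\<close>, \<open>Hm 2\<close>,
  \<open>Hs (2 + \<gamma>)\<close>, the Hessian form and \<open>ah\<close>. Vector valued integrals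
  are avoided: curves are paired with fixed vectors, and norm bounds are recovered by testing with
  the increment itself. Two obstacles shape the estimates. The smoother yields \<open>h^2\<close>
  where the claim has \<open>h^(2 \<gamma>)\<close>; since \<gamma> \<le> 1 and \<open>h\<close> is
  at most the diameter of the domain, the surplus power becomes a constant. And no Gronwall
  inequality is used, neither for the oscillators nor for the scheme: the energy balance is
  evaluated where the relevant quantity is largest, which leaves a quadratic inequality for that
  maximum. Elliptic regularity serves twice: it places eigenfunction expansions in
  \<open>H20\<close>, and it carries limits in time from \<open>L2\<close> to
  \<open>Hs (2 + \<gamma>)\<close>.\<close>

instantiation "fun" :: (type, real_vector) real_vector
begin

definition "r *\<^sub>R f = (\<lambda>x. r *\<^sub>R f x)"

instance
  by standard (simp_all add: scaleR_fun_def fun_eq_iff scaleR_add_right scaleR_add_left)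

end

lemma scaleR_fun_apply [simp]: "(r *\<^sub>R f) x = r *\<^sub>R f x"
  by (simp add: scaleR_fun_def)

lemma eventually_withinI: "(\<And>s. s \<in> S \<Longrightarrow> s \<noteq> t \<Longrightarrow> P s) \<Longrightarrow> \<forall>\<^sub>F s in at t within S. P s"
  by (auto simp: eventually_at_filter)

text \<open>Definiteness is not assumed, because null functions have norm 0. \<open>N\<close> is a
  parameter tied to \<open>B\<close> by an equation, so that norms defined elsewhere, such as
  \<open>l2norm\<close> and \<open>Hs_norm\<close>, can be plugged in directly.\<close>

locale semi_inner =
  fixes X :: "'v::real_vector set" and B :: "'v \<Rightarrow> 'v \<Rightarrow> real" and N :: "'v \<Rightarrow> real"
  assumes subspace: "subspace X"
    and sym: "v \<in> X \<Longrightarrow> w \<in> X \<Longrightarrow> B v w = B w v"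
    and add_left: "v \<in> X \<Longrightarrow> w \<in> X \<Longrightarrow> z \<in> X \<Longrightarrow> B (v + w) z = B v z + B w z"
    and scale_left: "v \<in> X \<Longrightarrow> z \<in> X \<Longrightarrow> B (r *\<^sub>R v) z = r * B v z"
    and pos: "v \<in> X \<Longrightarrow> 0 \<le> B v v"
    and N_eq: "v \<in> X \<Longrightarrow> N v = sqrt (B v v)"
begin

lemma X_closed [simp, intro]:
  "0 \<in> X" "v \<in> X \<Longrightarrow> w \<in> X \<Longrightarrow> v + w \<in> X" "v \<in> X \<Longrightarrow> w \<in> X \<Longrightarrow> v - w \<in> X"
  "v \<in> X \<Longrightarrow> r *\<^sub>R v \<in> X" "v \<in> X \<Longrightarrow> - v \<in> X"
  using subspace by (auto simp: subspace_0 subspace_add subspace_diff subspace_scale subspace_neg)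

lemma X_sum [intro]: "(\<And>i. i \<in> I \<Longrightarrow> f i \<in> X) \<Longrightarrow> (\<Sum>i\<in>I. f i) \<in> X"
  using subspace by (rule subspace_sum)

lemma add_right: "v \<in> X \<Longrightarrow> w \<in> X \<Longrightarrow> z \<in> X \<Longrightarrow> B z (v + w) = B z v + B z w"
  by (metis X_closed(2) add_left sym)

lemma scale_right: "v \<in> X \<Longrightarrow> z \<in> X \<Longrightarrow> B z (r *\<^sub>R v) = r * B z v"
  by (metis X_closed(4) scale_left sym)

lemma zero_left [simp]: "z \<in> X \<Longrightarrow> B 0 z = 0"
  using scale_left[of 0 z 0] by simp

lemma zero_right [simp]: "z \<in> X \<Longrightarrow> B z 0 = 0"
  using scale_right[of 0 z 0] by simp

lemma minus_left: "v \<in> X \<Longrightarrow> z \<in> X \<Longrightarrow> B (- v) z = - B v z"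
  using scale_left[of v z "-1"] by simp

lemma minus_right: "v \<in> X \<Longrightarrow> z \<in> X \<Longrightarrow> B z (- v) = - B z v"
  using scale_right[of v z "-1"] by simp

lemma diff_left: "v \<in> X \<Longrightarrow> w \<in> X \<Longrightarrow> z \<in> X \<Longrightarrow> B (v - w) z = B v z - B w z"
  using add_left[of v "-w" z] minus_left[of w z] by simp

lemma diff_right: "v \<in> X \<Longrightarrow> w \<in> X \<Longrightarrow> z \<in> X \<Longrightarrow> B z (v - w) = B z v - B z w"
  using add_right[of v "-w" z] minus_right[of w z] by simp

lemmas B_linear = add_left add_right scale_left scale_right minus_left minus_right diff_left diff_right

lemma sum_right: "(\<And>i. i \<in> I \<Longrightarrow> f i \<in> X) \<Longrightarrow> z \<in> X \<Longrightarrow> B z (\<Sum>i\<in>I. f i) = (\<Sum>i\<in>I. B z (f i))"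
  by (induction I rule: infinite_finite_induct) (auto simp: add_right X_sum)

lemma N_nonneg [simp]: "v \<in> X \<Longrightarrow> 0 \<le> N v"
  by (simp add: N_eq pos)

lemma N_square: "v \<in> X \<Longrightarrow> (N v)\<^sup>2 = B v v"
  by (simp add: N_eq pos)

lemma N_zero [simp]: "N 0 = 0"
  by (simp add: N_eq)

lemma Cauchy_Schwarz:
  assumes v: "v \<in> X" and w: "w \<in> X"
  shows "\<bar>B v w\<bar> \<le> N v * N w"
proof -
  have q: "0 \<le> B v v + 2 * r * B v w + r\<^sup>2 * B w w" for r
  proof -
    have "0 \<le> B (v + r *\<^sub>R w) (v + r *\<^sub>R w)" using v w by (intro pos) auto
    also have "\<dots> = B v v + 2 * r * B v w + r\<^sup>2 * B w w"
      using v w sym[of w v] by (simp add: B_linear algebra_simps power2_eq_square)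
    finally show ?thesis .
  qed
  have "(B v w)\<^sup>2 \<le> B v v * B w w"
  proof (cases "B w w = 0")
    case True
    \<comment> \<open>The polynomial in \<open>r\<close> is now affine; unless its slope vanishes,
      the chosen \<open>r\<close> gives it the value -1.\<close>
    have "B v w = 0"
    proof (rule ccontr)
      assume n: "B v w \<noteq> 0"
      have "0 \<le> B v v + 2 * (- (B v v + 1) / (2 * B v w)) * B v w" using q[of "- (B v v + 1) / (2 * B v w)"] True by simp
      then show False using n by (simp add: field_simps)
    qed
    then show ?thesis using True by simp
  next
    case False
    then have p: "B w w > 0" using pos[OF w] by simp
    have "0 \<le> B v v + 2 * (- B v w / B w w) * B v w + (- B v w / B w w)\<^sup>2 * B w w" by (rule q)
    also have "\<dots> = B v v - (B v w)\<^sup>2 / B w w" using p by (simp add: field_simps power2_eq_square)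
    finally show ?thesis using p by (simp add: field_simps)
  qed
  then have "\<bar>B v w\<bar> \<le> sqrt (B v v * B w w)" by (simp add: real_le_rsqrt)
  then show ?thesis using v w by (simp add: N_eq real_sqrt_mult)
qed

lemma B_le_N: "v \<in> X \<Longrightarrow> w \<in> X \<Longrightarrow> B v w \<le> N v * N w"
  using Cauchy_Schwarz[of v w] by simp

lemma N_triangle: assumes v: "v \<in> X" and w: "w \<in> X" shows "N (v + w) \<le> N v + N w"
proof -
  have "(N (v + w))\<^sup>2 = B v v + 2 * B v w + B w w"
    using v w sym[of w v] by (simp add: N_square B_linear)
  also have "\<dots> \<le> (N v + N w)\<^sup>2"
    using B_le_N[OF v w] v w by (simp add: power2_sum N_square)
  finally show ?thesis by (rule power2_le_imp_le) (use v w in simp)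
qed

lemma N_scale: "v \<in> X \<Longrightarrow> N (r *\<^sub>R v) = \<bar>r\<bar> * N v"
  by (simp add: N_eq B_linear real_sqrt_mult mult.assoc[symmetric] del: mult.assoc)

lemma N_minus: "v \<in> X \<Longrightarrow> N (- v) = N v"
  using N_scale[of v "-1"] by simp

lemma N_diff_commute: "v \<in> X \<Longrightarrow> w \<in> X \<Longrightarrow> N (v - w) = N (w - v)"
  using N_minus[of "w - v"] by simp

lemma N_triangle_diff: "v \<in> X \<Longrightarrow> w \<in> X \<Longrightarrow> N (v - w) \<le> N v + N w"
  using N_triangle[of v "-w"] N_minus[of w] by simp

lemma N_diff_triangle: "v \<in> X \<Longrightarrow> w \<in> X \<Longrightarrow> z \<in> X \<Longrightarrow> N (v - w) \<le> N (v - z) + N (z - w)"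
  using N_triangle[of "v - z" "z - w"] by simp

lemma N_reverse_triangle: "v \<in> X \<Longrightarrow> w \<in> X \<Longrightarrow> \<bar>N v - N w\<bar> \<le> N (v - w)"
  using N_triangle[of "v - w" w] N_triangle[of "w - v" v] N_diff_commute[of v w] by simp

text \<open>Bounds by duality end here: testing a vector with itself produces
  \<open>B v v \<le> c * N v\<close>, and one factor cancels. The assumption
  \<open>0 \<le> c\<close> covers \<open>N v = 0\<close>.\<close>

lemma N_le_of_square: 
  assumes "v \<in> X" "B v v \<le> c * N v" "0 \<le> c"
  shows "N v \<le> c"
proof (cases "N v = 0")
  case False
  then have "N v > 0" using assms(1) by (simp add: order_less_le)
  moreover have "N v * N v \<le> c * N v" using assms N_square[of v] by (simp add: power2_eq_square)
  ultimately show ?thesis by simp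
qed (use assms in simp)

section \<open>Continuous and differentiable curves\<close>

definition cont_curve :: "real set \<Rightarrow> (real \<Rightarrow> 'v) \<Rightarrow> bool" where
  "cont_curve S y \<longleftrightarrow> (\<forall>t\<in>S. y t \<in> X) \<and> (\<forall>t\<in>S. ((\<lambda>s. N (y s - y t)) \<longlongrightarrow> 0) (at t within S))"

text \<open>Limits of \<open>N\<close> stand in for a topology on the vectors. Since the limit is
  taken within \<open>S\<close>, derivatives at the ends of an interval are one-sided.\<close>

definition deriv_curve :: "real set \<Rightarrow> (real \<Rightarrow> 'v) \<Rightarrow> (real \<Rightarrow> 'v) \<Rightarrow> bool" where
  "deriv_curve S y y' \<longleftrightarrow> (\<forall>t\<in>S. y t \<in> X \<and> y' t \<in> X) \<and>
     (\<forall>t\<in>S. ((\<lambda>s. N ((1 / (s - t)) *\<^sub>R (y s - y t) - y' t)) \<longlongrightarrow> 0) (at t within S))"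

lemma cont_curve_in: "cont_curve S y \<Longrightarrow> t \<in> S \<Longrightarrow> y t \<in> X"
  by (simp add: cont_curve_def)

lemma deriv_curve_in: "deriv_curve S y y' \<Longrightarrow> t \<in> S \<Longrightarrow> y t \<in> X \<and> y' t \<in> X"
  by (simp add: deriv_curve_def)

lemma deriv_curve_subset: "deriv_curve S y y' \<Longrightarrow> R \<subseteq> S \<Longrightarrow> deriv_curve R y y'"
  unfolding deriv_curve_def by (meson subset_iff tendsto_within_subset)

lemma cont_curve_B: assumes y: "cont_curve S y" and v: "v \<in> X"
  shows "continuous_on S (\<lambda>t. B (y t) v)"
  unfolding continuous_on_def
proof
  fix t assume t: "t \<in> S"
  have "((\<lambda>s. N (y s - y t) * N v) \<longlongrightarrow> 0 * N v) (at t within S)"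
    using y t by (intro tendsto_intros) (auto simp: cont_curve_def)
  then have "((\<lambda>s. N (y s - y t) * N v) \<longlongrightarrow> 0) (at t within S)" by simp
  then have "((\<lambda>s. B (y s) v - B (y t) v) \<longlongrightarrow> 0) (at t within S)"
  proof (rule Lim_null_comparison[rotated])
    show "\<forall>\<^sub>F s in at t within S. norm (B (y s) v - B (y t) v) \<le> N (y s - y t) * N v"
    proof (rule eventually_withinI)
      fix s assume "s \<in> S"
      then have "y s \<in> X" "y t \<in> X" using y t by (auto simp: cont_curve_def)
      then show "norm (B (y s) v - B (y t) v) \<le> N (y s - y t) * N v"
        using v Cauchy_Schwarz[of "y s - y t" v] by (simp add: diff_left)
    qed
  qed
  then show "((\<lambda>s. B (y s) v) \<longlongrightarrow> B (y t) v) (at t within S)" by (simp add: LIM_zero_iff)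
qed

lemma cont_curve_N: assumes y: "cont_curve S y" shows "continuous_on S (\<lambda>t. N (y t))"
  unfolding continuous_on_def
proof
  fix t assume t: "t \<in> S"
  have "((\<lambda>s. N (y s - y t)) \<longlongrightarrow> 0) (at t within S)" using y t by (auto simp: cont_curve_def)
  then have "((\<lambda>s. N (y s) - N (y t)) \<longlongrightarrow> 0) (at t within S)"
  proof (rule Lim_null_comparison[rotated])
    show "\<forall>\<^sub>F s in at t within S. norm (N (y s) - N (y t)) \<le> N (y s - y t)"
      using y t by (auto simp: cont_curve_def intro!: eventually_withinI N_reverse_triangle)
  qed
  then show "((\<lambda>s. N (y s)) \<longlongrightarrow> N (y t)) (at t within S)" by (simp add: LIM_zero_iff)
qed

lemma cont_curve_add: assumes "cont_curve S y" "cont_curve S z" shows "cont_curve S (\<lambda>t. y t + z t)"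
  unfolding cont_curve_def
proof (intro conjI ballI)
  fix t assume t: "t \<in> S"
  show "((\<lambda>s. N ((y s + z s) - (y t + z t))) \<longlongrightarrow> 0) (at t within S)"
  proof (rule Lim_null_comparison)
    show "((\<lambda>s. N (y s - y t) + N (z s - z t)) \<longlongrightarrow> 0) (at t within S)"
      using assms t by (intro tendsto_add_zero) (auto simp: cont_curve_def)
    show "\<forall>\<^sub>F s in at t within S. norm (N ((y s + z s) - (y t + z t))) \<le> N (y s - y t) + N (z s - z t)"
      using assms t by (auto simp: cont_curve_def add_diff_add intro!: eventually_withinI N_triangle)
  qed
qed (use assms in \<open>auto simp: cont_curve_def\<close>)

lemma cont_curve_scale: assumes "cont_curve S y" shows "cont_curve S (\<lambda>t. r *\<^sub>R y t)"
  unfolding cont_curve_def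
proof (intro conjI ballI)
  fix t assume t: "t \<in> S"
  have "((\<lambda>s. \<bar>r\<bar> * N (y s - y t)) \<longlongrightarrow> \<bar>r\<bar> * 0) (at t within S)"
    using assms t by (intro tendsto_intros) (auto simp: cont_curve_def)
  moreover have "\<forall>\<^sub>F s in at t within S. \<bar>r\<bar> * N (y s - y t) = N (r *\<^sub>R y s - r *\<^sub>R y t)"
    using assms t by (auto simp: cont_curve_def N_scale scaleR_diff_right[symmetric] intro!: eventually_withinI)
  ultimately show "((\<lambda>s. N (r *\<^sub>R y s - r *\<^sub>R y t)) \<longlongrightarrow> 0) (at t within S)"
    by (auto elim: Lim_transform_eventually)
qed (use assms in \<open>auto simp: cont_curve_def\<close>)

lemma cont_curve_diff: assumes "cont_curve S y" "cont_curve S z" shows "cont_curve S (\<lambda>t. y t - z t)"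
  using cont_curve_add[OF assms(1) cont_curve_scale[OF assms(2), of "-1"]] by simp

lemma deriv_curve_add:
  assumes "deriv_curve S y y'" "deriv_curve S z z'"
  shows "deriv_curve S (\<lambda>t. y t + z t) (\<lambda>t. y' t + z' t)"
  unfolding deriv_curve_def
proof (intro conjI ballI)
  fix t assume t: "t \<in> S"
  let ?q = "\<lambda>y y' s. (1 / (s - t)) *\<^sub>R (y s - y t) - y' t"
  have e: "(1 / (s - t)) *\<^sub>R ((y s + z s) - (y t + z t)) - (y' t + z' t) = ?q y y' s + ?q z z' s" for s
    by (simp add: scaleR_add_right scaleR_diff_right)
  show "((\<lambda>s. N ((1 / (s - t)) *\<^sub>R ((y s + z s) - (y t + z t)) - (y' t + z' t))) \<longlongrightarrow> 0) (at t within S)"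
    unfolding e
  proof (rule Lim_null_comparison)
    show "((\<lambda>s. N (?q y y' s) + N (?q z z' s)) \<longlongrightarrow> 0) (at t within S)"
      using assms t by (intro tendsto_add_zero) (auto simp: deriv_curve_def)
    show "\<forall>\<^sub>F s in at t within S. norm (N (?q y y' s + ?q z z' s)) \<le> N (?q y y' s) + N (?q z z' s)"
      using assms t by (auto simp: deriv_curve_def intro!: eventually_withinI N_triangle)
  qed
qed (use assms in \<open>auto simp: deriv_curve_def\<close>)

lemma deriv_curve_scale:
  assumes "deriv_curve S y y'" shows "deriv_curve S (\<lambda>t. r *\<^sub>R y t) (\<lambda>t. r *\<^sub>R y' t)"
  unfolding deriv_curve_def
proof (intro conjI ballI)
  fix t assume t: "t \<in> S"
  let ?q = "\<lambda>s. (1 / (s - t)) *\<^sub>R (y s - y t) - y' t"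
  have e: "(1 / (s - t)) *\<^sub>R (r *\<^sub>R y s - r *\<^sub>R y t) - r *\<^sub>R y' t = r *\<^sub>R ?q s" for s
    by (simp add: scaleR_diff_right mult.commute)
  have "((\<lambda>s. \<bar>r\<bar> * N (?q s)) \<longlongrightarrow> \<bar>r\<bar> * 0) (at t within S)"
    using assms t by (intro tendsto_intros) (auto simp: deriv_curve_def)
  moreover have "\<forall>\<^sub>F s in at t within S. \<bar>r\<bar> * N (?q s) = N (r *\<^sub>R ?q s)"
    using assms t by (auto simp: deriv_curve_def intro!: eventually_withinI N_scale[symmetric])
  ultimately show "((\<lambda>s. N ((1 / (s - t)) *\<^sub>R (r *\<^sub>R y s - r *\<^sub>R y t) - r *\<^sub>R y' t)) \<longlongrightarrow> 0) (at t within S)"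
    unfolding e by (auto elim: Lim_transform_eventually)
qed (use assms in \<open>auto simp: deriv_curve_def\<close>)

lemma deriv_curve_diff:
  assumes "deriv_curve S y y'" "deriv_curve S z z'"
  shows "deriv_curve S (\<lambda>t. y t - z t) (\<lambda>t. y' t - z' t)"
  using deriv_curve_add[OF assms(1) deriv_curve_scale[OF assms(2), of "-1"]] by simp

lemma deriv_curve_B:
  assumes y: "deriv_curve S y y'" and v: "v \<in> X" and t: "t \<in> S"
  shows "((\<lambda>t. B (y t) v) has_real_derivative B (y' t) v) (at t within S)"
proof -
  let ?q = "\<lambda>s. (1 / (s - t)) *\<^sub>R (y s - y t) - y' t"
  have "((\<lambda>s. N (?q s) * N v) \<longlongrightarrow> 0 * N v) (at t within S)"
    using y t by (intro tendsto_intros) (auto simp: deriv_curve_def)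
  then have "((\<lambda>s. N (?q s) * N v) \<longlongrightarrow> 0) (at t within S)" by simp
  then have "((\<lambda>s. (B (y s) v - B (y t) v) / (s - t) - B (y' t) v) \<longlongrightarrow> 0) (at t within S)"
  proof (rule Lim_null_comparison[rotated])
    have "\<bar>(B (y s) v - B (y t) v) / (s - t) - B (y' t) v\<bar> \<le> N (?q s) * N v" if "s \<in> S" for s
    proof -
      have i: "y s \<in> X" "y t \<in> X" "y' t \<in> X" using y t that by (auto simp: deriv_curve_def)
      have "B (?q s) v = (B (y s) v - B (y t) v) / (s - t) - B (y' t) v"
        using i v by (simp add: B_linear)
      moreover have "\<bar>B (?q s) v\<bar> \<le> N (?q s) * N v" using i v by (intro Cauchy_Schwarz) auto
      ultimately show ?thesis by simp
    qed
    then show "\<forall>\<^sub>F s in at t within S. norm ((B (y s) v - B (y t) v) / (s - t) - B (y' t) v) \<le> N (?q s) * N v"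
      by (intro eventually_withinI) simp
  qed
  then show ?thesis unfolding has_field_derivative_iff by (simp add: LIM_zero_iff)
qed

text \<open>Pairing the increment with itself reduces this to the mean value inequality for real functions.\<close>

lemma deriv_curve_bound:
  assumes y: "deriv_curve {a..b} y y'" and ab: "a \<le> b"
    and g: "g integrable_on {a..b}" and le: "\<And>t. t \<in> {a..b} \<Longrightarrow> N (y' t) \<le> g t"
  shows "N (y b - y a) \<le> integral {a..b} g"
proof -
  define v where "v = y b - y a"
  have i: "y a \<in> X" "y b \<in> X" "v \<in> X" using y ab by (auto simp: deriv_curve_def v_def)
  have "((\<lambda>t. B (y' t) v) has_integral (B (y b) v - B (y a) v)) {a..b}"
    using deriv_curve_B[OF y i(3)]
    by (intro fundamental_theorem_of_calculus ab) (auto simp: has_real_derivative_iff_has_vector_derivative)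
  moreover have "((\<lambda>t. g t * N v) has_integral (integral {a..b} g * N v)) {a..b}"
    using g by (intro has_integral_mult_left integrable_integral)
  moreover have "B (y' t) v \<le> g t * N v" if "t \<in> {a..b}" for t
  proof -
    have "y' t \<in> X" using y that by (auto simp: deriv_curve_def)
    then have "B (y' t) v \<le> N (y' t) * N v" using i by (intro B_le_N)
    also have "\<dots> \<le> g t * N v" using le[OF that] i by (intro mult_right_mono) auto
    finally show ?thesis .
  qed
  ultimately have "B (y b) v - B (y a) v \<le> integral {a..b} g * N v"
    by (rule has_integral_le)
  moreover have "B v v = B (y b) v - B (y a) v" using diff_left[of "y b" "y a" v] i by (simp add: v_def)
  moreover have "0 \<le> integral {a..b} g"
  proof (intro integral_nonneg g)
    fix t assume t: "t \<in> {a..b}"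
    then have "0 \<le> N (y' t)" using deriv_curve_in[OF y t] by simp
    then show "0 \<le> g t" using le[OF t] by simp
  qed
  ultimately have "N v \<le> integral {a..b} g" using i(3) by (intro N_le_of_square) auto
  then show ?thesis by (simp add: v_def)
qed

lemma cont_curve_N_integrable: "cont_curve S y \<Longrightarrow> {a..b} \<subseteq> S \<Longrightarrow> (\<lambda>t. N (y t)) integrable_on {a..b}"
  by (intro integrable_continuous_interval continuous_on_subset[OF cont_curve_N])

lemma deriv_curve_increment:
  assumes y: "deriv_curve S y y'" and y': "cont_curve S y'" and S: "{a..b} \<subseteq> S" and ab: "a \<le> b"
  shows "N (y b - y a) \<le> integral {a..b} (\<lambda>t. N (y' t))"
  using deriv_curve_bound[OF deriv_curve_subset[OF y S] ab cont_curve_N_integrable[OF y' S]] by simp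

lemma deriv_curve_bound_const:
  assumes y: "deriv_curve {a..b} y y'" and ab: "a \<le> b" and le: "\<And>t. t \<in> {a..b} \<Longrightarrow> N (y' t) \<le> c"
  shows "N (y b - y a) \<le> (b - a) * c"
  using deriv_curve_bound[OF y ab integrable_const_ivl le] ab by simp

text \<open>With \<open>c \<noteq> 0\<close> the affine substitution never meets the punctured
  point, so the limit of the difference quotients can be composed with it. The value
  \<open>c = -1\<close> runs a curve backwards from \<open>t\<close>.\<close>

lemma deriv_curve_compose:
  assumes y: "deriv_curve S y y'" and r: "\<And>s. s \<in> R \<Longrightarrow> t + c * s \<in> S" and c: "c \<noteq> 0"
  shows "deriv_curve R (\<lambda>s. y (t + c * s)) (\<lambda>s. c *\<^sub>R y' (t + c * s))"
  unfolding deriv_curve_def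
proof (intro conjI ballI)
  fix s assume s: "s \<in> R"
  let ?q = "\<lambda>z. (1 / (z - (t + c * s))) *\<^sub>R (y z - y (t + c * s)) - y' (t + c * s)"
  have lim: "filterlim (\<lambda>z. t + c * z) (at (t + c * s) within S) (at s within R)"
    unfolding filterlim_at
  proof
    show "((\<lambda>z. t + c * z) \<longlongrightarrow> t + c * s) (at s within R)" by (intro tendsto_intros)
    show "\<forall>\<^sub>F x in at s within R. t + c * x \<in> S \<and> t + c * x \<noteq> t + c * s"
      using r c by (intro eventually_withinI) auto
  qed
  have "((\<lambda>z. N (?q z)) \<longlongrightarrow> 0) (at (t + c * s) within S)" using y r[OF s] by (auto simp: deriv_curve_def)
  from filterlim_compose[OF this lim]
  have "((\<lambda>z. \<bar>c\<bar> * N (?q (t + c * z))) \<longlongrightarrow> \<bar>c\<bar> * 0) (at s within R)" by (intro tendsto_intros)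
  moreover have "\<forall>\<^sub>F z in at s within R. \<bar>c\<bar> * N (?q (t + c * z)) =
      N ((1 / (z - s)) *\<^sub>R (y (t + c * z) - y (t + c * s)) - c *\<^sub>R y' (t + c * s))"
  proof -
    have "\<bar>c\<bar> * N (?q (t + c * z)) =
      N ((1 / (z - s)) *\<^sub>R (y (t + c * z) - y (t + c * s)) - c *\<^sub>R y' (t + c * s))" if "z \<in> R" "z \<noteq> s" for z
    proof -
      have "y (t + c * z) \<in> X" "y (t + c * s) \<in> X" "y' (t + c * s) \<in> X"
        using y r s that by (auto simp: deriv_curve_def)
      then have "\<bar>c\<bar> * N (?q (t + c * z)) = N (c *\<^sub>R ?q (t + c * z))" by (intro N_scale[symmetric]) auto
      also have "c *\<^sub>R ?q (t + c * z) = (1 / (z - s)) *\<^sub>R (y (t + c * z) - y (t + c * s)) - c *\<^sub>R y' (t + c * s)"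
      proof -
        have "c * (1 / (t + c * z - (t + c * s))) = 1 / (z - s)"
          using c that by (simp add: right_diff_distrib[symmetric])
        then show ?thesis by (simp only: scaleR_diff_right scaleR_scaleR)
      qed
      finally show ?thesis .
    qed
    then show ?thesis by (intro eventually_withinI) auto
  qed
  ultimately show "((\<lambda>z. N ((1 / (z - s)) *\<^sub>R (y (t + c * z) - y (t + c * s)) - c *\<^sub>R y' (t + c * s))) \<longlongrightarrow> 0) (at s within R)"
    by (auto elim: Lim_transform_eventually)
qed (use y r in \<open>auto simp: deriv_curve_def\<close>)

section \<open>Taylor estimates for difference quotients\<close>

lemma second_difference_bound:
  assumes y: "deriv_curve S y y'" and y': "deriv_curve S y' y''" and y'': "cont_curve S y''"
    and S: "{t - k..t + k} \<subseteq> S" and k: "k \<ge> 0"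
  shows "N (y (t + k) - 2 *\<^sub>R y t + y (t - k)) \<le> k * integral {t - k..t + k} (\<lambda>s. N (y'' s))"
proof -
  let ?I = "integral {t - k..t + k} (\<lambda>s. N (y'' s))"
  have a: "deriv_curve {0..k} (\<lambda>s. y (t + 1 * s)) (\<lambda>s. 1 *\<^sub>R y' (t + 1 * s))"
    using S by (intro deriv_curve_compose[OF y]) auto
  have b: "deriv_curve {0..k} (\<lambda>s. y (t + (-1) * s)) (\<lambda>s. (-1) *\<^sub>R y' (t + (-1) * s))"
    using S by (intro deriv_curve_compose[OF y]) auto
  \<comment> \<open>The even part of \<open>y\<close> around \<open>t\<close> has as derivative an
    increment of \<open>y'\<close> over a window of length \<open>2 * s\<close>, hence at most
    \<open>?I\<close>; integrating over \<open>{0..k}\<close> costs one factor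
    \<open>k\<close>.\<close>
  have d: "deriv_curve {0..k} (\<lambda>s. y (t + s) + y (t - s)) (\<lambda>s. y' (t + s) - y' (t - s))"
    using deriv_curve_add[OF a b] by simp
  have "N (y' (t + s) - y' (t - s)) \<le> ?I" if s: "s \<in> {0..k}" for s
  proof -
    have "N (y' (t + s) - y' (t - s)) \<le> integral {t - s..t + s} (\<lambda>s. N (y'' s))"
      using S s by (intro deriv_curve_increment[OF y' y'']) auto
    also have "\<dots> \<le> ?I"
      using S s y'' by (intro integral_subset_le cont_curve_N_integrable[OF y''])
        (auto simp: cont_curve_def subset_iff intro!: N_nonneg)
    finally show ?thesis .
  qed
  from deriv_curve_bound_const[OF d k this] show ?thesis
    by (simp add: algebra_simps scaleR_2)
qed

text \<open>Both terms are compared with \<open>y'' t\<close>. The remainder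
  \<open>D s - D 0\<close> has derivative \<open>D1 s\<close>, and \<open>D1\<close> vanishes at 0
  and has as derivative the second difference of \<open>y''\<close>, which is at most
  \<open>k\<close> times the window integral of \<open>N (y4 s)\<close>. Two integrations give
  \<open>k^3\<close> times that integral, and the division by \<open>k^2\<close> leaves one factor
  \<open>k\<close>.\<close>

lemma truncation_bound:
  assumes y: "deriv_curve S y y'" and y': "deriv_curve S y' y''" and y'': "deriv_curve S y'' y3"
    and y3: "deriv_curve S y3 y4" and y4: "cont_curve S y4"
    and S: "{t - k..t + k} \<subseteq> S" and k: "k > 0"
  shows "N ((1 / k\<^sup>2) *\<^sub>R (y (t + k) - 2 *\<^sub>R y t + y (t - k)) - (1 / 4) *\<^sub>R (y'' (t + k) + 2 *\<^sub>R y'' t + y'' (t - k)))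
    \<le> 2 * k * integral {t - k..t + k} (\<lambda>s. N (y4 s))"
proof -
  let ?I = "integral {t - k..t + k} (\<lambda>s. N (y4 s))"
  have tS: "t \<in> S" "t + k \<in> S" "t - k \<in> S" using S k by auto
  have inX: "y t \<in> X" "y (t + k) \<in> X" "y (t - k) \<in> X" "y'' t \<in> X" "y'' (t + k) \<in> X" "y'' (t - k) \<in> X"
    using y y'' tS by (auto simp: deriv_curve_def)
  have I0: "0 \<le> ?I"
    using S y4 by (intro integral_nonneg cont_curve_N_integrable[OF y4]) (auto simp: cont_curve_def subset_iff)
  have z: "N (y'' (t + s) - 2 *\<^sub>R y'' t + y'' (t - s)) \<le> k * ?I" if s: "s \<in> {0..k}" for s
  proof -
    have "N (y'' (t + s) - 2 *\<^sub>R y'' t + y'' (t - s)) \<le> s * integral {t - s..t + s} (\<lambda>s. N (y4 s))"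
      using S s by (intro second_difference_bound[OF y'' y3 y4]) auto
    also have "\<dots> \<le> k * ?I"
      using S s k y4 I0 by (intro mult_mono integral_subset_le cont_curve_N_integrable[OF y4] integral_nonneg)
        (auto simp: cont_curve_def subset_iff intro!: N_nonneg)
    finally show ?thesis .
  qed
  define D1 where "D1 s = y' (t + s) - y' (t - s) - (2 * s) *\<^sub>R y'' t" for s
  define D where "D s = y (t + s) + y (t - s) - (s\<^sup>2) *\<^sub>R y'' t" for s
  \<comment> \<open>Supplies the derivatives of the powers of \<open>s\<close>, times the fixed
    vector \<open>y'' t\<close>, that are subtracted in \<open>D1\<close> and
    \<open>D\<close>.\<close>
  have poly: "deriv_curve {0..k} (\<lambda>s. p s *\<^sub>R v) (\<lambda>s. p' s *\<^sub>R v)"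
    if v: "v \<in> X" and p: "\<And>s. (p has_real_derivative p' s) (at s)" for p p' v
    unfolding deriv_curve_def
  proof (intro conjI ballI)
    fix s assume "s \<in> {0..k}"
    have "((\<lambda>r. \<bar>(p r - p s) / (r - s) - p' s\<bar> * N v) \<longlongrightarrow> \<bar>p' s - p' s\<bar> * N v) (at s within {0..k})"
      using p[of s] by (intro tendsto_intros) (auto simp: has_field_derivative_iff intro: tendsto_within_subset)
    moreover have "N ((1 / (r - s)) *\<^sub>R (p r *\<^sub>R v - p s *\<^sub>R v) - p' s *\<^sub>R v) = \<bar>(p r - p s) / (r - s) - p' s\<bar> * N v" for r
      using N_scale[OF v, of "(p r - p s) / (r - s) - p' s"]
      by (simp add: scaleR_left_diff_distrib diff_divide_distrib scaleR_diff_right)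
    ultimately show "((\<lambda>r. N ((1 / (r - s)) *\<^sub>R (p r *\<^sub>R v - p s *\<^sub>R v) - p' s *\<^sub>R v)) \<longlongrightarrow> 0) (at s within {0..k})"
      by simp
  qed (use v in auto)
  have p1: "deriv_curve {0..k} (\<lambda>s. (2 * s) *\<^sub>R y'' t) (\<lambda>s. 2 *\<^sub>R y'' t)"
    by (rule poly[OF inX(4)]) (auto intro!: derivative_eq_intros)
  have p2: "deriv_curve {0..k} (\<lambda>s. (s\<^sup>2) *\<^sub>R y'' t) (\<lambda>s. (2 * s) *\<^sub>R y'' t)"
    by (rule poly[OF inX(4)]) (auto intro!: derivative_eq_intros)
  have pl: "deriv_curve {0..k} (\<lambda>s. w (t + s)) (\<lambda>s. w' (t + s))"
      and mi: "deriv_curve {0..k} (\<lambda>s. w (t - s)) (\<lambda>s. - w' (t - s))" if "deriv_curve S w w'" for w w'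
    using deriv_curve_compose[OF that, of "{0..k}" t 1] deriv_curve_compose[OF that, of "{0..k}" t "-1"] S
    by (simp_all add: subset_iff)
  have D1': "deriv_curve {0..k} D1 (\<lambda>s. y'' (t + s) - 2 *\<^sub>R y'' t + y'' (t - s))"
    unfolding D1_def using deriv_curve_diff[OF deriv_curve_diff[OF pl[OF y'] mi[OF y']] p1]
    by (simp add: algebra_simps)
  have D': "deriv_curve {0..k} D D1"
    unfolding D_def D1_def using deriv_curve_diff[OF deriv_curve_add[OF pl[OF y] mi[OF y]] p2]
    by (simp add: algebra_simps)
  have "N (D1 s) \<le> k * (k * ?I)" if s: "s \<in> {0..k}" for s
  proof -
    have "N (D1 s - D1 0) \<le> (s - 0) * (k * ?I)"
      using s z by (intro deriv_curve_bound_const[OF deriv_curve_subset[OF D1']]) auto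
    also have "\<dots> \<le> k * (k * ?I)" using s k I0 by (intro mult_right_mono) auto
    finally show ?thesis by (simp add: D1_def)
  qed
  then have "N (D k - D 0) \<le> (k - 0) * (k * (k * ?I))"
    using k by (intro deriv_curve_bound_const[OF D']) auto
  then have D3: "N (D k - D 0) \<le> k ^ 3 * ?I" by (simp add: power3_eq_cube mult.assoc)
  have DX: "D k - D 0 \<in> X" using D' k by (auto simp: deriv_curve_def)
  have eq: "(1 / k\<^sup>2) *\<^sub>R (y (t + k) - 2 *\<^sub>R y t + y (t - k)) - (1 / 4) *\<^sub>R (y'' (t + k) + 2 *\<^sub>R y'' t + y'' (t - k))
      = (1 / k\<^sup>2) *\<^sub>R (D k - D 0) - (1 / 4) *\<^sub>R (y'' (t + k) - 2 *\<^sub>R y'' t + y'' (t - k))"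
  proof -
    have "D k - D 0 = (y (t + k) - 2 *\<^sub>R y t + y (t - k)) - k\<^sup>2 *\<^sub>R y'' t"
      by (simp add: D_def algebra_simps scaleR_2)
    then have "(1 / k\<^sup>2) *\<^sub>R (D k - D 0) = (1 / k\<^sup>2) *\<^sub>R (y (t + k) - 2 *\<^sub>R y t + y (t - k)) - y'' t"
      using k by (simp add: scaleR_diff_right)
    moreover have "(1 / 4) *\<^sub>R (y'' (t + k) + 2 *\<^sub>R y'' t + y'' (t - k))
       = y'' t + (1 / 4) *\<^sub>R (y'' (t + k) - 2 *\<^sub>R y'' t + y'' (t - k))"
    proof -
      have "y'' t = (1/4) *\<^sub>R (4 *\<^sub>R y'' t)" by simp
      moreover have "y'' (t + k) + 2 *\<^sub>R y'' t + y'' (t - k) = 4 *\<^sub>R y'' t + (y'' (t + k) - 2 *\<^sub>R y'' t + y'' (t - k))"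
        using scaleR_add_left[of 2 2 "y'' t"] by simp
      ultimately show ?thesis by (metis scaleR_add_right)
    qed
    ultimately show ?thesis by simp
  qed
  have "N ((1 / k\<^sup>2) *\<^sub>R (D k - D 0) - (1 / 4) *\<^sub>R (y'' (t + k) - 2 *\<^sub>R y'' t + y'' (t - k)))
      \<le> N ((1 / k\<^sup>2) *\<^sub>R (D k - D 0)) + N ((1 / 4) *\<^sub>R (y'' (t + k) - 2 *\<^sub>R y'' t + y'' (t - k)))"
    using DX inX by (intro N_triangle_diff) auto
  also have "\<dots> = (1 / k\<^sup>2) * N (D k - D 0) + (1 / 4) * N (y'' (t + k) - 2 *\<^sub>R y'' t + y'' (t - k))"
    using DX inX by (simp add: N_scale)
  also have "\<dots> \<le> (1 / k\<^sup>2) * (k ^ 3 * ?I) + 1 / 4 * (k * ?I)"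
    using D3 z[of k] k by (intro add_mono mult_left_mono) auto
  \<comment> \<open>The two contributions are 1 and 1/4 times \<open>k * ?I\<close>; the constant is
    rounded up to 2.\<close>
  also have "\<dots> \<le> 2 * k * ?I"
    using k I0 by (simp add: power3_eq_cube power2_eq_square mult_nonneg_nonneg)
  finally show ?thesis unfolding eq .
qed

text \<open>A one-sided Taylor expansion at 0 with \<open>y'' 0\<close> frozen leaves a remainder of
  order \<open>k^3\<close>, and replacing \<open>y'' 0\<close> by the mean of its values at 0 and
  \<open>k\<close> costs another \<open>k^2\<close> after the factor \<open>k / 2\<close>. The third
  derivative enters through a bound at every point, whence the supremum norm of u_ttt in the final
  estimate.\<close>

lemma start_truncation_bound:
  assumes y: "deriv_curve S y y'" and y': "deriv_curve S y' y''" and y'': "deriv_curve S y'' y3"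
    and S: "{0..k} \<subseteq> S" and k: "k > 0" and M: "\<And>s. s \<in> {0..k} \<Longrightarrow> N (y3 s) \<le> M"
  shows "N ((1 / k) *\<^sub>R (y k - y 0) - y' 0 - (k / 2) *\<^sub>R ((1 / 2) *\<^sub>R (y'' k + y'' 0))) \<le> 2 * k\<^sup>2 * M"
proof -
  have S0: "0 \<in> S" "k \<in> S" using S k by auto
  have inX: "y 0 \<in> X" "y k \<in> X" "y' 0 \<in> X" "y'' 0 \<in> X" "y'' k \<in> X"
    using deriv_curve_in[OF y] deriv_curve_in[OF y'] deriv_curve_in[OF y''] S0 by auto
  have M0: "0 \<le> M"
  proof -
    have "0 \<in> S" using S k by auto
    then have "0 \<le> N (y3 0)" using y'' by (auto simp: deriv_curve_def)
    then show ?thesis using M[of 0] k by auto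
  qed
  have lin: "deriv_curve {0..k} (\<lambda>s. w s - (s *\<^sub>R v)) (\<lambda>s. w' s - v)" if "deriv_curve S w w'" "v \<in> X" for w w' v
  proof (rule deriv_curve_diff[OF deriv_curve_subset[OF that(1) S]])
    show "deriv_curve {0..k} (\<lambda>s. s *\<^sub>R v) (\<lambda>s. v)"
      unfolding deriv_curve_def
    proof (intro conjI ballI)
      fix t :: real
      have "\<forall>\<^sub>F s in at t within {0..k}. 0 = N ((1 / (s - t)) *\<^sub>R (s *\<^sub>R v - t *\<^sub>R v) - v)"
        by (intro eventually_withinI) (simp add: scaleR_left_diff_distrib[symmetric])
      then show "((\<lambda>s. N ((1 / (s - t)) *\<^sub>R (s *\<^sub>R v - t *\<^sub>R v) - v)) \<longlongrightarrow> 0) (at t within {0..k})"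
        by (rule Lim_transform_eventually[OF tendsto_const])
    qed (use that in auto)
  qed
  have a: "N (y'' s - y'' 0) \<le> k * M" if s: "s \<in> {0..k}" for s
  proof -
    have "N (y'' s - y'' 0) \<le> (s - 0) * M"
      using s S M by (intro deriv_curve_bound_const[OF deriv_curve_subset[OF y'']]) auto
    also have "\<dots> \<le> k * M" using s M0 by (intro mult_right_mono) auto
    finally show ?thesis .
  qed
  have b: "N (y' s - s *\<^sub>R y'' 0 - y' 0) \<le> k * (k * M)" if s: "s \<in> {0..k}" for s
  proof -
    have "N ((y' s - s *\<^sub>R y'' 0) - (y' 0 - 0 *\<^sub>R y'' 0)) \<le> (s - 0) * (k * M)"
      using s a by (intro deriv_curve_bound_const[OF deriv_curve_subset[OF lin[OF y' inX(4)]]]) auto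
    also have "\<dots> \<le> k * (k * M)" using s k M0 by (intro mult_right_mono) auto
    finally show ?thesis by simp
  qed
  define D where "D s = y s - s *\<^sub>R y' 0 - (s\<^sup>2 / 2) *\<^sub>R y'' 0" for s
  have D': "deriv_curve {0..k} D (\<lambda>s. y' s - y' 0 - s *\<^sub>R y'' 0)"
    unfolding D_def
  proof (rule deriv_curve_diff[OF lin[OF y inX(3)]])
    show "deriv_curve {0..k} (\<lambda>s. (s\<^sup>2 / 2) *\<^sub>R y'' 0) (\<lambda>s. s *\<^sub>R y'' 0)"
      unfolding deriv_curve_def
    proof (intro conjI ballI)
      fix t :: real
      have "((\<lambda>s. \<bar>(s - t) / 2\<bar> * N (y'' 0)) \<longlongrightarrow> \<bar>(t - t) / 2\<bar> * N (y'' 0)) (at t within {0..k})"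
        by (intro tendsto_intros) auto
      moreover have "\<forall>\<^sub>F s in at t within {0..k}. \<bar>(s - t) / 2\<bar> * N (y'' 0) =
          N ((1 / (s - t)) *\<^sub>R ((s\<^sup>2 / 2) *\<^sub>R y'' 0 - (t\<^sup>2 / 2) *\<^sub>R y'' 0) - t *\<^sub>R y'' 0)"
      proof -
        have "\<bar>(s - t) / 2\<bar> * N (y'' 0) =
          N ((1 / (s - t)) *\<^sub>R ((s\<^sup>2 / 2) *\<^sub>R y'' 0 - (t\<^sup>2 / 2) *\<^sub>R y'' 0) - t *\<^sub>R y'' 0)" if "s \<noteq> t" for s
        proof -
          have "(1 / (s - t)) *\<^sub>R ((s\<^sup>2 / 2) *\<^sub>R y'' 0 - (t\<^sup>2 / 2) *\<^sub>R y'' 0) - t *\<^sub>R y'' 0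
             = ((1 / (s - t)) * (s\<^sup>2 / 2 - t\<^sup>2 / 2) - t) *\<^sub>R y'' 0"
            by (simp add: scaleR_left_diff_distrib scaleR_diff_right right_diff_distrib)
          also have "(1 / (s - t)) * (s\<^sup>2 / 2 - t\<^sup>2 / 2) - t = (s - t) / 2"
            using that by (simp add: field_simps power2_eq_square)
          finally show ?thesis using inX by (simp only: N_scale)
        qed
        then show ?thesis by (intro eventually_withinI) auto
      qed
      ultimately show "((\<lambda>s. N ((1 / (s - t)) *\<^sub>R ((s\<^sup>2 / 2) *\<^sub>R y'' 0 - (t\<^sup>2 / 2) *\<^sub>R y'' 0) - t *\<^sub>R y'' 0)) \<longlongrightarrow> 0) (at t within {0..k})"
        by (auto elim: Lim_transform_eventually)
    qed (use inX in auto)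
  qed
  have "N (D k - D 0) \<le> (k - 0) * (k * (k * M))"
    using k b by (intro deriv_curve_bound_const[OF D']) (auto simp: algebra_simps)
  then have D3: "N (D k - D 0) \<le> k ^ 3 * M" by (simp add: power3_eq_cube mult.assoc)
  have DX: "D k - D 0 \<in> X" using D' k by (auto simp: deriv_curve_def)
  have eq: "(1 / k) *\<^sub>R (y k - y 0) - y' 0 - (k / 2) *\<^sub>R ((1 / 2) *\<^sub>R (y'' k + y'' 0))
      = (1 / k) *\<^sub>R (D k - D 0) - (k / 4) *\<^sub>R (y'' k - y'' 0)"
  proof -
    have "(1 / k) *\<^sub>R (D k - D 0) = (1 / k) *\<^sub>R (y k - y 0) - y' 0 - (k / 2) *\<^sub>R y'' 0"
      using k by (simp add: D_def scaleR_diff_right power2_eq_square)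
    moreover have "(k / 2) *\<^sub>R ((1 / 2) *\<^sub>R (y'' k + y'' 0)) = (k / 2) *\<^sub>R y'' 0 + (k / 4) *\<^sub>R (y'' k - y'' 0)"
      using scaleR_add_left[of "k/4" "k/4" "y'' 0"] by (simp add: scaleR_diff_right scaleR_add_right)
    ultimately show ?thesis by simp
  qed
  have "N ((1 / k) *\<^sub>R (D k - D 0) - (k / 4) *\<^sub>R (y'' k - y'' 0)) \<le>
     N ((1 / k) *\<^sub>R (D k - D 0)) + N ((k / 4) *\<^sub>R (y'' k - y'' 0))"
    using DX inX by (intro N_triangle_diff) auto
  also have "\<dots> = (1 / k) * N (D k - D 0) + (k / 4) * N (y'' k - y'' 0)"
    using DX inX k by (simp add: N_scale)
  also have "\<dots> \<le> (1 / k) * (k ^ 3 * M) + (k / 4) * (k * M)"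
    using D3 a[of k] k by (intro add_mono mult_left_mono) auto
  also have "\<dots> \<le> 2 * k\<^sup>2 * M"
    using k M0 by (simp add: power3_eq_cube power2_eq_square)
  finally show ?thesis unfolding eq .
qed

text \<open>Upgrades identities of scalar pairings to differentiability in norm. The Taylor
  remainder over a short interval is paired with itself, and norm continuity of \<open>y'\<close>
  makes the result small. Every strong derivative found from weak time derivatives or from Fourier
  coefficients passes through here.\<close>

lemma deriv_curveI_weak:
  assumes y: "\<And>t. t \<in> {a..b} \<Longrightarrow> y t \<in> X" and y': "cont_curve {a..b} y'"
    and d: "\<And>v s t. v \<in> X \<Longrightarrow> a \<le> s \<Longrightarrow> s \<le> t \<Longrightarrow> t \<le> b \<Longrightarrow>
      ((\<lambda>r. B (y' r) v) has_integral (B (y t) v - B (y s) v)) {s..t}"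
  shows "deriv_curve {a..b} y y'"
  unfolding deriv_curve_def
proof (intro conjI ballI)
  fix t assume t: "t \<in> {a..b}"
  have y'X: "\<And>s. s \<in> {a..b} \<Longrightarrow> y' s \<in> X" using y' by (auto simp: cont_curve_def)
  \<comment> \<open>Stated for any subinterval with the derivative frozen at \<open>t\<close>, so
    that it serves difference quotients from the right (\<open>p = t\<close>) as well as from the
    left (\<open>q = t\<close>).\<close>
  have half: "N (y q - y p - (q - p) *\<^sub>R y' t) \<le> (q - p) * e"
    if pq: "a \<le> p" "p \<le> q" "q \<le> b" and e: "\<And>r. r \<in> {p..q} \<Longrightarrow> N (y' r - y' t) \<le> e" "0 \<le> e" for p q e
  proof -
    define v where "v = y q - y p - (q - p) *\<^sub>R y' t"
    have v: "v \<in> X" using y pq t y'X by (auto simp: v_def)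
    have "((\<lambda>r. B (y' r) v - B (y' t) v) has_integral (B (y q) v - B (y p) v) - (q - p) *\<^sub>R B (y' t) v) {p..q}"
      using d[OF v pq] has_integral_const_real[of "B (y' t) v" p q] pq by (intro has_integral_diff) auto
    moreover have "((\<lambda>r. e * N v) has_integral (q - p) *\<^sub>R (e * N v)) {p..q}"
      using has_integral_const_real[of "e * N v" p q] pq by auto
    moreover have "B (y' r) v - B (y' t) v \<le> e * N v" if r: "r \<in> {p..q}" for r
    proof -
      have "y' r \<in> X" using r pq y'X by auto
      then have "B (y' r) v - B (y' t) v = B (y' r - y' t) v" using v t y'X by (simp add: B_linear)
      also have "\<dots> \<le> N (y' r - y' t) * N v" using v t y'X \<open>y' r \<in> X\<close> by (intro B_le_N) auto
      also have "\<dots> \<le> e * N v" using e(1)[OF r] v by (intro mult_right_mono) auto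
      finally show ?thesis .
    qed
    ultimately have "(B (y q) v - B (y p) v) - (q - p) *\<^sub>R B (y' t) v \<le> (q - p) *\<^sub>R (e * N v)"
      by (rule has_integral_le)
    moreover have "B v v = (B (y q) v - B (y p) v) - (q - p) *\<^sub>R B (y' t) v"
    proof -
      have "B v v = B (y q - y p - (q - p) *\<^sub>R y' t) v" by (simp add: v_def)
      also have "\<dots> = (B (y q) v - B (y p) v) - (q - p) *\<^sub>R B (y' t) v"
        using y pq t y'X v by (simp add: B_linear)
      finally show ?thesis .
    qed
    ultimately have "B v v \<le> ((q - p) * e) * N v" by (simp add: mult.assoc)
    then have "N v \<le> (q - p) * e" using v e pq by (intro N_le_of_square) auto
    then show ?thesis by (simp add: v_def)
  qed
  show "((\<lambda>s. N ((1 / (s - t)) *\<^sub>R (y s - y t) - y' t)) \<longlongrightarrow> 0) (at t within {a..b})"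
  proof (rule tendstoI)
    fix e :: real assume e: "0 < e"
    have "((\<lambda>s. N (y' s - y' t)) \<longlongrightarrow> 0) (at t within {a..b})" using y' t by (auto simp: cont_curve_def)
    from tendstoD[OF this, of "e/2"] e obtain \<delta> where \<delta>: "\<delta> > 0"
      "\<And>s. s \<in> {a..b} \<Longrightarrow> s \<noteq> t \<Longrightarrow> dist s t < \<delta> \<Longrightarrow> \<bar>N (y' s - y' t)\<bar> < e / 2"
      unfolding eventually_at by auto
    then have \<delta>': "N (y' s - y' t) \<le> e / 2" if "s \<in> {a..b}" "dist s t < \<delta>" for s
      using that e by (cases "s = t") force+
    have "N ((1 / (s - t)) *\<^sub>R (y s - y t) - y' t) < e" if s: "s \<in> {a..b}" "s \<noteq> t" "dist s t < \<delta>" for s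
    proof -
      have st: "y s \<in> X" "y t \<in> X" "y' t \<in> X" using s t y y'X by auto
      have "N (y s - y t - (s - t) *\<^sub>R y' t) \<le> \<bar>s - t\<bar> * (e / 2)"
      proof (cases "t \<le> s")
        case True
        then have "N (y s - y t - (s - t) *\<^sub>R y' t) \<le> (s - t) * (e / 2)"
          using s t e by (intro half \<delta>') (auto simp: dist_real_def)
        then show ?thesis using True by simp
      next
        case False
        then have "N (y t - y s - (t - s) *\<^sub>R y' t) \<le> (t - s) * (e / 2)"
          using s t e by (intro half \<delta>') (auto simp: dist_real_def)
        moreover have "y s - y t - (s - t) *\<^sub>R y' t = - (y t - y s - (t - s) *\<^sub>R y' t)" by (simp add: algebra_simps)
        ultimately show ?thesis using False st by (simp only: N_minus X_closed) auto
      qed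
      moreover have "(1 / (s - t)) *\<^sub>R (y s - y t) - y' t = (1 / (s - t)) *\<^sub>R (y s - y t - (s - t) *\<^sub>R y' t)"
        using s by (simp add: scaleR_diff_right)
      moreover have "N ((1 / (s - t)) *\<^sub>R (y s - y t - (s - t) *\<^sub>R y' t)) = \<bar>1 / (s - t)\<bar> * N (y s - y t - (s - t) *\<^sub>R y' t)"
        using st by (intro N_scale) auto
      ultimately have "N ((1 / (s - t)) *\<^sub>R (y s - y t) - y' t) \<le> \<bar>1 / (s - t)\<bar> * (\<bar>s - t\<bar> * (e / 2))"
        by (metis abs_ge_zero mult_left_mono)
      also have "\<dots> = e / 2" using s by (simp add: abs_divide)
      finally show ?thesis using e by simp
    qed
    moreover have "0 \<le> N ((1 / (s - t)) *\<^sub>R (y s - y t) - y' t)" if "s \<in> {a..b}" for s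
      using that t y y'X by (intro N_nonneg) auto
    ultimately show "\<forall>\<^sub>F s in at t within {a..b}. dist (N ((1 / (s - t)) *\<^sub>R (y s - y t) - y' t)) 0 < e"
      unfolding eventually_at using \<delta>(1) by (intro exI[of _ \<delta>]) auto
  qed
qed (use y y' in \<open>auto simp: cont_curve_def\<close>)

lemma deriv_curve_imp_cont_curve:
  assumes y: "deriv_curve S y y'" shows "cont_curve S y"
  unfolding cont_curve_def
proof (intro conjI ballI)
  fix t assume t: "t \<in> S"
  let ?q = "\<lambda>s. (1 / (s - t)) *\<^sub>R (y s - y t) - y' t"
  show "((\<lambda>s. N (y s - y t)) \<longlongrightarrow> 0) (at t within S)"
  proof (rule Lim_null_comparison)
    have "((\<lambda>s. N (?q s)) \<longlongrightarrow> 0) (at t within S)" using y t by (auto simp: deriv_curve_def)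
    then have "((\<lambda>s. \<bar>s - t\<bar> * (N (?q s) + N (y' t))) \<longlongrightarrow> \<bar>t - t\<bar> * (0 + N (y' t))) (at t within S)"
      by (intro tendsto_intros)
    then show "((\<lambda>s. \<bar>s - t\<bar> * (N (?q s) + N (y' t))) \<longlongrightarrow> 0) (at t within S)" by simp
    have "norm (N (y s - y t)) \<le> \<bar>s - t\<bar> * (N (?q s) + N (y' t))" if s: "s \<in> S" "s \<noteq> t" for s
    proof -
      have i: "y s \<in> X" "y t \<in> X" "y' t \<in> X" using y t s by (auto simp: deriv_curve_def)
      have "N (y s - y t) = N ((s - t) *\<^sub>R (?q s + y' t))" using s by simp
      also have "\<dots> = \<bar>s - t\<bar> * N (?q s + y' t)" using i by (intro N_scale) auto
      also have "\<dots> \<le> \<bar>s - t\<bar> * (N (?q s) + N (y' t))" using i by (intro mult_left_mono N_triangle) auto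
      finally show ?thesis using i by simp
    qed
    then show "\<forall>\<^sub>F s in at t within S. norm (N (y s - y t)) \<le> \<bar>s - t\<bar> * (N (?q s) + N (y' t))"
      by (intro eventually_withinI) auto
  qed
qed (use y in \<open>auto simp: deriv_curve_def\<close>)

end

section \<open>Square integrable functions\<close>

text \<open>An arbitrary measure is allowed because three kinds occur: Lebesgue measure on a domain,
  on a time interval, and the product measure that carries the fractional part of the Sobolev
  norm.\<close>

definition sq_int :: "'a measure \<Rightarrow> ('a \<Rightarrow> real) set" where
  "sq_int M = {v \<in> borel_measurable M. integrable M (\<lambda>x. (v x)\<^sup>2)}"

definition sq_ip :: "'a measure \<Rightarrow> ('a \<Rightarrow> real) \<Rightarrow> ('a \<Rightarrow> real) \<Rightarrow> real" where
  "sq_ip M v w = (LINT x|M. v x * w x)"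

definition sq_norm :: "'a measure \<Rightarrow> ('a \<Rightarrow> real) \<Rightarrow> real" where
  "sq_norm M v = sqrt (sq_ip M v v)"

lemma sq_int_measurable: "v \<in> sq_int M \<Longrightarrow> v \<in> borel_measurable M"
  by (simp add: sq_int_def)

lemma sq_int_mult_integrable:
  assumes "v \<in> sq_int M" "w \<in> sq_int M"
  shows "integrable M (\<lambda>x. v x * w x)"
proof (rule Bochner_Integration.integrable_bound)
  show "integrable M (\<lambda>x. (v x)\<^sup>2 + (w x)\<^sup>2)" using assms by (auto simp: sq_int_def)
  show "(\<lambda>x. v x * w x) \<in> borel_measurable M" using assms by (auto simp: sq_int_def)
  have "\<bar>a * b\<bar> \<le> a\<^sup>2 + b\<^sup>2" for a b :: real
    using sum_squares_bound[of "\<bar>a\<bar>" "\<bar>b\<bar>"] mult_nonneg_nonneg[of "\<bar>a\<bar>" "\<bar>b\<bar>"]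
    by (simp add: abs_mult del: mult_nonneg_nonneg)
  then show "AE x in M. norm (v x * w x) \<le> norm ((v x)\<^sup>2 + (w x)\<^sup>2)"
    by (intro AE_I2) (simp add: abs_mult)
qed

interpretation sq: semi_inner "sq_int M" "sq_ip M" "sq_norm M" for M :: "'a measure"
proof
  show "subspace (sq_int M)"
    unfolding subspace_def
  proof (intro conjI ballI allI)
    show "0 \<in> sq_int M" by (auto simp: sq_int_def zero_fun_def)
    fix v w :: "'a \<Rightarrow> real" assume vw: "v \<in> sq_int M" "w \<in> sq_int M"
    have "integrable M (\<lambda>x. (v x)\<^sup>2 + 2 * (v x * w x) + (w x)\<^sup>2)"
      using vw sq_int_mult_integrable[OF vw] by (auto simp: sq_int_def)
    then show "v + w \<in> sq_int M"
      using vw by (auto simp: sq_int_def plus_fun_def power2_sum algebra_simps)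
  next
    fix r and v :: "'a \<Rightarrow> real" assume "v \<in> sq_int M"
    then show "r *\<^sub>R v \<in> sq_int M" by (auto simp: sq_int_def scaleR_fun_def power_mult_distrib)
  qed
  show "v \<in> sq_int M \<Longrightarrow> w \<in> sq_int M \<Longrightarrow> sq_ip M v w = sq_ip M w v" for v w
    by (simp add: sq_ip_def mult.commute)
  show "v \<in> sq_int M \<Longrightarrow> w \<in> sq_int M \<Longrightarrow> z \<in> sq_int M \<Longrightarrow> sq_ip M (v + w) z = sq_ip M v z + sq_ip M w z" for v w z
    by (simp add: sq_ip_def distrib_right sq_int_mult_integrable)
  show "sq_ip M (r *\<^sub>R v) z = r * sq_ip M v z" for r v z
    by (simp add: sq_ip_def mult.assoc)
  show "0 \<le> sq_ip M v v" for v by (simp add: sq_ip_def)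
  show "sq_norm M v = sqrt (sq_ip M v v)" for v by (simp add: sq_norm_def)
qed

lemma sq_norm_square: "(sq_norm M v)\<^sup>2 = (LINT x|M. (v x)\<^sup>2)"
  by (simp add: sq_norm_def sq_ip_def power2_eq_square)

lemma nn_integral_sq:
  "v \<in> sq_int M \<Longrightarrow> (\<integral>\<^sup>+x. ennreal ((v x)\<^sup>2) \<partial>M) = ennreal ((sq_norm M v)\<^sup>2)"
  unfolding sq_norm_square by (intro nn_integral_eq_integral) (auto simp: sq_int_def)

lemma sq_int_nn_integral:
  assumes "v \<in> borel_measurable M" "(\<integral>\<^sup>+x. ennreal ((v x)\<^sup>2) \<partial>M) \<le> ennreal (c\<^sup>2)" "0 \<le> c"
  shows "v \<in> sq_int M" "sq_norm M v \<le> c"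
proof -
  have "(\<integral>\<^sup>+x. ennreal ((v x)\<^sup>2) \<partial>M) < \<infinity>" using assms(2) by (rule le_less_trans) simp
  then have v: "integrable M (\<lambda>x. (v x)\<^sup>2)" using assms(1) by (intro integrableI_bounded) auto
  then show "v \<in> sq_int M" using assms by (simp add: sq_int_def)
  from nn_integral_sq[OF this] assms(2) have "(sq_norm M v)\<^sup>2 \<le> c\<^sup>2" by simp
  then show "sq_norm M v \<le> c" using assms(3) by (rule power2_le_imp_le)
qed

text \<open>The weights \<open>2 ^ k\<close> still leave a convergent series of integrals, so
  \<open>2 ^ k * (d k x)^2\<close> is summable for almost every \<open>x\<close>. Then
  \<open>|d|\<close> is at most \<open>2 ^ k * d^2 + (1 / 2) ^ k\<close>, by the inequality between
  arithmetic and geometric mean.\<close>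

lemma AE_convergent_of_geometric_sq_norm:
  assumes d: "\<And>k. d k \<in> sq_int M" and le: "\<And>k. (sq_norm M (d k))\<^sup>2 \<le> (1 / 8) ^ k"
  shows "AE x in M. summable (\<lambda>k. d k x)"
proof -
  have [measurable]: "\<And>k. d k \<in> borel_measurable M" using d by (simp add: sq_int_def)
  have "(\<integral>\<^sup>+x. (\<Sum>k. ennreal (2 ^ k * (d k x)\<^sup>2)) \<partial>M) = (\<Sum>k. \<integral>\<^sup>+x. ennreal (2 ^ k * (d k x)\<^sup>2) \<partial>M)"
    by (rule nn_integral_suminf) simp
  also have "\<dots> \<le> (\<Sum>k. ennreal ((1 / 4) ^ k))"
  proof (rule suminf_le)
    fix k
    have "(\<integral>\<^sup>+x. ennreal (2 ^ k * (d k x)\<^sup>2) \<partial>M) = (\<integral>\<^sup>+x. ennreal (2 ^ k) * ennreal ((d k x)\<^sup>2) \<partial>M)"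
      by (simp add: ennreal_mult)
    also have "\<dots> = ennreal (2 ^ k) * ennreal ((sq_norm M (d k))\<^sup>2)"
      using nn_integral_sq[OF d[of k]] by (simp add: nn_integral_cmult)
    also have "\<dots> = ennreal (2 ^ k * (sq_norm M (d k))\<^sup>2)" by (simp add: ennreal_mult)
    also have "\<dots> \<le> ennreal (2 ^ k * (1 / 8) ^ k)" using le[of k] by (intro ennreal_leI mult_left_mono) auto
    also have "(2::real) ^ k * (1 / 8) ^ k = (1 / 4) ^ k" by (simp add: power_mult_distrib[symmetric])
    finally show "(\<integral>\<^sup>+x. ennreal (2 ^ k * (d k x)\<^sup>2) \<partial>M) \<le> ennreal ((1 / 4) ^ k)" .
  qed auto
  also have "\<dots> = ennreal (\<Sum>k. (1 / 4) ^ k)"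
    by (intro suminf_ennreal2) auto
  finally have "(\<integral>\<^sup>+x. (\<Sum>k. ennreal (2 ^ k * (d k x)\<^sup>2)) \<partial>M) \<noteq> \<infinity>" by (auto simp: top_unique)
  then have "AE x in M. (\<Sum>k. ennreal (2 ^ k * (d k x)\<^sup>2)) \<noteq> \<infinity>"
    by (intro nn_integral_noteq_infinite) auto
  then show ?thesis
  proof eventually_elim
    case (elim x)
    then have s: "summable (\<lambda>k. 2 ^ k * (d k x)\<^sup>2)" by (intro summable_suminf_not_top) auto
    have "summable (\<lambda>k. 2 ^ k * (d k x)\<^sup>2 + (1 / 2) ^ k)" by (intro summable_add s) auto
    then show ?case
    proof (rule summable_comparison_test')
      fix k :: nat assume "k \<ge> 0"
      have "2 * (2 ^ k * \<bar>d k x\<bar>) * 1 \<le> (2 ^ k * \<bar>d k x\<bar>)\<^sup>2 + 1\<^sup>2" by (rule sum_squares_bound)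
      then have "2 ^ k * \<bar>d k x\<bar> \<le> 2 ^ k * (2 ^ k * (d k x)\<^sup>2) + 1"
        using zero_le_power2[of "2 ^ k * d k x"] by (simp add: power_mult_distrib power2_eq_square mult_ac)
      also have "\<dots> = 2 ^ k * (2 ^ k * (d k x)\<^sup>2 + (1 / 2) ^ k)"
        by (simp add: distrib_left power_mult_distrib[symmetric])
      finally show "norm (d k x) \<le> 2 ^ k * (d k x)\<^sup>2 + (1 / 2) ^ k" by simp
    qed
  qed
qed

text \<open>A subsequence with geometrically small increments converges almost everywhere; Fatou's
  lemma then bounds the distance of the whole sequence to the pointwise limit.\<close>

theorem Riesz_Fischer:
  assumes f: "\<And>n::nat. f n \<in> sq_int M"
    and Cauchy: "\<And>e. e > 0 \<Longrightarrow> \<exists>n0. \<forall>m\<ge>n0. \<forall>n\<ge>n0. sq_norm M (f m - f n) < e"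
  obtains g where "g \<in> sq_int M" "(\<lambda>n. sq_norm M (f n - g)) \<longlonglongrightarrow> 0"
proof -
  have [measurable]: "\<And>n. f n \<in> borel_measurable M" using f by (simp add: sq_int_def)
  have "\<forall>k. \<exists>n0. \<forall>m\<ge>n0. \<forall>n\<ge>n0. sq_norm M (f m - f n) < (1 / 4) ^ k" by (intro allI Cauchy) simp
  then obtain p where p: "\<And>k m n. m \<ge> p k \<Longrightarrow> n \<ge> p k \<Longrightarrow> sq_norm M (f m - f n) < (1 / 4) ^ k" by metis
  \<comment> \<open>Summing the thresholds makes \<open>r\<close> monotone while keeping
    \<open>r k\<close> above \<open>p k\<close>; the extra \<open>k\<close> forces it to
    infinity.\<close>
  define r where "r k = (\<Sum>j\<le>k. p j) + k" for k
  have rp: "p k \<le> r k" for k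
    unfolding r_def using member_le_sum[of k "{..k}" p] by (simp add: trans_le_add1)
  have rk: "k \<le> r k" for k by (simp add: r_def)
  have rS: "r k \<le> r (Suc k)" for k by (simp add: r_def)
  define d where "d k = f (r (Suc k)) - f (r k)" for k
  have "AE x in M. summable (\<lambda>k. d k x)"
  proof (rule AE_convergent_of_geometric_sq_norm)
    show dk: "d k \<in> sq_int M" for k by (simp add: d_def f)
    fix k
    have "sq_norm M (d k) < (1 / 4) ^ k" unfolding d_def using rp rS by (meson order_trans p)
    moreover have "0 \<le> sq_norm M (d k)" using dk by simp
    ultimately have "(sq_norm M (d k))\<^sup>2 \<le> ((1 / 4) ^ k)\<^sup>2" by (intro power_mono) auto
    also have "\<dots> = (1 / 16) ^ k" by (simp add: power_mult_distrib[symmetric] power2_eq_square)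
    also have "\<dots> \<le> (1 / 8) ^ k" by (intro power_mono) auto
    finally show "(sq_norm M (d k))\<^sup>2 \<le> (1 / 8) ^ k" .
  qed
  then have conv: "AE x in M. convergent (\<lambda>k. f (r k) x)"
  proof eventually_elim
    case (elim x)
    have "f (r k) x = f (r 0) x + (\<Sum>j<k. d j x)" for k
      by (induction k) (auto simp: d_def)
    then have e: "(\<lambda>k. f (r k) x) = (\<lambda>k. f (r 0) x + (\<Sum>j<k. d j x))" by (rule ext)
    show ?case unfolding e using elim by (simp add: convergent_add_const_iff summable_iff_convergent)
  qed
  define g where "g x = lim (\<lambda>k. f (r k) x)" for x
  have [measurable]: "g \<in> borel_measurable M"
    unfolding g_def by (rule borel_measurable_lim_metric) simp
  have bound: "f n - g \<in> sq_int M \<and> sq_norm M (f n - g) \<le> e"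
    if e: "e > 0" and n: "\<And>m. m \<ge> n \<Longrightarrow> sq_norm M (f n - f m) \<le> e" for n e
  proof -
    \<comment> \<open>Fatou's lemma along the subsequence, where the integrand converges almost
      everywhere.\<close>
    have "(\<integral>\<^sup>+x. ennreal (((f n - g) x)\<^sup>2) \<partial>M) = (\<integral>\<^sup>+x. liminf (\<lambda>k. ennreal (((f n - f (r k)) x)\<^sup>2)) \<partial>M)"
    proof (rule nn_integral_cong_AE, use conv in eventually_elim)
      case (elim x)
      then have "(\<lambda>k. f (r k) x) \<longlonglongrightarrow> g x" unfolding g_def by (simp add: convergent_LIMSEQ_iff)
      then have "(\<lambda>k. ennreal (((f n - f (r k)) x)\<^sup>2)) \<longlonglongrightarrow> ennreal (((f n - g) x)\<^sup>2)"
        unfolding fun_diff_def by (intro tendsto_intros)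
      then show ?case by (rule lim_imp_Liminf[OF sequentially_bot, symmetric])
    qed
    also have "\<dots> \<le> liminf (\<lambda>k. \<integral>\<^sup>+x. ennreal (((f n - f (r k)) x)\<^sup>2) \<partial>M)"
      by (rule nn_integral_liminf) (simp add: fun_diff_def)
    also have "\<dots> = liminf (\<lambda>k. ennreal ((sq_norm M (f n - f (r k)))\<^sup>2))"
      using f by (subst nn_integral_sq) auto
    also have "\<dots> \<le> liminf (\<lambda>k. ennreal (e\<^sup>2))"
    proof (rule Liminf_mono)
      show "\<forall>\<^sub>F k in sequentially. ennreal ((sq_norm M (f n - f (r k)))\<^sup>2) \<le> ennreal (e\<^sup>2)"
        using eventually_ge_at_top[of n]
      proof eventually_elim
        case (elim k)
        then show ?case using rk[of k] n[of "r k"] f by (intro ennreal_leI power_mono) auto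
      qed
    qed
    also have "\<dots> = ennreal (e\<^sup>2)" by (simp add: Liminf_const)
    finally show ?thesis using e by (intro conjI sq_int_nn_integral) (auto simp: fun_diff_def)
  qed
  have ev: "\<exists>n0. \<forall>n\<ge>n0. f n - g \<in> sq_int M \<and> sq_norm M (f n - g) \<le> e" if e: "e > 0" for e
  proof -
    obtain n0 where "\<forall>m\<ge>n0. \<forall>n\<ge>n0. sq_norm M (f m - f n) < e" using Cauchy[OF e] by blast
    then show ?thesis using bound[OF e] by (meson less_imp_le order_trans)
  qed
  obtain n1 where n1: "f n1 - g \<in> sq_int M" using ev[of 1] by auto
  have g: "g \<in> sq_int M" using sq.X_closed(3)[OF f[of n1] n1] by simp
  have "(\<lambda>n. sq_norm M (f n - g)) \<longlonglongrightarrow> 0"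
  proof (rule LIMSEQ_I)
    fix e :: real assume e: "0 < e"
    then obtain n0 where "\<And>n. n \<ge> n0 \<Longrightarrow> sq_norm M (f n - g) \<le> e / 2" using ev[of "e/2"] by auto
    moreover have "0 \<le> sq_norm M (f n - g)" for n using f g by simp
    ultimately have "\<And>n. n \<ge> n0 \<Longrightarrow> norm (sq_norm M (f n - g) - 0) < e" using e by (smt (verit) field_sum_of_halves real_norm_def)
    then show "\<exists>n0. \<forall>n\<ge>n0. norm (sq_norm M (f n - g) - 0) < e" by blast
  qed
  with g that show ?thesis by blast
qed

lemma L2_eq_sq_int: "L2 S = sq_int (lebesgue_on S)"
  by (simp add: L2_def sq_int_def)

lemma ip_eq_sq_ip: "ip S = sq_ip (lebesgue_on S)"
  by (intro ext) (simp add: ip_def sq_ip_def)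

lemma l2norm_eq_sq_norm: "l2norm S = sq_norm (lebesgue_on S)"
  by (intro ext) (simp add: l2norm_def sq_norm_def ip_eq_sq_ip)

interpretation l2: semi_inner "L2 S" "ip S" "l2norm S" for S :: "'a::euclidean_space set"
  unfolding L2_eq_sq_int ip_eq_sq_ip l2norm_eq_sq_norm by (rule sq.semi_inner_axioms)

text \<open>Lebesgue measure is complete, so measurability survives a change on a null set. This is
  what makes integrals independent of the representative.\<close>

lemma borel_measurable_lebesgue_on_AE:
  fixes f g :: "'a::euclidean_space \<Rightarrow> real"
  assumes S: "S \<in> sets lebesgue" and f: "f \<in> borel_measurable (lebesgue_on S)"
    and ae: "AE x in lebesgue_on S. f x = g x"
  shows "g \<in> borel_measurable (lebesgue_on S)"
proof -
  have "(\<lambda>x. indicator S x * f x) \<in> borel_measurable lebesgue"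
    using f S by (simp add: borel_measurable_restrict_space_iff)
  moreover have "AE x in lebesgue. indicator S x * f x = indicator S x * g x"
    using ae S by (simp add: AE_restrict_space_iff) (auto simp: indicator_def elim: eventually_mono)
  ultimately have "(\<lambda>x. indicator S x * g x) \<in> borel_measurable lebesgue"
    by (rule borel_measurable_AE)
  then show ?thesis using S by (simp add: borel_measurable_restrict_space_iff)
qed

text \<open>No measurability is assumed: if \<open>f\<close> is not measurable, then neither is
  \<open>g\<close>, and both integrals take the default value 0.\<close>

lemma integral_cong_lebesgue_on_AE:
  fixes f g :: "'a::euclidean_space \<Rightarrow> real"
  assumes S: "S \<in> sets lebesgue" and ae: "AE x in lebesgue_on S. f x = g x"
  shows "(LINT x|lebesgue_on S. f x) = (LINT x|lebesgue_on S. g x)"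
proof (cases "f \<in> borel_measurable (lebesgue_on S)")
  case True
  then show ?thesis using borel_measurable_lebesgue_on_AE[OF S True ae] ae by (intro integral_cong_AE)
next
  case False
  then have "g \<notin> borel_measurable (lebesgue_on S)"
    using borel_measurable_lebesgue_on_AE[OF S, of g f] ae by (auto simp: eq_commute)
  then show ?thesis using False by (metis borel_measurable_integrable not_integrable_integral_eq)
qed

lemma integrable_cong_lebesgue_on_AE:
  fixes f g :: "'a::euclidean_space \<Rightarrow> real"
  assumes S: "S \<in> sets lebesgue" and ae: "AE x in lebesgue_on S. f x = g x" and f: "integrable (lebesgue_on S) f"
  shows "integrable (lebesgue_on S) g"
  using borel_measurable_lebesgue_on_AE[OF S borel_measurable_integrable[OF f] ae] ae f
  by (auto intro: Bochner_Integration.integrable_cong_AE[THEN iffD1, OF _ _ _ f])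

lemma aeq_refl [simp]: "aeq S v v" by (simp add: aeq_def)

lemma aeq_sym: "aeq S v w \<Longrightarrow> aeq S w v" by (simp add: aeq_def eq_commute)

lemma aeq_trans: "aeq S u v \<Longrightarrow> aeq S v w \<Longrightarrow> aeq S u w"
  unfolding aeq_def by (auto elim: eventually_elim2)

lemma aeq_diff: "aeq S u v \<Longrightarrow> aeq S u' v' \<Longrightarrow> aeq S (u - u') (v - v')"
  unfolding aeq_def by (auto elim: eventually_elim2)

lemma L2_aeq: 
  assumes S: "S \<in> sets lebesgue" and v: "v \<in> L2 S" and ae: "aeq S v w" shows "w \<in> L2 S"
proof -
  have "w \<in> borel_measurable (lebesgue_on S)"
    using v ae S by (auto simp: L2_def aeq_def intro: borel_measurable_lebesgue_on_AE)
  moreover have "integrable (lebesgue_on S) (\<lambda>x. (w x)\<^sup>2)"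
    using v ae S by (auto simp: L2_def aeq_def elim!: eventually_mono intro: integrable_cong_lebesgue_on_AE[where f = "\<lambda>x. (v x)\<^sup>2"])
  ultimately show ?thesis by (simp add: L2_def)
qed

lemma ip_aeq:
  assumes S: "S \<in> sets lebesgue" and "aeq S v v'" "aeq S w w'"
  shows "ip S v w = ip S v' w'"
  unfolding ip_def using assms
  by (intro integral_cong_lebesgue_on_AE) (auto simp: aeq_def elim: eventually_elim2)

lemma l2norm_aeq: "S \<in> sets lebesgue \<Longrightarrow> aeq S v w \<Longrightarrow> l2norm S v = l2norm S w"
  by (simp add: l2norm_def ip_aeq)

lemmas L2_complete = Riesz_Fischer[where M = "lebesgue_on S" for S, folded L2_eq_sq_int l2norm_eq_sq_norm]

section \<open>Smooth functions and test functions\<close>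

text \<open>The recursive form makes closure under products and affine substitutions an induction on
  the order; \<open>smooth\<close> itself quantifies over words of directions.\<close>

primrec Ck :: "nat \<Rightarrow> ('a::euclidean_space \<Rightarrow> real) \<Rightarrow> bool" where
  "Ck 0 \<phi> \<longleftrightarrow> \<phi> differentiable_on UNIV"
| "Ck (Suc k) \<phi> \<longleftrightarrow> \<phi> differentiable_on UNIV \<and> (\<forall>b\<in>Basis. Ck k (ddir b \<phi>))"

lemma Ck_iff_foldr:
  "Ck k \<phi> \<longleftrightarrow> (\<forall>bs. set bs \<subseteq> Basis \<and> length bs \<le> k \<longrightarrow> foldr ddir bs \<phi> differentiable_on UNIV)"
proof (induction k arbitrary: \<phi>)
  case (Suc k)
  show ?case
  proof
    assume L: "Ck (Suc k) \<phi>"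
    show "\<forall>bs. set bs \<subseteq> Basis \<and> length bs \<le> Suc k \<longrightarrow> foldr ddir bs \<phi> differentiable_on UNIV"
    proof (intro allI impI)
      fix bs :: "'a list" assume bs: "set bs \<subseteq> Basis \<and> length bs \<le> Suc k"
      show "foldr ddir bs \<phi> differentiable_on UNIV"
      \<comment> \<open>\<open>foldr\<close> applies the last direction of the word first, so the
        word is split at its end.\<close>
      proof (cases bs rule: rev_cases)
        case Nil then show ?thesis using L by simp
      next
        case (snoc cs b)
        then show ?thesis using L bs Suc.IH[of "ddir b \<phi>"] by simp
      qed
    qed
  next
    assume R: "\<forall>bs. set bs \<subseteq> Basis \<and> length bs \<le> Suc k \<longrightarrow> foldr ddir bs \<phi> differentiable_on UNIV"
    have "foldr ddir bs (ddir b \<phi>) differentiable_on UNIV"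
      if "b \<in> Basis" "set bs \<subseteq> Basis" "length bs \<le> k" for b bs
      using R[rule_format, of "bs @ [b]"] that by simp
    moreover have "\<phi> differentiable_on UNIV" using R[rule_format, of "[]"] by simp
    ultimately show "Ck (Suc k) \<phi>" using Suc.IH by simp
  qed
qed simp

lemma smooth_iff_Ck: "smooth \<phi> \<longleftrightarrow> (\<forall>k. Ck k \<phi>)"
  unfolding smooth_def Ck_iff_foldr by auto

lemma Ck_differentiable: "Ck k \<phi> \<Longrightarrow> \<phi> differentiable at x"
  by (cases k) (auto simp: differentiable_on_def)

lemma smooth_ddir: "smooth \<phi> \<Longrightarrow> b \<in> Basis \<Longrightarrow> smooth (ddir b \<phi>)"
  unfolding smooth_iff_Ck by (metis Ck.simps(2))

lemma smooth_has_derivative: "smooth \<phi> \<Longrightarrow> (\<phi> has_derivative (\<lambda>h. ddir h \<phi> x)) (at x)"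
  unfolding ddir_def using Ck_differentiable[of 0] smooth_iff_Ck frechet_derivative_works by blast

lemma smooth_continuous: "smooth \<phi> \<Longrightarrow> continuous_on S \<phi>"
  using smooth_has_derivative has_derivative_continuous_on has_derivative_at_withinI by metis

lemma ddir_eqI: "(\<phi> has_derivative D) (at x) \<Longrightarrow> ddir b \<phi> x = D b"
  unfolding ddir_def by (metis frechet_derivative_at)

lemma Ck_mono: "Ck (Suc k) \<phi> \<Longrightarrow> Ck k \<phi>"
  unfolding Ck_iff_foldr by auto

lemma ddir_add: "\<phi> differentiable at x \<Longrightarrow> \<psi> differentiable at x \<Longrightarrow> ddir b (\<lambda>x. \<phi> x + \<psi> x) x = ddir b \<phi> x + ddir b \<psi> x"
  unfolding frechet_derivative_works by (intro ddir_eqI[THEN trans]) (auto intro!: derivative_eq_intros simp: ddir_def)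

lemma ddir_mult: "\<phi> differentiable at x \<Longrightarrow> \<psi> differentiable at x \<Longrightarrow>
    ddir b (\<lambda>x. \<phi> x * \<psi> x) x = ddir b \<phi> x * \<psi> x + \<phi> x * ddir b \<psi> x"
  unfolding frechet_derivative_works by (intro ddir_eqI[THEN trans]) (auto intro!: derivative_eq_intros simp: ddir_def)

lemma Ck_add: "Ck k \<phi> \<Longrightarrow> Ck k \<psi> \<Longrightarrow> Ck k (\<lambda>x. \<phi> x + \<psi> x)"
proof (induction k arbitrary: \<phi> \<psi>)
  case (Suc k)
  have "ddir b (\<lambda>x. \<phi> x + \<psi> x) = (\<lambda>x. ddir b \<phi> x + ddir b \<psi> x)" for b
    using Suc.prems by (intro ext ddir_add Ck_differentiable)
  then show ?case using Suc by (auto intro: differentiable_on_add)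
qed (auto intro: differentiable_on_add)

lemma Ck_mult: "Ck k \<phi> \<Longrightarrow> Ck k \<psi> \<Longrightarrow> Ck k (\<lambda>x. \<phi> x * \<psi> x)"
proof (induction k arbitrary: \<phi> \<psi>)
  case (Suc k)
  have "ddir b (\<lambda>x. \<phi> x * \<psi> x) = (\<lambda>x. ddir b \<phi> x * \<psi> x + \<phi> x * ddir b \<psi> x)" for b
    using Suc.prems by (intro ext ddir_mult Ck_differentiable)
  then show ?case using Suc Ck_mono[OF Suc.prems(1)] Ck_mono[OF Suc.prems(2)]
    by (auto intro!: differentiable_on_mult Ck_add)
qed (auto intro: differentiable_on_mult)

lemma Ck_const: "Ck k (\<lambda>x. c)"
proof (induction k arbitrary: c)
  case (Suc k)
  have "ddir b (\<lambda>x::'a. c) = (\<lambda>x. 0)" for b by (intro ext ddir_eqI[THEN trans]) auto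
  then show ?case using Suc by simp
qed simp

lemma smooth_add: "smooth \<phi> \<Longrightarrow> smooth \<psi> \<Longrightarrow> smooth (\<lambda>x. \<phi> x + \<psi> x)"
  and smooth_mult: "smooth \<phi> \<Longrightarrow> smooth \<psi> \<Longrightarrow> smooth (\<lambda>x. \<phi> x * \<psi> x)"
  and smooth_const: "smooth (\<lambda>x. c)"
  by (auto simp: smooth_iff_Ck Ck_add Ck_mult Ck_const)

lemma smooth_prod: "finite I \<Longrightarrow> (\<And>i. i \<in> I \<Longrightarrow> smooth (\<phi> i)) \<Longrightarrow> smooth (\<lambda>x. \<Prod>i\<in>I. \<phi> i x)"
  by (induction I rule: finite_induct) (auto intro: smooth_mult smooth_const)

lemma ddir_affine:
  fixes f :: "real \<Rightarrow> real" and i :: "'a::euclidean_space"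
  assumes "f differentiable at (c * (x \<bullet> i) + d)"
  shows "ddir b (\<lambda>x. f (c * (x \<bullet> i) + d)) x = c * (b \<bullet> i) * ddir 1 f (c * (x \<bullet> i) + d)"
proof (rule ddir_eqI[THEN trans])
  show "((\<lambda>x. f (c * (x \<bullet> i) + d)) has_derivative (\<lambda>h. frechet_derivative f (at (c * (x \<bullet> i) + d)) (c * (h \<bullet> i)))) (at x)"
    by (rule has_derivative_compose[where f = "\<lambda>x. c * (x \<bullet> i) + d" and g = f])
      (auto intro!: derivative_eq_intros assms[unfolded frechet_derivative_works])
  have "linear (frechet_derivative f (at (c * (x \<bullet> i) + d)))" using assms by (rule linear_frechet_derivative)
  from linear_scale[OF this, of "c * (b \<bullet> i)" 1]
  show "frechet_derivative f (at (c * (x \<bullet> i) + d)) (c * (b \<bullet> i)) = c * (b \<bullet> i) * ddir 1 f (c * (x \<bullet> i) + d)"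
    by (simp add: ddir_def)
qed

lemma Ck_affine:
  fixes f :: "real \<Rightarrow> real" and i :: "'a::euclidean_space"
  shows "Ck k f \<Longrightarrow> Ck k (\<lambda>x. f (c * (x \<bullet> i) + d))"
proof (induction k arbitrary: f)
  have diff: "(\<lambda>x. f (c * (x \<bullet> i) + d)) differentiable_on UNIV" if "\<And>t. f differentiable at t" for f :: "real \<Rightarrow> real"
    unfolding differentiable_on_def
  proof (intro ballI)
    fix x :: 'a
    have "((\<lambda>x. c * (x \<bullet> i) + d) has_derivative (\<lambda>h. c * (h \<bullet> i))) (at x)" by (auto intro!: derivative_eq_intros)
    moreover have "(f has_derivative frechet_derivative f (at (c * (x \<bullet> i) + d))) (at (c * (x \<bullet> i) + d))"
      using that frechet_derivative_works by blast
    ultimately show "(\<lambda>x. f (c * (x \<bullet> i) + d)) differentiable at x within UNIV"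
      unfolding differentiable_def by (metis has_derivative_compose)
  qed
  case 0
  then show ?case using diff by (simp add: differentiable_on_def)
next
  case (Suc k)
  have d: "\<And>t. f differentiable at t" using Suc.prems by (auto simp: differentiable_on_def)
  have "ddir b (\<lambda>x. f (c * (x \<bullet> i) + d)) = (\<lambda>x. c * (b \<bullet> i) * ddir 1 f (c * (x \<bullet> i) + d))" for b
    by (intro ext ddir_affine d)
  moreover have "Ck k (ddir 1 f)" using Suc.prems by simp
  moreover have "(\<lambda>x. f (c * (x \<bullet> i) + d)) differentiable_on UNIV"
    unfolding differentiable_on_def
  proof (intro ballI)
    fix x :: 'a
    have "((\<lambda>x. c * (x \<bullet> i) + d) has_derivative (\<lambda>h. c * (h \<bullet> i))) (at x)" by (auto intro!: derivative_eq_intros)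
    moreover have "(f has_derivative frechet_derivative f (at (c * (x \<bullet> i) + d))) (at (c * (x \<bullet> i) + d))"
      using d frechet_derivative_works by blast
    ultimately show "(\<lambda>x. f (c * (x \<bullet> i) + d)) differentiable at x within UNIV"
      unfolding differentiable_def by (metis has_derivative_compose)
  qed
  ultimately show ?case using Suc.IH[of "ddir 1 f"] by (auto intro!: Ck_mult Ck_const)
qed

lemma smooth_affine: "smooth f \<Longrightarrow> smooth (\<lambda>x. f (c * (x \<bullet> i) + d))"
  by (simp add: smooth_iff_Ck Ck_affine)

section \<open>Smooth bump functions\<close>

definition flat_exp :: "real poly \<Rightarrow> real \<Rightarrow> real" where
  "flat_exp p t = (if t \<le> 0 then 0 else poly p (1 / t) * exp (- (1 / t)))"

lemma poly_over_exp_tendsto_0: "((\<lambda>s. poly p s * exp (- s)) \<longlongrightarrow> (0::real)) at_top"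
proof -
  have "((\<lambda>s. coeff p i * (s ^ i / exp s)) \<longlongrightarrow> coeff p i * 0) at_top" for i
    by (intro tendsto_intros tendsto_power_div_exp_0)
  then have "((\<lambda>s. \<Sum>i\<le>degree p. coeff p i * (s ^ i / exp s)) \<longlongrightarrow> (\<Sum>i\<le>degree p. 0)) at_top"
    by (intro tendsto_sum) simp
  moreover have "poly p s * exp (- s) = (\<Sum>i\<le>degree p. coeff p i * (s ^ i / exp s))" for s
    by (simp add: poly_altdef sum_distrib_right exp_minus divide_inverse mult.assoc)
  ultimately show ?thesis by simp
qed

lemma flat_exp_deriv:
  "(flat_exp p has_real_derivative flat_exp ([:0, 0, 1:] * (p - pderiv p)) t) (at t)"
proof -
  consider "t < 0" | "t = 0" | "t > 0" by linarith
  then show ?thesis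
  proof cases
    case 1
    have "((\<lambda>t. 0) has_real_derivative 0) (at t)" by simp
    then have "(flat_exp p has_real_derivative 0) (at t)"
      by (rule has_field_derivative_transform_within_open[of _ _ _ "{..<0}"]) (use 1 in \<open>auto simp: flat_exp_def\<close>)
    then show ?thesis using 1 by (simp add: flat_exp_def)
  next
    case 3
    have "((\<lambda>t. poly p (1 / t) * exp (- (1 / t))) has_real_derivative
       poly ([:0, 0, 1:] * (p - pderiv p)) (1 / t) * exp (- (1 / t))) (at t)"
      using 3 by (auto intro!: derivative_eq_intros simp: field_simps power2_eq_square)
    then have "(flat_exp p has_real_derivative poly ([:0, 0, 1:] * (p - pderiv p)) (1 / t) * exp (- (1 / t))) (at t)"
      by (rule has_field_derivative_transform_within_open[of _ _ _ "{0<..}"]) (use 3 in \<open>auto simp: flat_exp_def\<close>)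
    then show ?thesis using 3 by (simp add: flat_exp_def)
  next
    case 2
    \<comment> \<open>With \<open>s = 1 / t\<close> the right difference quotient at 0 is
      \<open>s * poly p s * exp (- s)\<close>; \<open>pCons 0 p\<close> absorbs the extra factor
      \<open>s\<close>.\<close>
    have "((\<lambda>s. poly (pCons 0 p) s * exp (- s)) \<longlongrightarrow> 0) at_top" by (rule poly_over_exp_tendsto_0)
    then have "((\<lambda>t. poly (pCons 0 p) (inverse t) * exp (- inverse t)) \<longlongrightarrow> 0) (at_right 0)"
      by (rule filterlim_compose[OF _ filterlim_inverse_at_top_right])
    moreover have "\<forall>\<^sub>F t in at_right 0. poly (pCons 0 p) (inverse t) * exp (- inverse t) = (flat_exp p t - flat_exp p 0) / (t - 0)"
      by (auto simp: eventually_at_filter flat_exp_def field_simps)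
    ultimately have r: "((\<lambda>t. (flat_exp p t - flat_exp p 0) / (t - 0)) \<longlongrightarrow> 0) (at_right 0)"
      by (rule Lim_transform_eventually)
    have "\<forall>\<^sub>F t in at_left 0. 0 = (flat_exp p t - flat_exp p 0) / (t - 0)"
      by (auto simp: eventually_at_filter flat_exp_def)
    then have "((\<lambda>t. (flat_exp p t - flat_exp p 0) / (t - 0)) \<longlongrightarrow> 0) (at_left 0)"
      by (rule Lim_transform_eventually[OF tendsto_const])
    with r have "((\<lambda>t. (flat_exp p t - flat_exp p 0) / (t - 0)) \<longlongrightarrow> 0) (at 0)"
      by (simp add: filterlim_split_at)
    then show ?thesis using 2 by (simp add: has_field_derivative_iff flat_exp_def)
  qed
qed

lemma Ck_flat_exp: "Ck k (flat_exp p)"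
proof (induction k arbitrary: p)
  have d: "flat_exp p differentiable_on UNIV" for p
    using flat_exp_deriv[of p] by (auto simp: differentiable_on_def real_differentiable_def)
  case 0
  then show ?case using d by simp
  case (Suc k)
  have "ddir 1 (flat_exp p) = flat_exp ([:0, 0, 1:] * (p - pderiv p))"
    by (intro ext ddir_eqI[THEN trans, OF flat_exp_deriv[unfolded has_field_derivative_def]]) simp
  moreover have "flat_exp p differentiable_on UNIV" 
    using flat_exp_deriv[of p] by (auto simp: differentiable_on_def real_differentiable_def)
  ultimately show ?case using Suc by simp
qed

abbreviation step :: "real \<Rightarrow> real" where "step \<equiv> flat_exp 1"

lemma step_bounds: "0 \<le> step t" "step t \<le> 1" "step t = 0 \<longleftrightarrow> t \<le> 0"
  by (auto simp: flat_exp_def)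

lemma step_tendsto: "t > 0 \<Longrightarrow> (\<lambda>n. step (real n * t)) \<longlonglongrightarrow> 1"
proof -
  assume t: "t > 0"
  have "(\<lambda>n. exp (- (1 / t * (1 / real n)))) \<longlonglongrightarrow> exp (- (1 / t * 0))"
    by (intro tendsto_intros lim_1_over_n)
  moreover have "\<forall>\<^sub>F n in sequentially. exp (- (1 / t * (1 / real n))) = step (real n * t)"
    using eventually_gt_at_top[of 0] by eventually_elim (use t in \<open>auto simp: flat_exp_def mult_le_0_iff field_simps\<close>)
  ultimately show ?thesis by (auto elim: Lim_transform_eventually)
qed

text \<open>Bounded by 1 and tending pointwise to the indicator of the open box as \<open>n\<close>
  grows, so dominated convergence turns identities for test functions into identities for box
  integrals.\<close>

definition bump :: "'a::euclidean_space \<Rightarrow> 'a \<Rightarrow> nat \<Rightarrow> 'a \<Rightarrow> real" where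
  "bump a b n x = (\<Prod>i\<in>Basis. step (real n * (x \<bullet> i - a \<bullet> i)) * step (real n * (b \<bullet> i - x \<bullet> i)))"

lemma smooth_bump: "smooth (bump a b n)"
proof -
  have s: "smooth step" by (simp add: smooth_iff_Ck Ck_flat_exp)
  have "smooth (\<lambda>x. step (real n * (x \<bullet> i) + - (real n * (a \<bullet> i))) * step (- real n * (x \<bullet> i) + real n * (b \<bullet> i)))" for i :: 'a
    by (intro smooth_mult smooth_affine s)
  then have "smooth (\<lambda>x. \<Prod>i\<in>Basis. step (real n * (x \<bullet> i) + - (real n * (a \<bullet> i))) * step (- real n * (x \<bullet> i) + real n * (b \<bullet> i)))"
    by (intro smooth_prod) auto
  moreover have "bump a b n = (\<lambda>x. \<Prod>i\<in>Basis. step (real n * (x \<bullet> i) + - (real n * (a \<bullet> i))) * step (- real n * (x \<bullet> i) + real n * (b \<bullet> i)))"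
    by (intro ext) (simp add: bump_def algebra_simps)
  ultimately show ?thesis by simp
qed

lemma bump_bounds: "0 \<le> bump a b n x" "bump a b n x \<le> 1"
  unfolding bump_def by (auto intro!: prod_nonneg prod_le_1 mult_le_one simp: step_bounds)

lemma bump_nonzero_imp_box: "bump a b n x \<noteq> 0 \<Longrightarrow> x \<in> box a b"
  by (auto simp: bump_def mem_box step_bounds mult_le_0_iff not_le)

lemma bump_test_fun:
  assumes "cbox a b \<subseteq> S" shows "bump a b n \<in> test_fun S"
proof -
  have sub: "{x. bump a b n x \<noteq> 0} \<subseteq> cbox a b"
    using bump_nonzero_imp_box[of a b n] box_subset_cbox[of a b] by blast
  then have "closure {x. bump a b n x \<noteq> 0} \<subseteq> cbox a b" by (intro closure_minimal) auto
  moreover have "compact (closure {x. bump a b n x \<noteq> 0})"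
    unfolding compact_closure using sub bounded_cbox bounded_subset by blast
  ultimately show ?thesis using assms smooth_bump[of a b n] by (auto simp: test_fun_def)
qed

lemma bump_tendsto: "(\<lambda>n. bump a b n x) \<longlonglongrightarrow> indicator (box a b) x"
proof (cases "x \<in> box a b")
  case True
  have "(\<lambda>n. \<Prod>i\<in>Basis. step (real n * (x \<bullet> i - a \<bullet> i)) * step (real n * (b \<bullet> i - x \<bullet> i))) \<longlonglongrightarrow> (\<Prod>i\<in>(Basis::'a set). 1 * 1)"
    using True by (intro tendsto_prod tendsto_mult step_tendsto) (auto simp: mem_box)
  then show ?thesis using True by (simp add: bump_def)
next
  case False
  then have "bump a b n x = 0" for n using bump_nonzero_imp_box by blast
  then show ?thesis using False by simp
qed

section \<open>The fundamental lemma of the calculus of variations\<close>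

lemma integrable_lebesgue_on_support:
  fixes f :: "'a::euclidean_space \<Rightarrow> real"
  assumes "K \<in> sets lebesgue" "S \<in> sets lebesgue" "K \<subseteq> S" "\<And>x. x \<in> S - K \<Longrightarrow> f x = 0"
  shows "integrable (lebesgue_on S) f \<longleftrightarrow> integrable (lebesgue_on K) f"
    and "(LINT x|lebesgue_on S. f x) = (LINT x|lebesgue_on K. f x)"
proof -
  have "(\<lambda>x. indicator S x *\<^sub>R f x) = (\<lambda>x. indicator K x *\<^sub>R f x)"
    using assms by (auto simp: indicator_def fun_eq_iff)
  then show "integrable (lebesgue_on S) f \<longleftrightarrow> integrable (lebesgue_on K) f"
    "(LINT x|lebesgue_on S. f x) = (LINT x|lebesgue_on K. f x)"
    using assms by (simp_all add: integrable_restrict_space integral_restrict_space)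
qed

text \<open>Open boxes are an intersection-stable generator of the Borel sets, so Dynkin's argument
  extends the vanishing to all of them; a Lebesgue set differs from a Borel set by a null set. The
  densities \<open>G\<close> and 0 then agree almost everywhere.\<close>

lemma AE_zero_of_box_integrals:
  fixes G :: "'a::euclidean_space \<Rightarrow> real"
  assumes G: "integrable lebesgue G" and box: "\<And>a b. (LINT x:box a b|lebesgue. G x) = 0"
  shows "AE x in lebesgue. G x = 0"
proof -
  have si: "set_integrable lebesgue A G" if "A \<in> sets lebesgue" for A
    using G that unfolding set_integrable_def by (rule integrable_mult_indicator[rotated])
  \<comment> \<open>The whole space is exhausted by boxes; its integral is what the complement step
    of the induction needs.\<close>
  have UN: "(LINT x:UNIV|lebesgue. G x) = 0"
  proof -
    have "(\<lambda>n::nat. LINT x:box (- real n *\<^sub>R One) (real n *\<^sub>R One)|lebesgue. G x)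
        \<longlonglongrightarrow> (LINT x:(\<Union>n::nat. box (- real n *\<^sub>R One) (real n *\<^sub>R One))|lebesgue. G x)"
      using si by (intro set_integral_cont_up) (force simp: incseq_def mem_box)+
    then show ?thesis using box by (simp add: UN_box_eq_UNIV LIMSEQ_const_iff)
  qed
  have borel: "(LINT x:A|lebesgue. G x) = 0" if "A \<in> sets borel" for A
  proof -
    have sb: "sigma_sets UNIV (range (\<lambda>(a, b). box a b :: 'a set)) = sets borel"
      by (simp add: borel_eq_box)
    then have A: "A \<in> sigma_sets UNIV (range (\<lambda>(a, b). box a b :: 'a set))" using that by simp
    have st: "Int_stable (range (\<lambda>(a, b). box a b :: 'a set))"
      by (auto simp: Int_stable_def box_Int_box)
    from st Pow_UNIV[THEN equalityD2, THEN subset_trans[OF subset_UNIV]] A show ?thesis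
    proof (induction A rule: sigma_sets_induct_disjoint)
      case empty then show ?case by (simp add: set_lebesgue_integral_def)
    next
      case (basic A) then show ?case using box by auto
    next
      case (compl A)
      then have A: "A \<in> sets lebesgue" using sb by simp
      have "(LINT x:UNIV|lebesgue. G x) = (LINT x:A|lebesgue. G x) + (LINT x:UNIV - A|lebesgue. G x)"
        using A by (subst set_integral_Un[symmetric]) (auto intro!: si simp: Un_Diff_cancel)
      then show ?case using UN compl by simp
    next
      case (union A)
      then have A: "A i \<in> sets lebesgue" for i using sb by auto
      show ?case using union A
        by (subst lebesgue_integral_countable_add) (auto intro!: si simp: disjoint_family_on_def)
    qed
  qed
  have "(LINT x:A|lebesgue. G x) = 0" if A: "A \<in> sets lebesgue" for A
  proof -
    have "A = main_part lborel A \<union> null_part lborel A" using A by (simp add: main_part_null_part_Un)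
    moreover have "null_part lborel A \<in> null_sets lebesgue" using A by (rule null_part_null_sets)
    ultimately have "AE x in lebesgue. indicator A x *\<^sub>R G x = indicator (main_part lborel A) x *\<^sub>R G x"
      by (intro AE_I'[of "null_part lborel A"]) (auto simp: indicator_def)
    then have "(LINT x:A|lebesgue. G x) = (LINT x:main_part lborel A|lebesgue. G x)"
      unfolding set_lebesgue_integral_def
      using si[unfolded set_integrable_def, THEN borel_measurable_integrable] A main_part_sets[OF A]
      by (intro integral_cong_AE) auto
    then show ?thesis using borel[of "main_part lborel A"] main_part_sets[OF A] by simp
  qed
  then show ?thesis using density_unique_real[of lebesgue G "\<lambda>x. 0"] G by simp
qed

text \<open>Testing with bumps shows that the integrals over boxes inside \<open>S\<close> vanish,
  which settles the claim on each such box. Countably many closed boxes cover \<open>S\<close>, and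
  their boundaries are null.\<close>

lemma fundamental_lemma:
  fixes g :: "'a::euclidean_space \<Rightarrow> real"
  assumes S: "open S" and g: "\<And>K. compact K \<Longrightarrow> K \<subseteq> S \<Longrightarrow> integrable (lebesgue_on K) g"
    and z: "\<And>\<phi>. \<phi> \<in> test_fun S \<Longrightarrow> ip S g \<phi> = 0"
  shows "AE x in lebesgue_on S. g x = 0"
proof -
  have Sm: "S \<in> sets lebesgue" using S by auto
  have box0: "(LINT x:box a b|lebesgue. g x) = 0" if ab: "cbox a b \<subseteq> S" for a b
  proof -
    have gi: "integrable (lebesgue_on (cbox a b)) g" using g ab by auto
    have "(\<lambda>n. LINT x|lebesgue_on (cbox a b). g x * bump a b n x) \<longlonglongrightarrow> (LINT x|lebesgue_on (cbox a b). g x * indicator (box a b) x)"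
    proof (rule integral_dominated_convergence[where w = "\<lambda>x. \<bar>g x\<bar>"])
      show "(\<lambda>x. g x * indicator (box a b) x) \<in> borel_measurable (lebesgue_on (cbox a b))"
        using borel_measurable_integrable[OF gi] box_subset_cbox[of a b] by (intro borel_measurable_times borel_measurable_indicator) (auto simp: sets_restrict_space_iff)
      show "(\<lambda>x. g x * bump a b n x) \<in> borel_measurable (lebesgue_on (cbox a b))" for n
        using borel_measurable_integrable[OF gi] smooth_bump[of a b n]
        by (intro borel_measurable_times[OF _ continuous_imp_measurable_on_sets_lebesgue[OF smooth_continuous]]) auto
      show "integrable (lebesgue_on (cbox a b)) (\<lambda>x. \<bar>g x\<bar>)" using gi by simp
      show "AE x in lebesgue_on (cbox a b). (\<lambda>n. g x * bump a b n x) \<longlonglongrightarrow> g x * indicator (box a b) x"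
        by (intro AE_I2 tendsto_intros bump_tendsto)
      show "AE x in lebesgue_on (cbox a b). norm (g x * bump a b n x) \<le> \<bar>g x\<bar>" for n
        using bump_bounds[of a b n] by (intro AE_I2) (simp add: abs_mult mult_left_le)
    qed
    moreover have "(LINT x|lebesgue_on (cbox a b). g x * bump a b n x) = 0" for n
    proof -
      have "ip S g (bump a b n) = 0" using z bump_test_fun[OF ab] by simp
      moreover have "ip S g (bump a b n) = (LINT x|lebesgue_on (cbox a b). g x * bump a b n x)"
        unfolding ip_def using ab Sm bump_nonzero_imp_box[of a b n] box_subset_cbox[of a b]
        by (intro integrable_lebesgue_on_support(2)) auto
      ultimately show ?thesis by simp
    qed
    ultimately have "(LINT x|lebesgue_on (cbox a b). g x * indicator (box a b) x) = 0"
      by (simp add: LIMSEQ_const_iff)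
    moreover have "(LINT x|lebesgue_on (cbox a b). g x * indicator (box a b) x) = (LINT x:box a b|lebesgue. g x)"
      unfolding set_lebesgue_integral_def using box_subset_cbox[of a b]
      by (subst integral_restrict_space) (auto intro!: Bochner_Integration.integral_cong simp: indicator_def)
    ultimately show ?thesis by simp
  qed
  have local: "AE x in lebesgue. x \<in> box a b \<longrightarrow> g x = 0" if ab: "cbox a b \<subseteq> S" for a b
  proof -
    have "AE x in lebesgue. indicator (box a b) x * g x = 0"
    proof (rule AE_zero_of_box_integrals)
      have "integrable (lebesgue_on (cbox a b)) g" using g ab by auto
      then have "set_integrable lebesgue (cbox a b) g" by (simp add: integrable_restrict_space set_integrable_def)
      then have "set_integrable lebesgue (box a b) g" by (rule set_integrable_subset) (auto intro: box_subset_cbox[THEN subsetD])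
      then show "integrable lebesgue (\<lambda>x. indicator (box a b) x * g x)" by (simp add: set_integrable_def)
      fix c d
      obtain p q where pq: "box a b \<inter> box c d = box p q" by (auto simp: box_Int_box)
      have "(LINT x:box c d|lebesgue. indicator (box a b) x * g x) = (LINT x:box p q|lebesgue. g x)"
        unfolding set_lebesgue_integral_def pq[symmetric]
        by (intro Bochner_Integration.integral_cong) (auto simp: indicator_def)
      moreover have "(LINT x:box p q|lebesgue. g x) = 0"
      \<comment> \<open>If the intersection is nonempty, \<open>cbox p q\<close> is its closure and
        stays inside \<open>cbox a b\<close>. If it is empty, its corners carry no information, but
        the integral is trivially 0.\<close>
      proof (cases "box p q = {}")
        case False
        then have "cbox p q = closure (box p q)" by (simp add: closure_box)
        also have "\<dots> \<subseteq> closure (box a b)" using pq by (intro closure_mono) auto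
        also have "\<dots> \<subseteq> cbox a b" by (intro closure_minimal box_subset_cbox closed_cbox)
        finally show ?thesis using ab by (intro box0) auto
      qed (simp add: set_lebesgue_integral_def)
      ultimately show "(LINT x:box c d|lebesgue. indicator (box a b) x * g x) = 0" by simp
    qed
    then show ?thesis by eventually_elim auto
  qed
  have local': "AE x in lebesgue. x \<in> cbox a b \<longrightarrow> g x = 0" if ab: "cbox a b \<subseteq> S" for a b
  proof -
    have "cbox a b - box a b \<in> null_sets lebesgue"
      using negligible_frontier_interval by (simp add: negligible_iff_null_sets)
    then have "AE x in lebesgue. x \<notin> cbox a b - box a b" by (rule AE_not_in)
    with local[OF ab] show ?thesis by eventually_elim auto
  qed
  obtain D where D: "countable D" "D \<subseteq> Pow S" "\<And>X. X \<in> D \<Longrightarrow> \<exists>a b. X = cbox a b" "\<Union>D = S"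
    using open_countable_Union_open_cbox[OF S] by metis
  have "AE x in lebesgue. \<forall>X\<in>D. x \<in> X \<longrightarrow> g x = 0"
    using D local' by (intro AE_ball_countable'[OF _ D(1)]) (metis PowD subsetD)
  then have "AE x in lebesgue. x \<in> S \<longrightarrow> g x = 0" using D(4) by (auto elim: eventually_mono)
  then show ?thesis using Sm by (simp add: AE_restrict_space_iff)
qed

section \<open>Test functions, integration by parts and exchange of partial derivatives\<close>

lemma ddir_outside_support:
  fixes \<phi> :: "'a::euclidean_space \<Rightarrow> real"
  assumes "x \<notin> closure {x. \<phi> x \<noteq> 0}" shows "ddir b \<phi> x = 0"
proof -
  have "((\<lambda>_. 0) has_derivative (\<lambda>_. 0)) (at x)" by simp
  then have "(\<phi> has_derivative (\<lambda>_. 0)) (at x)"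
  proof (rule has_derivative_transform_within_open)
    show "open (- closure {x. \<phi> x \<noteq> 0})" by auto
    show "0 = \<phi> y" if "y \<in> - closure {x. \<phi> x \<noteq> 0}" for y
      using that closure_subset[of "{x. \<phi> x \<noteq> 0}"] by (metis (mono_tags) Compl_iff mem_Collect_eq subsetD)
  qed (use assms in auto)
  then show ?thesis by (rule ddir_eqI)
qed

lemma support_ddir: "closure {x. ddir b \<phi> x \<noteq> 0} \<subseteq> closure {x. \<phi> x \<noteq> 0}"
  using ddir_outside_support[of _ \<phi> b] by (intro closure_minimal) auto

lemma test_fun_ddir:
  assumes \<phi>: "\<phi> \<in> test_fun S" and b: "b \<in> Basis" shows "ddir b \<phi> \<in> test_fun S"
proof -
  have "compact (closure {x. \<phi> x \<noteq> 0} \<inter> closure {x. ddir b \<phi> x \<noteq> 0})"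
    using \<phi> by (intro compact_Int_closed) (auto simp: test_fun_def)
  then have "compact (closure {x. ddir b \<phi> x \<noteq> 0})" using support_ddir[of b \<phi>] by (simp add: Int_absorb1)
  then show ?thesis using \<phi> b smooth_ddir support_ddir[of b \<phi>] by (auto simp: test_fun_def)
qed

lemma test_fun_support:
  assumes "\<phi> \<in> test_fun S"
  obtains K where "compact K" "K \<subseteq> S" "\<And>x. x \<notin> K \<Longrightarrow> \<phi> x = 0"
proof (rule that)
  show "compact (closure {x. \<phi> x \<noteq> 0})" "closure {x. \<phi> x \<noteq> 0} \<subseteq> S" using assms by (auto simp: test_fun_def)
  show "\<phi> x = 0" if "x \<notin> closure {x. \<phi> x \<noteq> 0}" for x
    using that closure_subset[of "{x. \<phi> x \<noteq> 0}"] by (metis (mono_tags) mem_Collect_eq subsetD)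
qed

lemma test_funI:
  assumes "smooth \<phi>" "compact K" "K \<subseteq> S" "\<And>x. x \<notin> K \<Longrightarrow> \<phi> x = 0"
  shows "\<phi> \<in> test_fun S"
proof -
  have sub: "{x. \<phi> x \<noteq> 0} \<subseteq> K" using assms(4) by blast
  then have "closure {x. \<phi> x \<noteq> 0} \<subseteq> K" using assms(2) by (intro closure_minimal compact_imp_closed)
  moreover have "compact (closure {x. \<phi> x \<noteq> 0})"
    unfolding compact_closure by (rule bounded_subset[OF compact_imp_bounded[OF assms(2)] sub])
  ultimately show ?thesis using assms by (auto simp: test_fun_def)
qed

lemma test_fun_smooth: "\<phi> \<in> test_fun S \<Longrightarrow> smooth \<phi>"
  by (simp add: test_fun_def)

lemma test_fun_comb:
  assumes "\<phi> \<in> test_fun S" "\<psi> \<in> test_fun S" shows "(\<lambda>x. r * \<phi> x + s * \<psi> x) \<in> test_fun S"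
proof -
  obtain K where K: "compact K" "K \<subseteq> S" "\<And>x. x \<notin> K \<Longrightarrow> \<phi> x = 0" using assms(1) by (rule test_fun_support) blast
  obtain L where L: "compact L" "L \<subseteq> S" "\<And>x. x \<notin> L \<Longrightarrow> \<psi> x = 0" using assms(2) by (rule test_fun_support) blast
  show ?thesis
    using K L by (intro test_funI[of _ "K \<union> L"] smooth_add smooth_mult smooth_const
      test_fun_smooth[OF assms(1)] test_fun_smooth[OF assms(2)]) auto
qed

lemma test_fun_mult:
  assumes "smooth \<phi>" "\<psi> \<in> test_fun S" shows "(\<lambda>x. \<phi> x * \<psi> x) \<in> test_fun S"
proof -
  obtain L where L: "compact L" "L \<subseteq> S" "\<And>x. x \<notin> L \<Longrightarrow> \<psi> x = 0" using assms(2) by (rule test_fun_support) blast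
  then show ?thesis by (intro test_funI[of _ L] smooth_mult assms(1) test_fun_smooth[OF assms(2)]) auto
qed

lemma continuous_compact_support_integrable:
  fixes f :: "'a::euclidean_space \<Rightarrow> real"
  assumes f: "continuous_on UNIV f" and K: "compact K" and z: "\<And>x. x \<notin> K \<Longrightarrow> f x = 0"
  shows "integrable lborel f"
proof -
  have "integrable lborel (\<lambda>x. indicator K x *\<^sub>R f x)"
    using f K by (intro borel_integrable_compact) (auto elim: continuous_on_subset)
  moreover have "(\<lambda>x. indicator K x *\<^sub>R f x) = f" using z by (auto simp: indicator_def fun_eq_iff)
  ultimately show ?thesis by simp
qed

lemma smooth_line_derivative:
  assumes "smooth \<phi>"
  shows "((\<lambda>t. \<phi> (x + t *\<^sub>R b)) has_real_derivative ddir b \<phi> (x + t *\<^sub>R b)) (at t)"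
proof -
  have "((\<lambda>t. \<phi> (x + t *\<^sub>R b)) has_derivative (\<lambda>h. ddir (h *\<^sub>R b) \<phi> (x + t *\<^sub>R b))) (at t)"
    by (rule has_derivative_compose[where f = "\<lambda>t. x + t *\<^sub>R b" and g = \<phi>])
      (auto intro!: derivative_eq_intros smooth_has_derivative assms)
  moreover have "ddir (h *\<^sub>R b) \<phi> y = ddir b \<phi> y * h" for h y
    using linear_scale[OF has_derivative_linear[OF smooth_has_derivative[OF assms, of y]], of h b] by simp
  ultimately show ?thesis by (simp add: has_field_derivative_def mult_commute_abs)
qed

text \<open>Translation invariance makes every difference quotient of \<open>h\<close> integrate to
  0, and dominated convergence passes to the derivative. No iterated integrals are involved.\<close>

lemma integral_ddir_eq_0:
  fixes h :: "'a::euclidean_space \<Rightarrow> real"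
  assumes h: "h \<in> test_fun UNIV" and b: "b \<in> Basis"
  shows "(LINT x|lborel. ddir b h x) = 0"
proof -
  obtain K where K: "compact K" "\<And>x. x \<notin> K \<Longrightarrow> h x = 0" using h by (rule test_fun_support) blast
  obtain L where L: "compact L" "\<And>x. x \<notin> L \<Longrightarrow> ddir b h x = 0"
    using test_fun_ddir[OF h b] by (rule test_fun_support) blast
  have hs: "smooth h" "smooth (ddir b h)" using h b smooth_ddir by (auto simp: test_fun_def)
  have hi: "integrable lborel h" by (rule continuous_compact_support_integrable[OF smooth_continuous[OF hs(1)] K])
  have hm [measurable]: "h \<in> borel_measurable borel" "ddir b h \<in> borel_measurable borel"
    using hs by (auto intro!: borel_measurable_continuous_onI smooth_continuous)
  have "bounded (ddir b h ` L)" using L hs by (intro compact_imp_bounded compact_continuous_image smooth_continuous)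
  then obtain M0 where "\<And>x. x \<in> L \<Longrightarrow> \<bar>ddir b h x\<bar> \<le> M0" by (auto simp: bounded_iff)
  then obtain M where M: "M \<ge> 0" "\<And>x. \<bar>ddir b h x\<bar> \<le> M"
    using L(2) by (metis abs_zero linorder_linear max.coboundedI1 max.coboundedI2)
  obtain R where R: "\<And>x. x \<in> K \<Longrightarrow> norm x \<le> R" using compact_imp_bounded[OF K(1)] by (auto simp: bounded_iff)
  define f where "f n x = real (Suc n) * (h (x + (1 / real (Suc n)) *\<^sub>R b) - h x)" for n x
  have mvt: "\<bar>h (x + t *\<^sub>R b) - h x\<bar> \<le> M * t" if t: "t > 0" for x t
  proof -
    have "\<exists>z. 0 < z \<and> z < t \<and> h (x + t *\<^sub>R b) - h (x + 0 *\<^sub>R b) = (t - 0) * ddir b h (x + z *\<^sub>R b)"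
      using smooth_line_derivative[OF hs(1)] t by (intro MVT2) auto
    then obtain z where "h (x + t *\<^sub>R b) - h x = t * ddir b h (x + z *\<^sub>R b)" by auto
    then show ?thesis using t mult_left_mono[OF M(2)[of "x + z *\<^sub>R b"], of t] by (simp add: abs_mult mult.commute)
  qed
  have "(\<lambda>n. LINT x|lborel. f n x) \<longlonglongrightarrow> (LINT x|lborel. ddir b h x)"
  \<comment> \<open>The mean value theorem bounds the quotients by \<open>M\<close>. Steps have
    length at most 1, so the quotients vanish outside a ball that exceeds the support of
    \<open>h\<close> by 1.\<close>
  proof (rule integral_dominated_convergence[where w = "\<lambda>x. M * indicator (cball 0 (R + 1)) x"])
    show "integrable lborel (\<lambda>x::'a. M * indicator (cball 0 (R + 1)) x)"
      using emeasure_bounded_finite[OF bounded_cball, of 0 "R + 1"]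
      by (intro integrable_mult_right integrable_real_indicator) auto
    show "f n \<in> borel_measurable lborel" for n unfolding f_def by measurable
    show "AE x in lborel. (\<lambda>n. f n x) \<longlonglongrightarrow> ddir b h x"
    proof (rule AE_I2)
      fix x
      have "((\<lambda>t. (h (x + t *\<^sub>R b) - h (x + 0 *\<^sub>R b)) / (t - 0)) \<longlongrightarrow> ddir b h (x + 0 *\<^sub>R b)) (at 0)"
        using smooth_line_derivative[OF hs(1), of x b 0] by (simp add: has_field_derivative_iff)
      moreover have "filterlim (\<lambda>n. 1 / real (Suc n)) (at 0) sequentially"
        unfolding filterlim_at using LIMSEQ_Suc[OF lim_1_over_n[where 'a = real]] by auto
      ultimately have "(\<lambda>n. (h (x + (1 / real (Suc n)) *\<^sub>R b) - h (x + 0 *\<^sub>R b)) / (1 / real (Suc n) - 0)) \<longlonglongrightarrow> ddir b h (x + 0 *\<^sub>R b)"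
        by (rule filterlim_compose)
      then show "(\<lambda>n. f n x) \<longlonglongrightarrow> ddir b h x" by (simp add: f_def mult.commute)
    qed
    show "AE x in lborel. norm (f n x) \<le> M * indicator (cball 0 (R + 1)) x" for n
    proof (rule AE_I2)
      fix x
      have t: "0 < 1 / real (Suc n)" "1 / real (Suc n) \<le> 1" by auto
      show "norm (f n x) \<le> M * indicator (cball 0 (R + 1)) x"
      proof (cases "x \<in> cball 0 (R + 1)")
        case True
        have "norm (f n x) = real (Suc n) * \<bar>h (x + (1 / real (Suc n)) *\<^sub>R b) - h x\<bar>" by (simp add: f_def abs_mult)
        also have "\<dots> \<le> real (Suc n) * (M * (1 / real (Suc n)))" using mvt[OF t(1)] by (intro mult_left_mono) auto
        finally show ?thesis using True by simp
      next
        case False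
        then have x: "norm x > R + 1" by simp
        have "norm x \<le> norm (x + (1 / real (Suc n)) *\<^sub>R b) + norm ((1 / real (Suc n)) *\<^sub>R b)"
          using norm_triangle_ineq4[of "x + (1 / real (Suc n)) *\<^sub>R b" "(1 / real (Suc n)) *\<^sub>R b"] by simp
        also have "norm ((1 / real (Suc n)) *\<^sub>R b) \<le> 1" using t b by simp
        finally have "norm (x + (1 / real (Suc n)) *\<^sub>R b) > R" using x by simp
        then have "h (x + (1 / real (Suc n)) *\<^sub>R b) = 0" using K(2) R by (meson not_le)
        moreover have "h x = 0" using K(2) R[of x] x by force
        ultimately show ?thesis using False by (simp add: f_def)
      qed
    qed
  qed (auto)
  moreover have "(LINT x|lborel. f n x) = 0" for n
  proof -
    let ?c = "(1 / real (Suc n)) *\<^sub>R b"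
    have tr: "(LINT x|lborel. h (?c + x)) = (LINT x|lborel. h x)"
      using integral_distr[of "(+) ?c" lborel borel h] unfolding lborel_distr_plus by simp
    have ti: "integrable lborel (\<lambda>x. h (?c + x))"
      using integrable_distr_eq[of "(+) ?c" lborel borel h] hi unfolding lborel_distr_plus by simp
    have "(LINT x|lborel. f n x) = (LINT x|lborel. real (Suc n) * (h (?c + x) - h x))"
      unfolding f_def by (simp only: add.commute)
    then show ?thesis using tr ti hi by simp
  qed
  ultimately show ?thesis by (simp add: LIMSEQ_const_iff)
qed

lemma LINT_lebesgue_on_eq_lborel:
  fixes f :: "'a::euclidean_space \<Rightarrow> real"
  assumes f: "continuous_on UNIV f" and S: "S \<in> sets lebesgue" and z: "\<And>x. x \<notin> S \<Longrightarrow> f x = 0"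
  shows "(LINT x|lebesgue_on S. f x) = (LINT x|lborel. f x)"
proof -
  have "(LINT x|lebesgue_on S. f x) = (LINT x|lebesgue. indicator S x *\<^sub>R f x)" using S by (simp add: integral_restrict_space)
  also have "\<dots> = (LINT x|lebesgue. f x)" using z by (intro Bochner_Integration.integral_cong) (auto simp: indicator_def)
  also have "\<dots> = (LINT x|lborel. f x)" using f by (intro integral_completion) (simp add: borel_measurable_continuous_onI)
  finally show ?thesis .
qed

lemma ip_ddir_by_parts:
  fixes \<phi> :: "'a::euclidean_space \<Rightarrow> real"
  assumes \<phi>: "smooth \<phi>" and \<psi>: "\<psi> \<in> test_fun S" and b: "b \<in> Basis" and S: "S \<in> sets lebesgue"
  shows "ip S \<phi> (ddir b \<psi>) = - ip S (ddir b \<phi>) \<psi>"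
proof -
  obtain K where K: "compact K" "K \<subseteq> S" "\<And>x. x \<notin> K \<Longrightarrow> \<psi> x = 0" using \<psi> by (rule test_fun_support) blast
  obtain L where L: "compact L" "L \<subseteq> S" "\<And>x. x \<notin> L \<Longrightarrow> ddir b \<psi> x = 0"
    using test_fun_ddir[OF \<psi> b] by (rule test_fun_support) blast
  note sm = \<phi> smooth_ddir[OF \<phi> b] test_fun_smooth[OF \<psi>] smooth_ddir[OF test_fun_smooth[OF \<psi>] b]
  have c: "continuous_on UNIV (\<lambda>x. \<phi> x * ddir b \<psi> x)" "continuous_on UNIV (\<lambda>x. ddir b \<phi> x * \<psi> x)"
    by (intro continuous_intros smooth_continuous sm)+
  have "(\<lambda>x. \<phi> x * \<psi> x) \<in> test_fun UNIV"
    using K \<phi> test_fun_smooth[OF \<psi>] by (intro test_funI[of _ K] smooth_mult) auto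
  from integral_ddir_eq_0[OF this b]
  have "(LINT x|lborel. ddir b \<phi> x * \<psi> x + \<phi> x * ddir b \<psi> x) = 0"
    using sm by (subst (asm) ddir_mult) (auto simp: smooth_iff_Ck intro: Ck_differentiable[of 0])
  moreover have "integrable lborel (\<lambda>x. \<phi> x * ddir b \<psi> x)" "integrable lborel (\<lambda>x. ddir b \<phi> x * \<psi> x)"
    using K L by (auto intro!: continuous_compact_support_integrable[OF c(1) L(1)] continuous_compact_support_integrable[OF c(2) K(1)])
  ultimately have "(LINT x|lborel. \<phi> x * ddir b \<psi> x) = - (LINT x|lborel. ddir b \<phi> x * \<psi> x)" by simp
  moreover have "ip S \<phi> (ddir b \<psi>) = (LINT x|lborel. \<phi> x * ddir b \<psi> x)"
    unfolding ip_def using S L by (intro LINT_lebesgue_on_eq_lborel c) auto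
  moreover have "ip S (ddir b \<phi>) \<psi> = (LINT x|lborel. ddir b \<phi> x * \<psi> x)"
    unfolding ip_def using S K by (intro LINT_lebesgue_on_eq_lborel c) auto
  ultimately show ?thesis by simp
qed

lemma second_difference_MVT:
  fixes f :: "'a::euclidean_space \<Rightarrow> real"
  assumes f: "smooth f" and a: "a \<in> Basis" and h: "h > 0"
  obtains s t where "0 < s" "s < h" "0 < t" "t < h"
    "f (x + h *\<^sub>R a + h *\<^sub>R b) - f (x + h *\<^sub>R a) - f (x + h *\<^sub>R b) + f x = h\<^sup>2 * ddir b (ddir a f) (x + s *\<^sub>R a + t *\<^sub>R b)"
proof -
  define g where "g s = f ((x + h *\<^sub>R b) + s *\<^sub>R a) - f (x + s *\<^sub>R a)" for s
  have "(g has_real_derivative (ddir a f ((x + h *\<^sub>R b) + s *\<^sub>R a) - ddir a f (x + s *\<^sub>R a))) (at s)" for s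
    unfolding g_def by (intro DERIV_diff smooth_line_derivative f)
  then have "\<exists>z. 0 < z \<and> z < h \<and> g h - g 0 = (h - 0) * (ddir a f ((x + h *\<^sub>R b) + z *\<^sub>R a) - ddir a f (x + z *\<^sub>R a))"
    using h by (intro MVT2) auto
  then obtain s where s: "0 < s" "s < h" "g h - g 0 = h * (ddir a f ((x + h *\<^sub>R b) + s *\<^sub>R a) - ddir a f (x + s *\<^sub>R a))" by auto
  have "\<exists>z. 0 < z \<and> z < h \<and> ddir a f ((x + s *\<^sub>R a) + h *\<^sub>R b) - ddir a f ((x + s *\<^sub>R a) + 0 *\<^sub>R b)
      = (h - 0) * ddir b (ddir a f) ((x + s *\<^sub>R a) + z *\<^sub>R b)"
    using h smooth_line_derivative[OF smooth_ddir[OF f a]] by (intro MVT2) auto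
  then obtain t where t: "0 < t" "t < h" "ddir a f ((x + s *\<^sub>R a) + h *\<^sub>R b) - ddir a f (x + s *\<^sub>R a) = h * ddir b (ddir a f) (x + s *\<^sub>R a + t *\<^sub>R b)" by auto
  have "f (x + h *\<^sub>R a + h *\<^sub>R b) - f (x + h *\<^sub>R a) - f (x + h *\<^sub>R b) + f x = g h - g 0"
    by (simp add: g_def algebra_simps)
  also have "\<dots> = h * (h * ddir b (ddir a f) (x + s *\<^sub>R a + t *\<^sub>R b))"
    using s(3) t(3) by (simp add: add_ac)
  finally show ?thesis using s t by (intro that[of s t]) (auto simp: power2_eq_square)
qed

text \<open>The mixed second difference with step \<open>h\<close> is symmetric in the two
  directions, and the mean value theorem writes it as \<open>h^2\<close> times either mixed
  derivative at points within \<open>2 * h\<close> of \<open>x\<close>. Continuity of both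
  derivatives finishes as \<open>h\<close> tends to 0.\<close>

lemma ddir_commute:
  fixes f :: "'a::euclidean_space \<Rightarrow> real"
  assumes f: "smooth f" and a: "a \<in> Basis" and b: "b \<in> Basis"
  shows "ddir a (ddir b f) = ddir b (ddir a f)"
proof
  fix x
  define D1 where "D1 = ddir b (ddir a f)"
  define D2 where "D2 = ddir a (ddir b f)"
  have sm: "smooth D1" "smooth D2" unfolding D1_def D2_def by (intro smooth_ddir f a b)+
  have ex: "\<exists>p q. dist p x \<le> 2 * h \<and> dist q x \<le> 2 * h \<and> D1 p = D2 q" if h: "h > 0" for h
  proof -
    obtain s t where st: "0 < s" "s < h" "0 < t" "t < h"
      "f (x + h *\<^sub>R a + h *\<^sub>R b) - f (x + h *\<^sub>R a) - f (x + h *\<^sub>R b) + f x = h\<^sup>2 * D1 (x + s *\<^sub>R a + t *\<^sub>R b)"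
      unfolding D1_def using second_difference_MVT[OF f a h, of x b] by metis
    obtain s' t' where st': "0 < s'" "s' < h" "0 < t'" "t' < h"
      "f (x + h *\<^sub>R b + h *\<^sub>R a) - f (x + h *\<^sub>R b) - f (x + h *\<^sub>R a) + f x = h\<^sup>2 * D2 (x + s' *\<^sub>R b + t' *\<^sub>R a)"
      unfolding D2_def using second_difference_MVT[OF f b h, of x a] by metis
    have "h\<^sup>2 * D1 (x + s *\<^sub>R a + t *\<^sub>R b) = h\<^sup>2 * D2 (x + s' *\<^sub>R b + t' *\<^sub>R a)"
      using st(5) st'(5) by (simp add: algebra_simps)
    then have "D1 (x + s *\<^sub>R a + t *\<^sub>R b) = D2 (x + s' *\<^sub>R b + t' *\<^sub>R a)" using h by simp
    moreover have "dist (x + p *\<^sub>R c + q *\<^sub>R d) x \<le> 2 * h" if "c \<in> Basis" "d \<in> Basis" "0 < p" "p < h" "0 < q" "q < h" for p q and c d :: 'a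
    proof -
      have "dist (x + p *\<^sub>R c + q *\<^sub>R d) x = norm (p *\<^sub>R c + q *\<^sub>R d)" by (simp add: dist_norm)
      also have "\<dots> \<le> norm (p *\<^sub>R c) + norm (q *\<^sub>R d)" by (rule norm_triangle_ineq)
      also have "\<dots> \<le> 2 * h" using that by simp
      finally show ?thesis .
    qed
    ultimately show ?thesis using st st' a b by blast
  qed
  then have "\<forall>n. \<exists>p q. dist p x \<le> 2 * (1 / real (Suc n)) \<and> dist q x \<le> 2 * (1 / real (Suc n)) \<and> D1 p = D2 q"
    by (intro allI ex) simp
  then obtain p q where pq: "\<And>n. dist (p n) x \<le> 2 * (1 / real (Suc n))" "\<And>n. dist (q n) x \<le> 2 * (1 / real (Suc n))" "\<And>n. D1 (p n) = D2 (q n)"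
    by metis
  have lim: "(\<lambda>n. 2 * (1 / real (Suc n))) \<longlonglongrightarrow> 2 * 0" by (intro tendsto_intros LIMSEQ_Suc[OF lim_1_over_n])
  have to: "r \<longlonglongrightarrow> x" if "\<And>n. dist (r n) x \<le> 2 * (1 / real (Suc n))" for r :: "nat \<Rightarrow> 'a"
  proof (rule metric_LIMSEQ_I)
    have "(\<lambda>n. dist (r n) x) \<longlonglongrightarrow> 0"
      by (rule tendsto_sandwich[OF _ _ tendsto_const lim[simplified]]) (use that in auto)
    then show "\<exists>no. \<forall>n\<ge>no. dist (r n) x < e" if "e > 0" for e
      using that by (auto simp: lim_sequentially)
  qed
  have "isCont D1 x" "isCont D2 x" using smooth_continuous[OF sm(1), of UNIV] smooth_continuous[OF sm(2), of UNIV]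
    by (auto simp: continuous_on_eq_continuous_at)
  then have "(\<lambda>n. D1 (p n)) \<longlonglongrightarrow> D1 x" "(\<lambda>n. D2 (q n)) \<longlonglongrightarrow> D2 x"
    using to[OF pq(1)] to[OF pq(2)] by (auto intro: isCont_tendsto_compose)
  then show "ddir a (ddir b f) x = ddir b (ddir a f) x"
    using pq(3) LIMSEQ_unique unfolding D1_def D2_def by fastforce
qed

abbreviation e1 :: "real^2" where "e1 \<equiv> axis 1 1"
abbreviation e2 :: "real^2" where "e2 \<equiv> axis 2 1"

lemma e_Basis: "e1 \<in> Basis" "e2 \<in> Basis"
  by (auto simp: axis_in_Basis_iff)

lemma smooth_ddir_pow: "smooth \<phi> \<Longrightarrow> b \<in> Basis \<Longrightarrow> smooth ((ddir b ^^ n) \<phi>)"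
  by (induction n) (auto intro: smooth_ddir)

lemma test_fun_ddir_pow: "\<phi> \<in> test_fun S \<Longrightarrow> b \<in> Basis \<Longrightarrow> (ddir b ^^ n) \<phi> \<in> test_fun S"
  by (induction n) (auto intro: test_fun_ddir)

lemma smooth_pderiv2: "smooth \<phi> \<Longrightarrow> smooth (pderiv2 \<mu> \<phi>)"
  unfolding pderiv2_def by (intro smooth_ddir_pow e_Basis)

lemma test_fun_pderiv2: "\<phi> \<in> test_fun S \<Longrightarrow> pderiv2 \<mu> \<phi> \<in> test_fun S"
  unfolding pderiv2_def by (intro test_fun_ddir_pow e_Basis)

lemma ddir_pow_commute1:
  "smooth f \<Longrightarrow> a \<in> Basis \<Longrightarrow> b \<in> Basis \<Longrightarrow> (ddir a ^^ n) (ddir b f) = ddir b ((ddir a ^^ n) f)"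
proof (induction n)
  case (Suc n)
  then show ?case using ddir_commute[of "(ddir a ^^ n) f" a b] by (simp add: smooth_ddir_pow)
qed simp

lemma ddir_pow_commute:
  assumes "smooth f" "a \<in> Basis" "b \<in> Basis"
  shows "(ddir a ^^ n) ((ddir b ^^ m) f) = (ddir b ^^ m) ((ddir a ^^ n) f)"
proof (induction m)
  case (Suc m)
  then show ?case using ddir_pow_commute1[of "(ddir b ^^ m) f" a b n] assms by (simp add: smooth_ddir_pow)
qed simp

lemma pderiv2_pderiv2:
  assumes "smooth \<phi>"
  shows "pderiv2 \<mu> (pderiv2 \<nu> \<phi>) = pderiv2 (fst \<mu> + fst \<nu>, snd \<mu> + snd \<nu>) \<phi>"
proof -
  have "pderiv2 \<mu> (pderiv2 \<nu> \<phi>) = (ddir e1 ^^ fst \<mu>) ((ddir e2 ^^ snd \<mu>) ((ddir e1 ^^ fst \<nu>) ((ddir e2 ^^ snd \<nu>) \<phi>)))"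
    by (simp only: pderiv2_def)
  also have "\<dots> = (ddir e1 ^^ fst \<mu>) ((ddir e1 ^^ fst \<nu>) ((ddir e2 ^^ snd \<mu>) ((ddir e2 ^^ snd \<nu>) \<phi>)))"
    by (subst ddir_pow_commute[OF smooth_ddir_pow[OF assms e_Basis(2)] e_Basis(2) e_Basis(1)]) (rule refl)
  finally show ?thesis by (simp only: pderiv2_def funpow_add fst_conv snd_conv o_apply)
qed

lemma ip_ddir_pow_by_parts:
  fixes \<phi> :: "'a::euclidean_space \<Rightarrow> real"
  assumes "smooth \<phi>" and "\<psi> \<in> test_fun S" and b: "b \<in> Basis" and S: "S \<in> sets lebesgue"
  shows "ip S \<phi> ((ddir b ^^ n) \<psi>) = (- 1) ^ n * ip S ((ddir b ^^ n) \<phi>) \<psi>"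
  using assms(1,2)
proof (induction n arbitrary: \<phi> \<psi>)
  case (Suc n)
  have "ip S \<phi> ((ddir b ^^ Suc n) \<psi>) = - ip S (ddir b \<phi>) ((ddir b ^^ n) \<psi>)"
    using Suc.prems by (simp add: ip_ddir_by_parts test_fun_ddir_pow b S)
  also have "\<dots> = - ((- 1) ^ n * ip S ((ddir b ^^ n) (ddir b \<phi>)) \<psi>)"
    using Suc.prems b by (subst Suc.IH) (auto intro: smooth_ddir)
  finally show ?case by (simp add: funpow_swap1)
qed simp

lemma ip_pderiv2_by_parts:
  assumes \<phi>: "smooth \<phi>" and \<psi>: "\<psi> \<in> test_fun S" and S: "S \<in> sets lebesgue"
  shows "ip S \<phi> (pderiv2 \<mu> \<psi>) = (- 1) ^ (fst \<mu> + snd \<mu>) * ip S (pderiv2 \<mu> \<phi>) \<psi>"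
proof -
  have "ip S \<phi> (pderiv2 \<mu> \<psi>) = (- 1) ^ fst \<mu> * ip S ((ddir e1 ^^ fst \<mu>) \<phi>) ((ddir e2 ^^ snd \<mu>) \<psi>)"
    unfolding pderiv2_def by (intro ip_ddir_pow_by_parts \<phi> test_fun_ddir_pow[OF \<psi>] e_Basis S)
  also have "\<dots> = (- 1) ^ fst \<mu> * ((- 1) ^ snd \<mu> * ip S ((ddir e2 ^^ snd \<mu>) ((ddir e1 ^^ fst \<mu>) \<phi>)) \<psi>)"
    by (subst ip_ddir_pow_by_parts) (auto intro!: smooth_ddir_pow \<phi> \<psi> e_Basis S)
  finally show ?thesis using \<phi> by (simp add: pderiv2_def power_add ddir_pow_commute[of _ e2 e1] e_Basis)
qed

lemma pderiv2_linear:
  assumes "smooth \<phi>" "smooth \<psi>"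
  shows "pderiv2 \<mu> (\<lambda>x. r * \<phi> x + s * \<psi> x) = (\<lambda>x. r * pderiv2 \<mu> \<phi> x + s * pderiv2 \<mu> \<psi> x)"
proof -
  have one: "ddir b (\<lambda>x. r * \<phi> x + s * \<psi> x) = (\<lambda>x. r * ddir b \<phi> x + s * ddir b \<psi> x)"
    if "smooth \<phi>" "smooth \<psi>" for b and \<phi> \<psi> :: fn
  proof
    fix x
    have "((\<lambda>x. r * \<phi> x + s * \<psi> x) has_derivative (\<lambda>h. r * ddir h \<phi> x + s * ddir h \<psi> x)) (at x)"
      by (rule has_derivative_add; rule has_derivative_mult_right; rule smooth_has_derivative) (fact that)+
    then show "ddir b (\<lambda>x. r * \<phi> x + s * \<psi> x) x = r * ddir b \<phi> x + s * ddir b \<psi> x" by (rule ddir_eqI)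
  qed
  have pow: "(ddir b ^^ n) (\<lambda>x. r * \<phi> x + s * \<psi> x) = (\<lambda>x. r * (ddir b ^^ n) \<phi> x + s * (ddir b ^^ n) \<psi> x)"
    if "smooth \<phi>" "smooth \<psi>" "b \<in> Basis" for b n and \<phi> \<psi> :: fn
  proof (induction n)
    case (Suc n)
    have "(ddir b ^^ Suc n) (\<lambda>x. r * \<phi> x + s * \<psi> x) = ddir b (\<lambda>x. r * (ddir b ^^ n) \<phi> x + s * (ddir b ^^ n) \<psi> x)"
      by (simp only: funpow.simps o_apply Suc)
    also have "\<dots> = (\<lambda>x. r * ddir b ((ddir b ^^ n) \<phi>) x + s * ddir b ((ddir b ^^ n) \<psi>) x)"
      by (rule one) (intro smooth_ddir_pow that)+
    finally show ?case by simp
  qed simp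
  show ?thesis unfolding pderiv2_def
    by (subst pow[OF assms e_Basis(2)], rule pow) (intro smooth_ddir_pow assms e_Basis)+
qed

section \<open>Sobolev spaces\<close>

lemma loc_integrable_mult:
  fixes g \<phi> :: fn
  assumes g: "loc_integrable S g" and \<phi>: "continuous_on UNIV \<phi>" and K: "compact K" "K \<subseteq> S"
    and z: "\<And>x. x \<notin> K \<Longrightarrow> \<phi> x = 0" and S: "S \<in> sets lebesgue"
  shows "integrable (lebesgue_on S) (\<lambda>x. g x * \<phi> x)"
proof -
  have Km: "K \<in> sets lebesgue" using K(1) by (simp add: borel_compact)
  have gi: "integrable (lebesgue_on K) g" using g K by (simp add: loc_integrable_def)
  have "bounded (\<phi> ` K)" using \<phi> K by (intro compact_imp_bounded compact_continuous_image) (auto elim: continuous_on_subset)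
  then obtain M where M: "\<And>x. x \<in> K \<Longrightarrow> \<bar>\<phi> x\<bar> \<le> M" by (auto simp: bounded_iff)
  have "integrable (lebesgue_on K) (\<lambda>x. g x * \<phi> x)"
  proof (rule Bochner_Integration.integrable_bound[of _ "\<lambda>x. M * \<bar>g x\<bar>"])
    show "integrable (lebesgue_on K) (\<lambda>x. M * \<bar>g x\<bar>)" using gi by simp
    show "(\<lambda>x. g x * \<phi> x) \<in> borel_measurable (lebesgue_on K)"
      by (intro borel_measurable_times borel_measurable_integrable[OF gi]
        continuous_imp_measurable_on_sets_lebesgue[OF continuous_on_subset[OF \<phi> subset_UNIV] Km])
    show "AE x in lebesgue_on K. norm (g x * \<phi> x) \<le> norm (M * \<bar>g x\<bar>)"
    proof (rule AE_I2)
      fix x assume "x \<in> space (lebesgue_on K)"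
      then have "\<bar>\<phi> x\<bar> \<le> M" using M by simp
      then have "\<bar>g x\<bar> * \<bar>\<phi> x\<bar> \<le> \<bar>g x\<bar> * \<bar>M\<bar>" by (intro mult_left_mono) auto
      then show "norm (g x * \<phi> x) \<le> norm (M * \<bar>g x\<bar>)" by (simp add: abs_mult mult.commute)
    qed
  qed
  then show ?thesis using integrable_lebesgue_on_support(1)[OF Km S K(2), of "\<lambda>x. g x * \<phi> x"] z by simp
qed

lemma loc_integrable_test_integrable:
  assumes "loc_integrable S g" "\<phi> \<in> test_fun S" "S \<in> sets lebesgue"
  shows "integrable (lebesgue_on S) (\<lambda>x. g x * \<phi> x)"
proof -
  obtain K where "compact K" "K \<subseteq> S" "\<And>x. x \<notin> K \<Longrightarrow> \<phi> x = 0" using assms(2) by (rule test_fun_support) blast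
  then show ?thesis using assms test_fun_smooth[OF assms(2)] by (intro loc_integrable_mult) (auto intro: smooth_continuous)
qed

lemma loc_integrable_comb:
  "loc_integrable S v \<Longrightarrow> loc_integrable S w \<Longrightarrow> loc_integrable S (r *\<^sub>R v + s *\<^sub>R w)"
  unfolding loc_integrable_def plus_fun_def by simp

lemma ip_test_comb:
  assumes "loc_integrable S v" "loc_integrable S w" "\<phi> \<in> test_fun S" "S \<in> sets lebesgue"
  shows "ip S (r *\<^sub>R v + s *\<^sub>R w) \<phi> = r * ip S v \<phi> + s * ip S w \<phi>"
proof -
  have "integrable (lebesgue_on S) (\<lambda>x. v x * \<phi> x)" "integrable (lebesgue_on S) (\<lambda>x. w x * \<phi> x)"
    using assms by (auto intro: loc_integrable_test_integrable)
  then show ?thesis unfolding ip_def by (simp add: distrib_right mult.assoc)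
qed

lemma L2_subset:
  assumes v: "v \<in> L2 S" and K: "K \<subseteq> S" "K \<in> sets lebesgue" "S \<in> sets lebesgue"
  shows "v \<in> L2 K"
proof -
  have "v \<in> borel_measurable (lebesgue_on K)"
    using v K by (auto simp: L2_def intro: measurable_restrict_mono)
  moreover have "set_integrable lebesgue S (\<lambda>x. (v x)\<^sup>2)" using v K by (simp add: L2_def set_integrable_def integrable_restrict_space)
  then have "set_integrable lebesgue K (\<lambda>x. (v x)\<^sup>2)" by (rule set_integrable_subset[OF _ K(2,1)])
  ultimately show ?thesis using K by (simp add: L2_def set_integrable_def integrable_restrict_space)
qed

lemma aeq_subset:
  assumes "aeq S v w" "K \<subseteq> S" "K \<in> sets lebesgue" "S \<in> sets lebesgue" shows "aeq K v w"
  using assms unfolding aeq_def by (auto simp: AE_restrict_space_iff elim: eventually_mono)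

lemma L2_loc_integrable:
  fixes v :: fn
  assumes v: "v \<in> L2 S" and S: "S \<in> sets lebesgue" shows "loc_integrable S v"
  unfolding loc_integrable_def
proof (intro allI impI)
  fix K assume K: "compact K \<and> K \<subseteq> S"
  then have Km: "K \<in> sets lebesgue" "K \<in> lmeasurable" by (auto simp: borel_compact lmeasurable_compact)
  have vK: "v \<in> L2 K" using L2_subset[OF v _ Km(1) S] K by blast
  interpret finite_measure "lebesgue_on K" using Km by (simp add: finite_measure_lebesgue_on)
  show "integrable (lebesgue_on K) v"
  proof (rule Bochner_Integration.integrable_bound[of _ "\<lambda>x. 1 + (v x)\<^sup>2"])
    show "integrable (lebesgue_on K) (\<lambda>x. 1 + (v x)\<^sup>2)" using vK by (auto simp: L2_def)
    have "\<bar>a\<bar> \<le> 1 + a\<^sup>2" for a :: real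
      using sum_squares_bound[of 1 "\<bar>a\<bar>"] by simp
    then show "AE x in lebesgue_on K. norm (v x) \<le> norm (1 + (v x)\<^sup>2)" by (intro AE_I2) simp
  qed (use vK in \<open>auto simp: L2_def\<close>)
qed

lemma loc_integrable_aeq:
  assumes "loc_integrable S v" "aeq S v w" "S \<in> sets lebesgue" shows "loc_integrable S w"
  unfolding loc_integrable_def
proof (intro allI impI)
  fix K assume K: "compact K \<and> K \<subseteq> S"
  then have Km: "K \<in> sets lebesgue" by (auto simp: borel_compact)
  have "aeq K v w" using assms K Km aeq_subset by blast
  then show "integrable (lebesgue_on K) w"
    using assms(1) K Km by (intro integrable_cong_lebesgue_on_AE[of K v w]) (auto simp: aeq_def loc_integrable_def)
qed

text \<open>The sign in the defining identity cancels, so the difference of two candidates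
  annihilates all test functions.\<close>

lemma is_wderiv_unique:
  assumes S: "open S" and g: "is_wderiv S \<mu> v g" "is_wderiv S \<mu> v h"
  shows "aeq S g h"
proof -
  have Sm: "S \<in> sets lebesgue" using S by auto
  have l: "loc_integrable S g" "loc_integrable S h" using g by (auto simp: is_wderiv_def)
  have d: "loc_integrable S (1 *\<^sub>R g + (- 1) *\<^sub>R h)" by (rule loc_integrable_comb[OF l])
  have "AE x in lebesgue_on S. (1 *\<^sub>R g + (- 1) *\<^sub>R h) x = 0"
  proof (rule fundamental_lemma[OF S])
    show "\<And>K. compact K \<Longrightarrow> K \<subseteq> S \<Longrightarrow> integrable (lebesgue_on K) (1 *\<^sub>R g + (- 1) *\<^sub>R h)"
      using d unfolding loc_integrable_def by blast
    fix \<phi> assume \<phi>: "\<phi> \<in> test_fun S"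
    have "(- 1) ^ (fst \<mu> + snd \<mu>) * ip S g \<phi> = (- 1) ^ (fst \<mu> + snd \<mu>) * ip S h \<phi>"
      using g \<phi> by (auto simp: is_wderiv_def)
    then have "ip S g \<phi> = ip S h \<phi>" by simp
    then show "ip S (1 *\<^sub>R g + (- 1) *\<^sub>R h) \<phi> = 0" unfolding ip_test_comb[OF l \<phi> Sm] by simp
  qed
  then show ?thesis unfolding aeq_def by eventually_elim simp
qed

lemma wderiv_is_wderiv: "is_wderiv S \<mu> v g \<Longrightarrow> is_wderiv S \<mu> v (wderiv S \<mu> v)"
  unfolding wderiv_def by (rule someI[of "is_wderiv S \<mu> v"])

lemma wderiv_aeq: "open S \<Longrightarrow> is_wderiv S \<mu> v g \<Longrightarrow> aeq S (wderiv S \<mu> v) g"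
  using is_wderiv_unique wderiv_is_wderiv by blast

lemma is_wderiv_cong:
  assumes S: "S \<in> sets lebesgue" and v: "aeq S v v'" and w: "is_wderiv S \<mu> v g" shows "is_wderiv S \<mu> v' g"
  using w ip_aeq[OF S v aeq_refl] loc_integrable_aeq[OF _ v S] unfolding is_wderiv_def by metis

text \<open>Genuine equality, because the predicate from which the choice is made is the same for
  both functions. For linear combinations the choices are independent and only almost everywhere
  equality can be had.\<close>

lemma wderiv_cong:
  assumes S: "S \<in> sets lebesgue" and v: "aeq S v v'" shows "wderiv S \<mu> v = wderiv S \<mu> v'"
proof -
  have "is_wderiv S \<mu> v g \<longleftrightarrow> is_wderiv S \<mu> v' g" for g
    using is_wderiv_cong[OF S v] is_wderiv_cong[OF S aeq_sym[OF v]] by blast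
  then show ?thesis by (simp add: wderiv_def)
qed

lemma is_wderiv_comb:
  assumes S: "S \<in> sets lebesgue" and v: "is_wderiv S \<mu> v g" and w: "is_wderiv S \<mu> w h"
  shows "is_wderiv S \<mu> (r *\<^sub>R v + s *\<^sub>R w) (r *\<^sub>R g + s *\<^sub>R h)"
  unfolding is_wderiv_def
proof (intro conjI ballI)
  have l: "loc_integrable S v" "loc_integrable S w" "loc_integrable S g" "loc_integrable S h"
    using v w by (auto simp: is_wderiv_def)
  then show "loc_integrable S (r *\<^sub>R v + s *\<^sub>R w)" "loc_integrable S (r *\<^sub>R g + s *\<^sub>R h)"
    by (auto intro: loc_integrable_comb)
  fix \<phi> assume \<phi>: "\<phi> \<in> test_fun S"
  show "ip S (r *\<^sub>R v + s *\<^sub>R w) (pderiv2 \<mu> \<phi>) = (- 1) ^ (fst \<mu> + snd \<mu>) * ip S (r *\<^sub>R g + s *\<^sub>R h) \<phi>"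
    using v w \<phi> unfolding ip_test_comb[OF l(1,2) test_fun_pderiv2[OF \<phi>] S] ip_test_comb[OF l(3,4) \<phi> S] is_wderiv_def
    by (simp add: algebra_simps)
qed

lemma is_wderiv_0: "loc_integrable S v \<Longrightarrow> is_wderiv S (0, 0) v v"
  by (simp add: is_wderiv_def pderiv2_def)

lemma smooth_loc_integrable:
  fixes \<phi> :: fn assumes "smooth \<phi>" shows "loc_integrable S \<phi>"
  unfolding loc_integrable_def
proof (intro allI impI)
  fix K assume "compact K \<and> K \<subseteq> S"
  then have K: "compact K" by simp
  have "integrable lborel (\<lambda>x. indicator K x *\<^sub>R \<phi> x)"
    using K smooth_continuous[OF assms] by (intro borel_integrable_compact)
  then have "integrable lebesgue (\<lambda>x. indicator K x *\<^sub>R \<phi> x)"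
    by (subst integrable_completion) auto
  then show "integrable (lebesgue_on K) \<phi>" using K by (simp add: integrable_restrict_space borel_compact)
qed

lemma is_wderiv_smooth:
  assumes "smooth \<phi>" "S \<in> sets lebesgue" shows "is_wderiv S \<mu> \<phi> (pderiv2 \<mu> \<phi>)"
  using assms by (simp add: is_wderiv_def smooth_loc_integrable smooth_pderiv2 ip_pderiv2_by_parts)

lemma Hm_L2: "v \<in> Hm m S \<Longrightarrow> v \<in> L2 S"
  by (simp add: Hm_def)

lemma Hm_wderiv:
  assumes S: "open S" and v: "v \<in> Hm m S" and \<mu>: "fst \<mu> + snd \<mu> \<le> m"
  shows "is_wderiv S \<mu> v (wderiv S \<mu> v)" "wderiv S \<mu> v \<in> L2 S"
proof -
  obtain g where g: "g \<in> L2 S" "is_wderiv S \<mu> v g" using v \<mu> unfolding Hm_def by blast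
  then show "is_wderiv S \<mu> v (wderiv S \<mu> v)" by (blast intro: wderiv_is_wderiv)
  show "wderiv S \<mu> v \<in> L2 S" using L2_aeq[OF _ g(1) aeq_sym[OF wderiv_aeq[OF S g(2)]]] S by auto
qed

lemma Hm_comb:
  assumes S: "open S" and v: "v \<in> Hm m S" and w: "w \<in> Hm m S"
  shows "r *\<^sub>R v + s *\<^sub>R w \<in> Hm m S"
    and "fst \<mu> + snd \<mu> \<le> m \<Longrightarrow> aeq S (wderiv S \<mu> (r *\<^sub>R v + s *\<^sub>R w)) (r *\<^sub>R wderiv S \<mu> v + s *\<^sub>R wderiv S \<mu> w)"
proof -
  have Sm: "S \<in> sets lebesgue" using S by auto
  have d: "is_wderiv S \<mu> (r *\<^sub>R v + s *\<^sub>R w) (r *\<^sub>R wderiv S \<mu> v + s *\<^sub>R wderiv S \<mu> w)" if "fst \<mu> + snd \<mu> \<le> m" for \<mu>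
    using Hm_wderiv(1)[OF S v that] Hm_wderiv(1)[OF S w that] by (rule is_wderiv_comb[OF Sm])
  moreover have "r *\<^sub>R wderiv S \<mu> v + s *\<^sub>R wderiv S \<mu> w \<in> L2 S" if "fst \<mu> + snd \<mu> \<le> m" for \<mu>
    using Hm_wderiv(2)[OF S v that] Hm_wderiv(2)[OF S w that] by (intro l2.X_closed)
  moreover have "r *\<^sub>R v + s *\<^sub>R w \<in> L2 S" using Hm_L2[OF v] Hm_L2[OF w] by (intro l2.X_closed)
  ultimately show "r *\<^sub>R v + s *\<^sub>R w \<in> Hm m S" unfolding Hm_def by blast
  show "fst \<mu> + snd \<mu> \<le> m \<Longrightarrow> aeq S (wderiv S \<mu> (r *\<^sub>R v + s *\<^sub>R w)) (r *\<^sub>R wderiv S \<mu> v + s *\<^sub>R wderiv S \<mu> w)"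
    by (rule wderiv_aeq[OF S d])
qed

lemma smooth_zero: "smooth (0 :: 'a::euclidean_space \<Rightarrow> real)"
  using smooth_const[of 0] by (simp add: zero_fun_def)

lemma pderiv2_zero: "pderiv2 \<mu> 0 = 0"
  using pderiv2_linear[OF smooth_zero smooth_zero, of \<mu> 0 0] by (simp add: zero_fun_def)

lemma Hm_zero: assumes "open S" shows "0 \<in> Hm m S" and "aeq S (wderiv S \<mu> 0) 0"
proof -
  have d: "is_wderiv S \<mu> 0 0" for \<mu>
    using is_wderiv_smooth[OF smooth_zero, of S \<mu>] assms pderiv2_zero[of \<mu>] by auto
  then show "0 \<in> Hm m S" unfolding Hm_def using l2.X_closed(1) by blast
  show "aeq S (wderiv S \<mu> 0) 0" by (rule wderiv_aeq[OF assms d])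
qed

lemma Hm_subspace: assumes S: "open S" shows "subspace (Hm m S)"
  unfolding subspace_def
proof (intro conjI ballI allI)
  fix v w r assume v: "v \<in> Hm m S"
  show "r *\<^sub>R v \<in> Hm m S" using Hm_comb(1)[OF S v v, of r 0] by simp
  assume w: "w \<in> Hm m S"
  show "v + w \<in> Hm m S" using Hm_comb(1)[OF S v w, of 1 1] by simp
qed (rule Hm_zero(1)[OF S])

lemma Hm_aeq:
  assumes S: "open S" and v: "v \<in> Hm m S" and a: "aeq S v w" shows "w \<in> Hm m S"
proof -
  have Sm: "S \<in> sets lebesgue" using S by auto
  show ?thesis using v L2_aeq[OF Sm _ a] is_wderiv_cong[OF Sm a] unfolding Hm_def by blast
qed

section \<open>Sobolev norms as semi-inner products\<close>

lemma sq_int_AE_cong: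
  assumes "f \<in> borel_measurable M" "g \<in> sq_int M" "AE x in M. f x = g x" shows "f \<in> sq_int M"
proof -
  have "AE x in M. (f x)\<^sup>2 = (g x)\<^sup>2" using assms(3) by eventually_elim simp
  then have "integrable M (\<lambda>x. (f x)\<^sup>2)"
    using assms(1,2) by (subst integrable_cong_AE[where g = "\<lambda>x. (g x)\<^sup>2"]) (auto simp: sq_int_def)
  then show ?thesis using assms(1) by (simp add: sq_int_def)
qed

lemma sq_ip_AE_cong:
  assumes "f \<in> borel_measurable M" "g \<in> borel_measurable M" "h \<in> borel_measurable M" "AE x in M. f x = g x"
  shows "sq_ip M f h = sq_ip M g h"
  unfolding sq_ip_def using assms by (intro integral_cong_AE) (auto elim: eventually_mono)

text \<open>Sobolev norms are weighted sums of squared norms of derivatives. The maps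
  \<open>L i\<close> are linear only almost everywhere, since weak derivatives are chosen;
  bilinearity survives because \<open>sq_ip\<close> does not see null sets.\<close>

lemma semi_inner_pullback:
  assumes X: "subspace X" and I: "finite I" and c: "\<And>i. i \<in> I \<Longrightarrow> 0 \<le> c i"
    and L: "\<And>i v. i \<in> I \<Longrightarrow> v \<in> X \<Longrightarrow> L i v \<in> sq_int M"
    and lin: "\<And>i v w r s. i \<in> I \<Longrightarrow> v \<in> X \<Longrightarrow> w \<in> X \<Longrightarrow>
      AE x in M. L i (r *\<^sub>R v + s *\<^sub>R w) x = (r *\<^sub>R L i v + s *\<^sub>R L i w) x"
  shows "semi_inner X (\<lambda>v w. \<Sum>i\<in>I. c i * sq_ip M (L i v) (L i w)) (\<lambda>v. sqrt (\<Sum>i\<in>I. c i * sq_ip M (L i v) (L i v)))"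
proof
  have comb: "sq_ip M (L i (r *\<^sub>R v + s *\<^sub>R w)) (L i z) = r * sq_ip M (L i v) (L i z) + s * sq_ip M (L i w) (L i z)"
    if "i \<in> I" "v \<in> X" "w \<in> X" "z \<in> X" for i r s v w z
  proof -
    have "r *\<^sub>R v + s *\<^sub>R w \<in> X" using X that by (simp add: subspace_add subspace_scale)
    then have Lm: "L i (r *\<^sub>R v + s *\<^sub>R w) \<in> sq_int M" using L that by blast
    have i: "L i v \<in> sq_int M" "L i w \<in> sq_int M" "L i z \<in> sq_int M" using L that by blast+
    then have i2: "r *\<^sub>R L i v + s *\<^sub>R L i w \<in> sq_int M" by (intro sq.X_closed)
    have "sq_ip M (L i (r *\<^sub>R v + s *\<^sub>R w)) (L i z) = sq_ip M (r *\<^sub>R L i v + s *\<^sub>R L i w) (L i z)"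
      by (intro sq_ip_AE_cong sq_int_measurable Lm i i2 lin that)
    then show ?thesis using i by (simp add: sq.B_linear)
  qed
  show "subspace X" by (rule X)
  show "(\<Sum>i\<in>I. c i * sq_ip M (L i v) (L i w)) = (\<Sum>i\<in>I. c i * sq_ip M (L i w) (L i v))" if "v \<in> X" "w \<in> X" for v w
    using L that by (intro sum.cong) (auto simp: sq.sym)
  show "(\<Sum>i\<in>I. c i * sq_ip M (L i (v + w)) (L i z)) = (\<Sum>i\<in>I. c i * sq_ip M (L i v) (L i z)) + (\<Sum>i\<in>I. c i * sq_ip M (L i w) (L i z))"
    if "v \<in> X" "w \<in> X" "z \<in> X" for v w z
    unfolding sum.distrib[symmetric] using comb[OF _ that, of _ 1 1] by (intro sum.cong) (auto simp: distrib_left)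
  show "(\<Sum>i\<in>I. c i * sq_ip M (L i (r *\<^sub>R v)) (L i z)) = r * (\<Sum>i\<in>I. c i * sq_ip M (L i v) (L i z))"
    if "v \<in> X" "z \<in> X" for v z r
    unfolding sum_distrib_left using comb[OF _ that(1) that(1) that(2), of _ r 0] by (intro sum.cong) auto
  show "0 \<le> (\<Sum>i\<in>I. c i * sq_ip M (L i v) (L i v))" if "v \<in> X" for v
    using c L that by (intro sum_nonneg mult_nonneg_nonneg sq.pos) auto
qed simp

lemma semi_inner_add:
  assumes "semi_inner X B1 N1" "semi_inner X B2 N2"
  shows "semi_inner X (\<lambda>v w. B1 v w + B2 v w) (\<lambda>v. sqrt (B1 v v + B2 v v))"
proof -
  interpret a: semi_inner X B1 N1 by fact
  interpret b: semi_inner X B2 N2 by fact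
  show ?thesis
    by unfold_locales (auto simp: a.subspace a.add_left b.add_left a.scale_left b.scale_left a.pos b.pos
      algebra_simps intro: arg_cong2[where f = "(+)", OF a.sym b.sym])
qed

text \<open>A signed square root of the Slobodeckij quotient. It is linear in \<open>g\<close>, so
  the fractional seminorm becomes a square integral norm on the product space.\<close>

definition slob :: "real \<Rightarrow> fn \<Rightarrow> (real^2) \<times> (real^2) \<Rightarrow> real" where
  "slob \<sigma> g p = (g (fst p) - g (snd p)) / norm (fst p - snd p) powr (1 + \<sigma>)"

lemma slob_square: "(slob \<sigma> g p)\<^sup>2 = slobodeckij_quot \<sigma> g p"
proof -
  have "2 + 2 * \<sigma> = (1 + \<sigma>) + (1 + \<sigma>)" by simp
  then have "norm (fst p - snd p) powr (2 + 2 * \<sigma>) = (norm (fst p - snd p) powr (1 + \<sigma>))\<^sup>2"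
    by (simp only: powr_add power2_eq_square)
  then show ?thesis by (simp add: slob_def slobodeckij_quot_def power_divide case_prod_beta)
qed

lemma slob_measurable:
  assumes [measurable]: "g \<in> borel_measurable (lebesgue_on S)"
  shows "slob \<sigma> g \<in> borel_measurable (lebesgue_on S \<Otimes>\<^sub>M lebesgue_on S)"
proof -
  have [measurable]: "(\<lambda>x. x) \<in> borel_measurable (lebesgue_on S)"
    using id_borel_measurable_lebesgue_on[of S] by (simp add: id_def)
  show ?thesis unfolding slob_def[abs_def] by measurable
qed

lemma AE_pair_fst_snd:
  assumes M: "sigma_finite_measure M" and P: "AE x in M. P x"
  shows "AE p in M \<Otimes>\<^sub>M M. P (fst p) \<and> P (snd p)"
proof -
  interpret sigma_finite_measure M by fact
  interpret pair_sigma_finite M M ..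
  obtain N where N: "{x \<in> space M. \<not> P x} \<subseteq> N" "N \<in> null_sets M" using P by (auto elim!: AE_E simp: null_sets_def)
  have [measurable]: "N \<in> sets M" using N by auto
  have "AE x in M. AE y in M. x \<notin> N \<and> y \<notin> N"
    using AE_not_in[OF N(2)] by auto
  then have "AE p in M \<Otimes>\<^sub>M M. fst p \<notin> N \<and> snd p \<notin> N"
    by (intro AE_pair_measure) auto
  then show ?thesis
    using AE_space[of "M \<Otimes>\<^sub>M M"] by eventually_elim (use N(1) in \<open>auto simp: space_pair_measure\<close>)
qed

lemma slob_comb_AE:
  assumes S: "S \<in> lmeasurable" and g: "aeq S g (r *\<^sub>R g1 + s *\<^sub>R g2)"
  shows "AE p in lebesgue_on S \<Otimes>\<^sub>M lebesgue_on S. slob \<sigma> g p = (r *\<^sub>R slob \<sigma> g1 + s *\<^sub>R slob \<sigma> g2) p"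
proof -
  interpret finite_measure "lebesgue_on S" using S by (rule finite_measure_lebesgue_on)
  have "AE p in lebesgue_on S \<Otimes>\<^sub>M lebesgue_on S. g (fst p) = (r *\<^sub>R g1 + s *\<^sub>R g2) (fst p) \<and> g (snd p) = (r *\<^sub>R g1 + s *\<^sub>R g2) (snd p)"
    using g unfolding aeq_def by (intro AE_pair_fst_snd sigma_finite_measure_axioms)
  then show ?thesis by eventually_elim (simp add: slob_def algebra_simps add_divide_distrib[symmetric] diff_divide_distrib[symmetric])
qed

lemma finite_multi_index: "finite {\<mu>. fst \<mu> + snd \<mu> \<le> (n::nat)}" "finite {\<mu>. fst \<mu> + snd \<mu> = (n::nat)}"
  by (rule finite_subset[of _ "{..n} \<times> {..n}"]; auto)+

text \<open>The condition \<open>frac s \<noteq> 0\<close> in the second index set empties that sum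
  for integer \<open>s\<close>, in agreement with the case distinction in \<open>Hs_norm\<close>.
  The weight 1 fits the shape of \<open>semi_inner_pullback\<close>.\<close>

definition Hs_ip :: "real \<Rightarrow> (real^2) set \<Rightarrow> fn \<Rightarrow> fn \<Rightarrow> real" where
  "Hs_ip s S v w = (\<Sum>\<mu> | fst \<mu> + snd \<mu> \<le> nat \<lfloor>s\<rfloor>. 1 * sq_ip (lebesgue_on S) (wderiv S \<mu> v) (wderiv S \<mu> w)) +
     (\<Sum>\<mu> | fst \<mu> + snd \<mu> = nat \<lfloor>s\<rfloor> \<and> frac s \<noteq> 0. (1 - frac s) *
         sq_ip (lebesgue_on S \<Otimes>\<^sub>M lebesgue_on S) (slob (frac s) (wderiv S \<mu> v)) (slob (frac s) (wderiv S \<mu> w)))"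

lemma Hs_norm_eq: "Hs_norm s S v = sqrt (Hs_ip s S v v)"
proof -
  have "(l2norm S w)\<^sup>2 = sq_ip (lebesgue_on S) w w" for w
    by (simp add: l2norm_eq_sq_norm sq_norm_def sq_ip_def)
  moreover have "(LINT p|(lebesgue_on S \<Otimes>\<^sub>M lebesgue_on S). slobodeckij_quot (frac s) w p)
      = sq_ip (lebesgue_on S \<Otimes>\<^sub>M lebesgue_on S) (slob (frac s) w) (slob (frac s) w)" for w
    by (simp add: sq_ip_def slob_square[symmetric] power2_eq_square)
  ultimately show ?thesis by (simp add: Hs_norm_def Hs_ip_def sum_distrib_left)
qed

lemma Hs_slob_sq_int:
  assumes S: "open S" and v: "v \<in> Hm (nat \<lfloor>s\<rfloor>) S" and \<mu>: "fst \<mu> + snd \<mu> = nat \<lfloor>s\<rfloor>"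
  shows "integrable (lebesgue_on S \<Otimes>\<^sub>M lebesgue_on S) (slobodeckij_quot \<sigma> (wderiv S \<mu> v))
    \<longleftrightarrow> slob \<sigma> (wderiv S \<mu> v) \<in> sq_int (lebesgue_on S \<Otimes>\<^sub>M lebesgue_on S)"
  using slob_measurable[of "wderiv S \<mu> v" S \<sigma>] Hm_wderiv(2)[OF S v] \<mu>
  by (auto simp: sq_int_def slob_square[abs_def] L2_def)

lemma Hs_subspace:
  assumes S: "open S" "S \<in> lmeasurable" shows "subspace (Hs s S)"
proof -
  have slob_in: "slob \<sigma> g \<in> sq_int (lebesgue_on S \<Otimes>\<^sub>M lebesgue_on S)"
    if "g \<in> borel_measurable (lebesgue_on S)" "aeq S g (r *\<^sub>R g1 + q *\<^sub>R g2)"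
      "slob \<sigma> g1 \<in> sq_int (lebesgue_on S \<Otimes>\<^sub>M lebesgue_on S)" "slob \<sigma> g2 \<in> sq_int (lebesgue_on S \<Otimes>\<^sub>M lebesgue_on S)"
    for g g1 g2 r q \<sigma>
    by (rule sq_int_AE_cong[OF slob_measurable[OF that(1)] _ slob_comb_AE[OF S(2) that(2)]])
      (intro sq.X_closed that)
  have comb: "r *\<^sub>R v + q *\<^sub>R w \<in> Hs s S" if v: "v \<in> Hs s S" and w: "w \<in> Hs s S" for v w r q
  proof -
    have vw: "v \<in> Hm (nat \<lfloor>s\<rfloor>) S" "w \<in> Hm (nat \<lfloor>s\<rfloor>) S" using v w by (auto simp: Hs_def)
    note c = Hm_comb[OF S(1) vw, where r = r and s = q]
    have "integrable (lebesgue_on S \<Otimes>\<^sub>M lebesgue_on S) (slobodeckij_quot (frac s) (wderiv S \<mu> (r *\<^sub>R v + q *\<^sub>R w)))"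
      if \<mu>: "fst \<mu> + snd \<mu> = nat \<lfloor>s\<rfloor>" and f: "frac s \<noteq> 0" for \<mu>
    proof -
      have m: "wderiv S \<mu> (r *\<^sub>R v + q *\<^sub>R w) \<in> borel_measurable (lebesgue_on S)"
        using Hm_wderiv(2)[OF S(1) c(1)] \<mu> by (auto simp: L2_def)
      have sv: "slob (frac s) (wderiv S \<mu> v) \<in> sq_int (lebesgue_on S \<Otimes>\<^sub>M lebesgue_on S)"
        and sw: "slob (frac s) (wderiv S \<mu> w) \<in> sq_int (lebesgue_on S \<Otimes>\<^sub>M lebesgue_on S)"
        using v w \<mu> f Hs_slob_sq_int[OF S(1) vw(1) \<mu>] Hs_slob_sq_int[OF S(1) vw(2) \<mu>] unfolding Hs_def by blast+
      have "aeq S (wderiv S \<mu> (r *\<^sub>R v + q *\<^sub>R w)) (r *\<^sub>R wderiv S \<mu> v + q *\<^sub>R wderiv S \<mu> w)"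
        using \<mu> by (intro c(2)) simp
      from slob_in[OF m this sv sw] show ?thesis unfolding Hs_slob_sq_int[OF S(1) c(1) \<mu>] .
    qed
    then show ?thesis using c(1) by (simp add: Hs_def)
  qed
  have "0 \<in> Hs s S"
  proof -
    have z: "0 \<in> Hm (nat \<lfloor>s\<rfloor>) S" by (rule Hm_zero[OF S(1)])
    have "integrable (lebesgue_on S \<Otimes>\<^sub>M lebesgue_on S) (slobodeckij_quot (frac s) (wderiv S \<mu> 0))"
      if \<mu>: "fst \<mu> + snd \<mu> = nat \<lfloor>s\<rfloor>" for \<mu>
    proof -
      have m: "wderiv S \<mu> 0 \<in> borel_measurable (lebesgue_on S)" using Hm_wderiv(2)[OF S(1) z] \<mu> by (auto simp: L2_def)
      have "slob (frac s) 0 = 0" by (intro ext) (simp add: slob_def)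
      then have s0: "slob (frac s) 0 \<in> sq_int (lebesgue_on S \<Otimes>\<^sub>M lebesgue_on S)" by simp
      have "aeq S (wderiv S \<mu> 0) (0 *\<^sub>R 0 + 0 *\<^sub>R 0)" using Hm_zero(2)[OF S(1), of \<mu>] by simp
      from slob_in[OF m this s0 s0] show ?thesis unfolding Hs_slob_sq_int[OF S(1) z \<mu>] .
    qed
    then show ?thesis using z by (simp add: Hs_def)
  qed
  moreover have "v + w \<in> Hs s S" if "v \<in> Hs s S" "w \<in> Hs s S" for v w using comb[OF that, of 1 1] by simp
  moreover have "r *\<^sub>R v \<in> Hs s S" if "v \<in> Hs s S" for v r using comb[OF that that, of r 0] by simp
  ultimately show ?thesis by (simp add: subspace_def)
qed

lemma Hs_semi_inner:
  assumes S: "open S" "S \<in> lmeasurable" shows "semi_inner (Hs s S) (Hs_ip s S) (Hs_norm s S)"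
proof -
  have sub: "subspace (Hs s S)" by (rule Hs_subspace[OF S])
  have Hm: "v \<in> Hs s S \<Longrightarrow> v \<in> Hm (nat \<lfloor>s\<rfloor>) S" for v by (simp add: Hs_def)
  have a: "semi_inner (Hs s S) (\<lambda>v w. \<Sum>\<mu> | fst \<mu> + snd \<mu> \<le> nat \<lfloor>s\<rfloor>. 1 * sq_ip (lebesgue_on S) (wderiv S \<mu> v) (wderiv S \<mu> w))
     (\<lambda>v. sqrt (\<Sum>\<mu> | fst \<mu> + snd \<mu> \<le> nat \<lfloor>s\<rfloor>. 1 * sq_ip (lebesgue_on S) (wderiv S \<mu> v) (wderiv S \<mu> v)))"
    using Hm_wderiv(2)[OF S(1) Hm] Hm_comb(2)[OF S(1) Hm Hm]
    by (intro semi_inner_pullback sub finite_multi_index) (auto simp: L2_eq_sq_int aeq_def)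
  have b: "semi_inner (Hs s S) (\<lambda>v w. \<Sum>\<mu> | fst \<mu> + snd \<mu> = nat \<lfloor>s\<rfloor> \<and> frac s \<noteq> 0. (1 - frac s) *
      sq_ip (lebesgue_on S \<Otimes>\<^sub>M lebesgue_on S) (slob (frac s) (wderiv S \<mu> v)) (slob (frac s) (wderiv S \<mu> w)))
     (\<lambda>v. sqrt (\<Sum>\<mu> | fst \<mu> + snd \<mu> = nat \<lfloor>s\<rfloor> \<and> frac s \<noteq> 0. (1 - frac s) *
      sq_ip (lebesgue_on S \<Otimes>\<^sub>M lebesgue_on S) (slob (frac s) (wderiv S \<mu> v)) (slob (frac s) (wderiv S \<mu> v))))"
  proof (intro semi_inner_pullback sub)
    show "finite {\<mu>. fst \<mu> + snd \<mu> = nat \<lfloor>s\<rfloor> \<and> frac s \<noteq> 0}"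
      by (rule finite_subset[OF _ finite_multi_index(2)[of "nat \<lfloor>s\<rfloor>"]]) auto
    show "0 \<le> 1 - frac s" using frac_lt_1[of s] by simp
    fix \<mu> assume \<mu>: "\<mu> \<in> {\<mu>. fst \<mu> + snd \<mu> = nat \<lfloor>s\<rfloor> \<and> frac s \<noteq> 0}"
    then have \<mu>': "fst \<mu> + snd \<mu> = nat \<lfloor>s\<rfloor>" by simp
    fix v assume v: "v \<in> Hs s S"
    show "slob (frac s) (wderiv S \<mu> v) \<in> sq_int (lebesgue_on S \<Otimes>\<^sub>M lebesgue_on S)"
      using Hs_slob_sq_int[OF S(1) Hm[OF v] \<mu>', of "frac s"] v \<mu> unfolding Hs_def by blast
    fix w r q assume w: "w \<in> Hs s S"
    show "AE p in lebesgue_on S \<Otimes>\<^sub>M lebesgue_on S. slob (frac s) (wderiv S \<mu> (r *\<^sub>R v + q *\<^sub>R w)) p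
        = (r *\<^sub>R slob (frac s) (wderiv S \<mu> v) + q *\<^sub>R slob (frac s) (wderiv S \<mu> w)) p"
      using \<mu>' by (intro slob_comb_AE[OF S(2)] Hm_comb(2)[OF S(1) Hm[OF v] Hm[OF w]]) simp
  qed
  have "Hs_ip s S = (\<lambda>v w. (\<Sum>\<mu> | fst \<mu> + snd \<mu> \<le> nat \<lfloor>s\<rfloor>. 1 * sq_ip (lebesgue_on S) (wderiv S \<mu> v) (wderiv S \<mu> w)) +
     (\<Sum>\<mu> | fst \<mu> + snd \<mu> = nat \<lfloor>s\<rfloor> \<and> frac s \<noteq> 0. (1 - frac s) *
         sq_ip (lebesgue_on S \<Otimes>\<^sub>M lebesgue_on S) (slob (frac s) (wderiv S \<mu> v)) (slob (frac s) (wderiv S \<mu> w))))"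
    by (intro ext) (rule Hs_ip_def)
  moreover have "Hs_norm s S = (\<lambda>v. sqrt (Hs_ip s S v v))" by (intro ext Hs_norm_eq)
  ultimately show ?thesis using semi_inner_add[OF a b] by simp
qed

lemma Hs_2: "Hs 2 S = Hm 2 S"
  by (auto simp: Hs_def)

lemma h2_semi_inner: "open S \<Longrightarrow> S \<in> lmeasurable \<Longrightarrow> semi_inner (Hm 2 S) (Hs_ip 2 S) (Hs_norm 2 S)"
  using Hs_semi_inner[of S 2] by (simp add: Hs_2)

lemma hess_semi_inner:
  assumes S: "open S"
  shows "semi_inner (Hm 2 S) (hess_form S) (\<lambda>v. sqrt (hess_form S v v))"
proof -
  \<comment> \<open>The mixed derivative occurs twice in the product of the Hessian
    matrices.\<close>
  define c :: "nat \<times> nat \<Rightarrow> real" where "c \<mu> = (if \<mu> = (1, 1) then 2 else 1)" for \<mu>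
  let ?I = "{(2, 0), (1, 1), (0, 2)} :: (nat \<times> nat) set"
  have "semi_inner (Hm 2 S) (\<lambda>v w. \<Sum>\<mu>\<in>?I. c \<mu> * sq_ip (lebesgue_on S) (wderiv S \<mu> v) (wderiv S \<mu> w))
     (\<lambda>v. sqrt (\<Sum>\<mu>\<in>?I. c \<mu> * sq_ip (lebesgue_on S) (wderiv S \<mu> v) (wderiv S \<mu> v)))"
  proof (intro semi_inner_pullback Hm_subspace[OF S])
    fix \<mu> :: "nat \<times> nat" assume "\<mu> \<in> ?I"
    then have \<mu>: "fst \<mu> + snd \<mu> \<le> 2" by auto
    show "0 \<le> c \<mu>" by (simp add: c_def)
    fix v w r s assume v: "v \<in> Hm 2 S"
    show "wderiv S \<mu> v \<in> sq_int (lebesgue_on S)" using Hm_wderiv(2)[OF S v \<mu>] by (simp add: L2_eq_sq_int)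
    assume w: "w \<in> Hm 2 S"
    show "AE x in lebesgue_on S. wderiv S \<mu> (r *\<^sub>R v + s *\<^sub>R w) x = (r *\<^sub>R wderiv S \<mu> v + s *\<^sub>R wderiv S \<mu> w) x"
      using Hm_comb(2)[OF S v w \<mu>] by (simp add: aeq_def)
  qed simp
  moreover have "(\<Sum>\<mu>\<in>?I. c \<mu> * sq_ip (lebesgue_on S) (wderiv S \<mu> v) (wderiv S \<mu> w)) = hess_form S v w" for v w
    by (simp add: hess_form_def c_def ip_eq_sq_ip)
  ultimately show ?thesis by simp
qed

lemma wderiv_norm_le_Hs_norm:
  assumes S: "open S" and v: "v \<in> Hm (nat \<lfloor>s\<rfloor>) S" and \<mu>: "fst \<mu> + snd \<mu> \<le> nat \<lfloor>s\<rfloor>"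
  shows "l2norm S (wderiv S \<mu> v) \<le> Hs_norm s S v"
proof -
  have "(l2norm S (wderiv S \<mu> v))\<^sup>2 \<le> (\<Sum>\<mu> | fst \<mu> + snd \<mu> \<le> nat \<lfloor>s\<rfloor>. (l2norm S (wderiv S \<mu> v))\<^sup>2)"
    using \<mu> finite_multi_index by (intro member_le_sum) auto
  also have "\<dots> \<le> (\<Sum>\<mu> | fst \<mu> + snd \<mu> \<le> nat \<lfloor>s\<rfloor>. (l2norm S (wderiv S \<mu> v))\<^sup>2) +
      (if frac s = 0 then 0 else (1 - frac s) * (\<Sum>\<mu> | fst \<mu> + snd \<mu> = nat \<lfloor>s\<rfloor>.
         (LINT p|(lebesgue_on S \<Otimes>\<^sub>M lebesgue_on S). slobodeckij_quot (frac s) (wderiv S \<mu> v) p)))"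
    using frac_lt_1[of s] by (auto simp: slob_square[symmetric] less_imp_le intro!: mult_nonneg_nonneg sum_nonneg integral_nonneg)
  finally have "sqrt ((l2norm S (wderiv S \<mu> v))\<^sup>2) \<le> Hs_norm s S v" unfolding Hs_norm_def by (rule real_sqrt_le_mono)
  then show ?thesis by simp
qed

lemma l2norm_le_Hs_norm:
  assumes S: "open S" and v: "v \<in> Hm (nat \<lfloor>s\<rfloor>) S"
  shows "l2norm S v \<le> Hs_norm s S v"
proof -
  have Sm: "S \<in> sets lebesgue" using S by auto
  have "aeq S (wderiv S (0, 0) v) v"
    using Hm_L2[OF v] Sm by (intro wderiv_aeq[OF S] is_wderiv_0 L2_loc_integrable)
  then show ?thesis using wderiv_norm_le_Hs_norm[OF S v, of "(0, 0)"] l2norm_aeq[OF Sm] by simp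
qed

lemma Hs_2_norm_le_Hs_norm:
  assumes s: "2 \<le> s" shows "Hs_norm 2 S v \<le> Hs_norm s S v"
proof -
  have n: "2 \<le> nat \<lfloor>s\<rfloor>" using s by (simp add: le_nat_iff le_floor_iff)
  have "(\<Sum>\<mu> | fst \<mu> + snd \<mu> \<le> 2. (l2norm S (wderiv S \<mu> v))\<^sup>2) \<le> (\<Sum>\<mu> | fst \<mu> + snd \<mu> \<le> nat \<lfloor>s\<rfloor>. (l2norm S (wderiv S \<mu> v))\<^sup>2)"
    using n finite_multi_index by (intro sum_mono2) auto
  also have "\<dots> \<le> (\<Sum>\<mu> | fst \<mu> + snd \<mu> \<le> nat \<lfloor>s\<rfloor>. (l2norm S (wderiv S \<mu> v))\<^sup>2) +
      (if frac s = 0 then 0 else (1 - frac s) * (\<Sum>\<mu> | fst \<mu> + snd \<mu> = nat \<lfloor>s\<rfloor>.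
         (LINT p|(lebesgue_on S \<Otimes>\<^sub>M lebesgue_on S). slobodeckij_quot (frac s) (wderiv S \<mu> v) p)))"
    using frac_lt_1[of s] by (auto simp: slob_square[symmetric] less_imp_le intro!: mult_nonneg_nonneg sum_nonneg integral_nonneg)
  finally show ?thesis by (simp add: Hs_norm_def)
qed

text \<open>The weights 1, 2, 1 of the second derivatives add up to 4, hence the factor 2 after
  taking the root.\<close>

lemma hess_le_Hs_norm:
  assumes S: "open S" and v: "v \<in> Hm 2 S"
  shows "sqrt (hess_form S v v) \<le> 2 * Hs_norm 2 S v"
proof -
  have d: "ip S (wderiv S \<mu> v) (wderiv S \<mu> v) \<le> (Hs_norm 2 S v)\<^sup>2" if "fst \<mu> + snd \<mu> \<le> 2" for \<mu>
  proof -
    have "l2norm S (wderiv S \<mu> v) \<le> Hs_norm 2 S v" using wderiv_norm_le_Hs_norm[OF S, of v 2 \<mu>] v that by simp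
    moreover have w: "wderiv S \<mu> v \<in> L2 S" by (rule Hm_wderiv(2)[OF S v that])
    ultimately have "(l2norm S (wderiv S \<mu> v))\<^sup>2 \<le> (Hs_norm 2 S v)\<^sup>2" by (intro power_mono) auto
    then show ?thesis using l2.N_square[OF w] by simp
  qed
  have "hess_form S v v \<le> (2 * Hs_norm 2 S v)\<^sup>2"
    using d[of "(2, 0)"] d[of "(1, 1)"] d[of "(0, 2)"] by (simp add: hess_form_def)
  moreover have "0 \<le> Hs_norm 2 S v" using wderiv_norm_le_Hs_norm[OF S, of v 2 "(0, 0)"] v Hm_wderiv(2)[OF S v, of "(0, 0)"]
    by (auto intro: order_trans[OF l2.N_nonneg])
  ultimately show ?thesis by (intro real_le_lsqrt) auto
qed

section \<open>The clamped space on a bounded open set\<close>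

locale bounded_open =
  fixes \<Omega> :: "(real^2) set"
  assumes open_Om: "open \<Omega>" and bounded_Om: "bounded \<Omega>"
begin

lemma lmeas: "\<Omega> \<in> lmeasurable" using open_Om bounded_Om by (simp add: lmeasurable_open)

lemma meas: "\<Omega> \<in> sets lebesgue" using open_Om by auto

sublocale h2: semi_inner "Hm 2 \<Omega>" "Hs_ip 2 \<Omega>" "Hs_norm 2 \<Omega>"
  by (rule h2_semi_inner[OF open_Om lmeas])

sublocale hess: semi_inner "Hm 2 \<Omega>" "hess_form \<Omega>" "\<lambda>v. sqrt (hess_form \<Omega> v v)"
  by (rule hess_semi_inner[OF open_Om])

lemma test_fun_L2: assumes "\<phi> \<in> test_fun \<Omega>" shows "\<phi> \<in> L2 \<Omega>"
proof -
  have sm: "smooth \<phi>" using assms by (rule test_fun_smooth)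
  have l: "loc_integrable \<Omega> \<phi>" using smooth_loc_integrable[OF sm] .
  have "integrable (lebesgue_on \<Omega>) (\<lambda>x. \<phi> x * \<phi> x)" by (rule loc_integrable_test_integrable[OF l assms meas])
  moreover have "\<phi> \<in> borel_measurable (lebesgue_on \<Omega>)"
    by (rule continuous_imp_measurable_on_sets_lebesgue[OF smooth_continuous[OF sm] meas])
  ultimately show ?thesis by (simp add: L2_def power2_eq_square)
qed

lemma test_fun_Hm: assumes "\<phi> \<in> test_fun \<Omega>" shows "\<phi> \<in> Hm m \<Omega>"
  unfolding Hm_def using assms test_fun_L2 test_fun_pderiv2[OF assms] is_wderiv_smooth[OF test_fun_smooth[OF assms] meas] by blast

lemma wderiv_test: "\<phi> \<in> test_fun \<Omega> \<Longrightarrow> aeq \<Omega> (wderiv \<Omega> \<mu> \<phi>) (pderiv2 \<mu> \<phi>)"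
  by (rule wderiv_aeq[OF open_Om is_wderiv_smooth[OF test_fun_smooth meas]])

lemma H20_Hm: "v \<in> H20 \<Omega> \<Longrightarrow> v \<in> Hm 2 \<Omega>" by (simp add: H20_def)

lemma H20_L2: "v \<in> H20 \<Omega> \<Longrightarrow> v \<in> L2 \<Omega>" using H20_Hm Hm_L2 by blast

lemma H20_approx:
  assumes "v \<in> H20 \<Omega>" "e > 0" obtains \<phi> where "\<phi> \<in> test_fun \<Omega>" "Hs_norm 2 \<Omega> (v - \<phi>) < e"
  using assms unfolding H20_def by (auto simp: fun_diff_def)

lemma H20I: "v \<in> Hm 2 \<Omega> \<Longrightarrow> (\<And>e. e > 0 \<Longrightarrow> \<exists>\<phi>\<in>test_fun \<Omega>. Hs_norm 2 \<Omega> (v - \<phi>) < e) \<Longrightarrow> v \<in> H20 \<Omega>"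
  unfolding H20_def by (auto simp: fun_diff_def)

lemma test_fun_H20: assumes "\<phi> \<in> test_fun \<Omega>" shows "\<phi> \<in> H20 \<Omega>"
proof (rule H20I[OF test_fun_Hm[OF assms]])
  show "\<exists>\<psi>\<in>test_fun \<Omega>. Hs_norm 2 \<Omega> (\<phi> - \<psi>) < e" if "e > 0" for e using assms that by (intro bexI[of _ \<phi>]) auto
qed

lemma H20_comb: assumes v: "v \<in> H20 \<Omega>" and w: "w \<in> H20 \<Omega>" shows "r *\<^sub>R v + s *\<^sub>R w \<in> H20 \<Omega>"
proof (rule H20I)
  show "r *\<^sub>R v + s *\<^sub>R w \<in> Hm 2 \<Omega>" using v w H20_Hm by auto
  fix e :: real assume e: "e > 0"
  define d where "d = e / (\<bar>r\<bar> + \<bar>s\<bar> + 1)"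
  have d: "d > 0" unfolding d_def using e by (intro divide_pos_pos) auto
  obtain \<phi> where \<phi>: "\<phi> \<in> test_fun \<Omega>" "Hs_norm 2 \<Omega> (v - \<phi>) < d" using H20_approx[OF v d] .
  obtain \<psi> where \<psi>: "\<psi> \<in> test_fun \<Omega>" "Hs_norm 2 \<Omega> (w - \<psi>) < d" using H20_approx[OF w d] .
  have t: "r *\<^sub>R \<phi> + s *\<^sub>R \<psi> \<in> test_fun \<Omega>"
    using test_fun_comb[OF \<phi>(1) \<psi>(1), of r s] by (simp add: plus_fun_def scaleR_fun_def)
  have H: "v - \<phi> \<in> Hm 2 \<Omega>" "w - \<psi> \<in> Hm 2 \<Omega>" using v w \<phi> \<psi> H20_Hm test_fun_Hm by auto
  have "Hs_norm 2 \<Omega> ((r *\<^sub>R v + s *\<^sub>R w) - (r *\<^sub>R \<phi> + s *\<^sub>R \<psi>)) = Hs_norm 2 \<Omega> (r *\<^sub>R (v - \<phi>) + s *\<^sub>R (w - \<psi>))"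
    by (simp add: algebra_simps)
  also have "\<dots> \<le> Hs_norm 2 \<Omega> (r *\<^sub>R (v - \<phi>)) + Hs_norm 2 \<Omega> (s *\<^sub>R (w - \<psi>))" 
    by (rule h2.N_triangle[OF h2.X_closed(4)[OF H(1)] h2.X_closed(4)[OF H(2)]])
  also have "\<dots> = \<bar>r\<bar> * Hs_norm 2 \<Omega> (v - \<phi>) + \<bar>s\<bar> * Hs_norm 2 \<Omega> (w - \<psi>)" using H by (simp add: h2.N_scale)
  also have "\<dots> \<le> \<bar>r\<bar> * d + \<bar>s\<bar> * d" using \<phi> \<psi> by (intro add_mono mult_left_mono) auto
  also have "\<dots> < (\<bar>r\<bar> + \<bar>s\<bar> + 1) * d" using d by (simp add: algebra_simps)
  also have "\<dots> = e"
  proof -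
    have "\<bar>r\<bar> + \<bar>s\<bar> + 1 \<noteq> 0" by linarith
    then show ?thesis by (simp add: d_def)
  qed
  finally show "\<exists>\<phi>\<in>test_fun \<Omega>. Hs_norm 2 \<Omega> ((r *\<^sub>R v + s *\<^sub>R w) - \<phi>) < e" using t by blast
qed

lemma H20_subspace: "subspace (H20 \<Omega>)"
  unfolding subspace_def
proof (intro conjI ballI allI)
  have "0 \<in> test_fun \<Omega>" by (rule test_funI[OF smooth_zero compact_empty]) auto
  then show "0 \<in> H20 \<Omega>" by (rule test_fun_H20)
  fix v w r assume v: "v \<in> H20 \<Omega>"
  show "r *\<^sub>R v \<in> H20 \<Omega>" using H20_comb[OF v v, of r 0] by simp
  assume w: "w \<in> H20 \<Omega>"
  show "v + w \<in> H20 \<Omega>" using H20_comb[OF v w, of 1 1] by simp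
qed

lemma Hs_norm_cong: "aeq \<Omega> v w \<Longrightarrow> Hs_norm s \<Omega> v = Hs_norm s \<Omega> w"
  by (simp add: Hs_norm_def wderiv_cong[OF meas])

lemma hess_form_cong: "aeq \<Omega> v v' \<Longrightarrow> aeq \<Omega> w w' \<Longrightarrow> hess_form \<Omega> v w = hess_form \<Omega> v' w'"
  by (simp add: hess_form_def wderiv_cong[OF meas])

lemma H20_aeq: assumes v: "v \<in> H20 \<Omega>" and a: "aeq \<Omega> v w" shows "w \<in> H20 \<Omega>"
proof (rule H20I)
  show "w \<in> Hm 2 \<Omega>" by (rule Hm_aeq[OF open_Om H20_Hm[OF v] a])
  fix e :: real assume "e > 0"
  then obtain \<phi> where "\<phi> \<in> test_fun \<Omega>" "Hs_norm 2 \<Omega> (v - \<phi>) < e" using H20_approx[OF v] by blast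
  moreover have "Hs_norm 2 \<Omega> (v - \<phi>) = Hs_norm 2 \<Omega> (w - \<phi>)" by (intro Hs_norm_cong aeq_diff a aeq_refl)
  ultimately show "\<exists>\<phi>\<in>test_fun \<Omega>. Hs_norm 2 \<Omega> (w - \<phi>) < e" by auto
qed

text \<open>Each weak second derivative of \<open>v\<close> is moved onto the test function without
  a sign, the order being even. The weights 1, 2, 1 then assemble the fourth order derivatives into
  the squared Laplacian.\<close>

lemma hess_form_test:
  assumes v: "v \<in> Hm 2 \<Omega>" and \<phi>: "\<phi> \<in> test_fun \<Omega>"
  shows "hess_form \<Omega> v \<phi> = ip \<Omega> v (laplacian (laplacian \<phi>))"
proof -
  have sm: "smooth \<phi>" by (rule test_fun_smooth[OF \<phi>])
  have t: "pderiv2 \<nu> \<phi> \<in> test_fun \<Omega>" for \<nu> by (rule test_fun_pderiv2[OF \<phi>])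
  have part: "ip \<Omega> (wderiv \<Omega> \<mu> v) (wderiv \<Omega> \<mu> \<phi>) = ip \<Omega> v (pderiv2 (2 * fst \<mu>, 2 * snd \<mu>) \<phi>)"
    if \<mu>: "fst \<mu> + snd \<mu> = 2" for \<mu>
  proof -
    have "ip \<Omega> (wderiv \<Omega> \<mu> v) (wderiv \<Omega> \<mu> \<phi>) = ip \<Omega> (wderiv \<Omega> \<mu> v) (pderiv2 \<mu> \<phi>)"
      by (intro ip_aeq[OF meas] wderiv_test[OF \<phi>] aeq_refl)
    also have "\<dots> = ip \<Omega> v (pderiv2 \<mu> (pderiv2 \<mu> \<phi>))"
      using Hm_wderiv(1)[OF open_Om v, of \<mu>] t[of \<mu>] \<mu> by (simp add: is_wderiv_def)
    finally show ?thesis by (simp add: pderiv2_pderiv2[OF sm] mult_2)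
  qed
  have lin: "laplacian (laplacian \<phi>) = (\<lambda>x. pderiv2 (4, 0) \<phi> x + 2 * pderiv2 (2, 2) \<phi> x + pderiv2 (0, 4) \<phi> x)"
  proof
    fix x
    have l: "laplacian \<phi> = (\<lambda>x. 1 * pderiv2 (2, 0) \<phi> x + 1 * pderiv2 (0, 2) \<phi> x)" by (simp add: laplacian_def)
    have "pderiv2 \<mu> (laplacian \<phi>) = (\<lambda>x. 1 * pderiv2 \<mu> (pderiv2 (2, 0) \<phi>) x + 1 * pderiv2 \<mu> (pderiv2 (0, 2) \<phi>) x)" for \<mu>
      unfolding l by (rule pderiv2_linear[OF smooth_pderiv2[OF sm] smooth_pderiv2[OF sm]])
    note p = this
    have "pderiv2 (2, 0) (laplacian \<phi>) x = pderiv2 (4, 0) \<phi> x + pderiv2 (2, 2) \<phi> x"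
      unfolding p[of "(2, 0)"] pderiv2_pderiv2[OF sm] by (simp add: numeral_eq_Suc)
    moreover have "pderiv2 (0, 2) (laplacian \<phi>) x = pderiv2 (2, 2) \<phi> x + pderiv2 (0, 4) \<phi> x"
      unfolding p[of "(0, 2)"] pderiv2_pderiv2[OF sm] by (simp add: numeral_eq_Suc)
    ultimately show "laplacian (laplacian \<phi>) x = pderiv2 (4, 0) \<phi> x + 2 * pderiv2 (2, 2) \<phi> x + pderiv2 (0, 4) \<phi> x"
      unfolding laplacian_def[of "laplacian \<phi>"] by simp
  qed
  have i: "pderiv2 \<nu> \<phi> \<in> L2 \<Omega>" for \<nu> by (rule test_fun_L2[OF t])
  have "hess_form \<Omega> v \<phi> = ip \<Omega> v (pderiv2 (4, 0) \<phi>) + 2 * ip \<Omega> v (pderiv2 (2, 2) \<phi>) + ip \<Omega> v (pderiv2 (0, 4) \<phi>)"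
    unfolding hess_form_def using part[of "(2, 0)"] part[of "(1, 1)"] part[of "(0, 2)"] by simp
  also have "\<dots> = ip \<Omega> v (pderiv2 (4, 0) \<phi> + 2 *\<^sub>R pderiv2 (2, 2) \<phi> + pderiv2 (0, 4) \<phi>)"
    using Hm_L2[OF v] i by (simp add: l2.B_linear)
  also have "pderiv2 (4, 0) \<phi> + 2 *\<^sub>R pderiv2 (2, 2) \<phi> + pderiv2 (0, 4) \<phi> = laplacian (laplacian \<phi>)"
    unfolding lin by (intro ext) simp
  finally show ?thesis .
qed

text \<open>True for test functions by \<open>hess_form_test\<close>. Both sides are continuous in
  the \<open>Hs_norm 2\<close> of \<open>v\<close>, in which test functions are dense in
  \<open>H20\<close>; hence no boundary terms appear.\<close>

lemma bilaplacian_green: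
  assumes \<psi>: "\<psi> \<in> H20 \<Omega>" and g: "is_bilaplacian \<Omega> \<psi> g" and v: "v \<in> H20 \<Omega>"
  shows "hess_form \<Omega> \<psi> v = ip \<Omega> g v"
proof -
  have gL: "g \<in> L2 \<Omega>" using g by (simp add: is_bilaplacian_def)
  define c where "c = 2 * sqrt (hess_form \<Omega> \<psi> \<psi>) + l2norm \<Omega> g"
  have c0: "0 \<le> c" unfolding c_def using gL H20_Hm[OF \<psi>] by (simp add: hess.pos)
  have bound: "\<bar>hess_form \<Omega> \<psi> v - ip \<Omega> g v\<bar> \<le> c * e" if e: "e > 0" for e
  proof -
    obtain \<phi> where \<phi>: "\<phi> \<in> test_fun \<Omega>" "Hs_norm 2 \<Omega> (v - \<phi>) < e" using H20_approx[OF v e] .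
    have H: "v \<in> Hm 2 \<Omega>" "\<phi> \<in> Hm 2 \<Omega>" "\<psi> \<in> Hm 2 \<Omega>" "v - \<phi> \<in> Hm 2 \<Omega>" using v \<phi> \<psi> H20_Hm test_fun_Hm by auto
    have L: "v \<in> L2 \<Omega>" "\<phi> \<in> L2 \<Omega>" "v - \<phi> \<in> L2 \<Omega>" using H Hm_L2 by auto
    have "hess_form \<Omega> \<psi> \<phi> = ip \<Omega> g \<phi>" using hess_form_test[OF H(3) \<phi>(1)] g \<phi>(1) by (simp add: is_bilaplacian_def)
    then have "hess_form \<Omega> \<psi> v - ip \<Omega> g v = hess_form \<Omega> \<psi> (v - \<phi>) - ip \<Omega> g (v - \<phi>)"
      using H L gL by (simp add: hess.B_linear l2.B_linear)
    then have "\<bar>hess_form \<Omega> \<psi> v - ip \<Omega> g v\<bar> \<le> \<bar>hess_form \<Omega> \<psi> (v - \<phi>)\<bar> + \<bar>ip \<Omega> g (v - \<phi>)\<bar>" by simp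
    also have "\<dots> \<le> sqrt (hess_form \<Omega> \<psi> \<psi>) * sqrt (hess_form \<Omega> (v - \<phi>) (v - \<phi>)) + l2norm \<Omega> g * l2norm \<Omega> (v - \<phi>)"
      using H L gL by (intro add_mono hess.Cauchy_Schwarz l2.Cauchy_Schwarz)
    also have "\<dots> \<le> sqrt (hess_form \<Omega> \<psi> \<psi>) * (2 * e) + l2norm \<Omega> g * e"
      using hess_le_Hs_norm[OF open_Om H(4)] l2norm_le_Hs_norm[OF open_Om, of "v - \<phi>" 2] H(4) \<phi>(2) gL hess.pos[OF H(3)]
      by (intro add_mono mult_left_mono) auto
    finally show ?thesis by (simp add: c_def algebra_simps)
  qed
  show ?thesis
  proof (rule ccontr)
    assume "hess_form \<Omega> \<psi> v \<noteq> ip \<Omega> g v"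
    then have d: "\<bar>hess_form \<Omega> \<psi> v - ip \<Omega> g v\<bar> > 0" (is "?d > 0") by simp
    have "?d \<le> c * (?d / (2 * (c + 1)))" using d c0 by (intro bound divide_pos_pos) auto
    also have "\<dots> \<le> (c + 1) * (?d / (2 * (c + 1)))" using c0 by (intro mult_right_mono) auto
    also have "\<dots> = ?d / 2" using c0 by (simp add: field_simps)
    finally show False using d by simp
  qed
qed

lemma smooth_coordinate: "smooth (\<lambda>x::real^2. x $ 1)"
proof -
  have "Ck k (\<lambda>t::real. t)" for k
  proof (cases k)
    case (Suc j)
    have "ddir 1 (\<lambda>t::real. t) = (\<lambda>t. 1)" by (intro ext ddir_eqI[THEN trans, OF has_derivative_ident]) simp
    then show ?thesis using Suc Ck_const[of j 1] by simp
  qed simp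
  then have "smooth (\<lambda>t::real. t)" by (simp add: smooth_iff_Ck)
  from smooth_affine[OF this, of 1 e1 0] show ?thesis by (simp add: inner_axis)
qed

lemma ddir_coordinate: "ddir e1 (\<lambda>x::real^2. x $ 1) x = 1"
  by (rule ddir_eqI[THEN trans, OF bounded_linear_imp_has_derivative[OF bounded_linear_vec_nth]]) (simp add: axis_def)

text \<open>Integration by parts of \<open>x $ 1 * \<phi>\<close> against the derivative of \<phi>
  gives that the squared norm of \<phi> equals -2 times the inner product of
  \<open>x $ 1 * \<phi>\<close> with that derivative. The coordinate is bounded by
  \<open>R\<close>.\<close>

lemma Poincare_test:
  assumes R: "\<And>x. x \<in> \<Omega> \<Longrightarrow> \<bar>x $ 1\<bar> \<le> R" "R \<ge> 0" and \<phi>: "\<phi> \<in> test_fun \<Omega>"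
  shows "l2norm \<Omega> \<phi> \<le> 2 * R * l2norm \<Omega> (ddir e1 \<phi>)"
proof -
  let ?x = "\<lambda>x::real^2. x $ 1"
  have sm: "smooth \<phi>" by (rule test_fun_smooth[OF \<phi>])
  have d\<phi>: "ddir e1 \<phi> \<in> test_fun \<Omega>" by (rule test_fun_ddir[OF \<phi> e_Basis(1)])
  have x\<phi>: "(\<lambda>x. x $ 1 * \<phi> x) \<in> test_fun \<Omega>" by (rule test_fun_mult[OF smooth_coordinate \<phi>])
  have xd\<phi>: "(\<lambda>x. x $ 1 * ddir e1 \<phi> x) \<in> test_fun \<Omega>" by (rule test_fun_mult[OF smooth_coordinate d\<phi>])
  note L = \<phi>[THEN test_fun_L2] d\<phi>[THEN test_fun_L2] x\<phi>[THEN test_fun_L2] xd\<phi>[THEN test_fun_L2]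
  have "ddir e1 (\<lambda>x. x $ 1 * \<phi> x) = \<phi> + (\<lambda>x. x $ 1 * ddir e1 \<phi> x)"
  proof
    fix x :: "real^2"
    have "ddir e1 (\<lambda>x. x $ 1 * \<phi> x) x = ddir e1 ?x x * \<phi> x + x $ 1 * ddir e1 \<phi> x"
      using sm smooth_coordinate by (intro ddir_mult) (auto simp: smooth_iff_Ck intro: Ck_differentiable[of 0])
    then show "ddir e1 (\<lambda>x. x $ 1 * \<phi> x) x = (\<phi> + (\<lambda>x. x $ 1 * ddir e1 \<phi> x)) x" by (simp add: ddir_coordinate)
  qed
  with ip_ddir_by_parts[OF test_fun_smooth[OF x\<phi>] \<phi> e_Basis(1) meas]
  have "ip \<Omega> (\<lambda>x. x $ 1 * \<phi> x) (ddir e1 \<phi>) = - ip \<Omega> \<phi> \<phi> - ip \<Omega> (\<lambda>x. x $ 1 * ddir e1 \<phi> x) \<phi>"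
    using L by (simp add: l2.B_linear)
  moreover have "ip \<Omega> (\<lambda>x. x $ 1 * ddir e1 \<phi> x) \<phi> = ip \<Omega> (\<lambda>x. x $ 1 * \<phi> x) (ddir e1 \<phi>)"
    by (simp add: ip_def mult_ac)
  ultimately have "ip \<Omega> \<phi> \<phi> = 2 * (- ip \<Omega> (\<lambda>x. x $ 1 * \<phi> x) (ddir e1 \<phi>))" by simp
  also have "\<dots> \<le> 2 * (l2norm \<Omega> (\<lambda>x. x $ 1 * \<phi> x) * l2norm \<Omega> (ddir e1 \<phi>))"
    using l2.Cauchy_Schwarz[OF L(3) L(2)] by linarith
  also have "\<dots> \<le> 2 * ((R * l2norm \<Omega> \<phi>) * l2norm \<Omega> (ddir e1 \<phi>))"
  proof -
    have "(l2norm \<Omega> (\<lambda>x. x $ 1 * \<phi> x))\<^sup>2 \<le> (R * l2norm \<Omega> \<phi>)\<^sup>2"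
    proof -
      have "(l2norm \<Omega> (\<lambda>x. x $ 1 * \<phi> x))\<^sup>2 = (LINT x|lebesgue_on \<Omega>. (x $ 1 * \<phi> x)\<^sup>2)" by (simp add: l2norm_eq_sq_norm sq_norm_square)
      also have "\<dots> \<le> (LINT x|lebesgue_on \<Omega>. R\<^sup>2 * (\<phi> x)\<^sup>2)"
      proof (rule integral_mono)
        fix x assume "x \<in> space (lebesgue_on \<Omega>)"
        then have "\<bar>x $ 1\<bar> \<le> \<bar>R\<bar>" using R(1)[of x] R(2) by simp
        then have "(x $ 1)\<^sup>2 \<le> R\<^sup>2" by (simp only: abs_le_square_iff)
        then show "(x $ 1 * \<phi> x)\<^sup>2 \<le> R\<^sup>2 * (\<phi> x)\<^sup>2" by (simp add: power_mult_distrib mult_right_mono)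
      qed (use L in \<open>auto simp: L2_def\<close>)
      also have "\<dots> = (R * l2norm \<Omega> \<phi>)\<^sup>2" by (simp add: l2norm_eq_sq_norm sq_norm_square power_mult_distrib)
      finally show ?thesis .
    qed
    then have "l2norm \<Omega> (\<lambda>x. x $ 1 * \<phi> x) \<le> R * l2norm \<Omega> \<phi>" 
      by (rule power2_le_imp_le) (use R(2) l2.N_nonneg[OF L(1)] in simp)
    then show ?thesis using l2.N_nonneg[OF L(2)] by (intro mult_left_mono mult_right_mono) auto
  qed
  finally have "ip \<Omega> \<phi> \<phi> \<le> (2 * R * l2norm \<Omega> (ddir e1 \<phi>)) * l2norm \<Omega> \<phi>" by (simp add: mult_ac)
  from l2.N_le_of_square[OF L(1) this] show ?thesis using R(2) l2.N_nonneg[OF L(2)] by simp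
qed

text \<open>Definiteness of the Hessian form on \<open>H20\<close>. The derivative of a test
  function is again a test function, so the inequality can be applied twice to reach a second
  derivative. It is used to see that an \<open>ah\<close>-null discrete function is null in
  \<open>L2\<close>.\<close>

lemma Poincare_H20:
  assumes v: "v \<in> H20 \<Omega>" and z: "hess_form \<Omega> v v = 0"
  shows "l2norm \<Omega> v = 0"
proof -
  obtain R0 where R0: "\<And>x. x \<in> \<Omega> \<Longrightarrow> norm x \<le> R0" using bounded_Om by (auto simp: bounded_iff)
  define R where "R = max R0 0"
  have R: "\<And>x. x \<in> \<Omega> \<Longrightarrow> \<bar>x $ 1\<bar> \<le> R" "R \<ge> 0"
    using R0 component_le_norm_cart[of _ 1] unfolding R_def by (force intro: order_trans max.coboundedI1)+
  \<comment> \<open>Two uses of the inequality give \<open>4 * R^2\<close> times the Hessian norm of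
    \<phi>, which is at most \<open>2 * e\<close>; the remaining \<open>e\<close> is the distance
    from \<open>v\<close> to \<phi>.\<close>
  have bound: "l2norm \<Omega> v \<le> (8 * R\<^sup>2 + 1) * e" if e: "e > 0" for e
  proof -
    obtain \<phi> where \<phi>: "\<phi> \<in> test_fun \<Omega>" "Hs_norm 2 \<Omega> (v - \<phi>) < e" using H20_approx[OF v e] .
    have H: "v \<in> Hm 2 \<Omega>" "\<phi> \<in> Hm 2 \<Omega>" "v - \<phi> \<in> Hm 2 \<Omega>" using v \<phi> H20_Hm test_fun_Hm by auto
    have d1: "ddir e1 \<phi> \<in> test_fun \<Omega>" by (rule test_fun_ddir[OF \<phi>(1) e_Basis(1)])
    have "l2norm \<Omega> \<phi> \<le> 2 * R * l2norm \<Omega> (ddir e1 \<phi>)" by (rule Poincare_test[OF R \<phi>(1)])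
    also have "\<dots> \<le> 2 * R * (2 * R * l2norm \<Omega> (ddir e1 (ddir e1 \<phi>)))"
      using Poincare_test[OF R d1] R(2) by (intro mult_left_mono) auto
    also have "ddir e1 (ddir e1 \<phi>) = pderiv2 (2, 0) \<phi>" by (simp add: pderiv2_def numeral_2_eq_2)
    also have "l2norm \<Omega> (pderiv2 (2, 0) \<phi>) = l2norm \<Omega> (wderiv \<Omega> (2, 0) \<phi>)"
      by (rule l2norm_aeq[OF meas aeq_sym[OF wderiv_test[OF \<phi>(1)]]])
    also have "l2norm \<Omega> (wderiv \<Omega> (2, 0) \<phi>) \<le> sqrt (hess_form \<Omega> \<phi> \<phi>)"
      unfolding l2norm_def hess_form_def using Hm_wderiv(2)[OF open_Om H(2)] by (auto intro!: real_sqrt_le_mono add_increasing2 l2.pos)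
    also have "sqrt (hess_form \<Omega> \<phi> \<phi>) \<le> sqrt (hess_form \<Omega> v v) + sqrt (hess_form \<Omega> (v - \<phi>) (v - \<phi>))"
      using hess.N_triangle_diff[OF H(1) H(3)] by simp
    also have "\<dots> \<le> 2 * e" using z hess_le_Hs_norm[OF open_Om H(3)] \<phi>(2) by simp
    finally have p: "l2norm \<Omega> \<phi> \<le> 2 * R * (2 * R * (2 * e))" using R(2) by (simp add: mult_left_mono)
    have "l2norm \<Omega> v \<le> l2norm \<Omega> \<phi> + l2norm \<Omega> (v - \<phi>)" using l2.N_triangle[of \<phi> \<Omega> "v - \<phi>"] H Hm_L2 by simp
    also have "\<dots> \<le> 2 * R * (2 * R * (2 * e)) + e"
      using p l2norm_le_Hs_norm[OF open_Om, of "v - \<phi>" 2] H(3) \<phi>(2) by simp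
    finally show ?thesis by (simp add: power2_eq_square algebra_simps)
  qed
  show ?thesis
  proof (rule ccontr)
    assume "l2norm \<Omega> v \<noteq> 0"
    then have p: "l2norm \<Omega> v > 0" (is "?d > 0") using H20_L2[OF v] by (simp add: order_less_le)
    define c where "c = 8 * R\<^sup>2 + 1"
    have c: "c > 0" unfolding c_def by (intro add_nonneg_pos) auto
    have "?d \<le> c * (?d / (2 * c))" unfolding c_def[symmetric] using p c bound[of "?d / (2 * c)"] by (simp add: c_def)
    also have "\<dots> = ?d / 2" using c by simp
    finally show False using p by simp
  qed
qed

text \<open>The weak derivatives up to order two converge in \<open>L2\<close> by completeness, and
  pairing with test functions identifies their limits as the weak derivatives of \<open>v\<close>.
  So convergence takes place in the norm of \<open>Hm 2\<close>, and approximants of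
  \<open>f n\<close> also approximate \<open>v\<close>.\<close>

lemma H20_complete:
  assumes f: "\<And>n::nat. f n \<in> H20 \<Omega>"
    and Cauchy: "\<And>e. e > 0 \<Longrightarrow> \<exists>n0. \<forall>m\<ge>n0. \<forall>n\<ge>n0. Hs_norm 2 \<Omega> (f m - f n) < e"
    and v: "v \<in> L2 \<Omega>" and lim: "(\<lambda>n. l2norm \<Omega> (f n - v)) \<longlonglongrightarrow> 0"
  shows "v \<in> H20 \<Omega>"
proof -
  have fH: "f n \<in> Hm 2 \<Omega>" for n by (rule H20_Hm[OF f])
  have ex: "\<exists>g. g \<in> L2 \<Omega> \<and> (\<lambda>n. l2norm \<Omega> (wderiv \<Omega> \<mu> (f n) - g)) \<longlonglongrightarrow> 0" if \<mu>: "fst \<mu> + snd \<mu> \<le> 2" for \<mu>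
  proof -
    have i: "wderiv \<Omega> \<mu> (f n) \<in> L2 \<Omega>" for n by (rule Hm_wderiv(2)[OF open_Om fH \<mu>])
    have "\<exists>n0. \<forall>m\<ge>n0. \<forall>n\<ge>n0. l2norm \<Omega> (wderiv \<Omega> \<mu> (f m) - wderiv \<Omega> \<mu> (f n)) < e" if e: "e > 0" for e
    proof -
      obtain n0 where n0: "\<And>m n. m \<ge> n0 \<Longrightarrow> n \<ge> n0 \<Longrightarrow> Hs_norm 2 \<Omega> (f m - f n) < e" using Cauchy[OF e] by blast
      have "l2norm \<Omega> (wderiv \<Omega> \<mu> (f m) - wderiv \<Omega> \<mu> (f n)) \<le> Hs_norm 2 \<Omega> (f m - f n)" for m n
      proof -
        have "aeq \<Omega> (wderiv \<Omega> \<mu> (f m - f n)) (wderiv \<Omega> \<mu> (f m) - wderiv \<Omega> \<mu> (f n))"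
          using Hm_comb(2)[OF open_Om fH fH \<mu>, of 1 m "-1" n] by simp
        then have "l2norm \<Omega> (wderiv \<Omega> \<mu> (f m) - wderiv \<Omega> \<mu> (f n)) = l2norm \<Omega> (wderiv \<Omega> \<mu> (f m - f n))"
          by (rule l2norm_aeq[OF meas aeq_sym])
        also have "\<dots> \<le> Hs_norm 2 \<Omega> (f m - f n)"
          using wderiv_norm_le_Hs_norm[OF open_Om, of "f m - f n" 2 \<mu>] fH \<mu> by simp
        finally show ?thesis .
      qed
      then show ?thesis using n0 by (meson le_less_trans)
    qed
    from L2_complete[OF i this] show ?thesis by blast
  qed
  then obtain g where g: "\<And>\<mu>. fst \<mu> + snd \<mu> \<le> 2 \<Longrightarrow> g \<mu> \<in> L2 \<Omega>"
    "\<And>\<mu>. fst \<mu> + snd \<mu> \<le> 2 \<Longrightarrow> (\<lambda>n. l2norm \<Omega> (wderiv \<Omega> \<mu> (f n) - g \<mu>)) \<longlonglongrightarrow> 0" by metis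
  have ip_lim: "(\<lambda>n. ip \<Omega> (a n) w) \<longlonglongrightarrow> ip \<Omega> b w"
    if a: "\<And>n. a n \<in> L2 \<Omega>" and b: "b \<in> L2 \<Omega>" and w: "w \<in> L2 \<Omega>" and l: "(\<lambda>n. l2norm \<Omega> (a n - b)) \<longlonglongrightarrow> 0" for a b w
  proof -
    have "(\<lambda>n. l2norm \<Omega> (a n - b) * l2norm \<Omega> w) \<longlonglongrightarrow> 0" using tendsto_mult_left_zero[OF l] .
    then have "(\<lambda>n. ip \<Omega> (a n) w - ip \<Omega> b w) \<longlonglongrightarrow> 0"
    proof (rule Lim_null_comparison[rotated])
      show "\<forall>\<^sub>F n in sequentially. norm (ip \<Omega> (a n) w - ip \<Omega> b w) \<le> l2norm \<Omega> (a n - b) * l2norm \<Omega> w"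
        using a b w l2.Cauchy_Schwarz[of "a _ - b" \<Omega> w] by (intro always_eventually allI) (simp add: l2.diff_left[symmetric])
    qed
    then show ?thesis by (simp add: LIM_zero_iff)
  qed
  have vd: "is_wderiv \<Omega> \<mu> v (g \<mu>)" if \<mu>: "fst \<mu> + snd \<mu> \<le> 2" for \<mu>
    unfolding is_wderiv_def
  proof (intro conjI ballI)
    show "loc_integrable \<Omega> v" "loc_integrable \<Omega> (g \<mu>)" using v g(1)[OF \<mu>] by (auto intro: L2_loc_integrable meas)
    fix \<phi> assume \<phi>: "\<phi> \<in> test_fun \<Omega>"
    have "(\<lambda>n. ip \<Omega> (f n) (pderiv2 \<mu> \<phi>)) \<longlonglongrightarrow> ip \<Omega> v (pderiv2 \<mu> \<phi>)"
      by (rule ip_lim[OF Hm_L2[OF fH] v test_fun_L2[OF test_fun_pderiv2[OF \<phi>]] lim])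
    moreover have "(\<lambda>n. (- 1) ^ (fst \<mu> + snd \<mu>) * ip \<Omega> (wderiv \<Omega> \<mu> (f n)) \<phi>) \<longlonglongrightarrow> (- 1) ^ (fst \<mu> + snd \<mu>) * ip \<Omega> (g \<mu>) \<phi>"
      by (intro tendsto_intros ip_lim[OF Hm_wderiv(2)[OF open_Om fH \<mu>] g(1)[OF \<mu>] test_fun_L2[OF \<phi>] g(2)[OF \<mu>]])
    moreover have "ip \<Omega> (f n) (pderiv2 \<mu> \<phi>) = (- 1) ^ (fst \<mu> + snd \<mu>) * ip \<Omega> (wderiv \<Omega> \<mu> (f n)) \<phi>" for n
      using Hm_wderiv(1)[OF open_Om fH \<mu>, of n] \<phi> by (auto simp: is_wderiv_def)
    ultimately show "ip \<Omega> v (pderiv2 \<mu> \<phi>) = (- 1) ^ (fst \<mu> + snd \<mu>) * ip \<Omega> (g \<mu>) \<phi>" by (simp add: LIMSEQ_unique)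
  qed
  have vH: "v \<in> Hm 2 \<Omega>" unfolding Hm_def using v vd g(1) by blast
  have norm_lim: "(\<lambda>n. Hs_norm 2 \<Omega> (f n - v)) \<longlonglongrightarrow> 0"
  proof -
    have "(\<lambda>n. l2norm \<Omega> (wderiv \<Omega> \<mu> (f n - v))) \<longlonglongrightarrow> 0" if \<mu>: "fst \<mu> + snd \<mu> \<le> 2" for \<mu>
    proof -
      have "aeq \<Omega> (wderiv \<Omega> \<mu> (f n - v)) (wderiv \<Omega> \<mu> (f n) - g \<mu>)" for n
        using aeq_trans[OF Hm_comb(2)[OF open_Om fH vH \<mu>, of 1 n "-1", simplified] aeq_diff[OF aeq_refl wderiv_aeq[OF open_Om vd[OF \<mu>]]]] by simp
      then have "l2norm \<Omega> (wderiv \<Omega> \<mu> (f n - v)) = l2norm \<Omega> (wderiv \<Omega> \<mu> (f n) - g \<mu>)" for n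
        by (rule l2norm_aeq[OF meas])
      then show ?thesis using g(2)[OF \<mu>] by simp
    qed
    then have "(\<lambda>n. sqrt (\<Sum>\<mu> | fst \<mu> + snd \<mu> \<le> (2::nat). (l2norm \<Omega> (wderiv \<Omega> \<mu> (f n - v)))\<^sup>2)) \<longlonglongrightarrow> sqrt (\<Sum>\<mu> | fst \<mu> + snd \<mu> \<le> (2::nat). 0\<^sup>2)"
      by (intro tendsto_intros) auto
    then show ?thesis by (simp add: Hs_norm_def)
  qed
  show ?thesis
  proof (rule H20I[OF vH])
    fix e :: real assume e: "e > 0"
    obtain n where n: "Hs_norm 2 \<Omega> (f n - v) < e / 2"
      using order_tendstoD(2)[OF norm_lim, of "e / 2"] e by (auto simp: eventually_sequentially)
    have "e / 2 > 0" using e by simp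
    from H20_approx[OF f[of n] this] obtain \<phi> where \<phi>: "\<phi> \<in> test_fun \<Omega>" "Hs_norm 2 \<Omega> (f n - \<phi>) < e / 2" .
    have "Hs_norm 2 \<Omega> (v - \<phi>) \<le> Hs_norm 2 \<Omega> (v - f n) + Hs_norm 2 \<Omega> (f n - \<phi>)"
      by (rule h2.N_diff_triangle[OF vH test_fun_Hm[OF \<phi>(1)] fH])
    also have "\<dots> < e" using n \<phi>(2) h2.N_diff_commute[OF vH fH, of n] by simp
    finally show "\<exists>\<phi>\<in>test_fun \<Omega>. Hs_norm 2 \<Omega> (v - \<phi>) < e" using \<phi>(1) by blast
  qed
qed

end

section \<open>Weak derivatives in time\<close>

text \<open>\<open>V\<close> acts as a variation function: over a partition finer than \<delta> the
  increments of \<open>H\<close> add up to at most \<open>e * (V b - V a)\<close>. This replaces a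
  vanishing derivative for functions that are only absolutely continuous.\<close>

lemma eq_of_small_increments:
  fixes H V :: "real \<Rightarrow> real"
  assumes ab: "a \<le> b"
    and small: "\<And>e. e > 0 \<Longrightarrow> \<exists>\<delta>>0. \<forall>u v. a \<le> u \<and> u \<le> v \<and> v \<le> b \<and> v - u < \<delta> \<longrightarrow> \<bar>H v - H u\<bar> \<le> e * (V v - V u)"
  shows "H b = H a"
proof -
  have "\<bar>H b - H a\<bar> \<le> e * (V b - V a)" if e: "e > 0" for e
  proof -
    obtain \<delta> where \<delta>: "\<delta> > 0"
      "\<And>u v. a \<le> u \<Longrightarrow> u \<le> v \<Longrightarrow> v \<le> b \<Longrightarrow> v - u < \<delta> \<Longrightarrow> \<bar>H v - H u\<bar> \<le> e * (V v - V u)"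
      using small[OF e] by blast
    obtain n :: nat where n: "(b - a) / \<delta> < real n" using reals_Archimedean2 by blast
    then have n0: "n > 0" using ab \<delta>(1) by (cases n) (auto simp: divide_less_0_iff)
    define x where "x i = a + real i * ((b - a) / real n)" for i :: nat
    have x0: "x 0 = a" "x n = b" using n0 by (auto simp: x_def)
    have st: "x (Suc i) - x i = (b - a) / real n" for i
      by (simp add: x_def distrib_right add_divide_distrib)
    have small_step: "(b - a) / real n < \<delta>" using n n0 \<delta>(1) by (simp add: field_simps)
    have mono: "a \<le> x i" "x i \<le> x (Suc i)" for i
    proof -
      show "a \<le> x i" using ab by (simp add: x_def)
      have "0 \<le> x (Suc i) - x i" unfolding st using ab by simp
      then show "x i \<le> x (Suc i)" by simp
    qed
    have xb: "x (Suc i) \<le> b" if "i < n" for i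
    proof -
      have "real (Suc i) * ((b - a) / real n) \<le> real n * ((b - a) / real n)"
        using that ab by (intro mult_right_mono) auto
      then show ?thesis using n0 by (simp add: x_def)
    qed
    have "H b - H a = (\<Sum>i<n. H (x (Suc i)) - H (x i))" using sum_lessThan_telescope[of "\<lambda>i. H (x i)" n] x0 by simp
    then have "\<bar>H b - H a\<bar> \<le> (\<Sum>i<n. \<bar>H (x (Suc i)) - H (x i)\<bar>)" by simp
    also have "\<dots> \<le> (\<Sum>i<n. e * (V (x (Suc i)) - V (x i)))"
      using mono xb st small_step by (intro sum_mono \<delta>(2)) auto
    also have "\<dots> = e * (V b - V a)"
      using sum_lessThan_telescope[of "\<lambda>i. V (x i)" n] x0 by (simp add: sum_distrib_left[symmetric])
    finally show ?thesis .
  qed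
  note bound = this
  show ?thesis
  proof (rule ccontr)
    assume "H b \<noteq> H a"
    then have p: "\<bar>H b - H a\<bar> > 0" by simp
    define X where "X = \<bar>V b - V a\<bar> + 1"
    have X: "X > 0" "V b - V a \<le> X" unfolding X_def by linarith+
    have "\<bar>H b - H a\<bar> \<le> (\<bar>H b - H a\<bar> / (2 * X)) * (V b - V a)"
      using p X by (intro bound divide_pos_pos) auto
    also have "\<dots> \<le> (\<bar>H b - H a\<bar> / (2 * X)) * X"
      using X by (intro mult_left_mono) auto
    also have "\<dots> = \<bar>H b - H a\<bar> / 2" using X by simp
    finally show False using p by simp
  qed
qed

lemma abs_integral_mult_le:
  fixes g q :: "real \<Rightarrow> real"
  assumes "(\<lambda>r. g r * q r) integrable_on {u..v}" "(\<lambda>r. \<bar>q r\<bar>) integrable_on {u..v}" "\<And>r. r \<in> {u..v} \<Longrightarrow> \<bar>g r\<bar> \<le> e"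
  shows "\<bar>integral {u..v} (\<lambda>r. g r * q r)\<bar> \<le> e * integral {u..v} (\<lambda>r. \<bar>q r\<bar>)"
proof -
  have "norm (integral {u..v} (\<lambda>r. g r * q r)) \<le> integral {u..v} (\<lambda>r. e * \<bar>q r\<bar>)"
    using assms by (intro integral_norm_bound_integral integrable_on_mult_right) (auto simp: abs_mult intro!: mult_right_mono)
  then show ?thesis by simp
qed

lemma integrable_continuous_mult:
  fixes g q :: "real \<Rightarrow> real"
  assumes g: "continuous_on {a..b} g" and q: "q absolutely_integrable_on {a..b}"
  shows "(\<lambda>r. g r * q r) absolutely_integrable_on {a..b}"
proof (rule absolutely_integrable_bounded_measurable_product_real)
  show "g \<in> borel_measurable (lebesgue_on {a..b})" using g by (intro continuous_imp_measurable_on_sets_lebesgue) auto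
  show "bounded (g ` {a..b})" using g by (intro compact_imp_bounded compact_continuous_image) auto
qed (use q in auto)

text \<open>\<open>F\<close> is only an indefinite integral, so there is no product rule at every
  point. Instead the difference \<open>H\<close> of the two sides, with the endpoint variable, has
  increments that are small relative to those of the integral of \<open>|q|\<close> plus that of
  \<open>|g'|\<close>.\<close>

lemma absolutely_continuous_by_parts:
  fixes g g' q :: "real \<Rightarrow> real"
  assumes ab: "a \<le> b" and g: "\<And>t. t \<in> {a..b} \<Longrightarrow> (g has_real_derivative g' t) (at t within {a..b})"
    and g': "continuous_on {a..b} g'" and q: "q absolutely_integrable_on {a..b}"
    and F: "\<And>t. t \<in> {a..b} \<Longrightarrow> F t = F a + integral {a..t} q"
  shows "integral {a..b} (\<lambda>r. g' r * F r) = g b * F b - g a * F a - integral {a..b} (\<lambda>r. g r * q r)"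
proof -
  have gc: "continuous_on {a..b} g" using g by (meson DERIV_continuous_on)
  have qi: "q integrable_on {a..b}" using q absolutely_integrable_on_def by blast
  have Fc: "continuous_on {a..b} F"
    using indefinite_integral_continuous_1[OF qi] F
    by (subst continuous_on_cong[OF refl F]) (auto intro: continuous_intros)
  have aq: "(\<lambda>r. \<bar>q r\<bar>) integrable_on {a..b}"
    using q unfolding absolutely_integrable_on_def by simp
  have gq: "(\<lambda>r. g r * q r) integrable_on {a..b}"
    using integrable_continuous_mult[OF gc q] absolutely_integrable_on_def by blast
  have sub: "f integrable_on {u..v}" if "f integrable_on {a..b}" "a \<le> u" "v \<le> b" for f :: "real \<Rightarrow> real" and u v
    using that by (auto intro: integrable_subinterval_real)
  have g'F: "(\<lambda>r. g' r * F r) integrable_on {a..b}"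
    using g' Fc by (intro integrable_continuous_interval continuous_intros)
  have ag': "(\<lambda>r. \<bar>g' r\<bar>) integrable_on {a..b}"
    using g' by (intro integrable_continuous_interval continuous_intros)
  define H where "H t = g t * F t - integral {a..t} (\<lambda>r. g r * q r) - integral {a..t} (\<lambda>r. g' r * F r)" for t
  define V where "V t = integral {a..t} (\<lambda>r. \<bar>q r\<bar>) + integral {a..t} (\<lambda>r. \<bar>g' r\<bar>)" for t
  have split: "integral {a..v} f - integral {a..u} f = integral {u..v} f"
    if "f integrable_on {a..b}" "a \<le> u" "u \<le> v" "v \<le> b" for f :: "real \<Rightarrow> real" and u v
    using Henstock_Kurzweil_Integration.integral_combine[of a u v f] that sub[OF that(1), of a v] by simp
  have "H b = H a"
  proof (rule eq_of_small_increments[OF ab, where V = V])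
    fix e :: real assume e: "e > 0"
    have "uniformly_continuous_on {a..b} g" "uniformly_continuous_on {a..b} F"
      using gc Fc by (auto intro: compact_uniformly_continuous)
    then obtain d1 d2 where d: "d1 > 0" "d2 > 0"
      "\<And>x x'. x \<in> {a..b} \<Longrightarrow> x' \<in> {a..b} \<Longrightarrow> dist x' x < d1 \<Longrightarrow> dist (g x') (g x) < e"
      "\<And>x x'. x \<in> {a..b} \<Longrightarrow> x' \<in> {a..b} \<Longrightarrow> dist x' x < d2 \<Longrightarrow> dist (F x') (F x) < e"
      unfolding uniformly_continuous_on_def using e by metis
    show "\<exists>\<delta>>0. \<forall>u v. a \<le> u \<and> u \<le> v \<and> v \<le> b \<and> v - u < \<delta> \<longrightarrow> \<bar>H v - H u\<bar> \<le> e * (V v - V u)"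
    proof (intro exI[of _ "min d1 d2"] conjI allI impI)
      fix u v assume uv: "a \<le> u \<and> u \<le> v \<and> v \<le> b \<and> v - u < min d1 d2"
      have uvi: "a \<le> u" "u \<le> v" "v \<le> b" using uv by auto
      have Fq: "F v - F u = integral {u..v} q"
        using F[of u] F[of v] uvi split[OF qi uvi] by simp
      have gg: "g v - g u = integral {u..v} g'"
      proof -
        have "(g' has_integral (g v - g u)) {u..v}"
          using uvi by (intro fundamental_theorem_of_calculus)
            (auto simp: has_real_derivative_iff_has_vector_derivative[symmetric] intro!: DERIV_subset[OF g])
        then show ?thesis by (simp add: integral_unique)
      qed
      have i1: "q integrable_on {u..v}" "(\<lambda>r. g r * q r) integrable_on {u..v}" "(\<lambda>r. g' r * F r) integrable_on {u..v}"
          "(\<lambda>r. \<bar>q r\<bar>) integrable_on {u..v}" "(\<lambda>r. \<bar>g' r\<bar>) integrable_on {u..v}" "g' integrable_on {u..v}"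
        using sub uvi qi gq g'F aq ag' integrable_continuous_interval[OF g'] by auto
      \<comment> \<open>Taking \<open>g\<close> at the right end and \<open>F\<close> at the left
        end leaves integrands that contain only deviations of \<open>g\<close> and \<open>F\<close>;
        uniform continuity makes these at most \<open>e\<close>.\<close>
      have "H v - H u = (g v * integral {u..v} q - integral {u..v} (\<lambda>r. g r * q r))
          + (F u * integral {u..v} g' - integral {u..v} (\<lambda>r. g' r * F r))"
        using split[OF gq uvi] split[OF g'F uvi] unfolding H_def Fq[symmetric] gg[symmetric] by (simp add: algebra_simps)
      also have "\<dots> = integral {u..v} (\<lambda>r. (g v - g r) * q r) + integral {u..v} (\<lambda>r. (F u - F r) * g' r)"
        using i1 by (simp add: left_diff_distrib integral_diff integrable_on_mult_right integrable_on_mult_left mult.commute[of "F _" "g' _"] mult.commute[of "F _" "integral _ _"])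
      finally have eq: "H v - H u = integral {u..v} (\<lambda>r. (g v - g r) * q r) + integral {u..v} (\<lambda>r. (F u - F r) * g' r)" .
      have "\<bar>integral {u..v} (\<lambda>r. (g v - g r) * q r)\<bar> \<le> e * integral {u..v} (\<lambda>r. \<bar>q r\<bar>)"
      proof (rule abs_integral_mult_le)
        show "(\<lambda>r. (g v - g r) * q r) integrable_on {u..v}"
          using i1 by (auto simp: left_diff_distrib intro!: integrable_diff integrable_on_mult_right)
        show "\<bar>g v - g r\<bar> \<le> e" if "r \<in> {u..v}" for r
          using d(3)[of v r] that uv by (auto simp: dist_real_def abs_minus_commute)
      qed (rule i1)
      moreover have "\<bar>integral {u..v} (\<lambda>r. (F u - F r) * g' r)\<bar> \<le> e * integral {u..v} (\<lambda>r. \<bar>g' r\<bar>)"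
      proof (rule abs_integral_mult_le)
        show "(\<lambda>r. (F u - F r) * g' r) integrable_on {u..v}"
          using i1 by (auto simp: left_diff_distrib mult.commute[of "F _" "g' _"] intro!: integrable_diff integrable_on_mult_right integrable_on_mult_left)
        show "\<bar>F u - F r\<bar> \<le> e" if "r \<in> {u..v}" for r
          using d(4)[of u r] that uv by (auto simp: dist_real_def abs_minus_commute)
      qed (rule i1)
      ultimately have "\<bar>H v - H u\<bar> \<le> e * integral {u..v} (\<lambda>r. \<bar>q r\<bar>) + e * integral {u..v} (\<lambda>r. \<bar>g' r\<bar>)"
        unfolding eq by linarith
      then show "\<bar>H v - H u\<bar> \<le> e * (V v - V u)"
        using split[OF aq uvi] split[OF ag' uvi] by (simp add: V_def algebra_simps)
    qed (use d in auto)
  qed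
  then show ?thesis by (simp add: H_def)
qed

section \<open>Primitives of test functions and the du Bois-Reymond lemma\<close>

lemma smooth_DERIV: "smooth \<phi> \<Longrightarrow> (\<phi> has_real_derivative ddir 1 \<phi> t) (at t)"
proof -
  assume s: "smooth \<phi>"
  have d: "(\<phi> has_derivative (\<lambda>h. ddir h \<phi> t)) (at t)" using s by (rule smooth_has_derivative)
  have "ddir h \<phi> t = ddir 1 \<phi> t * h" for h
    using linear_scale[OF has_derivative_linear[OF d], of h 1] by simp
  then have "(\<lambda>h. ddir h \<phi> t) = times (ddir 1 \<phi> t)" by (intro ext)
  then show ?thesis using d by (simp only: has_field_derivative_def)
qed

lemma deriv_eq_ddir: "smooth \<phi> \<Longrightarrow> deriv \<phi> = ddir 1 \<phi>"
  using smooth_DERIV DERIV_imp_deriv by blast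

lemma smooth_antideriv:
  fixes \<phi> \<eta> :: "real \<Rightarrow> real"
  assumes "smooth \<eta>" and d: "\<And>t. (\<phi> has_real_derivative \<eta> t) (at t)"
  shows "smooth \<phi>"
proof -
  have "ddir 1 \<phi> = \<eta>" by (intro ext ddir_eqI[THEN trans, OF d[unfolded has_field_derivative_def]]) simp
  moreover have "\<phi> differentiable_on UNIV" using d by (auto simp: differentiable_on_def real_differentiable_def)
  ultimately have "Ck (Suc k) \<phi>" for k using assms(1) by (simp add: smooth_iff_Ck)
  then show ?thesis unfolding smooth_iff_Ck using Ck_mono by blast
qed

lemma test_fun_real_support:
  fixes T :: real
  assumes "\<phi> \<in> test_fun {0<..<T}" "T > 0"
  obtains lo hi where "0 < lo" "lo \<le> hi" "hi < T" "\<And>t. t \<notin> {lo..hi} \<Longrightarrow> \<phi> t = 0"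
proof (cases "{t. \<phi> t \<noteq> 0} = {}")
  case True
  then show ?thesis using that[of "T/2" "T/2"] assms(2) by auto
next
  case False
  let ?K = "closure {t. \<phi> t \<noteq> 0}"
  have K: "compact ?K" "?K \<noteq> {}" "?K \<subseteq> {0<..<T}" using assms False by (auto simp: test_fun_def)
  obtain lo hi where lh: "lo \<in> ?K" "\<forall>t\<in>?K. lo \<le> t" "hi \<in> ?K" "\<forall>t\<in>?K. t \<le> hi"
    using compact_attains_inf[OF K(1,2)] compact_attains_sup[OF K(1,2)] by blast
  have out: "\<phi> t = 0" if "t \<notin> {lo..hi}" for t
  proof (rule ccontr)
    assume "\<phi> t \<noteq> 0"
    then have "t \<in> ?K" using closure_subset[of "{t. \<phi> t \<noteq> 0}"] by auto
    then show False using lh(2,4) that by auto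
  qed
  have "0 < lo" "hi < T" using K(3) lh(1,3) by auto
  moreover have "lo \<le> hi" using lh by blast
  ultimately show ?thesis using that out by blast
qed

text \<open>Mean zero is what makes the primitive vanish again to the right of the support.\<close>

lemma test_fun_antideriv:
  assumes \<eta>: "\<eta> \<in> test_fun {0<..<T}" and T: "T > 0" and z: "integral {0..T} \<eta> = 0"
  obtains \<phi> where "\<phi> \<in> test_fun {0<..<T}" "deriv \<phi> = \<eta>"
proof -
  have s: "smooth \<eta>" using \<eta> by (simp add: test_fun_def)
  have ci: "\<eta> integrable_on {a..b}" for a b using smooth_continuous[OF s] by (intro integrable_continuous_interval)
  obtain lo hi where lh: "0 < lo" "lo \<le> hi" "hi < T" "\<And>t. t \<notin> {lo..hi} \<Longrightarrow> \<eta> t = 0"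
    using test_fun_real_support[OF \<eta> T] by metis
  define \<phi> where "\<phi> t = integral {0..t} \<eta>" for t
  \<comment> \<open>The integral may start anywhere left of 0 without changing its value. Thus every
    \<open>t\<close> is interior to an interval of integration, and two-sided derivatives exist also
    for \<open>t \<le> 0\<close>, where the integral from 0 is 0 by convention.\<close>
  have shift: "integral {L..t} \<eta> = \<phi> t" if "L \<le> 0" "L \<le> t" for L t
  proof (cases "0 \<le> t")
    case True
    have "integral {L..0} \<eta> = integral {L..0} (\<lambda>t. 0)" using lh by (intro integral_cong) auto
    moreover have "integral {L..0} \<eta> + integral {0..t} \<eta> = integral {L..t} \<eta>"
      using True that ci by (intro Henstock_Kurzweil_Integration.integral_combine) auto
    ultimately show ?thesis by (simp add: \<phi>_def)
  next
    case False
    have "integral {L..t} \<eta> = integral {L..t} (\<lambda>t. 0)" using lh False by (intro integral_cong) auto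
    then show ?thesis using False by (simp add: \<phi>_def)
  qed
  have d: "(\<phi> has_real_derivative \<eta> t) (at t)" for t
  proof -
    let ?L = "min t 0 - 1"
    have "((\<lambda>x. integral {?L..x} \<eta>) has_real_derivative \<eta> t) (at t within {?L..t + 1})"
      using smooth_continuous[OF s] by (intro integral_has_real_derivative) auto
    then have "((\<lambda>x. integral {?L..x} \<eta>) has_real_derivative \<eta> t) (at t)"
      by (subst (asm) at_within_interior) auto
    then show ?thesis
      by (rule has_field_derivative_transform_within_open[of _ _ _ "{?L<..}"]) (auto intro: shift)
  qed
  have z1: "\<phi> t = 0" if "t < lo" for t
  proof -
    have "integral {0..t} \<eta> = integral {0..t} (\<lambda>t. 0)" using lh that by (intro integral_cong) auto
    then show ?thesis by (simp add: \<phi>_def)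
  qed
  have z2: "\<phi> t = 0" if t: "t > hi" for t
  proof -
    have e: "integral {hi..M} \<eta> = 0" if "M \<ge> hi" for M
    proof -
      have "integral {hi..M} \<eta> = integral {hi..M} (\<lambda>t. 0)"
        by (rule integral_spike[of "{hi}"]) (use lh in \<open>auto simp: \<close>)
      then show ?thesis by simp
    qed
    have "integral {0..hi} \<eta> + integral {hi..M} \<eta> = integral {0..M} \<eta>" if "M \<ge> hi" for M
      using that lh ci by (intro Henstock_Kurzweil_Integration.integral_combine) auto
    from this[of T] this[of t] e[of T] e[of t] z lh t show ?thesis by (simp add: \<phi>_def)
  qed
  have sub: "{t. \<phi> t \<noteq> 0} \<subseteq> {lo..hi}" using z1 z2 by (force simp: not_less)
  then have "closure {t. \<phi> t \<noteq> 0} \<subseteq> {lo..hi}" by (intro closure_minimal) auto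
  moreover have "compact (closure {t. \<phi> t \<noteq> 0})" unfolding compact_closure using sub bounded_closed_interval bounded_subset by blast
  moreover have "smooth \<phi>" using s d by (rule smooth_antideriv)
  ultimately have "\<phi> \<in> test_fun {0<..<T}" using lh by (auto simp: test_fun_def)
  moreover have "deriv \<phi> = \<eta>" using d DERIV_imp_deriv by blast
  ultimately show ?thesis using that by blast
qed

text \<open>The set of disagreement is open and null, hence empty.\<close>

lemma eq_of_AE_eq_continuous:
  fixes f g :: "'a::euclidean_space \<Rightarrow> real"
  assumes S: "open S" and f: "continuous_on S f" and g: "continuous_on S g"
    and ae: "AE x in lebesgue_on S. f x = g x" and x: "x \<in> S"
  shows "f x = g x"
proof (rule ccontr)
  assume ne: "f x \<noteq> g x"
  let ?U = "{y \<in> S. f y - g y \<in> - {0}}"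
  have U: "open ?U" using continuous_open_preimage[OF continuous_on_diff[OF f g] S, of "- {0}"]
    by (simp add: vimage_def Int_def conj_commute open_Compl)
  have "AE x in lebesgue. x \<in> S \<longrightarrow> f x = g x" using ae S by (simp add: AE_restrict_space_iff)
  then have "AE x in lebesgue. x \<notin> ?U" by eventually_elim auto
  then have "?U \<in> null_sets lebesgue" using U by (subst (asm) AE_iff_null_sets[symmetric]) auto
  then have "negligible ?U" by (simp add: negligible_iff_null_sets)
  moreover have "?U \<noteq> {}" using ne x by auto
  ultimately show False using U open_not_negligible by blast
qed

lemma LINT_eq_integral:
  fixes f :: "real \<Rightarrow> real"
  shows "integrable (lebesgue_on {a..b}) f \<Longrightarrow> (LINT t|lebesgue_on {a..b}. f t) = integral {a..b} f"
  by (simp add: lebesgue_integral_eq_integral)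

lemma integrable_continuous_lebesgue_on:
  fixes f :: "real \<Rightarrow> real"
  assumes "continuous_on {a..b} f" shows "integrable (lebesgue_on {a..b}) f"
  using absolutely_integrable_continuous_real[OF assms] by (simp add: integrable_restrict_space set_integrable_def)

lemma integrable_iff_absolutely_integrable:
  fixes f :: "real \<Rightarrow> real"
  shows "integrable (lebesgue_on {a..b}) f \<longleftrightarrow> f absolutely_integrable_on {a..b}"
  by (simp add: integrable_restrict_space set_integrable_def)

text \<open>The difference \<open>P\<close> of \<open>p\<close> and the primitive of
  \<open>q\<close> is orthogonal to all derivatives of test functions, that is, to all test
  functions of mean zero, and is therefore constant.\<close>

lemma weak_derivative_integral:
  fixes p q :: "real \<Rightarrow> real"
  assumes T: "T > 0" and p: "continuous_on {0..T} p" and q: "integrable (lebesgue_on {0..T}) q"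
    and w: "\<And>\<phi>. \<phi> \<in> test_fun {0<..<T} \<Longrightarrow>
      (LINT t|lebesgue_on {0..T}. deriv \<phi> t * p t) = - (LINT t|lebesgue_on {0..T}. \<phi> t * q t)"
    and ab: "0 \<le> a" "a \<le> b" "b \<le> T"
  shows "(q has_integral (p b - p a)) {a..b}"
proof -
  have qa: "q absolutely_integrable_on {0..T}" using q by (simp add: integrable_iff_absolutely_integrable)
  then have qi: "q integrable_on {0..T}" using absolutely_integrable_on_def by blast
  define F where "F t = integral {0..t} q" for t
  define P where "P t = p t - F t" for t
  have Fc: "continuous_on {0..T} F" unfolding F_def by (rule indefinite_integral_continuous_1[OF qi])
  have Pc: "continuous_on {0..T} P" unfolding P_def by (intro continuous_intros p Fc)
  have smc: "continuous_on {0..T} \<phi>" if "\<phi> \<in> test_fun {0<..<T}" for \<phi> :: "real \<Rightarrow> real"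
    using that by (intro smooth_continuous) (simp add: test_fun_def)
  have orth: "integral {0..T} (\<lambda>t. \<eta> t * P t) = 0"
    if \<eta>: "\<eta> \<in> test_fun {0<..<T}" and z: "integral {0..T} \<eta> = 0" for \<eta>
  proof -
    obtain \<phi> where \<phi>: "\<phi> \<in> test_fun {0<..<T}" "deriv \<phi> = \<eta>" using test_fun_antideriv[OF \<eta> T z] by blast
    have s: "smooth \<phi>" using \<phi> by (simp add: test_fun_def)
    obtain lo hi where lh: "0 < lo" "lo \<le> hi" "hi < T" "\<And>t. t \<notin> {lo..hi} \<Longrightarrow> \<phi> t = 0"
      using test_fun_real_support[OF \<phi>(1) T] by metis
    have z0: "\<phi> 0 = 0" "\<phi> T = 0" using lh by auto
    have "integral {0..T} (\<lambda>t. \<eta> t * p t) = - integral {0..T} (\<lambda>t. \<phi> t * q t)"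
      using w[OF \<phi>(1)] \<phi>(2) integrable_continuous_mult[OF smc[OF \<phi>(1)] qa]
        integrable_continuous_lebesgue_on[OF continuous_on_mult[OF smc[OF \<eta>] p]]
      by (simp add: LINT_eq_integral integrable_iff_absolutely_integrable)
    moreover have "integral {0..T} (\<lambda>t. \<eta> t * F t) = \<phi> T * F T - \<phi> 0 * F 0 - integral {0..T} (\<lambda>t. \<phi> t * q t)"
    proof (rule absolutely_continuous_by_parts)
      show "(\<phi> has_real_derivative \<eta> t) (at t within {0..T})" for t
        using smooth_DERIV[OF s, of t] \<phi>(2) deriv_eq_ddir[OF s] by (auto intro: has_field_derivative_at_within)
    qed (use T smc[OF \<eta>] qa in \<open>auto simp: F_def\<close>)
    moreover have "integral {0..T} (\<lambda>t. \<eta> t * P t) = integral {0..T} (\<lambda>t. \<eta> t * p t) - integral {0..T} (\<lambda>t. \<eta> t * F t)"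
      unfolding P_def right_diff_distrib
      by (intro integral_diff integrable_continuous_interval continuous_intros smc[OF \<eta>] p Fc)
    ultimately show ?thesis using z0 by simp
  qed
  \<comment> \<open>A fixed test function of positive integral: subtracting a multiple of it turns
    any test function into one of mean zero.\<close>
  define \<eta>0 where "\<eta>0 = bump (T/3) (2*T/3) 1"
  have \<eta>0: "\<eta>0 \<in> test_fun {0<..<T}" unfolding \<eta>0_def using T by (intro bump_test_fun) auto
  define m where "m = integral {0..T} \<eta>0"
  have m: "m > 0"
  proof -
    have "m \<ge> 0" unfolding m_def \<eta>0_def using smc[OF \<eta>0] bump_bounds
      by (intro integral_nonneg integrable_continuous_interval) (auto simp: \<eta>0_def)
    moreover have "m \<noteq> 0"
    proof
      assume "m = 0"
      then have "(\<eta>0 has_integral 0) {0..T}" using smc[OF \<eta>0] integrable_continuous_interval m_def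
        by (metis integrable_integral)
      then have "\<eta>0 (T/2) = 0" using smc[OF \<eta>0] bump_bounds T
        by (intro has_integral_0_cbox_imp_0[of 0 T \<eta>0]) (auto simp: \<eta>0_def)
      then show False using T by (simp add: \<eta>0_def bump_def flat_exp_def)
    qed
    ultimately show ?thesis by simp
  qed
  \<comment> \<open>The only possible constant value of \<open>P\<close> is its mean with weight
    \<eta>0.\<close>
  define c where "c = integral {0..T} (\<lambda>t. \<eta>0 t * P t) / m"
  have "AE t in lebesgue_on {0<..<T}. P t - c = 0"
  proof (rule fundamental_lemma)
    show "integrable (lebesgue_on K) (\<lambda>t. P t - c)" if "compact K" "K \<subseteq> {0<..<T}" for K
    proof -
      have "integrable (lebesgue_on {0..T}) (\<lambda>t. P t - c)"
        by (intro integrable_continuous_lebesgue_on continuous_intros Pc)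
      then have "set_integrable lebesgue {0..T} (\<lambda>t. P t - c)" by (simp add: integrable_iff_absolutely_integrable)
      moreover have K: "K \<in> sets lebesgue" using that(1) by (simp add: borel_compact)
      moreover have "K \<subseteq> {0..T}" using that(2) by auto
      ultimately have "set_integrable lebesgue K (\<lambda>t. P t - c)" by (rule set_integrable_subset)
      then show ?thesis using K by (simp add: integrable_restrict_space set_integrable_def)
    qed
    fix \<eta> assume \<eta>: "\<eta> \<in> test_fun {0<..<T}"
    define k where "k = integral {0..T} \<eta> / m"
    have \<eta>i: "\<eta> integrable_on {0..T}" "\<eta>0 integrable_on {0..T}" using smc \<eta> \<eta>0 integrable_continuous_interval by blast+
    have t: "(\<lambda>t. \<eta> t + (- k) * \<eta>0 t) \<in> test_fun {0<..<T}"
      using test_fun_comb[OF \<eta> \<eta>0, of 1 "- k"] by simp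
    have "integral {0..T} (\<lambda>t. \<eta> t + (- k) * \<eta>0 t) = integral {0..T} \<eta> + (- k) * m"
      using \<eta>i by (simp add: m_def integral_diff integrable_on_mult_right)
    then have "integral {0..T} (\<lambda>t. \<eta> t + (- k) * \<eta>0 t) = 0" using m by (simp add: k_def)
    from orth[OF t this] have o: "integral {0..T} (\<lambda>t. (\<eta> t + (- k) * \<eta>0 t) * P t) = 0" .
    have "integral {0..T} (\<lambda>t. (\<eta> t + (- k) * \<eta>0 t) * P t)
        = integral {0..T} (\<lambda>t. \<eta> t * P t) + (- k) * integral {0..T} (\<lambda>t. \<eta>0 t * P t)"
      unfolding distrib_right mult.assoc
      by (subst integral_add) (auto intro!: integrable_continuous_interval continuous_intros smc[OF \<eta>] smc[OF \<eta>0] Pc)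
    moreover have "integral {0..T} (\<lambda>t. \<eta>0 t * P t) = c * m" using m by (simp add: c_def)
    ultimately have "integral {0..T} (\<lambda>t. \<eta> t * P t) = c * integral {0..T} \<eta>" using o m by (simp add: k_def field_simps)
    moreover have "integral {0..T} (\<lambda>t. (P t - c) * \<eta> t) = integral {0..T} (\<lambda>t. \<eta> t * P t) - c * integral {0..T} \<eta>"
      unfolding left_diff_distrib
      by (subst integral_diff) (auto intro!: integrable_continuous_interval continuous_intros smc[OF \<eta>] Pc simp: mult.commute)
    moreover have "ip {0<..<T} (\<lambda>t. P t - c) \<eta> = (LINT t|lebesgue_on {0..T}. (P t - c) * \<eta> t)"
    proof -
      obtain l h where a: "0 < l" "h < T" "\<And>t. t \<notin> {l..h} \<Longrightarrow> \<eta> t = 0" using test_fun_real_support[OF \<eta> T] by metis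
      show ?thesis unfolding ip_def using a
        by (intro integrable_lebesgue_on_support(2)[symmetric]) force+
    qed
    moreover have "\<dots> = integral {0..T} (\<lambda>t. (P t - c) * \<eta> t)"
      by (intro LINT_eq_integral integrable_continuous_lebesgue_on continuous_intros smc[OF \<eta>] Pc)
    ultimately show "ip {0<..<T} (\<lambda>t. P t - c) \<eta> = 0" by simp
  qed auto
  then have "AE t in lebesgue_on {0<..<T}. P t = c" by simp
  then have Pin: "P t = c" if "t \<in> {0<..<T}" for t
    using that Pc by (intro eq_of_AE_eq_continuous[of "{0<..<T}" P "\<lambda>_. c"])
      (auto elim: continuous_on_subset)
  \<comment> \<open>The fundamental lemma speaks about the open interval; continuity adds the two
    ends.\<close>
  have Pall: "P t = c" if t: "t \<in> {0..T}" for t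
  proof -
    have "closure {0<..<T} = {0..T}" using T by simp
    then show ?thesis using continuous_constant_on_closure[of "{0<..<T}" P c t] Pc Pin t by simp
  qed
  have "p b - p a = integral {0..b} q - integral {0..a} q"
    using Pall[of a] Pall[of b] ab by (simp add: P_def F_def)
  moreover have "integral {0..a} q + integral {a..b} q = integral {0..b} q"
    using ab qi by (intro Henstock_Kurzweil_Integration.integral_combine integrable_subinterval_real[OF qi]) auto
  moreover have "q integrable_on {a..b}" using ab qi by (auto intro: integrable_subinterval_real)
  ultimately show ?thesis by (metis add_diff_cancel_left' integrable_integral)
qed

section \<open>Eigenfunction expansions\<close>

definition sqs :: "(nat \<Rightarrow> real) \<Rightarrow> bool" where
  "sqs c \<longleftrightarrow> summable (\<lambda>n. (c n)\<^sup>2)"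

lemma sqs_comparison: "sqs c \<Longrightarrow> (\<And>n. \<bar>d n\<bar> \<le> \<bar>c n\<bar>) \<Longrightarrow> sqs d"
  unfolding sqs_def by (rule summable_comparison_test') (auto simp: abs_le_square_iff)

lemma sqs_add: assumes "sqs c" "sqs d" shows "sqs (\<lambda>n. c n + d n)"
proof -
  have s: "summable (\<lambda>n. 2 * (c n)\<^sup>2 + 2 * (d n)\<^sup>2)" using assms by (auto simp: sqs_def intro!: summable_add summable_mult)
  have le: "(c n + d n)\<^sup>2 \<le> 2 * (c n)\<^sup>2 + 2 * (d n)\<^sup>2" for n
    using sum_squares_bound[of "c n" "d n"] by (simp add: power2_sum)
  show ?thesis unfolding sqs_def by (rule summable_comparison_test'[OF s, of 0]) (use le in simp)
qed

lemma sqs_scale: "sqs c \<Longrightarrow> sqs (\<lambda>n. r * c n)"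
  unfolding sqs_def by (simp add: power_mult_distrib summable_mult)

lemma sqs_abs: "sqs c \<Longrightarrow> sqs (\<lambda>n. \<bar>c n\<bar>)"
  by (simp add: sqs_def)

lemma sqs_diff: "sqs c \<Longrightarrow> sqs d \<Longrightarrow> sqs (\<lambda>n. c n - d n)"
  using sqs_add[of c "\<lambda>n. (- 1) * d n"] sqs_scale[of d "- 1"] by simp

lemma sqs_sqrt: "summable c \<Longrightarrow> (\<And>n. 0 \<le> c n) \<Longrightarrow> sqs (\<lambda>n. sqrt (c n))"
  by (simp add: sqs_def)

locale eigen_system = bounded_open +
  fixes lam :: "nat \<Rightarrow> real" and \<psi> :: "nat \<Rightarrow> fn"
  assumes eb: "eigenbasis \<Omega> lam \<psi>"
begin

lemma psi_H20: "\<psi> n \<in> H20 \<Omega>" and psi_bilaplacian: "is_bilaplacian \<Omega> (\<psi> n) (lam n *\<^sub>R \<psi> n)"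
  and psi_orthonormal: "ip \<Omega> (\<psi> m) (\<psi> n) = (if m = n then 1 else 0)"
  using eb by (auto simp: eigenbasis_def DA_def scaleR_fun_def)

lemma psi_L2 [simp]: "\<psi> n \<in> L2 \<Omega>" by (rule H20_L2[OF psi_H20])

definition coef :: "fn \<Rightarrow> nat \<Rightarrow> real" where "coef w n = ip \<Omega> w (\<psi> n)"

definition psum :: "(nat \<Rightarrow> real) \<Rightarrow> nat \<Rightarrow> fn" where "psum c N = (\<Sum>i<N. c i *\<^sub>R \<psi> i)"

lemma psum_L2 [simp]: "psum c N \<in> L2 \<Omega>"
  unfolding psum_def by (intro l2.X_sum l2.X_closed psi_L2)

lemma psum_H20: "psum c N \<in> H20 \<Omega>"
  unfolding psum_def by (intro subspace_sum subspace_scale H20_subspace psi_H20)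

lemma ip_psum: "w \<in> L2 \<Omega> \<Longrightarrow> ip \<Omega> w (psum c N) = (\<Sum>i<N. c i * coef w i)"
  unfolding psum_def coef_def by (subst l2.sum_right) (auto simp: l2.scale_right intro: l2.X_closed)

lemma coef_psum: "coef (psum c N) n = (if n < N then c n else 0)"
proof -
  have "coef (psum c N) n = (\<Sum>i<N. c i * coef (\<psi> n) i)"
    using ip_psum[OF psi_L2, of n c N] l2.sym[of "psum c N" \<Omega> "\<psi> n"] by (simp add: coef_def)
  also have "\<dots> = (\<Sum>i<N. if n = i then c i else 0)" by (intro sum.cong) (auto simp: coef_def psi_orthonormal)
  finally show ?thesis by simp
qed

lemma norm_psum: "(l2norm \<Omega> (psum c N))\<^sup>2 = (\<Sum>i<N. (c i)\<^sup>2)"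
  unfolding l2.N_square[OF psum_L2] using ip_psum[OF psum_L2, of c N c N] by (simp add: coef_psum power2_eq_square)

lemma coef_diff: "v \<in> L2 \<Omega> \<Longrightarrow> w \<in> L2 \<Omega> \<Longrightarrow> coef (v - w) n = coef v n - coef w n"
  by (simp add: coef_def l2.diff_left)

lemma expansion_tendsto: "w \<in> L2 \<Omega> \<Longrightarrow> (\<lambda>N. l2norm \<Omega> (w - psum (coef w) N)) \<longlonglongrightarrow> 0"
proof -
  assume "w \<in> L2 \<Omega>"
  then have "(\<lambda>n. l2norm \<Omega> (\<lambda>x. w x - (\<Sum>i<n. ip \<Omega> w (\<psi> i) * \<psi> i x))) \<longlonglongrightarrow> 0" using eb by (simp add: eigenbasis_def)
  moreover have "(\<lambda>x. w x - (\<Sum>i<n. ip \<Omega> w (\<psi> i) * \<psi> i x)) = w - psum (coef w) n" for n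
  proof
    fix x
    have "(\<Sum>i<n. coef w i *\<^sub>R \<psi> i) x = (\<Sum>i<n. coef w i * \<psi> i x)" by (induction n) auto
    then show "w x - (\<Sum>i<n. ip \<Omega> w (\<psi> i) * \<psi> i x) = (w - psum (coef w) n) x" by (simp add: psum_def coef_def)
  qed
  ultimately show ?thesis by simp
qed

text \<open>The basis property is norm convergence of the partial sums, and their norms are finite
  sums by orthonormality.\<close>

lemma Parseval: assumes w: "w \<in> L2 \<Omega>" shows "(\<lambda>n. (coef w n)\<^sup>2) sums (l2norm \<Omega> w)\<^sup>2"
proof -
  have "(\<lambda>N. l2norm \<Omega> (psum (coef w) N) - l2norm \<Omega> w) \<longlonglongrightarrow> 0"
  proof (rule Lim_null_comparison[OF _ expansion_tendsto[OF w]])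
    show "\<forall>\<^sub>F N in sequentially. norm (l2norm \<Omega> (psum (coef w) N) - l2norm \<Omega> w) \<le> l2norm \<Omega> (w - psum (coef w) N)"
      using l2.N_reverse_triangle[OF w psum_L2, of "coef w"] by (intro always_eventually) (simp add: abs_minus_commute)
  qed
  then have "(\<lambda>N. (l2norm \<Omega> (psum (coef w) N))\<^sup>2) \<longlonglongrightarrow> (l2norm \<Omega> w)\<^sup>2"
    by (intro tendsto_power) (simp add: LIM_zero_iff)
  then show ?thesis unfolding sums_def norm_psum .
qed

lemma coef_sqs: "w \<in> L2 \<Omega> \<Longrightarrow> sqs (coef w)"
  unfolding sqs_def using Parseval sums_summable by blast

lemma Bessel: assumes "w \<in> L2 \<Omega>" shows "(\<Sum>i<N. (coef w i)\<^sup>2) \<le> (l2norm \<Omega> w)\<^sup>2"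
  using Parseval[OF assms] sum_le_suminf[of "\<lambda>n. (coef w n)\<^sup>2" "{..<N}"] by (auto simp: sums_iff)

lemma psum_Cauchy:
  assumes c: "sqs c" and e: "e > 0"
  shows "\<exists>n0. \<forall>m\<ge>n0. \<forall>n\<ge>n0. l2norm \<Omega> (psum c m - psum c n) < e"
proof -
  have le: "l2norm \<Omega> (psum c m - psum c n) = sqrt (\<Sum>i\<in>{n..<m}. (c i)\<^sup>2)" if "n \<le> m" for m n
  proof -
    have d: "psum c m - psum c n \<in> L2 \<Omega>" by (intro l2.X_closed psum_L2)
    have "coef (psum c m - psum c n) i = (if n \<le> i \<and> i < m then c i else 0)" for i
      using that by (simp add: coef_diff coef_psum)
    then have "(\<lambda>i. (coef (psum c m - psum c n) i)\<^sup>2) = (\<lambda>i. if i \<in> {n..<m} then (c i)\<^sup>2 else 0)" by auto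
    then have "(\<lambda>i. if i \<in> {n..<m} then (c i)\<^sup>2 else 0) sums (l2norm \<Omega> (psum c m - psum c n))\<^sup>2"
      using Parseval[OF d] by simp
    moreover have "(\<lambda>i. if i \<in> {n..<m} then (c i)\<^sup>2 else 0) sums (\<Sum>i\<in>{n..<m}. (c i)\<^sup>2)" by (rule sums_If_finite_set) simp
    ultimately have "(l2norm \<Omega> (psum c m - psum c n))\<^sup>2 = (\<Sum>i\<in>{n..<m}. (c i)\<^sup>2)" by (rule sums_unique2)
    then show ?thesis using l2.N_nonneg[OF d] by (simp add: real_sqrt_unique)
  qed
  have "summable (\<lambda>n. (c n)\<^sup>2)" using c by (simp add: sqs_def)
  then obtain n0 where n0: "\<And>m n. m \<ge> n0 \<Longrightarrow> norm (\<Sum>i\<in>{m..<n}. (c i)\<^sup>2) < e\<^sup>2"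
    unfolding summable_Cauchy using e by (meson zero_less_power)
  have "l2norm \<Omega> (psum c m - psum c n) < e" if "m \<ge> n0" "n \<ge> n0" "n \<le> m" for m n
  proof -
    have "(\<Sum>i\<in>{n..<m}. (c i)\<^sup>2) < e\<^sup>2" using n0[OF that(2), of m] by (simp add: sum_nonneg)
    then show ?thesis using le[OF that(3)] e real_sqrt_less_mono[of _ "e\<^sup>2"] by simp
  qed
  moreover have "l2norm \<Omega> (psum c m - psum c n) = l2norm \<Omega> (psum c n - psum c m)" for m n
    by (intro l2.N_diff_commute psum_L2)
  ultimately show ?thesis by (metis linorder_linear)
qed

lemma synth_exists: assumes c: "sqs c" shows "\<exists>w. w \<in> L2 \<Omega> \<and> (\<forall>n. coef w n = c n)"
proof -
  obtain w where w: "w \<in> L2 \<Omega>" "(\<lambda>N. l2norm \<Omega> (psum c N - w)) \<longlonglongrightarrow> 0"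
    using L2_complete[of "psum c" \<Omega>] psum_Cauchy[OF c] psum_L2 by metis
  have "coef w n = c n" for n
  proof -
    have "(\<lambda>N. coef (psum c N) n - coef w n) \<longlonglongrightarrow> 0"
    proof (rule Lim_null_comparison[OF _ w(2)])
      have "norm (coef (psum c N) n - coef w n) \<le> l2norm \<Omega> (psum c N - w)" for N
      proof -
        have "norm (coef (psum c N - w) n) \<le> l2norm \<Omega> (psum c N - w) * l2norm \<Omega> (\<psi> n)"
          unfolding coef_def real_norm_def using w by (intro l2.Cauchy_Schwarz) auto
        moreover have "l2norm \<Omega> (\<psi> n) = 1" by (simp add: l2norm_def psi_orthonormal)
        ultimately show ?thesis using w by (simp add: coef_diff)
      qed
      then show "\<forall>\<^sub>F N in sequentially. norm (coef (psum c N) n - coef w n) \<le> l2norm \<Omega> (psum c N - w)" by simp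
    qed
    moreover have "\<forall>\<^sub>F N in sequentially. coef (psum c N) n - coef w n = c n - coef w n"
      using eventually_gt_at_top[of n] by eventually_elim (simp add: coef_psum)
    ultimately have "(\<lambda>N::nat. c n - coef w n) \<longlonglongrightarrow> 0" by (rule Lim_transform_eventually)
    then show ?thesis by (simp add: LIMSEQ_const_iff)
  qed
  then show ?thesis using w by blast
qed

text \<open>A choice is needed because the coefficients fix the function only up to null
  sets.\<close>

definition synth :: "(nat \<Rightarrow> real) \<Rightarrow> fn" where
  "synth c = (SOME w. w \<in> L2 \<Omega> \<and> (\<forall>n. coef w n = c n))"

lemma synth: "sqs c \<Longrightarrow> synth c \<in> L2 \<Omega>" "sqs c \<Longrightarrow> coef (synth c) n = c n"
  using someI_ex[OF synth_exists, of c] unfolding synth_def by auto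

text \<open>The squared distance to \<open>w t\<close> is a series of continuous functions dominated
  by \<open>(2 * M n)^2\<close>, so the Weierstrass test makes it continuous. Norm continuity is
  thus reduced to continuity of the single modes plus one square summable majorant, uniform in
  time.\<close>

lemma cont_curve_coef:
  assumes w: "\<And>t. t \<in> S \<Longrightarrow> w t \<in> L2 \<Omega>"
    and c: "\<And>n. continuous_on S (\<lambda>t. coef (w t) n)"
    and M: "sqs M" "\<And>t n. t \<in> S \<Longrightarrow> \<bar>coef (w t) n\<bar> \<le> M n"
  shows "l2.cont_curve \<Omega> S w"
  unfolding l2.cont_curve_def
proof (intro conjI ballI)
  fix t assume t: "t \<in> S"
  define g where "g s = (\<Sum>n. (coef (w s) n - coef (w t) n)\<^sup>2)" for s
  have norm_g: "l2norm \<Omega> (w s - w t) = sqrt (g s)" if s: "s \<in> S" for s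
  proof -
    have d: "w s - w t \<in> L2 \<Omega>" using w s t by auto
    have "(l2norm \<Omega> (w s - w t))\<^sup>2 = g s"
      using sums_unique[OF Parseval[OF d]] w[OF s] w[OF t] by (simp add: g_def coef_diff)
    then show ?thesis using l2.N_nonneg[OF d] by (simp add: real_sqrt_unique)
  qed
  have "uniform_limit S (\<lambda>N s. \<Sum>n<N. (coef (w s) n - coef (w t) n)\<^sup>2) g sequentially"
    unfolding g_def
  proof (rule Weierstrass_m_test)
    show "norm ((coef (w s) n - coef (w t) n)\<^sup>2) \<le> (2 * M n)\<^sup>2" if "s \<in> S" for s n
    proof -
      have "\<bar>coef (w s) n - coef (w t) n\<bar> \<le> \<bar>2 * M n\<bar>" using M(2)[OF that, of n] M(2)[OF t, of n] by linarith
      then have "(coef (w s) n - coef (w t) n)\<^sup>2 \<le> (2 * M n)\<^sup>2" by (simp only: abs_le_square_iff)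
      then show ?thesis by simp
    qed
    show "summable (\<lambda>n. (2 * M n)\<^sup>2)" using sqs_scale[OF M(1), of 2] by (simp add: sqs_def)
  qed
  then have "continuous_on S g"
    by (rule uniform_limit_theorem[rotated]) (auto intro!: always_eventually continuous_intros c)
  then have "(g \<longlongrightarrow> g t) (at t within S)" using t by (simp add: continuous_on_def)
  moreover have "g t = 0" by (simp add: g_def)
  ultimately have "((\<lambda>s. sqrt (g s)) \<longlongrightarrow> sqrt 0) (at t within S)" by (intro tendsto_intros) simp
  moreover have "\<forall>\<^sub>F s in at t within S. sqrt (g s) = l2norm \<Omega> (w s - w t)" using norm_g by (intro eventually_withinI) simp
  ultimately show "((\<lambda>s. l2norm \<Omega> (w s - w t)) \<longlongrightarrow> 0) (at t within S)" by (auto elim: Lim_transform_eventually)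
qed (use w in auto)

text \<open>Paired with a partial sum of the expansion of \<open>v\<close>, the integral identity
  holds mode by mode. The error of replacing \<open>v\<close> by the partial sum is controlled
  because \<open>l2norm \<Omega> (y' r)\<close> is bounded on the compact interval; then
  \<open>deriv_curveI_weak\<close> applies.\<close>

lemma deriv_curve_coef:
  assumes y: "\<And>t. t \<in> {a..b} \<Longrightarrow> y t \<in> L2 \<Omega>" and y': "l2.cont_curve \<Omega> {a..b} y'"
    and d: "\<And>n t. t \<in> {a..b} \<Longrightarrow> ((\<lambda>t. coef (y t) n) has_real_derivative coef (y' t) n) (at t within {a..b})"
  shows "l2.deriv_curve \<Omega> {a..b} y y'"
proof (rule l2.deriv_curveI_weak[OF y y'])
  fix v s t assume v: "v \<in> L2 \<Omega>" and st: "a \<le> s" "s \<le> t" "t \<le> b"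
  have sub: "{s..t} \<subseteq> {a..b}" using st by auto
  have y'L: "y' r \<in> L2 \<Omega>" if "r \<in> {a..b}" for r using y' that by (simp add: l2.cont_curve_def)
  have coef_int: "((\<lambda>r. coef (y' r) n) has_integral (coef (y t) n - coef (y s) n)) {s..t}" for n
    using st by (intro fundamental_theorem_of_calculus)
      (auto simp: has_real_derivative_iff_has_vector_derivative[symmetric] intro!: DERIV_subset[OF d])
  have ps_int: "((\<lambda>r. ip \<Omega> (y' r) (psum (coef v) N)) has_integral (ip \<Omega> (y t) (psum (coef v) N) - ip \<Omega> (y s) (psum (coef v) N))) {s..t}" for N
  proof -
    have "((\<lambda>r. \<Sum>i<N. coef v i * coef (y' r) i) has_integral (\<Sum>i<N. coef v i * (coef (y t) i - coef (y s) i))) {s..t}"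
      by (intro has_integral_sum has_integral_mult_right coef_int) simp
    moreover have "(\<Sum>i<N. coef v i * (coef (y t) i - coef (y s) i)) = ip \<Omega> (y t) (psum (coef v) N) - ip \<Omega> (y s) (psum (coef v) N)"
      using y st by (simp add: ip_psum right_diff_distrib sum_subtractf)
    moreover have "((\<lambda>r. ip \<Omega> (y' r) (psum (coef v) N)) has_integral X) {s..t} \<longleftrightarrow>
        ((\<lambda>r. \<Sum>i<N. coef v i * coef (y' r) i) has_integral X) {s..t}" for X
      using y'L sub by (intro has_integral_cong ip_psum) auto
    ultimately show ?thesis by simp
  qed
  have c: "continuous_on {s..t} (\<lambda>r. ip \<Omega> (y' r) w)" if "w \<in> L2 \<Omega>" for w
    by (rule continuous_on_subset[OF l2.cont_curve_B[OF y' that] sub])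
  obtain M where M: "\<And>r. r \<in> {a..b} \<Longrightarrow> l2norm \<Omega> (y' r) \<le> M" "0 \<le> M"
  proof -
    have "bounded ((\<lambda>r. l2norm \<Omega> (y' r)) ` {a..b})"
      by (intro compact_imp_bounded compact_continuous_image l2.cont_curve_N[OF y']) auto
    then obtain M where M: "\<forall>r\<in>{a..b}. \<bar>l2norm \<Omega> (y' r)\<bar> \<le> M" by (auto simp: bounded_iff)
    show ?thesis by (rule that[of "max M 0"]) (use M in force)+
  qed
  define I where "I = integral {s..t} (\<lambda>r. ip \<Omega> (y' r) v)"
  let ?e = "\<lambda>N. l2norm \<Omega> (v - psum (coef v) N)"
  have L: "v - psum (coef v) N \<in> L2 \<Omega>" for N using v by (intro l2.X_closed psum_L2)
  have "\<bar>I - (ip \<Omega> (y t) v - ip \<Omega> (y s) v)\<bar> \<le> ((t - s) * M + l2norm \<Omega> (y t) + l2norm \<Omega> (y s)) * ?e N" for N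
  proof -
    have yt: "y t \<in> L2 \<Omega>" "y s \<in> L2 \<Omega>" using y st by auto
    have "((\<lambda>r. ip \<Omega> (y' r) v - ip \<Omega> (y' r) (psum (coef v) N)) has_integral (I - (ip \<Omega> (y t) (psum (coef v) N) - ip \<Omega> (y s) (psum (coef v) N)))) {s..t}"
      unfolding I_def by (intro has_integral_diff ps_int integrable_integral integrable_continuous_interval c v)
    moreover have "norm (ip \<Omega> (y' r) v - ip \<Omega> (y' r) (psum (coef v) N)) \<le> M * ?e N" if "r \<in> {s..t}" for r
    proof -
      have r: "r \<in> {a..b}" using that sub by auto
      have "ip \<Omega> (y' r) v - ip \<Omega> (y' r) (psum (coef v) N) = ip \<Omega> (y' r) (v - psum (coef v) N)"
        using v y'L[OF r] by (simp add: l2.diff_right)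
      then show ?thesis using l2.Cauchy_Schwarz[OF y'L[OF r] L, of N] M(1)[OF r] mult_right_mono[OF M(1)[OF r] l2.N_nonneg[OF L[of N]]]
        by simp
    qed
    ultimately have "norm (I - (ip \<Omega> (y t) (psum (coef v) N) - ip \<Omega> (y s) (psum (coef v) N))) \<le> (M * ?e N) * measure lborel (cbox s t)"
      using M(2) l2.N_nonneg[OF L[of N]] by (intro has_integral_bound[of "M * ?e N" _ _ s t]) auto
    then have "\<bar>I - (ip \<Omega> (y t) (psum (coef v) N) - ip \<Omega> (y s) (psum (coef v) N))\<bar> \<le> (t - s) * M * ?e N"
      using st by (simp add: mult_ac)
    moreover have "\<bar>ip \<Omega> (y t) v - ip \<Omega> (y t) (psum (coef v) N)\<bar> \<le> l2norm \<Omega> (y t) * ?e N"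
      using l2.Cauchy_Schwarz[OF yt(1) L, of N] v yt by (simp add: l2.diff_right)
    moreover have "\<bar>ip \<Omega> (y s) v - ip \<Omega> (y s) (psum (coef v) N)\<bar> \<le> l2norm \<Omega> (y s) * ?e N"
      using l2.Cauchy_Schwarz[OF yt(2) L, of N] v yt by (simp add: l2.diff_right)
    ultimately show ?thesis unfolding distrib_right by linarith
  qed
  moreover have "(\<lambda>N. ((t - s) * M + l2norm \<Omega> (y t) + l2norm \<Omega> (y s)) * ?e N) \<longlonglongrightarrow> 0"
    by (rule tendsto_mult_right_zero[OF expansion_tendsto[OF v]])
  ultimately have "\<bar>I - (ip \<Omega> (y t) v - ip \<Omega> (y s) v)\<bar> \<le> 0"
    by (intro LIMSEQ_le[OF tendsto_const]) auto
  then have "I = ip \<Omega> (y t) v - ip \<Omega> (y s) v" by simp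
  then show "((\<lambda>r. ip \<Omega> (y' r) v) has_integral (ip \<Omega> (y t) v - ip \<Omega> (y s) v)) {s..t}"
    unfolding I_def using integrable_integral[OF integrable_continuous_interval[OF c[OF v]]] by simp
qed

lemma bilaplacian_comb:
  assumes "v \<in> L2 \<Omega>" "w \<in> L2 \<Omega>" "is_bilaplacian \<Omega> v g" "is_bilaplacian \<Omega> w h"
  shows "is_bilaplacian \<Omega> (r *\<^sub>R v + s *\<^sub>R w) (r *\<^sub>R g + s *\<^sub>R h)"
proof -
  have g: "g \<in> L2 \<Omega>" "h \<in> L2 \<Omega>" using assms by (auto simp: is_bilaplacian_def)
  have "ip \<Omega> (r *\<^sub>R v + s *\<^sub>R w) (laplacian (laplacian \<phi>)) = ip \<Omega> (r *\<^sub>R g + s *\<^sub>R h) \<phi>" if \<phi>: "\<phi> \<in> test_fun \<Omega>" for \<phi>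
  proof -
    have l: "laplacian \<eta> \<in> test_fun \<Omega>" if "\<eta> \<in> test_fun \<Omega>" for \<eta>
      using test_fun_comb[OF test_fun_pderiv2[OF that] test_fun_pderiv2[OF that], of 1 "(2,0)" 1 "(0,2)"] by (simp add: laplacian_def[abs_def])
    have "laplacian (laplacian \<phi>) \<in> L2 \<Omega>" "\<phi> \<in> L2 \<Omega>" using test_fun_L2[OF l[OF l[OF \<phi>]]] test_fun_L2[OF \<phi>] .
    then show ?thesis using assms g \<phi> by (simp add: l2.B_linear is_bilaplacian_def)
  qed
  then show ?thesis using g by (simp add: is_bilaplacian_def)
qed

lemma psum_bilaplacian: "is_bilaplacian \<Omega> (psum c N) (psum (\<lambda>n. lam n * c n) N)"
proof (induction N)
  case 0
  show ?case using l2.X_closed(1)[of \<Omega>] by (simp add: is_bilaplacian_def psum_def ip_def zero_fun_def)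
next
  case (Suc N)
  have "is_bilaplacian \<Omega> (1 *\<^sub>R psum c N + c N *\<^sub>R \<psi> N) (1 *\<^sub>R psum (\<lambda>n. lam n * c n) N + c N *\<^sub>R (lam N *\<^sub>R \<psi> N))"
    by (intro bilaplacian_comb Suc psi_bilaplacian psum_L2 psi_L2)
  moreover have "psum c (Suc N) = 1 *\<^sub>R psum c N + c N *\<^sub>R \<psi> N"
    "psum (\<lambda>n. lam n * c n) (Suc N) = 1 *\<^sub>R psum (\<lambda>n. lam n * c n) N + c N *\<^sub>R (lam N *\<^sub>R \<psi> N)"
    by (simp_all add: psum_def mult.commute)
  ultimately show ?case by (simp only:)
qed

text \<open>The eigenvalue is the Hessian energy of its normalised eigenfunction. The sign makes
  \<open>powr\<close> in \<open>DAr\<close> agree with ordinary powers and keeps the oscillator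
  energies nonnegative.\<close>

lemma lam_nonneg: "0 \<le> lam n"
proof -
  have "hess_form \<Omega> (\<psi> n) (\<psi> n) = ip \<Omega> (lam n *\<^sub>R \<psi> n) (\<psi> n)"
    by (rule bilaplacian_green[OF psi_H20 psi_bilaplacian psi_H20])
  then have "hess_form \<Omega> (\<psi> n) (\<psi> n) = lam n" by (simp add: l2.B_linear psi_orthonormal)
  then show ?thesis using hess.pos[OF H20_Hm[OF psi_H20], of n] by simp
qed

lemma hess_form_psi: assumes w: "w \<in> H20 \<Omega>" shows "hess_form \<Omega> w (\<psi> n) = lam n * coef w n"
proof -
  have "hess_form \<Omega> w (\<psi> n) = hess_form \<Omega> (\<psi> n) w" by (intro hess.sym H20_Hm w psi_H20)
  also have "\<dots> = ip \<Omega> (lam n *\<^sub>R \<psi> n) w" by (rule bilaplacian_green[OF psi_H20 psi_bilaplacian w])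
  also have "\<dots> = lam n * coef w n" using H20_L2[OF w] l2.sym[of w \<Omega> "\<psi> n"] by (simp add: l2.B_linear coef_def)
  finally show ?thesis .
qed

lemma coef_bilaplacian: "w \<in> H20 \<Omega> \<Longrightarrow> is_bilaplacian \<Omega> w z \<Longrightarrow> coef z n = lam n * coef w n"
  using hess_form_psi[of w n] bilaplacian_green[OF _ _ psi_H20, of w z n] by (simp add: coef_def)

text \<open>The way back from coefficients to function spaces. The partial sums of \<open>w\<close>
  and \<open>z\<close> are Cauchy in \<open>L2\<close>, and elliptic regularity applied to their
  differences makes those of \<open>w\<close> Cauchy in the norm of \<open>Hm 2\<close>. The
  distributional identity passes to the limit.\<close>

lemma H20_of_coef:
  assumes reg: "elliptic_regularity \<Omega> \<gamma>" "0 \<le> \<gamma>"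
    and w: "w \<in> L2 \<Omega>" and z: "z \<in> L2 \<Omega>" and c: "\<And>n. coef z n = lam n * coef w n"
  shows "w \<in> H20 \<Omega>" "is_bilaplacian \<Omega> w z"
proof -
  obtain c0 where c0: "\<And>v g. v \<in> H20 \<Omega> \<Longrightarrow> is_bilaplacian \<Omega> v g \<Longrightarrow> Hs_norm (2 + \<gamma>) \<Omega> v \<le> c0 * (l2norm \<Omega> v + l2norm \<Omega> g)"
    using reg unfolding elliptic_regularity_def by blast
  \<comment> \<open>The regularity constant may have any sign; this one is positive and can be
    divided by.\<close>
  define c1 where "c1 = \<bar>c0\<bar> + 1"
  have c1: "c1 > 0" unfolding c1_def by linarith
  let ?P = "psum (coef w)" and ?Z = "psum (coef z)"
  have zc: "(\<lambda>n. lam n * coef w n) = coef z" using c by auto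
  have bl: "is_bilaplacian \<Omega> (?P m - ?P n) (?Z m - ?Z n)" for m n
    using bilaplacian_comb[OF psum_L2 psum_L2 psum_bilaplacian psum_bilaplacian, of 1 "coef w" m "-1" "coef w" n] by (simp add: zc)
  have PH: "?P m - ?P n \<in> H20 \<Omega>" for m n by (intro subspace_diff H20_subspace psum_H20)
  have le: "Hs_norm 2 \<Omega> (?P m - ?P n) \<le> c1 * (l2norm \<Omega> (?P m - ?P n) + l2norm \<Omega> (?Z m - ?Z n))" for m n
  proof -
    have "Hs_norm 2 \<Omega> (?P m - ?P n) \<le> Hs_norm (2 + \<gamma>) \<Omega> (?P m - ?P n)" using reg(2) by (intro Hs_2_norm_le_Hs_norm) simp
    also have "\<dots> \<le> c0 * (l2norm \<Omega> (?P m - ?P n) + l2norm \<Omega> (?Z m - ?Z n))" by (rule c0[OF PH bl])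
    also have "\<dots> \<le> c1 * (l2norm \<Omega> (?P m - ?P n) + l2norm \<Omega> (?Z m - ?Z n))"
      unfolding c1_def by (intro mult_right_mono add_nonneg_nonneg l2.N_nonneg l2.X_closed psum_L2) simp
    finally show ?thesis .
  qed
  show "w \<in> H20 \<Omega>"
  proof (rule H20_complete[OF psum_H20 _ w])
    show "(\<lambda>n. l2norm \<Omega> (?P n - w)) \<longlonglongrightarrow> 0"
      using expansion_tendsto[OF w] l2.N_diff_commute[OF w psum_L2] by simp
    fix e :: real assume e: "e > 0"
    then have e2: "e / (2 * c1) > 0" using c1 by simp
    obtain n1 where n1: "\<And>m n. m \<ge> n1 \<Longrightarrow> n \<ge> n1 \<Longrightarrow> l2norm \<Omega> (?P m - ?P n) < e / (2 * c1)"
      using psum_Cauchy[OF coef_sqs[OF w] e2] by blast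
    obtain n2 where n2: "\<And>m n. m \<ge> n2 \<Longrightarrow> n \<ge> n2 \<Longrightarrow> l2norm \<Omega> (?Z m - ?Z n) < e / (2 * c1)"
      using psum_Cauchy[OF coef_sqs[OF z] e2] by blast
    have "Hs_norm 2 \<Omega> (?P m - ?P n) < e" if "m \<ge> max n1 n2" "n \<ge> max n1 n2" for m n
    proof -
      have "l2norm \<Omega> (?P m - ?P n) + l2norm \<Omega> (?Z m - ?Z n) < e / (2 * c1) + e / (2 * c1)"
        using n1[of m n] n2[of m n] that by (intro add_strict_mono) auto
      then have "c1 * (l2norm \<Omega> (?P m - ?P n) + l2norm \<Omega> (?Z m - ?Z n)) < c1 * (e / (2 * c1) + e / (2 * c1))"
        using c1 by (rule mult_strict_left_mono)
      also have "\<dots> = e" using c1 by (simp add: field_simps)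
      finally show ?thesis using le[of m n] by simp
    qed
    then show "\<exists>n0. \<forall>m\<ge>n0. \<forall>n\<ge>n0. Hs_norm 2 \<Omega> (?P m - ?P n) < e" by blast
  qed
  show "is_bilaplacian \<Omega> w z"
    unfolding is_bilaplacian_def
  proof (intro conjI ballI z)
    fix \<phi> assume \<phi>: "\<phi> \<in> test_fun \<Omega>"
    have ip_lim: "(\<lambda>N. ip \<Omega> (psum (coef v) N) g) \<longlonglongrightarrow> ip \<Omega> v g" if v: "v \<in> L2 \<Omega>" and g: "g \<in> L2 \<Omega>" for v g
    proof -
      have "(\<lambda>N. ip \<Omega> (psum (coef v) N) g - ip \<Omega> v g) \<longlonglongrightarrow> 0"
      proof (rule Lim_null_comparison[OF _ tendsto_mult_left_zero[OF expansion_tendsto[OF v]]])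
        have "norm (ip \<Omega> (psum (coef v) N) g - ip \<Omega> v g) \<le> l2norm \<Omega> (v - psum (coef v) N) * l2norm \<Omega> g" for N
          using l2.Cauchy_Schwarz[OF l2.X_closed(3)[OF v psum_L2] g, of "coef v" N] v g by (simp add: l2.diff_left abs_minus_commute)
        then show "\<forall>\<^sub>F N in sequentially. norm (ip \<Omega> (psum (coef v) N) g - ip \<Omega> v g) \<le> l2norm \<Omega> (v - psum (coef v) N) * l2norm \<Omega> g" by simp
      qed
      then show ?thesis by (simp add: LIM_zero_iff)
    qed
    have l: "laplacian \<eta> \<in> test_fun \<Omega>" if "\<eta> \<in> test_fun \<Omega>" for \<eta>
      using test_fun_comb[OF test_fun_pderiv2[OF that] test_fun_pderiv2[OF that], of 1 "(2,0)" 1 "(0,2)"] by (simp add: laplacian_def[abs_def])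
    have L: "laplacian (laplacian \<phi>) \<in> L2 \<Omega>" "\<phi> \<in> L2 \<Omega>" using test_fun_L2[OF l[OF l[OF \<phi>]]] test_fun_L2[OF \<phi>] .
    have "ip \<Omega> (?P N) (laplacian (laplacian \<phi>)) = ip \<Omega> (?Z N) \<phi>" for N
      using psum_bilaplacian[of "coef w" N] \<phi> by (simp add: is_bilaplacian_def zc)
    then show "ip \<Omega> w (laplacian (laplacian \<phi>)) = ip \<Omega> z \<phi>"
      using ip_lim[OF w L(1)] ip_lim[OF z L(2)] LIMSEQ_unique by fastforce
  qed
qed

end

section \<open>Energy estimates for a single oscillator\<close>

lemma le_of_square_le:
  fixes x a b :: real
  assumes "x\<^sup>2 \<le> a\<^sup>2 + 2 * b * x" "0 \<le> a" "0 \<le> b" "0 \<le> x"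
  shows "x \<le> a + 2 * b"
proof (rule ccontr)
  assume "\<not> ?thesis"
  then have g: "x > a + 2 * b" by simp
  then have "x - 2 * b > a" by simp
  then have "x * (x - 2 * b) > a * a"
    using assms g by (intro mult_strict_mono') auto
  then show False using assms(1) by (simp add: power2_eq_square algebra_simps)
qed

lemma continuous_attains_abs_sup:
  fixes f :: "real \<Rightarrow> real"
  assumes "0 \<le> T" "continuous_on {0..T} f"
  obtains s where "s \<in> {0..T}" "\<And>t. t \<in> {0..T} \<Longrightarrow> \<bar>f t\<bar> \<le> \<bar>f s\<bar>"
proof -
  have "continuous_on {0..T} (\<lambda>t. \<bar>f t\<bar>)" using assms by (intro continuous_intros)
  then show ?thesis using continuous_attains_sup[of "{0..T}" "\<lambda>t. \<bar>f t\<bar>"] assms that by fastforce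
qed

text \<open>The energy \<open>z^2 + l * w^2\<close> has derivative \<open>2 * z * F\<close>.
  Integrated up to the time where \<open>|z|\<close> is largest, this is a quadratic inequality for
  that maximum. Beyond the initial energy the bound is uniform in \<open>l\<close>, as summation
  over the modes requires.\<close>

lemma oscillator_velocity_bound:
  fixes w z F :: "real \<Rightarrow> real"
  assumes T: "0 \<le> T" and l: "0 \<le> l"
    and w: "\<And>t. t \<in> {0..T} \<Longrightarrow> (w has_real_derivative z t) (at t within {0..T})"
    and z: "\<And>t. t \<in> {0..T} \<Longrightarrow> (z has_real_derivative F t - l * w t) (at t within {0..T})"
    and F: "\<And>t. t \<in> {0..T} \<Longrightarrow> \<bar>F t\<bar> \<le> Fm" and Fc: "continuous_on {0..T} F"
    and t: "t \<in> {0..T}"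
  shows "\<bar>z t\<bar> \<le> sqrt ((z 0)\<^sup>2 + l * (w 0)\<^sup>2) + 2 * (T * Fm)"
proof -
  have zc: "continuous_on {0..T} z" by (rule DERIV_continuous_on[OF z])
  obtain s where s: "s \<in> {0..T}" "\<And>t. t \<in> {0..T} \<Longrightarrow> \<bar>z t\<bar> \<le> \<bar>z s\<bar>"
    using continuous_attains_abs_sup[OF T zc] by blast
  have Fm: "0 \<le> Fm" using F[of 0] T by simp
  let ?E = "\<lambda>t. (z t)\<^sup>2 + l * (w t)\<^sup>2"
  have "((\<lambda>t. 2 * z t * F t) has_integral (?E s - ?E 0)) {0..s}"
  proof (rule fundamental_theorem_of_calculus)
    fix t assume "t \<in> {0..s}"
    then have t: "t \<in> {0..T}" "{0..s} \<subseteq> {0..T}" using s by auto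
    note dw = DERIV_subset[OF w[OF t(1)] t(2)] and dz = DERIV_subset[OF z[OF t(1)] t(2)]
    have "(?E has_real_derivative 2 * z t * F t) (at t within {0..s})"
      by (auto intro!: derivative_eq_intros dw dz simp: algebra_simps power2_eq_square)
    then show "(?E has_vector_derivative 2 * z t * F t) (at t within {0..s})"
      by (simp add: has_real_derivative_iff_has_vector_derivative)
  qed (use s in auto)
  moreover have "((\<lambda>t. 2 * \<bar>z s\<bar> * Fm) has_integral (s - 0) *\<^sub>R (2 * \<bar>z s\<bar> * Fm)) {0..s}"
    using has_integral_const_real[of "2 * \<bar>z s\<bar> * Fm" 0 s] s by auto
  moreover have "2 * z t * F t \<le> 2 * \<bar>z s\<bar> * Fm" if "t \<in> {0..s}" for t
  proof -
    have "t \<in> {0..T}" using that s by auto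
    then have "\<bar>z t\<bar> * \<bar>F t\<bar> \<le> \<bar>z s\<bar> * Fm" using s F by (intro mult_mono) auto
    moreover have "z t * F t \<le> \<bar>z t\<bar> * \<bar>F t\<bar>" by (simp flip: abs_mult)
    ultimately show ?thesis by simp
  qed
  ultimately have "?E s - ?E 0 \<le> (s - 0) *\<^sub>R (2 * \<bar>z s\<bar> * Fm)" by (rule has_integral_le)
  also have "\<dots> \<le> T * (2 * \<bar>z s\<bar> * Fm)" using s Fm by (simp add: mult_right_mono)
  finally have "(z s)\<^sup>2 + l * (w s)\<^sup>2 \<le> (z 0)\<^sup>2 + l * (w 0)\<^sup>2 + 2 * (T * Fm) * \<bar>z s\<bar>" by (simp add: mult_ac)
  moreover have "0 \<le> l * (w s)\<^sup>2" "0 \<le> (z 0)\<^sup>2 + l * (w 0)\<^sup>2" using l by auto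
  ultimately have "\<bar>z s\<bar>\<^sup>2 \<le> (sqrt ((z 0)\<^sup>2 + l * (w 0)\<^sup>2))\<^sup>2 + 2 * (T * Fm) * \<bar>z s\<bar>" by simp
  then have "\<bar>z s\<bar> \<le> sqrt ((z 0)\<^sup>2 + l * (w 0)\<^sup>2) + 2 * (T * Fm)"
    using l T Fm by (intro le_of_square_le) auto
  then show ?thesis using s(2)[OF t] by simp
qed

text \<open>The energy is multiplied by \<open>l\<close> to control \<open>l * w\<close>; its
  derivative \<open>2 * l * z * F\<close> then contains \<open>l * z\<close>, for which no bound is
  available. Integration by parts in time turns \<open>l * z\<close> into \<open>l * w\<close> at
  the price of the derivative \<open>q\<close> of the force, and the balance is read at the time
  where \<open>|l * w|\<close> is largest. Two boundary terms and one integral account for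
  \<open>2 * Fm\<close> plus the integral of \<open>|q|\<close>.\<close>

lemma oscillator_force_bound:
  fixes w z F q :: "real \<Rightarrow> real"
  assumes T: "0 \<le> T" and l: "0 \<le> l"
    and w: "\<And>t. t \<in> {0..T} \<Longrightarrow> (w has_real_derivative z t) (at t within {0..T})"
    and z: "\<And>t. t \<in> {0..T} \<Longrightarrow> (z has_real_derivative F t - l * w t) (at t within {0..T})"
    and F: "\<And>t. t \<in> {0..T} \<Longrightarrow> \<bar>F t\<bar> \<le> Fm" and Fq: "\<And>t. t \<in> {0..T} \<Longrightarrow> F t = F 0 + integral {0..t} q"
    and q: "q absolutely_integrable_on {0..T}"
    and t: "t \<in> {0..T}"
  shows "\<bar>l * w t\<bar> \<le> sqrt ((l * w 0)\<^sup>2 + l * (z 0)\<^sup>2) + 2 * (2 * Fm + integral {0..T} (\<lambda>t. \<bar>q t\<bar>))"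
proof -
  have wc: "continuous_on {0..T} w" by (rule DERIV_continuous_on[OF w])
  have zc: "continuous_on {0..T} z" by (rule DERIV_continuous_on[OF z])
  have aq: "(\<lambda>r. \<bar>q r\<bar>) integrable_on {0..T}" using q unfolding absolutely_integrable_on_def by simp
  have qi: "q integrable_on {0..T}" using q absolutely_integrable_on_def by blast
  have Fc: "continuous_on {0..T} F"
    using indefinite_integral_continuous_1[OF qi]
    by (subst continuous_on_cong[OF refl Fq]) (auto intro: continuous_intros)
  obtain s where s: "s \<in> {0..T}" "\<And>t. t \<in> {0..T} \<Longrightarrow> \<bar>l * w t\<bar> \<le> \<bar>l * w s\<bar>"
    using continuous_attains_abs_sup[OF T continuous_on_mult_left[OF wc]] by blast
  have Fm: "0 \<le> Fm" using F[of 0] T by simp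
  define Q where "Q = integral {0..T} (\<lambda>t. \<bar>q t\<bar>)"
  have Q: "0 \<le> Q" unfolding Q_def by (intro integral_nonneg aq) auto
  have sub: "{0..s} \<subseteq> {0..T}" using s by auto
  let ?E = "\<lambda>t. (l * w t)\<^sup>2 + l * (z t)\<^sup>2"
  have "((\<lambda>t. 2 * l * z t * F t) has_integral (?E s - ?E 0)) {0..s}"
  proof (rule fundamental_theorem_of_calculus)
    fix t assume "t \<in> {0..s}"
    then have t: "t \<in> {0..T}" using s by auto
    note dw = DERIV_subset[OF w[OF t] sub] and dz = DERIV_subset[OF z[OF t] sub]
    have "(?E has_real_derivative 2 * l * z t * F t) (at t within {0..s})"
      by (auto intro!: derivative_eq_intros dw dz simp: algebra_simps power2_eq_square)
    then show "(?E has_vector_derivative 2 * l * z t * F t) (at t within {0..s})"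
      by (simp add: has_real_derivative_iff_has_vector_derivative)
  qed (use s in auto)
  then have E: "?E s - ?E 0 = integral {0..s} (\<lambda>t. (2 * l * z t) * F t)" by (simp add: integral_unique)
  have qs: "q absolutely_integrable_on {0..s}" using q sub by (rule absolutely_integrable_on_subinterval)
  have "integral {0..s} (\<lambda>t. (2 * l * z t) * F t) = (2 * l * w s) * F s - (2 * l * w 0) * F 0 - integral {0..s} (\<lambda>t. (2 * l * w t) * q t)"
  proof (rule absolutely_continuous_by_parts[OF _ _ _ qs])
    show "((\<lambda>t. 2 * l * w t) has_real_derivative 2 * l * z t) (at t within {0..s})" if "t \<in> {0..s}" for t
      using that sub by (intro DERIV_cmult DERIV_subset[OF w sub]) auto
    show "continuous_on {0..s} (\<lambda>t. 2 * l * z t)" using zc sub by (intro continuous_intros) (auto elim: continuous_on_subset)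
    show "F t = F 0 + integral {0..t} q" if "t \<in> {0..s}" for t
      by (rule Fq) (use that sub in blast)
  qed (use s in auto)
  moreover have "\<bar>integral {0..s} (\<lambda>t. (2 * l * w t) * q t)\<bar> \<le> 2 * \<bar>l * w s\<bar> * Q"
  proof -
    have "\<bar>integral {0..s} (\<lambda>t. (2 * l * w t) * q t)\<bar> \<le> (2 * \<bar>l * w s\<bar>) * integral {0..s} (\<lambda>t. \<bar>q t\<bar>)"
    proof (rule abs_integral_mult_le)
      have "continuous_on {0..s} (\<lambda>t. 2 * l * w t)" using wc sub by (intro continuous_intros) (auto elim: continuous_on_subset)
      from integrable_continuous_mult[OF this qs] show "(\<lambda>t. (2 * l * w t) * q t) integrable_on {0..s}"
        using absolutely_integrable_on_def by blast
      show "(\<lambda>t. \<bar>q t\<bar>) integrable_on {0..s}" using qs unfolding absolutely_integrable_on_def by simp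
      show "\<bar>2 * l * w t\<bar> \<le> 2 * \<bar>l * w s\<bar>" if "t \<in> {0..s}" for t
        using s(2)[of t] that sub by (auto simp: abs_mult)
    qed
    also have "\<dots> \<le> (2 * \<bar>l * w s\<bar>) * Q"
      unfolding Q_def using sub aq qs by (intro mult_left_mono integral_subset_le) (auto simp: absolutely_integrable_on_def)
    finally show ?thesis .
  qed
  moreover have "(2 * l * w s) * F s \<le> 2 * \<bar>l * w s\<bar> * Fm"
  proof -
    have "(l * w s) * F s \<le> \<bar>l * w s\<bar> * \<bar>F s\<bar>" by (metis abs_ge_self abs_mult)
    also have "\<dots> \<le> \<bar>l * w s\<bar> * Fm" using F[OF s(1)] by (intro mult_left_mono) auto
    finally show ?thesis by simp
  qed
  moreover have "- ((2 * l * w 0) * F 0) \<le> 2 * \<bar>l * w s\<bar> * Fm"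
  proof -
    have "- ((l * w 0) * F 0) \<le> \<bar>l * w 0\<bar> * \<bar>F 0\<bar>" by (metis abs_ge_minus_self abs_mult)
    also have "\<dots> \<le> \<bar>l * w s\<bar> * Fm" using F[of 0] s(2)[of 0] T by (intro mult_mono) auto
    finally show ?thesis by (simp add: mult_ac)
  qed
  ultimately have "?E s - ?E 0 \<le> 2 * (2 * Fm + Q) * \<bar>l * w s\<bar>" unfolding E by (simp add: algebra_simps)
  moreover have "0 \<le> l * (z s)\<^sup>2" "0 \<le> (l * w 0)\<^sup>2 + l * (z 0)\<^sup>2" using l by auto
  ultimately have "\<bar>l * w s\<bar>\<^sup>2 \<le> (sqrt ((l * w 0)\<^sup>2 + l * (z 0)\<^sup>2))\<^sup>2 + 2 * (2 * Fm + Q) * \<bar>l * w s\<bar>" by simp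
  then have "\<bar>l * w s\<bar> \<le> sqrt ((l * w 0)\<^sup>2 + l * (z 0)\<^sup>2) + 2 * (2 * Fm + Q)"
    using l Q Fm by (intro le_of_square_le) auto
  then show ?thesis using s(2)[OF t] by (simp add: Q_def)
qed

section \<open>Regularity of the solution\<close>

lemma time_cont_iff: "time_cont T (L2 \<Omega>) (l2norm \<Omega>) w \<longleftrightarrow> l2.cont_curve \<Omega> {0..T} w"
  by (simp add: time_cont_def l2.cont_curve_def fun_diff_def)

lemma time_deriv_imp:
  assumes "time_deriv T (l2norm \<Omega>) w w'" "\<And>t. t \<in> {0..T} \<Longrightarrow> w t \<in> L2 \<Omega> \<and> w' t \<in> L2 \<Omega>"
  shows "l2.deriv_curve \<Omega> {0..T} w w'"
proof -
  have "(\<lambda>x. (w s x - w t x) / (s - t) - w' t x) = (1 / (s - t)) *\<^sub>R (w s - w t) - w' t" for s t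
    by (intro ext) simp
  then show ?thesis using assms by (simp add: time_deriv_def l2.deriv_curve_def)
qed

text \<open>For each fixed \<open>v\<close> this is the scalar du Bois-Reymond lemma; continuity of
  \<open>w'\<close> in norm makes the result uniform in \<open>v\<close>.\<close>

lemma weak_time_deriv_imp_deriv_curve:
  assumes T: "T > 0" and w: "l2.cont_curve \<Omega> {0..T} w" and w': "l2.cont_curve \<Omega> {0..T} w'"
    and wk: "weak_time_deriv \<Omega> T w w'"
  shows "l2.deriv_curve \<Omega> {0..T} w w'"
proof (rule l2.deriv_curveI_weak[OF _ w'])
  show "\<And>t. t \<in> {0..T} \<Longrightarrow> w t \<in> L2 \<Omega>" using w by (simp add: l2.cont_curve_def)
  fix v s t assume v: "v \<in> L2 \<Omega>" and st: "0 \<le> s" "s \<le> t" "t \<le> T"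
  show "((\<lambda>r. ip \<Omega> (w' r) v) has_integral (ip \<Omega> (w t) v - ip \<Omega> (w s) v)) {s..t}"
    by (rule weak_derivative_integral[OF T l2.cont_curve_B[OF w v] integrable_continuous_lebesgue_on[OF l2.cont_curve_B[OF w' v]] _ st])
      (use wk v in \<open>auto simp: weak_time_deriv_def\<close>)
qed

lemma deriv_curve_imp_weak_time_deriv:
  assumes T: "T > 0" and w: "l2.deriv_curve \<Omega> {0..T} w w'" and w': "l2.cont_curve \<Omega> {0..T} w'"
  shows "weak_time_deriv \<Omega> T w w'"
  unfolding weak_time_deriv_def
proof (intro ballI)
  fix v \<phi> assume v: "v \<in> L2 \<Omega>" and \<phi>: "\<phi> \<in> test_fun {0<..<T}"
  define p where "p t = ip \<Omega> (w t) v" for t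
  define q where "q t = ip \<Omega> (w' t) v" for t
  have pd: "(p has_real_derivative q t) (at t within {0..T})" if "t \<in> {0..T}" for t
    unfolding p_def q_def by (rule l2.deriv_curve_B[OF w v that])
  have qc: "continuous_on {0..T} q" unfolding q_def by (rule l2.cont_curve_B[OF w' v])
  have pc: "continuous_on {0..T} p" by (rule DERIV_continuous_on[OF pd])
  have sm: "smooth \<phi>" by (rule test_fun_smooth[OF \<phi>])
  obtain lo hi where lh: "0 < lo" "lo \<le> hi" "hi < T" "\<And>t. t \<notin> {lo..hi} \<Longrightarrow> \<phi> t = 0"
    using test_fun_real_support[OF \<phi> T] by metis
  have z: "\<phi> 0 = 0" "\<phi> T = 0" using lh by auto
  have d\<phi>: "smooth (ddir 1 \<phi>)" by (rule smooth_ddir[OF sm]) simp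
  have "integral {0..T} (\<lambda>t. deriv \<phi> t * p t) = \<phi> T * p T - \<phi> 0 * p 0 - integral {0..T} (\<lambda>t. \<phi> t * q t)"
  proof (rule absolutely_continuous_by_parts)
    show "(\<phi> has_real_derivative deriv \<phi> t) (at t within {0..T})" for t
      unfolding deriv_eq_ddir[OF sm] by (rule has_field_derivative_at_within[OF smooth_DERIV[OF sm]])
    show "continuous_on {0..T} (deriv \<phi>)" unfolding deriv_eq_ddir[OF sm] by (rule smooth_continuous[OF d\<phi>])
    show "q absolutely_integrable_on {0..T}" by (rule absolutely_integrable_continuous_real[OF qc])
    show "p t = p 0 + integral {0..t} q" if t: "t \<in> {0..T}" for t
    proof -
      have "(q has_integral (p t - p 0)) {0..t}"
        using t by (intro fundamental_theorem_of_calculus)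
          (auto simp: has_real_derivative_iff_has_vector_derivative[symmetric] intro!: DERIV_subset[OF pd])
      then show ?thesis by (simp add: integral_unique)
    qed
  qed (use T in auto)
  moreover have "continuous_on {0..T} (\<lambda>t. deriv \<phi> t * p t)" "continuous_on {0..T} (\<lambda>t. \<phi> t * q t)"
    unfolding deriv_eq_ddir[OF sm] by (intro continuous_intros smooth_continuous d\<phi> sm pc qc)+
  ultimately show "(LINT t|lebesgue_on {0..T}. deriv \<phi> t * ip \<Omega> (w t) v) = - (LINT t|lebesgue_on {0..T}. \<phi> t * ip \<Omega> (w' t) v)"
    using z unfolding p_def[symmetric] q_def[symmetric] by (simp add: LINT_eq_integral integrable_continuous_lebesgue_on)
qed

lemma has_real_derivative_of_integrals:
  fixes p q :: "real \<Rightarrow> real"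
  assumes pq: "\<And>t. t \<in> {0..T} \<Longrightarrow> (q has_integral (p t - p 0)) {0..t}" and q: "continuous_on {0..T} q" and t: "t \<in> {0..T}"
  shows "(p has_real_derivative q t) (at t within {0..T})"
proof -
  have "((\<lambda>x. integral {0..x} q) has_real_derivative q t) (at t within {0..T})"
    by (rule integral_has_real_derivative[OF q t])
  then have "((\<lambda>x. p 0 + integral {0..x} q) has_real_derivative q t) (at t within {0..T})"
    by (auto intro!: derivative_eq_intros)
  then show ?thesis
  proof (rule has_field_derivative_transform_within[OF _ zero_less_one t])
    show "p 0 + integral {0..x} q = p x" if "x \<in> {0..T}" for x using integral_unique[OF pq[OF that]] by simp
  qed
qed

section \<open>Continuous curves in the time-dependent function spaces\<close>

lemma (in semi_inner) cont_curve_tendsto: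
  assumes "cont_curve S y" "t \<in> S" "\<And>n. r n \<in> S" "r \<longlonglongrightarrow> t"
  shows "(\<lambda>n. N (y t - y (r n))) \<longlonglongrightarrow> 0"
proof -
  have "((\<lambda>s. N (y s - y t)) \<longlongrightarrow> N (y t - y t)) (at t within S)" using assms by (auto simp: cont_curve_def)
  then have "continuous (at t within S) (\<lambda>s. N (y s - y t))" by (simp add: continuous_within)
  then have "(\<lambda>n. N (y (r n) - y t)) \<longlonglongrightarrow> N (y t - y t)"
    using assms(3,4) unfolding continuous_within_sequentially by (auto simp: comp_def)
  moreover have "N (y (r n) - y t) = N (y t - y (r n))" for n
    using assms by (intro N_diff_commute) (auto simp: cont_curve_def)
  ultimately show ?thesis by simp
qed

text \<open>Rounding \<open>t\<close> down to a grid of width \<open>T / Suc n\<close> gives curves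
  with finitely many values, and continuity makes them converge at every time.\<close>

lemma cont_curve_strongly_measurable:
  assumes T: "T > 0" and X: "semi_inner X B N" and w: "semi_inner.cont_curve X N {0..T} w"
  shows "strongly_measurable T X N w"
proof -
  interpret semi_inner X B N by fact
  define r where "r n t = T * (of_int \<lfloor>real (Suc n) * t / T\<rfloor> / real (Suc n))" for n :: nat and t :: real
  have r_le: "r n t \<le> t" and r_ge: "t - T / real (Suc n) \<le> r n t" for n t
  proof -
    have "of_int \<lfloor>real (Suc n) * t / T\<rfloor> / real (Suc n) \<le> (real (Suc n) * t / T) / real (Suc n)"
      by (intro divide_right_mono) auto
    then have "T * (of_int \<lfloor>real (Suc n) * t / T\<rfloor> / real (Suc n)) \<le> T * ((real (Suc n) * t / T) / real (Suc n))"
      using T by (intro mult_left_mono) auto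
    also have "\<dots> = t" using T by (simp del: of_nat_Suc)
    finally show "r n t \<le> t" by (simp add: r_def)
    have "(real (Suc n) * t / T - 1) / real (Suc n) \<le> of_int \<lfloor>real (Suc n) * t / T\<rfloor> / real (Suc n)"
      using real_of_int_floor_gt_diff_one[of "real (Suc n) * t / T"] by (intro divide_right_mono) auto
    then have "T * ((real (Suc n) * t / T - 1) / real (Suc n)) \<le> r n t"
      unfolding r_def using T by (intro mult_left_mono) auto
    moreover have "T * ((real (Suc n) * t / T - 1) / real (Suc n)) = t - T / real (Suc n)"
      using T by (simp add: diff_divide_distrib right_diff_distrib del: of_nat_Suc)
    ultimately show "t - T / real (Suc n) \<le> r n t" by simp
  qed
  have r_nonneg: "0 \<le> r n t" if "0 \<le> t" for n t unfolding r_def using T that by auto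
  have r_in: "r n t \<in> {0..T}" if "t \<in> {0..T}" for n t using r_nonneg[of t n] r_le[of n t] that by auto
  have r_lim: "(\<lambda>n. r n t) \<longlonglongrightarrow> t" for t
  proof (rule tendsto_sandwich[where f = "\<lambda>n. t - T * (1 / real (Suc n))" and h = "\<lambda>n. t"])
    have "(\<lambda>n. t - T * (1 / real (Suc n))) \<longlonglongrightarrow> t - T * 0" by (intro tendsto_intros LIMSEQ_Suc[OF lim_1_over_n])
    then show "(\<lambda>n. t - T * (1 / real (Suc n))) \<longlonglongrightarrow> t" by simp
  qed (use r_le r_ge in auto)
  have r_simple: "simple_function (lebesgue_on {0..T}) (r n)" for n
  proof (rule simple_function_borel_measurable)
    have "(\<lambda>t. T * (of_int \<lfloor>real (Suc n) * t / T\<rfloor> / real (Suc n))) \<in> borel_measurable borel" by measurable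
    then have "r n \<in> borel_measurable borel" by (simp add: r_def[abs_def])
    then have "r n \<in> borel_measurable lebesgue" by (simp add: measurable_completion)
    then show "r n \<in> borel_measurable (lebesgue_on {0..T})" by (rule measurable_restrict_space1)
    have "r n ` {0..T} \<subseteq> (\<lambda>k. T * (of_int k / real (Suc n))) ` {0..int (Suc n)}"
    proof (clarify)
      fix t :: real assume t: "t \<in> {0..T}"
      have "0 \<le> \<lfloor>real (Suc n) * t / T\<rfloor>" using t T by auto
      moreover have "real (Suc n) * t / T \<le> real (Suc n)" using t T by (simp add: divide_le_eq mult_left_mono)
      then have "\<lfloor>real (Suc n) * t / T\<rfloor> \<le> int (Suc n)" by linarith
      ultimately show "r n t \<in> (\<lambda>k. T * (of_int k / real (Suc n))) ` {0..int (Suc n)}" by (auto simp: r_def)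
    qed
    then show "finite (r n ` space (lebesgue_on {0..T}))" by (simp add: finite_subset)
  qed
  show ?thesis
    unfolding strongly_measurable_def
  proof (intro exI[of _ "\<lambda>n t. w (r n t)"] conjI allI ballI)
    show "simple_function (lebesgue_on {0..T}) (\<lambda>t. w (r n t))" for n
      using simple_function_compose[OF r_simple, of w n] by (simp add: comp_def)
    show "w (r n t) \<in> X" if "t \<in> {0..T}" for n t using cont_curve_in[OF w r_in[OF that]] .
    show "AE t in lebesgue_on {0..T}. w t \<in> X \<and> (\<lambda>n. N (\<lambda>x. w t x - w (r n t) x)) \<longlonglongrightarrow> 0"
    proof (intro AE_I2 conjI)
      fix t assume "t \<in> space (lebesgue_on {0..T})"
      then have t: "t \<in> {0..T}" by simp
      show "w t \<in> X" by (rule cont_curve_in[OF w t])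
      show "(\<lambda>n. N (\<lambda>x. w t x - w (r n t) x)) \<longlonglongrightarrow> 0"
        using cont_curve_tendsto[OF w t r_in[OF t] r_lim] by (simp add: fun_diff_def)
    qed
  qed
qed

text \<open>\<open>max (g t) L\<close> equals \<open>L\<close> almost everywhere, hence at every
  interior point by continuity of both sides, and then at the ends.\<close>

lemma continuous_AE_le:
  fixes g :: "real \<Rightarrow> real"
  assumes T: "T > 0" and g: "continuous_on {0..T} g" and ae: "AE t in lebesgue_on {0..T}. g t \<le> L" and t: "t \<in> {0..T}"
  shows "g t \<le> L"
proof -
  have c: "continuous_on {0..T} (\<lambda>t. max (g t) L)" by (intro continuous_intros g)
  have "AE t in lebesgue. t \<in> {0..T} \<longrightarrow> g t \<le> L" using ae by (simp add: AE_restrict_space_iff)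
  then have "AE t in lebesgue. t \<in> {0<..<T} \<longrightarrow> max (g t) L = L" by eventually_elim auto
  then have ae': "AE t in lebesgue_on {0<..<T}. max (g t) L = L" by (simp add: AE_restrict_space_iff)
  have "max (g t) L = L" if "t \<in> {0<..<T}" for t
    by (rule eq_of_AE_eq_continuous[OF _ _ _ ae' that]) (auto intro: continuous_on_subset[OF c])
  moreover have "closure {0<..<T} = {0..T}" using T by simp
  ultimately have "max (g t) L = L"
    using continuous_constant_on_closure[of "{0<..<T}" "\<lambda>t. max (g t) L" L t] c t by simp
  then show ?thesis by simp
qed

text \<open>The error analysis evaluates norms at grid points, whereas \<open>Linf_norm\<close> is
  an essential supremum; continuity closes this gap.\<close>

lemma cont_curve_Linf:
  assumes T: "T > 0" and X: "semi_inner X B N" and w: "semi_inner.cont_curve X N {0..T} w"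
  shows "w \<in> Linf_time T X N" and "t \<in> {0..T} \<Longrightarrow> N (w t) \<le> Linf_norm T N w"
proof -
  interpret semi_inner X B N by fact
  have c: "continuous_on {0..T} (\<lambda>t. N (w t))" by (rule cont_curve_N[OF w])
  have m: "(\<lambda>t. ereal (N (w t))) \<in> borel_measurable (lebesgue_on {0..T})"
    by (intro borel_measurable_ereal continuous_imp_measurable_on_sets_lebesgue[OF c]) auto
  have "bounded ((\<lambda>t. N (w t)) ` {0..T})" by (intro compact_imp_bounded compact_continuous_image c) auto
  then obtain C where C: "\<forall>t\<in>{0..T}. \<bar>N (w t)\<bar> \<le> C" by (auto simp: bounded_iff)
  have "esssup (lebesgue_on {0..T}) (\<lambda>t. ereal (N (w t))) \<le> ereal C"
    by (rule esssup_I[OF m AE_I2]) (use C in force)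
  then have fin: "esssup (lebesgue_on {0..T}) (\<lambda>t. ereal (N (w t))) < \<infinity>" by (rule le_less_trans) simp
  show "w \<in> Linf_time T X N" unfolding Linf_time_def using fin cont_curve_strongly_measurable[OF T X w] by simp
  have ae: "AE t in lebesgue_on {0..T}. ereal (N (w t)) \<le> esssup (lebesgue_on {0..T}) (\<lambda>t. ereal (N (w t)))"
    by (rule esssup_AE)
  \<comment> \<open>The conversion to a real number is faithful only for finite values; the value
    minus infinity would force negative norms.\<close>
  have ni: "esssup (lebesgue_on {0..T}) (\<lambda>t. ereal (N (w t))) \<noteq> - \<infinity>"
  proof
    assume e: "esssup (lebesgue_on {0..T}) (\<lambda>t. ereal (N (w t))) = - \<infinity>"
    have "AE t in lebesgue_on {0..T}. N (w t) \<le> -1" using ae unfolding e by eventually_elim simp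
    from continuous_AE_le[OF T c this, of 0] T show False using N_nonneg[OF cont_curve_in[OF w, of 0]] by simp
  qed
  have "AE t in lebesgue_on {0..T}. N (w t) \<le> Linf_norm T N w"
    using ae unfolding Linf_norm_def
  proof eventually_elim
    case (elim t)
    then show ?case using fin ni by (cases "esssup (lebesgue_on {0..T}) (\<lambda>t. ereal (N (w t)))") auto
  qed
  then show "t \<in> {0..T} \<Longrightarrow> N (w t) \<le> Linf_norm T N w" by (rule continuous_AE_le[OF T c])
qed

text \<open>The Cauchy-Schwarz inequality in time against the constant 1; the source of every
  \<open>sqrt T\<close> in the final constant.\<close>

lemma integral_le_L2_time_norm:
  assumes T: "T > 0" and X: "semi_inner X B N" and w: "semi_inner.cont_curve X N {0..T} w"
  shows "integral {0..T} (\<lambda>t. N (w t)) \<le> sqrt T * L2_time_norm T N w"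
proof -
  interpret semi_inner X B N by fact
  let ?M = "lebesgue_on {0..T}"
  have c: "continuous_on {0..T} (\<lambda>t. N (w t))" by (rule cont_curve_N[OF w])
  have i: "integrable ?M (\<lambda>t. (N (w t))\<^sup>2)" by (intro integrable_continuous_lebesgue_on continuous_intros c)
  have a: "(\<lambda>t. N (w t)) \<in> sq_int ?M" unfolding sq_int_def using i continuous_imp_measurable_on_sets_lebesgue[OF c] by simp
  have "integrable ?M (\<lambda>t. 1::real)" by (intro integrable_continuous_lebesgue_on continuous_intros)
  then have b: "(\<lambda>t. 1) \<in> sq_int ?M" by (simp add: sq_int_def)
  have "\<bar>sq_ip ?M (\<lambda>t. 1) (\<lambda>t. N (w t))\<bar> \<le> sq_norm ?M (\<lambda>t. 1) * sq_norm ?M (\<lambda>t. N (w t))" by (rule sq.Cauchy_Schwarz[OF b a])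
  moreover have "sq_ip ?M (\<lambda>t. 1) (\<lambda>t. N (w t)) = integral {0..T} (\<lambda>t. N (w t))"
    unfolding sq_ip_def using LINT_eq_integral[OF integrable_continuous_lebesgue_on[OF c]] by simp
  moreover have "sq_norm ?M (\<lambda>t. 1) = sqrt T"
    using T by (simp add: sq_norm_def sq_ip_def measure_restrict_space)
  moreover have "sq_norm ?M (\<lambda>t. N (w t)) = L2_time_norm T N w"
    by (simp add: sq_norm_def sq_ip_def L2_time_norm_def power2_eq_square)
  ultimately show ?thesis by simp
qed

lemma (in bounded_open) hs: "semi_inner (Hs s \<Omega>) (Hs_ip s \<Omega>) (Hs_norm s \<Omega>)"
  by (rule Hs_semi_inner[OF open_Om lmeas])

section \<open>Modes of the wave equation\<close>

locale wave = eigen_system +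
  fixes \<gamma> T :: real and u0 v0 :: fn and f ft ftt fttt u ut :: "real \<Rightarrow> fn"
  assumes reg: "elliptic_regularity \<Omega> \<gamma>" and \<gamma>: "0 \<le> \<gamma>" and T: "T > 0"
    and data: "data_regular \<Omega> T lam \<psi> u0 v0 f ft ftt fttt"
    and sol: "weak_solution \<Omega> T f u0 v0 u ut"
begin

lemma f_cont: "l2.cont_curve \<Omega> {0..T} f" and ft_cont: "l2.cont_curve \<Omega> {0..T} ft" and ftt_cont: "l2.cont_curve \<Omega> {0..T} ftt"
  using data by (auto simp: data_regular_def time_cont_iff)

lemma f_deriv: "l2.deriv_curve \<Omega> {0..T} f ft"
  using data by (intro weak_time_deriv_imp_deriv_curve[OF T f_cont ft_cont]) (simp add: data_regular_def)

lemma ft_deriv: "l2.deriv_curve \<Omega> {0..T} ft ftt"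
  using data by (intro weak_time_deriv_imp_deriv_curve[OF T ft_cont ftt_cont]) (simp add: data_regular_def)

lemma u_H20: "t \<in> {0..T} \<Longrightarrow> u t \<in> H20 \<Omega>"
  using sol by (simp add: weak_solution_def time_cont_def)

lemma ut_cont: "l2.cont_curve \<Omega> {0..T} ut"
  using sol by (simp add: weak_solution_def time_cont_iff)

lemma u_deriv: "l2.deriv_curve \<Omega> {0..T} u ut"
  using sol u_H20 H20_L2 l2.cont_curve_in[OF ut_cont] by (intro time_deriv_imp) (auto simp: weak_solution_def)

lemma u_cont: "l2.cont_curve \<Omega> {0..T} u"
  by (rule l2.deriv_curve_imp_cont_curve[OF u_deriv])

lemma coef_cont: "l2.cont_curve \<Omega> {0..T} y \<Longrightarrow> continuous_on {0..T} (\<lambda>t. coef (y t) n)"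
  unfolding coef_def by (rule l2.cont_curve_B[OF _ psi_L2])

lemma coef_deriv: "l2.deriv_curve \<Omega> {0..T} y y' \<Longrightarrow> t \<in> {0..T} \<Longrightarrow>
    ((\<lambda>t. coef (y t) n) has_real_derivative coef (y' t) n) (at t within {0..T})"
  unfolding coef_def by (rule l2.deriv_curve_B[OF _ psi_L2])

text \<open>The mode of u_tt as dictated by the equation, before u_tt is known to exist;
  \<open>jerk\<close> plays the same role for u_ttt.\<close>

definition acc :: "nat \<Rightarrow> real \<Rightarrow> real" where "acc n t = coef (f t) n - lam n * coef (u t) n"
definition jerk :: "nat \<Rightarrow> real \<Rightarrow> real" where "jerk n t = coef (ft t) n - lam n * coef (ut t) n"

lemma acc_cont: "continuous_on {0..T} (acc n)"
  unfolding acc_def by (intro continuous_intros coef_cont f_cont u_cont)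

text \<open>Tested with an eigenfunction, the weak formulation is a weak derivative of a scalar
  function, since \<open>hess_form_psi\<close> turns the Hessian form into \<open>lam n\<close>
  times a coefficient.\<close>

lemma ut_coef_deriv:
  assumes t: "t \<in> {0..T}"
  shows "((\<lambda>t. coef (ut t) n) has_real_derivative acc n t) (at t within {0..T})"
proof (rule has_real_derivative_of_integrals[OF _ acc_cont t])
  fix s assume s: "s \<in> {0..T}"
  show "(acc n has_integral coef (ut s) n - coef (ut 0) n) {0..s}"
  proof (rule weak_derivative_integral[OF T coef_cont[OF ut_cont] integrable_continuous_lebesgue_on[OF acc_cont]])
    fix \<phi> assume \<phi>: "\<phi> \<in> test_fun {0<..<T}"
    have pc: "continuous_on {0..T} \<phi>" by (rule smooth_continuous[OF test_fun_smooth[OF \<phi>]])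
    let ?L = "lebesgue_on {0..T}"
    have "- (LINT t|?L. deriv \<phi> t * ip \<Omega> (ut t) (\<psi> n)) + (LINT t|?L. \<phi> t * hess_form \<Omega> (u t) (\<psi> n)) = (LINT t|?L. \<phi> t * ip \<Omega> (f t) (\<psi> n))"
      using sol \<phi> psi_H20[of n] by (simp add: weak_solution_def)
    moreover have "(LINT t|?L. \<phi> t * hess_form \<Omega> (u t) (\<psi> n)) = (LINT t|?L. \<phi> t * (lam n * coef (u t) n))"
      using u_H20 by (intro Bochner_Integration.integral_cong) (auto simp: hess_form_psi)
    moreover have "(LINT t|?L. \<phi> t * acc n t) = (LINT t|?L. \<phi> t * coef (f t) n) - (LINT t|?L. \<phi> t * (lam n * coef (u t) n))"
      unfolding acc_def right_diff_distrib
      by (intro Bochner_Integration.integral_diff integrable_continuous_lebesgue_on continuous_intros pc coef_cont f_cont u_cont)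
    ultimately show "(LINT t|?L. deriv \<phi> t * coef (ut t) n) = - (LINT t|?L. \<phi> t * acc n t)" by (simp add: coef_def)
  qed (use s in auto)
qed

lemma acc_deriv: assumes t: "t \<in> {0..T}" shows "(acc n has_real_derivative jerk n t) (at t within {0..T})"
  unfolding acc_def[abs_def] jerk_def
  by (intro DERIV_diff DERIV_cmult coef_deriv[OF f_deriv t] coef_deriv[OF u_deriv t])

text \<open>With \<open>acc_deriv\<close> this is the oscillator equation for \<open>acc n\<close>
  with the mode of f_tt as force. The equation differentiated twice in time is used because bounds
  are wanted for u_tt, u_ttt and the bilaplacian of u_tt.\<close>

lemma jerk_deriv:
  assumes t: "t \<in> {0..T}" shows "(jerk n has_real_derivative coef (ftt t) n - lam n * acc n t) (at t within {0..T})"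
  unfolding jerk_def[abs_def]
  by (intro DERIV_diff DERIV_cmult coef_deriv[OF ft_deriv t] ut_coef_deriv t)

lemma fttt_L2_AE: "AE t in lebesgue_on {0..T}. fttt t \<in> L2 \<Omega>"
  and fttt_sq_integrable: "integrable (lebesgue_on {0..T}) (\<lambda>t. (l2norm \<Omega> (fttt t))\<^sup>2)"
  using data by (auto simp: data_regular_def L2_time_def strongly_measurable_def elim: eventually_mono)

text \<open>f_ttt has no continuous representative; the coefficient is almost everywhere the limit
  of coefficients of simple functions.\<close>

lemma fttt_coef_measurable: "(\<lambda>t. coef (fttt t) n) \<in> borel_measurable (lebesgue_on {0..T})"
proof -
  have "strongly_measurable T (L2 \<Omega>) (l2norm \<Omega>) fttt" using data by (simp add: data_regular_def L2_time_def)
  then obtain s where s: "\<And>k. simple_function (lebesgue_on {0..T}) (s k)" "\<And>k t. t \<in> {0..T} \<Longrightarrow> s k t \<in> L2 \<Omega>"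
    "AE t in lebesgue_on {0..T}. fttt t \<in> L2 \<Omega> \<and> (\<lambda>k. l2norm \<Omega> (\<lambda>x. fttt t x - s k t x)) \<longlonglongrightarrow> 0"
    unfolding strongly_measurable_def by blast
  have m: "(\<lambda>t. coef (s k t) n) \<in> borel_measurable (lebesgue_on {0..T})" for k
    using borel_measurable_simple_function[OF simple_function_compose[OF s(1)[of k], of "\<lambda>v. coef v n"]] by (simp add: comp_def)
  have "AE t in lebesgue_on {0..T}. lim (\<lambda>k. coef (s k t) n) = coef (fttt t) n"
    using s(3) AE_space
  proof eventually_elim
    case (elim t)
    have t: "t \<in> {0..T}" using elim by simp
    have l: "(\<lambda>k. l2norm \<Omega> (fttt t - s k t)) \<longlonglongrightarrow> 0" using elim by (simp add: fun_diff_def)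
    have "(\<lambda>k. coef (s k t) n - coef (fttt t) n) \<longlonglongrightarrow> 0"
    proof (rule Lim_null_comparison[OF _ l])
      have "norm (coef (s k t) n - coef (fttt t) n) \<le> l2norm \<Omega> (fttt t - s k t)" for k
      proof -
        have "\<bar>ip \<Omega> (fttt t - s k t) (\<psi> n)\<bar> \<le> l2norm \<Omega> (fttt t - s k t) * l2norm \<Omega> (\<psi> n)"
          using elim s(2)[OF t] by (intro l2.Cauchy_Schwarz) auto
        moreover have "l2norm \<Omega> (\<psi> n) = 1" by (simp add: l2norm_def psi_orthonormal)
        ultimately show ?thesis using elim s(2)[OF t] by (simp add: coef_def l2.diff_left abs_minus_commute)
      qed
      then show "\<forall>\<^sub>F k in sequentially. norm (coef (s k t) n - coef (fttt t) n) \<le> l2norm \<Omega> (fttt t - s k t)" by simp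
    qed
    then show ?case by (simp add: LIM_zero_iff limI)
  qed
  from borel_measurable_lebesgue_on_AE[OF _ borel_measurable_lim_metric[OF m] this] show ?thesis by simp
qed

lemma fttt_coef_sq: "integrable (lebesgue_on {0..T}) (\<lambda>t. (coef (fttt t) n)\<^sup>2)"
  and fttt_coef_integrable: "integrable (lebesgue_on {0..T}) (\<lambda>t. coef (fttt t) n)"
proof -
  have le: "AE t in lebesgue_on {0..T}. (coef (fttt t) n)\<^sup>2 \<le> (l2norm \<Omega> (fttt t))\<^sup>2"
    using fttt_L2_AE
  proof eventually_elim
    case (elim t)
    have "(coef (fttt t) n)\<^sup>2 \<le> (\<Sum>i<Suc n. (coef (fttt t) i)\<^sup>2)" by (rule member_le_sum) auto
    then show ?case using Bessel[OF elim, of "Suc n"] by simp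
  qed
  show sq: "integrable (lebesgue_on {0..T}) (\<lambda>t. (coef (fttt t) n)\<^sup>2)"
    by (rule Bochner_Integration.integrable_bound[OF fttt_sq_integrable])
      (use fttt_coef_measurable le in auto)
  have one: "integrable (lebesgue_on {0..T}) (\<lambda>t. 1::real)" by (intro integrable_continuous_lebesgue_on continuous_intros)
  show "integrable (lebesgue_on {0..T}) (\<lambda>t. coef (fttt t) n)"
  proof (rule Bochner_Integration.integrable_bound[OF Bochner_Integration.integrable_add[OF one sq] fttt_coef_measurable])
    have "\<bar>a\<bar> \<le> 1 + a\<^sup>2" for a :: real using sum_squares_bound[of 1 "\<bar>a\<bar>"] by simp
    then show "AE t in lebesgue_on {0..T}. norm (coef (fttt t) n) \<le> norm (1 + (coef (fttt t) n)\<^sup>2)" by (intro AE_I2) simp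
  qed
qed

lemma ftt_coef_integral: "t \<in> {0..T} \<Longrightarrow> coef (ftt t) n = coef (ftt 0) n + integral {0..t} (\<lambda>t. coef (fttt t) n)"
proof -
  assume t: "t \<in> {0..T}"
  have wk: "(LINT t|lebesgue_on {0..T}. deriv \<phi> t * coef (ftt t) n) = - (LINT t|lebesgue_on {0..T}. \<phi> t * coef (fttt t) n)"
    if "\<phi> \<in> test_fun {0<..<T}" for \<phi>
    using data that psi_L2[of n] by (simp add: data_regular_def weak_time_deriv_def coef_def)
  have "((\<lambda>t. coef (fttt t) n) has_integral (coef (ftt t) n - coef (ftt 0) n)) {0..t}"
    by (rule weak_derivative_integral[OF T coef_cont[OF ftt_cont] fttt_coef_integrable wk]) (use t in auto)
  then show ?thesis by (simp add: integral_unique)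
qed

definition Q3 :: "nat \<Rightarrow> real" where "Q3 n = integral {0..T} (\<lambda>t. \<bar>coef (fttt t) n\<bar>)"

lemma fttt_abs: "(\<lambda>t. coef (fttt t) n) absolutely_integrable_on {0..T}"
  using fttt_coef_integrable by (simp add: integrable_iff_absolutely_integrable)

lemma Q3_nonneg: "0 \<le> Q3 n"
  unfolding Q3_def using fttt_abs[of n] by (intro integral_nonneg) (auto simp: absolutely_integrable_on_def)

text \<open>The Cauchy-Schwarz inequality in time for each mode, then Bessel's inequality at almost
  every time: the squares add up to at most \<open>T\<close> times the squared norm of f_ttt in
  space and time.\<close>

lemma Q3_sqs: "sqs Q3"
  unfolding sqs_def
proof (rule summableI_nonneg_bounded)
  let ?L = "lebesgue_on {0..T}"
  have sqQ: "(Q3 n)\<^sup>2 \<le> T * (LINT t|?L. (coef (fttt t) n)\<^sup>2)" for n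
  proof -
    have a: "(\<lambda>t. \<bar>coef (fttt t) n\<bar>) \<in> sq_int ?L"
      using fttt_coef_sq[of n] fttt_coef_measurable[of n] by (simp add: sq_int_def)
    have "integrable ?L (\<lambda>t. 1::real)" by (intro integrable_continuous_lebesgue_on continuous_intros)
    then have b: "(\<lambda>t. 1) \<in> sq_int ?L" by (simp add: sq_int_def)
    have q: "sq_ip ?L (\<lambda>t. 1) (\<lambda>t. \<bar>coef (fttt t) n\<bar>) = Q3 n"
      unfolding sq_ip_def Q3_def using LINT_eq_integral[OF integrable_abs[OF fttt_coef_integrable[of n]]] by simp
    have "Q3 n \<le> sq_norm ?L (\<lambda>t. 1) * sq_norm ?L (\<lambda>t. \<bar>coef (fttt t) n\<bar>)"
      using sq.Cauchy_Schwarz[OF b a] q by simp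
    then have "(Q3 n)\<^sup>2 \<le> (sq_norm ?L (\<lambda>t. 1) * sq_norm ?L (\<lambda>t. \<bar>coef (fttt t) n\<bar>))\<^sup>2" using Q3_nonneg by (intro power_mono) auto
    then show ?thesis using T by (simp add: power_mult_distrib sq_norm_square measure_restrict_space)
  qed
  fix N
  have "(\<Sum>n<N. (Q3 n)\<^sup>2) \<le> (\<Sum>n<N. T * (LINT t|?L. (coef (fttt t) n)\<^sup>2))" by (intro sum_mono sqQ)
  also have "\<dots> = T * (LINT t|?L. (\<Sum>n<N. (coef (fttt t) n)\<^sup>2))"
    using fttt_coef_sq by (simp add: sum_distrib_left[symmetric] Bochner_Integration.integral_sum)
  also have "\<dots> \<le> T * (LINT t|?L. (l2norm \<Omega> (fttt t))\<^sup>2)"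
  proof (intro mult_left_mono integral_mono_AE)
    show "AE t in ?L. (\<Sum>n<N. (coef (fttt t) n)\<^sup>2) \<le> (l2norm \<Omega> (fttt t))\<^sup>2"
      using fttt_L2_AE by eventually_elim (rule Bessel)
  qed (use T fttt_coef_sq fttt_sq_integrable in auto)
  finally show "(\<Sum>n<N. (Q3 n)\<^sup>2) \<le> T * (LINT t|?L. (l2norm \<Omega> (fttt t))\<^sup>2)" .
qed simp

lemma initial_coefs: "coef (u 0) n = coef u0 n" "coef (ut 0) n = coef v0 n"
  using sol ip_aeq[OF meas _ aeq_refl] by (auto simp: weak_solution_def coef_def)

text \<open>Translates the spectral spaces of the data into summability: exponent
  \<open>2 * r\<close> on the eigenvalue gives the powers 4, 3 and 1. For \<open>f 0\<close>, given
  in the domain of the operator, the coefficients of its bilaplacian are used.\<close>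

lemma data_sqs:
  shows "sqs (coef (f 0))" "sqs (coef (ft 0))" "sqs (coef (ftt 0))"
    and "sqs (\<lambda>n. lam n * coef (f 0) n)" "summable (\<lambda>n. lam n * (coef (ft 0) n)\<^sup>2)"
    and "sqs (coef u0)" "sqs (coef v0)" "sqs (\<lambda>n. (lam n)\<^sup>2 * coef u0 n)" "summable (\<lambda>n. (lam n) ^ 3 * (coef v0 n)\<^sup>2)"
proof -
  have 0: "0 \<in> {0..T}" using T by simp
  show "sqs (coef (f 0))" "sqs (coef (ft 0))" "sqs (coef (ftt 0))"
    using l2.cont_curve_in[OF f_cont 0] l2.cont_curve_in[OF ft_cont 0] l2.cont_curve_in[OF ftt_cont 0] by (auto intro: coef_sqs)
  obtain g where g: "f 0 \<in> H20 \<Omega>" "is_bilaplacian \<Omega> (f 0) g" using data by (auto simp: data_regular_def DA_def)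
  then have "sqs (coef g)" by (intro coef_sqs) (simp add: is_bilaplacian_def)
  moreover have "coef g = (\<lambda>n. lam n * coef (f 0) n)" using coef_bilaplacian[OF g] by auto
  ultimately show "sqs (\<lambda>n. lam n * coef (f 0) n)" by simp
  have d: "u0 \<in> DAr \<Omega> lam \<psi> 2" "v0 \<in> DAr \<Omega> lam \<psi> (3/2)" "ft 0 \<in> DAr \<Omega> lam \<psi> (1/2)" using data by (auto simp: data_regular_def)
  then show "sqs (coef u0)" "sqs (coef v0)" by (auto simp: DAr_def intro: coef_sqs)
  have p: "lam n powr 4 = lam n ^ 4" "lam n powr 3 = lam n ^ 3" for n using lam_nonneg[of n] by auto
  have "((lam n)\<^sup>2 * c)\<^sup>2 = lam n ^ 4 * c\<^sup>2" for n c by (simp add: power_mult_distrib flip: power_mult)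
  then show "sqs (\<lambda>n. (lam n)\<^sup>2 * coef u0 n)" using d(1) p by (simp add: DAr_def sqs_def coef_def)
  show "summable (\<lambda>n. (lam n) ^ 3 * (coef v0 n)\<^sup>2)" using d(2) p by (simp add: DAr_def coef_def)
  have "lam n powr 1 = lam n" for n using lam_nonneg[of n] by simp
  then show "summable (\<lambda>n. lam n * (coef (ft 0) n)\<^sup>2)" using d(3) by (simp add: DAr_def coef_def)
qed

text \<open>These are the initial energies of the oscillators for \<open>acc\<close>, whose initial
  values are the modes of f(0) - A u0 and f_t(0) - A v0. Intermediate powers of the eigenvalue
  follow by interpolation, from \<open>l \<le> 1 + l^2\<close> and
  \<open>l^2 \<le> 1 + l^3\<close>.\<close>

lemma initial_sqs:
  shows "sqs (\<lambda>n. acc n 0)" "sqs (\<lambda>n. lam n * acc n 0)" "sqs (\<lambda>n. jerk n 0)" "summable (\<lambda>n. lam n * (jerk n 0)\<^sup>2)"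
proof -
  have sq1: "\<bar>l * c\<bar> \<le> \<bar>\<bar>c\<bar> + \<bar>l\<^sup>2 * c\<bar>\<bar>" if "l \<ge> 0" for l c :: real
  proof -
    have "l \<le> 1 + l\<^sup>2" using sum_squares_bound[of 1 l] that by simp
    then have "l * \<bar>c\<bar> \<le> (1 + l\<^sup>2) * \<bar>c\<bar>" by (intro mult_right_mono) auto
    then show ?thesis using that by (simp add: abs_mult algebra_simps)
  qed
  have a1: "sqs (\<lambda>n. lam n * coef u0 n)"
    by (rule sqs_comparison[OF sqs_add[OF sqs_abs[OF data_sqs(6)] sqs_abs[OF data_sqs(8)]]]) (rule sq1[OF lam_nonneg])
  show "sqs (\<lambda>n. acc n 0)" unfolding acc_def initial_coefs by (rule sqs_diff[OF data_sqs(1) a1])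
  have "sqs (\<lambda>n. lam n * coef (f 0) n - (lam n)\<^sup>2 * coef u0 n)" by (rule sqs_diff[OF data_sqs(4) data_sqs(8)])
  then show "sqs (\<lambda>n. lam n * acc n 0)" unfolding acc_def initial_coefs by (simp add: algebra_simps power2_eq_square)
  have sv: "summable (\<lambda>n. (coef v0 n)\<^sup>2 + (lam n) ^ 3 * (coef v0 n)\<^sup>2)"
    using data_sqs(7,9) by (intro summable_add) (auto simp: sqs_def)
  have "sqs (\<lambda>n. lam n * coef v0 n)" unfolding sqs_def
  proof (rule summable_comparison_test'[OF sv, of 0])
    fix n
    have "(lam n)\<^sup>2 \<le> 1 + (lam n) ^ 3"
    proof (cases "lam n \<le> 1")
      case True
      then have "(lam n)\<^sup>2 \<le> 1" using lam_nonneg[of n] by (simp add: power_le_one)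
      then show ?thesis using zero_le_power[OF lam_nonneg, of n 3] by linarith
    next
      case False
      then have "(lam n)\<^sup>2 \<le> (lam n) ^ 3" by (intro power_increasing) auto
      then show ?thesis by simp
    qed
    then have "(lam n)\<^sup>2 * (coef v0 n)\<^sup>2 \<le> (1 + (lam n) ^ 3) * (coef v0 n)\<^sup>2" by (intro mult_right_mono) auto
    then show "norm ((lam n * coef v0 n)\<^sup>2) \<le> (coef v0 n)\<^sup>2 + (lam n) ^ 3 * (coef v0 n)\<^sup>2" by (simp add: power_mult_distrib algebra_simps)
  qed
  then show "sqs (\<lambda>n. jerk n 0)" unfolding jerk_def initial_coefs by (rule sqs_diff[OF data_sqs(2)])
  have s2: "summable (\<lambda>n. 2 * (lam n * (coef (ft 0) n)\<^sup>2) + 2 * ((lam n) ^ 3 * (coef v0 n)\<^sup>2))"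
    using data_sqs(5,9) by (intro summable_add summable_mult)
  show "summable (\<lambda>n. lam n * (jerk n 0)\<^sup>2)"
  proof (rule summable_comparison_test'[OF s2, of 0])
    fix n
    have "(jerk n 0)\<^sup>2 \<le> 2 * (coef (ft 0) n)\<^sup>2 + 2 * (lam n * coef v0 n)\<^sup>2"
      using sum_squares_bound[of "coef (ft 0) n" "- (lam n * coef v0 n)"] by (simp add: jerk_def initial_coefs power2_diff)
    then have "lam n * (jerk n 0)\<^sup>2 \<le> lam n * (2 * (coef (ft 0) n)\<^sup>2 + 2 * (lam n * coef v0 n)\<^sup>2)" by (intro mult_left_mono lam_nonneg)
    also have "\<dots> = 2 * (lam n * (coef (ft 0) n)\<^sup>2) + 2 * ((lam n) ^ 3 * (coef v0 n)\<^sup>2)"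
      by (simp add: algebra_simps power2_eq_square power3_eq_cube)
    finally show "norm (lam n * (jerk n 0)\<^sup>2) \<le> 2 * (lam n * (coef (ft 0) n)\<^sup>2) + 2 * ((lam n) ^ 3 * (coef v0 n)\<^sup>2)"
      using lam_nonneg[of n] by simp
  qed
qed

text \<open>Majorants over the whole time interval, one number per mode: for the force, for u_ttt,
  for u_tt and for the bilaplacian of u_tt. Their square summability is the hypothesis
  \<open>M\<close> of \<open>cont_curve_coef\<close>.\<close>

definition Fm :: "nat \<Rightarrow> real" where "Fm n = \<bar>coef (ftt 0) n\<bar> + Q3 n"
definition jerk_sup :: "nat \<Rightarrow> real" where "jerk_sup n = sqrt ((jerk n 0)\<^sup>2 + lam n * (acc n 0)\<^sup>2) + 2 * (T * Fm n)"
definition acc_sup :: "nat \<Rightarrow> real" where "acc_sup n = \<bar>acc n 0\<bar> + T * jerk_sup n"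
definition lam_acc_sup :: "nat \<Rightarrow> real" where
  "lam_acc_sup n = sqrt ((lam n * acc n 0)\<^sup>2 + lam n * (jerk n 0)\<^sup>2) + 2 * (2 * Fm n + Q3 n)"

lemma Fm: "t \<in> {0..T} \<Longrightarrow> \<bar>coef (ftt t) n\<bar> \<le> Fm n"
proof -
  assume t: "t \<in> {0..T}"
  have sub: "{0..t} \<subseteq> {0..T}" using t by auto
  have i: "(\<lambda>t. \<bar>coef (fttt t) n\<bar>) integrable_on {0..T}" "(\<lambda>t. coef (fttt t) n) integrable_on {0..T}"
    using fttt_abs[of n] by (auto simp: absolutely_integrable_on_def)
  then have i': "(\<lambda>t. \<bar>coef (fttt t) n\<bar>) integrable_on {0..t}" "(\<lambda>t. coef (fttt t) n) integrable_on {0..t}"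
    using sub by (auto intro: integrable_subinterval_real)
  have "\<bar>integral {0..t} (\<lambda>t. coef (fttt t) n)\<bar> \<le> integral {0..t} (\<lambda>t. \<bar>coef (fttt t) n\<bar>)"
    using integral_norm_bound_integral[OF i'(2) i'(1)] by simp
  also have "\<dots> \<le> Q3 n" unfolding Q3_def by (intro integral_subset_le sub i i') auto
  finally show ?thesis using ftt_coef_integral[OF t, of n] by (simp add: Fm_def)
qed

lemma mode_bounds:
  assumes t: "t \<in> {0..T}"
  shows "\<bar>jerk n t\<bar> \<le> jerk_sup n" "\<bar>acc n t\<bar> \<le> acc_sup n" "\<bar>lam n * acc n t\<bar> \<le> lam_acc_sup n"
proof -
  have T0: "0 \<le> T" using T by simp
  have j: "\<bar>jerk n t\<bar> \<le> jerk_sup n" if "t \<in> {0..T}" for t unfolding jerk_sup_def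
    by (rule oscillator_velocity_bound[OF T0 lam_nonneg acc_deriv jerk_deriv Fm coef_cont[OF ftt_cont] that])
  show "\<bar>jerk n t\<bar> \<le> jerk_sup n" by (rule j[OF t])
  show "\<bar>lam n * acc n t\<bar> \<le> lam_acc_sup n" unfolding lam_acc_sup_def Q3_def
    by (rule oscillator_force_bound[OF T0 lam_nonneg acc_deriv jerk_deriv Fm ftt_coef_integral fttt_abs t])
  \<comment> \<open>\<open>acc\<close> is bounded by integrating \<open>jerk\<close>, because the
    energy only controls \<open>lam n * (acc n t)^2\<close>, which says little when the eigenvalue
    is small.\<close>
  have "norm (acc n t - acc n 0) \<le> jerk_sup n * norm (t - 0)"
  proof (rule field_differentiable_bound[where S = "{0..T}" and f' = "jerk n"])
    show "\<And>z. z \<in> {0..T} \<Longrightarrow> (acc n has_field_derivative jerk n z) (at z within {0..T})" by (rule acc_deriv)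
    show "\<And>z. z \<in> {0..T} \<Longrightarrow> norm (jerk n z) \<le> jerk_sup n" using j by simp
  qed (use t T in auto)
  moreover have "jerk_sup n * norm (t - 0) \<le> jerk_sup n * T"
    using t j[of 0] T by (intro mult_left_mono) auto
  ultimately have "\<bar>acc n t - acc n 0\<bar> \<le> T * jerk_sup n" by (simp add: mult.commute)
  then show "\<bar>acc n t\<bar> \<le> acc_sup n" unfolding acc_sup_def by linarith
qed

lemma sups_sqs: "sqs jerk_sup" "sqs acc_sup" "sqs lam_acc_sup"
proof -
  have F: "sqs Fm" unfolding Fm_def[abs_def] by (intro sqs_add sqs_abs data_sqs Q3_sqs)
  have s1: "summable (\<lambda>n. (acc n 0)\<^sup>2 + (lam n * acc n 0)\<^sup>2)" using initial_sqs(1,2) by (intro summable_add) (auto simp: sqs_def)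
  have "summable (\<lambda>n. lam n * (acc n 0)\<^sup>2)"
  proof (rule summable_comparison_test'[OF s1, of 0])
    fix n
    have "lam n \<le> 1 + (lam n)\<^sup>2" using sum_squares_bound[of 1 "lam n"] lam_nonneg[of n] by simp
    then have "lam n * (acc n 0)\<^sup>2 \<le> (1 + (lam n)\<^sup>2) * (acc n 0)\<^sup>2" by (intro mult_right_mono) auto
    then show "norm (lam n * (acc n 0)\<^sup>2) \<le> (acc n 0)\<^sup>2 + (lam n * acc n 0)\<^sup>2"
      using lam_nonneg[of n] by (simp add: power_mult_distrib algebra_simps)
  qed
  then have a: "summable (\<lambda>n. (jerk n 0)\<^sup>2 + lam n * (acc n 0)\<^sup>2)"
    using initial_sqs(3) by (intro summable_add) (auto simp: sqs_def)
  show j: "sqs jerk_sup" unfolding jerk_sup_def[abs_def]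
    by (intro sqs_add sqs_scale sqs_sqrt a F) (simp add: lam_nonneg)
  show "sqs acc_sup" unfolding acc_sup_def[abs_def] by (intro sqs_add sqs_scale sqs_abs initial_sqs j)
  have b: "summable (\<lambda>n. (lam n * acc n 0)\<^sup>2 + lam n * (jerk n 0)\<^sup>2)"
    using initial_sqs(2,4) by (intro summable_add) (auto simp: sqs_def)
  show "sqs lam_acc_sup" unfolding lam_acc_sup_def[abs_def]
    by (intro sqs_add sqs_scale sqs_sqrt b F Q3_sqs) (simp add: lam_nonneg)
qed

lemma time_sqs:
  assumes "t \<in> {0..T}" shows "sqs (\<lambda>n. acc n t)" "sqs (\<lambda>n. jerk n t)" "sqs (\<lambda>n. lam n * acc n t)"
  by (rule sqs_comparison[OF sups_sqs(2)], rule order_trans[OF mode_bounds(2)[OF assms] abs_ge_self],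
      rule sqs_comparison[OF sups_sqs(1)], rule order_trans[OF mode_bounds(1)[OF assms] abs_ge_self],
      rule sqs_comparison[OF sups_sqs(3)], rule order_trans[OF mode_bounds(3)[OF assms] abs_ge_self])

definition utt :: "real \<Rightarrow> fn" where "utt t = synth (\<lambda>n. acc n t)"
definition uttt :: "real \<Rightarrow> fn" where "uttt t = synth (\<lambda>n. jerk n t)"
definition Autt :: "real \<Rightarrow> fn" where "Autt t = synth (\<lambda>n. lam n * acc n t)"
text \<open>The equation differentiated twice in time, solved for its leading term; continuity and
  coefficients come from those of \<open>ftt\<close> and \<open>Autt\<close>.\<close>

definition utttt :: "real \<Rightarrow> fn" where "utttt t = ftt t - Autt t"

lemma derivatives_L2: assumes "t \<in> {0..T}" shows "utt t \<in> L2 \<Omega>" "uttt t \<in> L2 \<Omega>" "Autt t \<in> L2 \<Omega>"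
  using synth(1)[OF time_sqs(1)[OF assms]] synth(1)[OF time_sqs(2)[OF assms]] synth(1)[OF time_sqs(3)[OF assms]]
  by (simp_all add: utt_def uttt_def Autt_def)

lemma derivatives_coef: assumes "t \<in> {0..T}"
  shows "coef (utt t) n = acc n t" "coef (uttt t) n = jerk n t" "coef (Autt t) n = lam n * acc n t"
  using synth(2)[OF time_sqs(1)[OF assms]] synth(2)[OF time_sqs(2)[OF assms]] synth(2)[OF time_sqs(3)[OF assms]]
  by (simp_all add: utt_def uttt_def Autt_def)

lemma jerk_cont: "continuous_on {0..T} (jerk n)"
  by (rule DERIV_continuous_on[OF jerk_deriv])

lemma utt_cont: "l2.cont_curve \<Omega> {0..T} utt"
proof (rule cont_curve_coef[OF derivatives_L2(1) _ sups_sqs(2)])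
  show "continuous_on {0..T} (\<lambda>t. coef (utt t) n)" for n
    using acc_cont[of n] by (rule continuous_on_eq) (simp add: derivatives_coef)
qed (use derivatives_coef mode_bounds in auto)

lemma uttt_cont: "l2.cont_curve \<Omega> {0..T} uttt"
proof (rule cont_curve_coef[OF derivatives_L2(2) _ sups_sqs(1)])
  show "continuous_on {0..T} (\<lambda>t. coef (uttt t) n)" for n
    using jerk_cont[of n] by (rule continuous_on_eq) (simp add: derivatives_coef)
qed (use derivatives_coef mode_bounds in auto)

lemma Autt_cont: "l2.cont_curve \<Omega> {0..T} Autt"
proof (rule cont_curve_coef[OF derivatives_L2(3) _ sups_sqs(3)])
  show "continuous_on {0..T} (\<lambda>t. coef (Autt t) n)" for n
    using continuous_on_mult_left[OF acc_cont[of n], of "lam n"] by (rule continuous_on_eq) (simp add: derivatives_coef)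
qed (use derivatives_coef mode_bounds in auto)

lemma utttt_cont: "l2.cont_curve \<Omega> {0..T} utttt"
  unfolding utttt_def[abs_def] by (rule l2.cont_curve_diff[OF ftt_cont Autt_cont])

lemma DERIV_coef_cong:
  assumes "\<And>t. t \<in> {0..T} \<Longrightarrow> g t = h t" "t \<in> {0..T}" "(h has_real_derivative D) (at t within {0..T})"
  shows "(g has_real_derivative D) (at t within {0..T})"
  by (rule has_field_derivative_transform_within[OF assms(3) zero_less_one assms(2)]) (use assms(1) in simp)

lemma ut_deriv: "l2.deriv_curve \<Omega> {0..T} ut utt"
  by (rule deriv_curve_coef[OF l2.cont_curve_in[OF ut_cont] utt_cont]) (use ut_coef_deriv derivatives_coef in auto)

lemma utt_deriv: "l2.deriv_curve \<Omega> {0..T} utt uttt"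
proof (rule deriv_curve_coef[OF derivatives_L2(1) uttt_cont])
  show "((\<lambda>t. coef (utt t) n) has_real_derivative coef (uttt t) n) (at t within {0..T})" if "t \<in> {0..T}" for n t
    by (rule DERIV_coef_cong[OF derivatives_coef(1) that]) (use acc_deriv[OF that, of n] derivatives_coef(2)[OF that] in simp_all)
qed

lemma uttt_deriv: "l2.deriv_curve \<Omega> {0..T} uttt utttt"
proof (rule deriv_curve_coef[OF derivatives_L2(2) utttt_cont])
  show "((\<lambda>t. coef (uttt t) n) has_real_derivative coef (utttt t) n) (at t within {0..T})" if "t \<in> {0..T}" for n t
  proof (rule DERIV_coef_cong[OF derivatives_coef(2) that])
    have "coef (utttt t) n = coef (ftt t) n - lam n * acc n t"
      using derivatives_coef(3)[OF that] derivatives_L2(3)[OF that] l2.cont_curve_in[OF ftt_cont that] by (simp add: utttt_def coef_diff)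
    then show "(jerk n has_real_derivative coef (utttt t) n) (at t within {0..T})" using jerk_deriv[OF that, of n] by simp
  qed
qed

text \<open>At a fixed time, u and its first two time derivatives each solve a stationary problem
  with right-hand side in \<open>L2\<close>: the coefficients satisfy the hypothesis of
  \<open>H20_of_coef\<close>.\<close>

lemma regularity:
  assumes t: "t \<in> {0..T}"
  shows "is_bilaplacian \<Omega> (u t) (f t - utt t)"
    and "ut t \<in> H20 \<Omega>" "is_bilaplacian \<Omega> (ut t) (ft t - uttt t)"
    and "utt t \<in> H20 \<Omega>" "is_bilaplacian \<Omega> (utt t) (ftt t - utttt t)"
proof -
  note L = derivatives_L2[OF t] l2.cont_curve_in[OF f_cont t] l2.cont_curve_in[OF ft_cont t] l2.cont_curve_in[OF u_cont t] l2.cont_curve_in[OF ut_cont t]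
  note c = derivatives_coef[OF t]
  show "is_bilaplacian \<Omega> (u t) (f t - utt t)"
    by (rule H20_of_coef(2)[OF reg \<gamma>]) (use L c in \<open>auto simp: coef_diff acc_def\<close>)
  have z: "ft t - uttt t \<in> L2 \<Omega>" "coef (ft t - uttt t) n = lam n * coef (ut t) n" for n using L c by (auto simp: coef_diff jerk_def)
  show "ut t \<in> H20 \<Omega>" "is_bilaplacian \<Omega> (ut t) (ft t - uttt t)" by (rule H20_of_coef[OF reg \<gamma> L(7) z])+
  have z: "Autt t \<in> L2 \<Omega>" "coef (Autt t) n = lam n * coef (utt t) n" for n using L c by auto
  have "ftt t - utttt t = Autt t" by (simp add: utttt_def)
  then show "utt t \<in> H20 \<Omega>" "is_bilaplacian \<Omega> (utt t) (ftt t - utttt t)" using H20_of_coef[OF reg \<gamma> L(1) z] by simp_all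
qed

section \<open>Curves with values in \<open>Hs (2 + \<gamma>)\<close> and regularity of the
  solution\<close>

lemma Hs_cont_curve:
  assumes H: "\<And>t. t \<in> {0..T} \<Longrightarrow> y t \<in> H20 \<Omega> \<and> is_bilaplacian \<Omega> (y t) (a t)"
    and y: "l2.cont_curve \<Omega> {0..T} y" and a: "l2.cont_curve \<Omega> {0..T} a"
  shows "semi_inner.cont_curve (Hs (2 + \<gamma>) \<Omega>) (Hs_norm (2 + \<gamma>) \<Omega>) {0..T} y"
proof -
  interpret h: semi_inner "Hs (2 + \<gamma>) \<Omega>" "Hs_ip (2 + \<gamma>) \<Omega>" "Hs_norm (2 + \<gamma>) \<Omega>" by (rule hs)
  obtain c where c: "\<And>v g. v \<in> H20 \<Omega> \<Longrightarrow> is_bilaplacian \<Omega> v g \<Longrightarrow> v \<in> Hs (2 + \<gamma>) \<Omega> \<and> Hs_norm (2 + \<gamma>) \<Omega> v \<le> c * (l2norm \<Omega> v + l2norm \<Omega> g)"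
    using reg unfolding elliptic_regularity_def by blast
  show ?thesis unfolding h.cont_curve_def
  proof (intro conjI ballI)
    fix t assume t: "t \<in> {0..T}"
    show "y t \<in> Hs (2 + \<gamma>) \<Omega>" using c H[OF t] by blast
    \<comment> \<open>Elliptic regularity applied to the increment bounds its \<open>Hs_norm\<close>
      by \<open>L2\<close> increments of \<open>y\<close> and of its bilaplacian \<open>a\<close>,
      which tend to 0.\<close>
    have "((\<lambda>s. c * (l2norm \<Omega> (y s - y t) + l2norm \<Omega> (a s - a t))) \<longlongrightarrow> c * (0 + 0)) (at t within {0..T})"
      using y a t by (intro tendsto_intros) (auto simp: l2.cont_curve_def)
    then have l: "((\<lambda>s. c * (l2norm \<Omega> (y s - y t) + l2norm \<Omega> (a s - a t))) \<longlongrightarrow> 0) (at t within {0..T})" by simp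
    show "((\<lambda>s. Hs_norm (2 + \<gamma>) \<Omega> (y s - y t)) \<longlongrightarrow> 0) (at t within {0..T})"
    proof (rule Lim_null_comparison[OF _ l], rule eventually_withinI)
      fix s assume s: "s \<in> {0..T}"
      have "y s - y t \<in> H20 \<Omega>" using H[OF s] H[OF t] by (intro subspace_diff H20_subspace) auto
      moreover have "is_bilaplacian \<Omega> (y s - y t) (a s - a t)"
        using bilaplacian_comb[of "y s" "y t" "a s" "a t" 1 "-1"] H[OF s] H[OF t] H20_L2 by simp
      ultimately have "y s - y t \<in> Hs (2 + \<gamma>) \<Omega>" "Hs_norm (2 + \<gamma>) \<Omega> (y s - y t) \<le> c * (l2norm \<Omega> (y s - y t) + l2norm \<Omega> (a s - a t))"
        using c by blast+
      then show "norm (Hs_norm (2 + \<gamma>) \<Omega> (y s - y t)) \<le> c * (l2norm \<Omega> (y s - y t) + l2norm \<Omega> (a s - a t))" by simp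
    qed
  qed
qed

text \<open>The bilaplacian commutes with difference quotients in time, so elliptic regularity turns
  \<open>L2\<close> differentiability of \<open>y\<close> and \<open>a\<close> into
  differentiability in the stronger norm.\<close>

lemma Hs_deriv_curve:
  assumes H: "\<And>t. t \<in> {0..T} \<Longrightarrow> y t \<in> H20 \<Omega> \<and> is_bilaplacian \<Omega> (y t) (a t)"
    and H': "\<And>t. t \<in> {0..T} \<Longrightarrow> y' t \<in> H20 \<Omega> \<and> is_bilaplacian \<Omega> (y' t) (a' t)"
    and y: "l2.deriv_curve \<Omega> {0..T} y y'" and a: "l2.deriv_curve \<Omega> {0..T} a a'"
  shows "semi_inner.deriv_curve (Hs (2 + \<gamma>) \<Omega>) (Hs_norm (2 + \<gamma>) \<Omega>) {0..T} y y'"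
proof -
  interpret h: semi_inner "Hs (2 + \<gamma>) \<Omega>" "Hs_ip (2 + \<gamma>) \<Omega>" "Hs_norm (2 + \<gamma>) \<Omega>" by (rule hs)
  obtain c where c: "\<And>v g. v \<in> H20 \<Omega> \<Longrightarrow> is_bilaplacian \<Omega> v g \<Longrightarrow> v \<in> Hs (2 + \<gamma>) \<Omega> \<and> Hs_norm (2 + \<gamma>) \<Omega> v \<le> c * (l2norm \<Omega> v + l2norm \<Omega> g)"
    using reg unfolding elliptic_regularity_def by blast
  show ?thesis unfolding h.deriv_curve_def
  proof (intro conjI ballI)
    fix t assume t: "t \<in> {0..T}"
    show "y t \<in> Hs (2 + \<gamma>) \<Omega>" "y' t \<in> Hs (2 + \<gamma>) \<Omega>" using c H[OF t] H'[OF t] by blast+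
    let ?q = "\<lambda>y y' s. (1 / (s - t)) *\<^sub>R (y s - y t) - y' t"
    have "((\<lambda>s. c * (l2norm \<Omega> (?q y y' s) + l2norm \<Omega> (?q a a' s))) \<longlongrightarrow> c * (0 + 0)) (at t within {0..T})"
      using y a t by (intro tendsto_intros) (auto simp: l2.deriv_curve_def)
    then have l: "((\<lambda>s. c * (l2norm \<Omega> (?q y y' s) + l2norm \<Omega> (?q a a' s))) \<longlongrightarrow> 0) (at t within {0..T})" by simp
    show "((\<lambda>s. Hs_norm (2 + \<gamma>) \<Omega> (?q y y' s)) \<longlongrightarrow> 0) (at t within {0..T})"
    proof (rule Lim_null_comparison[OF _ l], rule eventually_withinI)
      fix s assume s: "s \<in> {0..T}"
      have d: "y s - y t \<in> H20 \<Omega>" using H[OF s] H[OF t] by (intro subspace_diff H20_subspace) auto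
      have qH: "?q y y' s \<in> H20 \<Omega>"
        using H'[OF t] by (intro subspace_diff[OF H20_subspace subspace_scale[OF H20_subspace d]]) simp
      have b: "is_bilaplacian \<Omega> (y s - y t) (a s - a t)"
        using bilaplacian_comb[of "y s" "y t" "a s" "a t" 1 "-1"] H[OF s] H[OF t] H20_L2 by simp
      have "is_bilaplacian \<Omega> ((1 / (s - t)) *\<^sub>R (y s - y t) + (-1) *\<^sub>R y' t) ((1 / (s - t)) *\<^sub>R (a s - a t) + (-1) *\<^sub>R a' t)"
        using b H'[OF t] by (intro bilaplacian_comb H20_L2 d) auto
      then have "is_bilaplacian \<Omega> (?q y y' s) (?q a a' s)" by simp
      from c[OF qH this]
      show "norm (Hs_norm (2 + \<gamma>) \<Omega> (?q y y' s)) \<le> c * (l2norm \<Omega> (?q y y' s) + l2norm \<Omega> (?q a a' s))" by simp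
    qed
  qed
qed

lemma u_Hs_deriv: "semi_inner.deriv_curve (Hs (2 + \<gamma>) \<Omega>) (Hs_norm (2 + \<gamma>) \<Omega>) {0..T} u ut"
  by (rule Hs_deriv_curve[OF _ _ u_deriv l2.deriv_curve_diff[OF f_deriv utt_deriv]]) (auto intro: u_H20 regularity)

lemma ut_Hs_deriv: "semi_inner.deriv_curve (Hs (2 + \<gamma>) \<Omega>) (Hs_norm (2 + \<gamma>) \<Omega>) {0..T} ut utt"
  by (rule Hs_deriv_curve[OF _ _ ut_deriv l2.deriv_curve_diff[OF ft_deriv uttt_deriv]]) (auto intro: regularity)

lemma utt_Hs_cont: "semi_inner.cont_curve (Hs (2 + \<gamma>) \<Omega>) (Hs_norm (2 + \<gamma>) \<Omega>) {0..T} utt"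
  by (rule Hs_cont_curve[OF _ utt_cont l2.cont_curve_diff[OF ftt_cont utttt_cont]]) (auto intro: regularity)

lemma u_Hs_cont: "semi_inner.cont_curve (Hs (2 + \<gamma>) \<Omega>) (Hs_norm (2 + \<gamma>) \<Omega>) {0..T} u"
  and ut_Hs_cont: "semi_inner.cont_curve (Hs (2 + \<gamma>) \<Omega>) (Hs_norm (2 + \<gamma>) \<Omega>) {0..T} ut"
  using semi_inner.deriv_curve_imp_cont_curve[OF hs] u_Hs_deriv ut_Hs_deriv by blast+

theorem solution_is_regular: "solution_regular \<Omega> T \<gamma> u ut utt uttt utttt"
  unfolding solution_regular_def
  using deriv_curve_imp_weak_time_deriv[OF T ut_deriv utt_cont] deriv_curve_imp_weak_time_deriv[OF T utt_deriv uttt_cont]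
    deriv_curve_imp_weak_time_deriv[OF T uttt_deriv utttt_cont]
    cont_curve_Linf(1)[OF T hs u_Hs_cont] cont_curve_Linf(1)[OF T hs ut_Hs_cont] cont_curve_Linf(1)[OF T hs utt_Hs_cont]
    cont_curve_Linf(1)[OF T l2.semi_inner_axioms utt_cont] cont_curve_Linf(1)[OF T l2.semi_inner_axioms uttt_cont]
    cont_curve_Linf(1)[OF T l2.semi_inner_axioms utttt_cont]
  by simp

text \<open>The equation at a single time, for all test vectors in \<open>H20\<close>; it is used
  with the smoothed discrete functions \<open>Q v\<close>.\<close>

lemma hess_form_u: "t \<in> {0..T} \<Longrightarrow> v \<in> H20 \<Omega> \<Longrightarrow> hess_form \<Omega> (u t) v = ip \<Omega> (f t - utt t) v"
  by (rule bilaplacian_green[OF u_H20 regularity(1)])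

end

section \<open>The discrete space and the Ritz projection\<close>

lemma borel_measurable_lebesgue_on_Un:
  fixes f :: "'a::euclidean_space \<Rightarrow> real"
  assumes A: "A \<in> sets lebesgue" "f \<in> borel_measurable (lebesgue_on A)"
    and B: "B \<in> sets lebesgue" "f \<in> borel_measurable (lebesgue_on B)"
  shows "f \<in> borel_measurable (lebesgue_on (A \<union> B))"
proof -
  have a: "(\<lambda>x. indicator A x * f x) \<in> borel_measurable lebesgue" "(\<lambda>x. indicator B x * f x) \<in> borel_measurable lebesgue"
    using A B by (auto simp: borel_measurable_restrict_space_iff)
  have "(\<lambda>x. indicator A x * f x + indicator (- A) x * (indicator B x * f x)) \<in> borel_measurable lebesgue"
    by (rule borel_measurable_add[OF a(1) borel_measurable_times[OF borel_measurable_indicator a(2)]]) (use A(1) in \<open>auto simp: Compl_eq_Diff_UNIV intro!: sets.Diff\<close>)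
  moreover have "(\<lambda>x. indicator A x * f x + indicator (- A) x * (indicator B x * f x)) = (\<lambda>x. indicator (A \<union> B) x * f x)"
    by (auto simp: indicator_def fun_eq_iff)
  ultimately show ?thesis using A B by (simp add: borel_measurable_restrict_space_iff)
qed

lemma L2_Un:
  assumes A: "A \<in> sets lebesgue" "v \<in> L2 A" and B: "B \<in> sets lebesgue" "v \<in> L2 B"
  shows "v \<in> L2 (A \<union> B)"
proof -
  have "set_integrable lebesgue A (\<lambda>x. (v x)\<^sup>2)" "set_integrable lebesgue B (\<lambda>x. (v x)\<^sup>2)"
    using A B by (auto simp: L2_def set_integrable_def integrable_restrict_space)
  then have "set_integrable lebesgue (A \<union> B) (\<lambda>x. (v x)\<^sup>2)" using A B by (intro set_integrable_Un)
  then have "integrable (lebesgue_on (A \<union> B)) (\<lambda>x. (v x)\<^sup>2)"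
    using A(1) B(1) by (simp add: set_integrable_def integrable_restrict_space)
  moreover have "v \<in> borel_measurable (lebesgue_on (A \<union> B))"
    using A B by (intro borel_measurable_lebesgue_on_Un) (auto simp: L2_def)
  ultimately show ?thesis by (simp add: L2_def)
qed

lemma L2_UN:
  assumes "finite I" "\<And>i. i \<in> I \<Longrightarrow> A i \<in> sets lebesgue" "\<And>i. i \<in> I \<Longrightarrow> v \<in> L2 (A i)"
  shows "v \<in> L2 (\<Union>i\<in>I. A i)"
  using assms
proof (induction I rule: finite_induct)
  case empty
  have "v \<in> borel_measurable (lebesgue_on {})" by (auto simp: measurable_def)
  then show ?case by (simp add: L2_def)
next
  case (insert i I)
  have "v \<in> L2 (A i \<union> (\<Union>i\<in>I. A i))" using insert by (intro L2_Un) auto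
  then show ?case by simp
qed

lemma L2_AE_subset:
  assumes v: "v \<in> L2 B" and B: "B \<in> sets lebesgue" and A: "A \<in> sets lebesgue" and n: "A - B \<in> null_sets lebesgue"
  shows "v \<in> L2 A"
proof -
  have i: "v \<in> L2 (A \<inter> B)" by (rule L2_subset[OF v _ _ B]) (use A B in auto)
  have ae: "AE x in lebesgue. x \<notin> A - B" using n by (rule AE_not_in)
  have z: "AE x in lebesgue_on (A - B). 0 = v x" using ae A B by (simp add: AE_restrict_space_iff) (auto elim: eventually_mono)
  have "(\<lambda>x. 0) \<in> L2 (A - B)" using l2.X_closed(1)[of "A - B"] by (simp add: zero_fun_def)
  then have "v \<in> L2 (A - B)" by (rule L2_aeq[rotated]) (use A B z in \<open>auto simp: aeq_def\<close>)
  then have "v \<in> L2 ((A \<inter> B) \<union> (A - B))" using i A B by (intro L2_Un) auto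
  then show ?thesis by (simp add: Int_Diff_Un)
qed

section \<open>Mesh geometry, discrete energy and the Ritz projection\<close>

locale discretization = bounded_open +
  fixes \<T> :: mesh and Vh :: "fn set" and ah :: "fn \<Rightarrow> fn \<Rightarrow> real" and IM J Rh :: "fn \<Rightarrow> fn"
    and \<alpha> \<beta> \<gamma> C1 C2 :: real
  assumes nonempty: "\<Omega> \<noteq> {}" and poly: "polygonal \<Omega>" and mesh: "mesh_of \<Omega> \<T>"
    and Vh: "fin_dim_subspace Vh" "Vh \<subseteq> H2_mesh \<T>" and form: "discrete_form \<Omega> \<T> \<alpha> \<beta> Vh ah"
    and IM: "morley_interpolation \<Omega> \<T> IM" and J: "companion \<Omega> \<T> J"
    and smoother: "smoother_estimate \<Omega> \<T> C1 Vh (J \<circ> IM)"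
    and ritz: "ritz_projection \<Omega> Vh ah (J \<circ> IM) Rh" and ritz_est: "ritz_estimate \<Omega> \<T> \<gamma> C2 Rh"
    and pos: "\<alpha> > 0" "C1 > 0" "C2 > 0" and \<gamma>: "0 \<le> \<gamma>" "\<gamma> \<le> 1"
begin

abbreviation Q :: "fn \<Rightarrow> fn" where "Q \<equiv> J \<circ> IM"
abbreviation hh :: real where "hh \<equiv> mesh_size \<T>"

lemma finite_mesh: "finite \<T>"
  using mesh by (simp add: mesh_of_def triangulation_def)

text \<open>A 2-simplex in the plane has full affine dimension, so its relative interior is its
  interior; the frontier of a convex set is null.\<close>

lemma mesh_triangle:
  assumes K: "K \<in> \<T>"
  shows "compact K" "convex K" "K \<subseteq> closure \<Omega>" "interior K \<noteq> {}" "closure (interior K) = K" "K - interior K \<in> null_sets lebesgue"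
proof -
  have s: "2 simplex K" "\<Union>\<T> = closure \<Omega>" using mesh K by (auto simp: mesh_of_def)
  show c: "compact K" "convex K" using s compact_simplex convex_simplex by blast+
  show "K \<subseteq> closure \<Omega>" using s K by blast
  have "aff_dim K = 2" using s(1) aff_dim_simplex by blast
  then have "affine hull K = UNIV" using aff_dim_eq_full[of K] by simp
  then have "rel_interior K = interior K" by (rule rel_interior_interior)
  moreover have "K \<noteq> {}" using \<open>aff_dim K = 2\<close> by auto
  ultimately show i: "interior K \<noteq> {}" using c by (metis rel_interior_eq_empty)
  show "closure (interior K) = K" using convex_closure_interior[OF c(2) i] c(1) by (simp add: compact_imp_closed)
  have "negligible (frontier K)" by (rule negligible_convex_frontier[OF c(2)])
  then show "K - interior K \<in> null_sets lebesgue"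
    using c(1) by (simp add: negligible_iff_null_sets frontier_def compact_imp_closed)
qed

lemma mesh_size_bounds: "0 \<le> hh" "hh \<le> diameter (closure \<Omega>)"
proof -
  have ne: "\<T> \<noteq> {}" using mesh nonempty closure_subset[of \<Omega>] by (auto simp: mesh_of_def)
  have b: "bounded (closure \<Omega>)" by (rule bounded_closure[OF bounded_Om])
  have d: "0 \<le> diameter K \<and> diameter K \<le> diameter (closure \<Omega>)" if "K \<in> \<T>" for K
    using mesh_triangle[OF that] b by (auto intro: diameter_ge_0 diameter_subset compact_imp_bounded)
  then show "hh \<le> diameter (closure \<Omega>)" unfolding mesh_size_def using finite_mesh ne by (intro Max.boundedI) auto
  obtain K where K: "K \<in> \<T>" using ne by blast
  then have "diameter K \<le> hh" unfolding mesh_size_def using finite_mesh by (intro Max_ge) auto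
  then show "0 \<le> hh" using d[OF K] by simp
qed

text \<open>The triangles lie in the closure of the domain only. To pass square integrability from
  the domain to the triangles, its polygonal boundary must be null; it is a finite union of
  segments.\<close>

lemma frontier_null: "frontier \<Omega> \<in> null_sets lebesgue"
proof -
  obtain S where S': "finite S \<and> (\<forall>s\<in>S. \<exists>p q. s = closed_segment p q) \<and> frontier \<Omega> = \<Union>S"
    using poly[unfolded polygonal_def] by (rule exE)
  note S = conjunct1[OF S'] conjunct1[OF conjunct2[OF S']] conjunct2[OF conjunct2[OF S']]
  have seg: "negligible (closed_segment p q)" for p q :: "real^2"
    by (intro negligible_convex_interior[THEN iffD2] convex_closed_segment interior_closed_segment_ge2) simp
  have "negligible s" if s: "s \<in> S" for s
    using bspec[OF S(2) s] by (elim exE) (simp only: seg)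
  then have "negligible (\<Union>S)" using S(1) by (intro negligible_Union) auto
  then show ?thesis using S(3) by (simp add: negligible_iff_null_sets)
qed

lemma L2_interior: assumes "w \<in> L2 \<Omega>" "K \<in> \<T>" shows "w \<in> L2 (interior K)"
proof (rule L2_AE_subset[OF assms(1) meas])
  show "interior K \<in> sets lebesgue" by simp
  have "interior K - \<Omega> \<subseteq> frontier \<Omega>"
    using mesh_triangle(3)[OF assms(2)] interior_subset[of K] open_Om by (auto simp: frontier_def interior_open)
  then show "interior K - \<Omega> \<in> null_sets lebesgue"
    using frontier_null negligible_subset by (metis negligible_iff_null_sets)
qed

lemma cover_null: "\<Omega> - (\<Union>K\<in>\<T>. interior K) \<in> null_sets lebesgue"
proof -
  have "(\<Union>K\<in>\<T>. K - interior K) \<in> null_sets lebesgue"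
    using mesh_triangle(6) finite_mesh by (intro null_sets_UN') (auto intro: countable_finite)
  moreover have "\<Omega> - (\<Union>K\<in>\<T>. interior K) \<subseteq> (\<Union>K\<in>\<T>. K - interior K)"
  proof
    fix x assume x: "x \<in> \<Omega> - (\<Union>K\<in>\<T>. interior K)"
    then have "x \<in> \<Union>\<T>" using mesh closure_subset[of \<Omega>] by (simp add: mesh_of_def subset_iff)
    then show "x \<in> (\<Union>K\<in>\<T>. K - interior K)" using x by auto
  qed
  ultimately show ?thesis by (metis negligible_iff_null_sets negligible_subset)
qed

lemma L2_of_pieces: assumes "\<And>K. K \<in> \<T> \<Longrightarrow> v \<in> L2 (interior K)" shows "v \<in> L2 \<Omega>"
proof (rule L2_AE_subset[OF L2_UN _ meas cover_null])
  show "finite \<T>" by (rule finite_mesh)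
  show "(\<Union>K\<in>\<T>. interior K) \<in> sets lebesgue" using finite_mesh by (intro sets.finite_UN) auto
qed (use assms in auto)

lemma Vh_L2: "v \<in> Vh \<Longrightarrow> v \<in> L2 \<Omega>"
  using Vh(2) by (intro L2_of_pieces) (auto simp: H2_mesh_def intro: Hm_L2)

text \<open>On each triangle \<open>Hs_norm 0\<close> is the \<open>L2\<close> norm, and the open
  triangles cover the domain up to a null set. The smoother estimate is stated in the mesh norm, the
  error analysis in \<open>l2norm\<close>.\<close>

lemma l2norm_le_mesh_norm:
  assumes w: "w \<in> L2 \<Omega>" shows "l2norm \<Omega> w \<le> Hs_mesh_norm 0 \<T> w"
proof -
  have H0: "(Hs_norm 0 (interior K) w)\<^sup>2 = (LINT x|lebesgue. indicator (interior K) x * (w x)\<^sup>2)" if K: "K \<in> \<T>" for K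
  proof -
    have wK: "w \<in> L2 (interior K)" by (rule L2_interior[OF w K])
    have "aeq (interior K) (wderiv (interior K) (0, 0) w) w"
      by (intro wderiv_aeq is_wderiv_0 L2_loc_integrable wK) auto
    then have e: "l2norm (interior K) (wderiv (interior K) (0, 0) w) = l2norm (interior K) w" by (intro l2norm_aeq) auto
    have "{\<mu>. fst \<mu> + snd \<mu> \<le> (0::nat)} = {(0, 0)}" by auto
    then have "(Hs_norm 0 (interior K) w)\<^sup>2 = (l2norm (interior K) w)\<^sup>2" by (simp add: Hs_norm_def e)
    then show ?thesis by (simp add: l2norm_eq_sq_norm sq_norm_square integral_restrict_space)
  qed
  have iK: "integrable lebesgue (\<lambda>x. indicator (interior K) x * (w x)\<^sup>2)" if "K \<in> \<T>" for K
    using L2_interior[OF w that] by (simp add: L2_def integrable_restrict_space)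
  have "(l2norm \<Omega> w)\<^sup>2 = (LINT x|lebesgue. indicator \<Omega> x * (w x)\<^sup>2)"
    using meas by (simp add: l2norm_eq_sq_norm sq_norm_square integral_restrict_space)
  also have "\<dots> \<le> (LINT x|lebesgue. (\<Sum>K\<in>\<T>. indicator (interior K) x * (w x)\<^sup>2))"
  proof (rule integral_mono_AE)
    show "integrable lebesgue (\<lambda>x. indicator \<Omega> x * (w x)\<^sup>2)" using w meas by (simp add: L2_def integrable_restrict_space)
    show "integrable lebesgue (\<lambda>x. \<Sum>K\<in>\<T>. indicator (interior K) x * (w x)\<^sup>2)" using iK by simp
    have "AE x in lebesgue. x \<notin> \<Omega> - (\<Union>K\<in>\<T>. interior K)" by (rule AE_not_in[OF cover_null])
    then show "AE x in lebesgue. indicator \<Omega> x * (w x)\<^sup>2 \<le> (\<Sum>K\<in>\<T>. indicator (interior K) x * (w x)\<^sup>2)"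
    proof eventually_elim
      case (elim x)
      show ?case
      proof (cases "x \<in> \<Omega>")
        case True
        then obtain K where K: "K \<in> \<T>" "x \<in> interior K" using elim by auto
        have "indicator (interior K) x * (w x)\<^sup>2 \<le> (\<Sum>K\<in>\<T>. indicator (interior K) x * (w x)\<^sup>2)"
          using finite_mesh K(1) by (intro member_le_sum[of K \<T> "\<lambda>K. indicator (interior K) x * (w x)\<^sup>2"]) auto
        then show ?thesis using True K by simp
      qed (simp add: sum_nonneg)
    qed
  qed
  also have "\<dots> = (\<Sum>K\<in>\<T>. (Hs_norm 0 (interior K) w)\<^sup>2)" using iK by (simp add: H0)
  finally have "sqrt ((l2norm \<Omega> w)\<^sup>2) \<le> Hs_mesh_norm 0 \<T> w" unfolding Hs_mesh_norm_def by (rule real_sqrt_le_mono)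
  then show ?thesis using l2.N_nonneg[OF w] by simp
qed

lemma Vh_subspace: "subspace Vh"
proof -
  obtain B where B: "finite B" "Vh = {v. \<exists>c. v = (\<lambda>x. \<Sum>b\<in>B. c b * b x)}" using Vh(1) unfolding fin_dim_subspace_def by blast
  show ?thesis unfolding subspace_def
  proof (intro conjI ballI allI)
    have "0 = (\<lambda>x. \<Sum>b\<in>B. 0 * b x)" by (simp add: fun_eq_iff)
    then show "0 \<in> Vh" unfolding B(2) by (intro CollectI exI)
    fix v w r assume v: "v \<in> Vh"
    then obtain c where c: "v = (\<lambda>x. \<Sum>b\<in>B. c b * b x)" unfolding B(2) by blast
    then have "r *\<^sub>R v = (\<lambda>x. \<Sum>b\<in>B. (r * c b) * b x)" by (auto simp: fun_eq_iff sum_distrib_left mult.assoc)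
    then show "r *\<^sub>R v \<in> Vh" unfolding B(2) by (intro CollectI exI)
    assume "w \<in> Vh"
    then obtain d where "w = (\<lambda>x. \<Sum>b\<in>B. d b * b x)" unfolding B(2) by blast
    with c have "v + w = (\<lambda>x. \<Sum>b\<in>B. (c b + d b) * b x)" by (auto simp: fun_eq_iff sum.distrib distrib_right)
    then show "v + w \<in> Vh" unfolding B(2) by (intro CollectI exI)
  qed
qed

text \<open>A continuous representative of a null function vanishes on the interior, and by density
  on the closed triangle; this makes the value unique.\<close>

lemma pt_val_zero:
  assumes K: "K \<in> \<T>" and z: "z \<in> K" and v: "aeq (interior K) v 0" shows "pt_val K v z = 0"
  unfolding pt_val_def
proof (rule the_equality)
  have "aeq (interior K) 0 v" by (rule aeq_sym[OF v])
  then show "\<exists>g. continuous_on K g \<and> aeq (interior K) g v \<and> g z = 0"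
    by (intro exI[of _ 0]) (auto simp: zero_fun_def)
  fix c assume "\<exists>g. continuous_on K g \<and> aeq (interior K) g v \<and> g z = c"
  then obtain g where g: "continuous_on K g" "aeq (interior K) g v" "g z = c" by blast
  have ae: "AE x in lebesgue_on (interior K). g x = 0" using aeq_trans[OF g(2) v] by (simp add: aeq_def)
  have "g x = 0" if "x \<in> interior K" for x
    by (rule eq_of_AE_eq_continuous[OF open_interior _ _ ae that]) (auto intro: continuous_on_subset[OF g(1) interior_subset])
  then have "g z = 0" using continuous_constant_on_closure[of "interior K" g 0 z] mesh_triangle(5)[OF K] g(1) z by simp
  then show "c = 0" using g(3) by simp
qed

text \<open>A facet of a triangle is compact, convex and of dimension 1, hence a segment. So the
  choice in \<open>edge_param\<close> has a witness and its midpoint lies on the edge.\<close>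

lemma edge_mid_in:
  assumes K: "K \<in> \<T>" and e: "e facet_of K" shows "edge_mid e \<in> K"
proof -
  have f: "e face_of K" "e \<noteq> {}" "aff_dim e = aff_dim K - 1" using e by (auto simp: facet_of_def)
  have "aff_dim K = 2" using mesh K aff_dim_simplex by (auto simp: mesh_of_def)
  then have "collinear e" using f(3) by (simp add: collinear_aff_dim)
  moreover have "compact e" using face_of_imp_compact[OF mesh_triangle(2)[OF K] mesh_triangle(1)[OF K] f(1)] .
  moreover have "convex e" using f(1) face_of_imp_convex by blast
  ultimately obtain p q where "e = closed_segment p q" using f(2) compact_convex_collinear_segment[of e] by metis
  then have "\<exists>\<gamma>. \<exists>p q. e = closed_segment p q \<and> \<gamma> = linepath p q" by blast
  from someI_ex[OF this] obtain p q where pq: "e = closed_segment p q" "edge_param e = linepath p q"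
    unfolding edge_param_def by blast
  have "edge_mid e \<in> path_image (linepath p q)" unfolding edge_mid_def pq(2) path_image_def by (rule imageI) simp
  then show ?thesis using pq(1) f(1) face_of_imp_subset by auto
qed

text \<open>
  The form \<open>a\<^sub>h\<close> is only known to be bilinear on the sum of \<open>V\<^sub>h\<close> and the Morley space, which contains
  \<open>V\<^sub>h\<close> because \<open>0\<close> is a Morley function.
\<close>

lemma zero_Morley: "0 \<in> Morley \<Omega> \<T>"
proof -
  have p: "pt_val K 0 z = 0" if "K \<in> \<T>" "z \<in> K" for K z by (rule pt_val_zero[OF that aeq_refl])
  have n: "normal_deriv_at K e 0 (edge_mid e) = 0" if "K \<in> edge_tris \<T> e" for K e
  proof -
    have K: "K \<in> \<T>" "e facet_of K" using that by (auto simp: edge_tris_def)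
    have "pt_val K (wderiv (interior K) \<mu> 0) (edge_mid e) = 0" for \<mu>
      by (rule pt_val_zero[OF K(1) edge_mid_in[OF K] Hm_zero(2)[OF open_interior]])
    then show ?thesis by (simp add: normal_deriv_at_def)
  qed
  have "0 \<in> Pr_mesh 2 \<T>" unfolding Pr_mesh_def is_poly_on_def
    by (auto intro!: exI[of _ "\<lambda>_. 0"] simp: aeq_def)
  then show ?thesis unfolding Morley_def using p n by (auto simp: vert_tris_def)
qed

lemma Vh_sum: "v \<in> Vh \<Longrightarrow> v \<in> fn_sum Vh (Morley \<Omega> \<T>)"
  unfolding fn_sum_def using zero_Morley by (intro CollectI exI[of _ v] exI[of _ "0 :: fn"]) auto

lemma h_norm_nonneg: "0 \<le> h_norm \<T> v"
proof -
  have "0 \<le> hess_form S v v" for S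
    unfolding hess_form_def ip_def by (intro add_nonneg_nonneg mult_nonneg_nonneg integral_nonneg) auto
  then show ?thesis unfolding h_norm_def by (intro real_sqrt_ge_zero add_nonneg_nonneg sum_nonneg) auto
qed

lemma ah_coercive: "v \<in> Vh \<Longrightarrow> \<alpha> * (h_norm \<T> v)\<^sup>2 \<le> ah v v"
  using form by (simp add: discrete_form_def)

lemma ah_aeq: "v \<in> Vh \<Longrightarrow> v' \<in> Vh \<Longrightarrow> w \<in> Vh \<Longrightarrow> aeq \<Omega> v v' \<Longrightarrow> ah v w = ah v' w"
  using form Vh_sum unfolding discrete_form_def sym_bilinear_on_def by blast

sublocale en: semi_inner Vh ah "\<lambda>v. sqrt (ah v v)"
proof
  have lin: "ah (\<lambda>x. r * v x + s * w x) z = r * ah v z + s * ah w z" if "v \<in> Vh" "w \<in> Vh" "z \<in> Vh" for v w z r s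
    using form Vh_sum that unfolding discrete_form_def sym_bilinear_on_def by blast
  have c: "(\<lambda>x. r * v x + s * w x) = r *\<^sub>R v + s *\<^sub>R w" for r s and v w :: fn by (auto simp: fun_eq_iff)
  show "subspace Vh" by (rule Vh_subspace)
  show "\<And>v w. v \<in> Vh \<Longrightarrow> w \<in> Vh \<Longrightarrow> ah v w = ah w v"
    using form Vh_sum unfolding discrete_form_def sym_bilinear_on_def by blast
  show "ah (v + w) z = ah v z + ah w z" if "v \<in> Vh" "w \<in> Vh" "z \<in> Vh" for v w z using lin[OF that, of 1 1] c[of 1 v 1 w] by simp
  show "ah (r *\<^sub>R v) z = r * ah v z" if "v \<in> Vh" "z \<in> Vh" for v z r using lin[OF that(1) that(1) that(2), of r 0] c[of r v 0 v] by simp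
  show "0 \<le> ah v v" if "v \<in> Vh" for v using ah_coercive[OF that] pos by (meson less_imp_le mult_nonneg_nonneg order_trans zero_le_power2)
qed simp

lemma Q_H20: "v \<in> Vh \<Longrightarrow> Q v \<in> H20 \<Omega>"
  using Vh(2) IM J by (auto simp: morley_interpolation_def companion_def)

text \<open>The infimum in the smoother estimate is at most its value at 0, which coercivity bounds
  by the energy norm of \<open>v\<close>. Thus smoothing changes a discrete function by order
  \<open>h^2\<close> times its energy norm.\<close>

lemma smoother_L2:
  assumes v: "v \<in> Vh" shows "l2norm \<Omega> (v - Q v) \<le> (C1 * hh powr 2 / sqrt \<alpha>) * sqrt (ah v v)"
proof -
  have L: "v - Q v \<in> L2 \<Omega>" by (intro l2.X_closed Vh_L2[OF v] H20_L2[OF Q_H20[OF v]])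
  have "l2norm \<Omega> (v - Q v) \<le> Hs_mesh_norm 0 \<T> (v - Q v)" by (rule l2norm_le_mesh_norm[OF L])
  also have "v - Q v = (\<lambda>x. v x - Q v x)" by (rule fun_diff_def)
  also have "Hs_mesh_norm 0 \<T> (\<lambda>x. v x - Q v x) \<le> C1 * hh powr (2 - 0) * (INF w\<in>H20 \<Omega>. h_norm \<T> (\<lambda>x. w x - v x))"
    using smoother[unfolded smoother_estimate_def, rule_format, OF v, of 0] by simp
  also have "\<dots> \<le> C1 * hh powr 2 * (sqrt (ah v v) / sqrt \<alpha>)"
  proof -
    have z: "0 \<in> H20 \<Omega>" using H20_subspace by (rule subspace_0)
    \<comment> \<open>The value of the infimum at 0 is the norm of \<open>- v\<close>; coercivity is
      applied to \<open>- v\<close> itself, and bilinearity removes the sign.\<close>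
    have m: "- v \<in> Vh" using v by auto
    have "(INF w\<in>H20 \<Omega>. h_norm \<T> (\<lambda>x. w x - v x)) \<le> h_norm \<T> (\<lambda>x. 0 x - v x)"
      by (rule cINF_lower[OF bdd_belowI2[of _ 0] z]) (rule h_norm_nonneg)
    also have "(\<lambda>x. 0 x - v x) = - v" by (auto simp: fun_eq_iff)
    also have "h_norm \<T> (- v) \<le> sqrt (ah v v) / sqrt \<alpha>"
    proof -
      have "\<alpha> * (h_norm \<T> (- v))\<^sup>2 \<le> ah v v" using ah_coercive[OF m] v by (simp add: en.B_linear)
      then have "(h_norm \<T> (- v))\<^sup>2 \<le> ah v v / \<alpha>" using pos by (simp add: field_simps)
      then have "h_norm \<T> (- v) \<le> sqrt (ah v v / \<alpha>)" by (rule real_le_rsqrt)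
      then show ?thesis by (simp add: real_sqrt_divide)
    qed
    finally have i: "(INF w\<in>H20 \<Omega>. h_norm \<T> (\<lambda>x. w x - v x)) \<le> sqrt (ah v v) / sqrt \<alpha>" .
    then have "C1 * hh powr 2 * (INF w\<in>H20 \<Omega>. h_norm \<T> (\<lambda>x. w x - v x)) \<le> C1 * hh powr 2 * (sqrt (ah v v) / sqrt \<alpha>)"
      using pos by (intro mult_left_mono) auto
    then show ?thesis by simp
  qed
  finally show ?thesis by (simp add: fun_diff_def)
qed

text \<open>
  \<open>R\<^sub>h\<close> is not linear as a map on representatives, so its values on linear combinations are replaced
  by this relation; it determines \<open>Z\<close> up to functions that vanish almost everywhere.
\<close>

definition represents :: "fn \<Rightarrow> fn \<Rightarrow> bool" where
  "represents W Z \<longleftrightarrow> W \<in> H20 \<Omega> \<and> Z \<in> Vh \<and> (\<forall>v\<in>Vh. ah Z v = hess_form \<Omega> W (Q v))"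

lemma represents_ritz: "W \<in> H20 \<Omega> \<Longrightarrow> represents W (Rh W)"
  using ritz by (simp add: represents_def ritz_projection_def)

lemma represents_comb:
  assumes "represents W Z" "represents W' Z'" shows "represents (r *\<^sub>R W + s *\<^sub>R W') (r *\<^sub>R Z + s *\<^sub>R Z')"
  unfolding represents_def
proof (intro conjI ballI)
  have H: "W \<in> H20 \<Omega>" "W' \<in> H20 \<Omega>" "Z \<in> Vh" "Z' \<in> Vh" using assms by (auto simp: represents_def)
  show "r *\<^sub>R W + s *\<^sub>R W' \<in> H20 \<Omega>" "r *\<^sub>R Z + s *\<^sub>R Z' \<in> Vh" using H H20_comb by auto
  fix v assume v: "v \<in> Vh"
  then show "ah (r *\<^sub>R Z + s *\<^sub>R Z') v = hess_form \<Omega> (r *\<^sub>R W + s *\<^sub>R W') (Q v)"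
    using assms H H20_Hm[OF Q_H20[OF v]] by (simp add: en.B_linear hess.B_linear H20_Hm represents_def)
qed

text \<open>Coercivity speaks only of \<open>h_norm\<close>, so definiteness in \<open>L2\<close>
  takes a detour: the smoother identifies \<open>z\<close> with \<open>Q z\<close>, the Hessian
  energy of \<open>Q z\<close> is the pairing of \<open>z\<close> with its Ritz projection and hence
  0, and \<open>Poincare_H20\<close> concludes.\<close>

lemma ah_null_imp_l2_null:
  assumes z: "z \<in> Vh" and n: "\<And>v. v \<in> Vh \<Longrightarrow> ah z v = 0" shows "l2norm \<Omega> z = 0"
proof -
  have L: "z \<in> L2 \<Omega>" "Q z \<in> L2 \<Omega>" using Vh_L2[OF z] H20_L2[OF Q_H20[OF z]] .
  have "l2norm \<Omega> (z - Q z) \<le> 0" using smoother_L2[OF z] n[OF z] by simp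
  moreover have "hess_form \<Omega> (Q z) (Q z) = 0"
  proof -
    have r: "represents (Q z) (Rh (Q z))" by (rule represents_ritz[OF Q_H20[OF z]])
    then have "hess_form \<Omega> (Q z) (Q z) = ah (Rh (Q z)) z" using z by (simp add: represents_def)
    also have "\<dots> = ah z (Rh (Q z))" using r z by (intro en.sym) (auto simp: represents_def)
    finally show ?thesis using n r by (simp add: represents_def)
  qed
  then have "l2norm \<Omega> (Q z) = 0" by (rule Poincare_H20[OF Q_H20[OF z]])
  moreover have "l2norm \<Omega> z \<le> l2norm \<Omega> (z - Q z) + l2norm \<Omega> (Q z)" using l2.N_triangle[of "z - Q z" \<Omega> "Q z"] L by simp
  ultimately show ?thesis using l2.N_nonneg[OF L(1)] by simp
qed

text \<open>\<open>Z\<close> and \<open>Rh W\<close> differ by an element that \<open>ah\<close>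
  annihilates, which has \<open>L2\<close> norm 0. Hence the Ritz estimate is available for
  difference quotients of projections.\<close>

lemma represents_estimate:
  assumes r: "represents W Z" and W: "W \<in> Hs (2 + \<gamma>) \<Omega>"
  shows "l2norm \<Omega> (W - Z) \<le> C2 * hh powr (2 * \<gamma>) * Hs_norm (2 + \<gamma>) \<Omega> W"
proof -
  have H: "W \<in> H20 \<Omega>" "Z \<in> Vh" using r by (auto simp: represents_def)
  have r': "represents W (Rh W)" by (rule represents_ritz[OF H(1)])
  have R: "Rh W \<in> Vh" using r' by (simp add: represents_def)
  have "l2norm \<Omega> (Rh W - Z) = 0"
  proof (rule ah_null_imp_l2_null)
    show "Rh W - Z \<in> Vh" using R H by auto
    show "ah (Rh W - Z) v = 0" if "v \<in> Vh" for v using r r' that R H by (simp add: en.B_linear represents_def)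
  qed
  moreover have "l2norm \<Omega> (W - Z) \<le> l2norm \<Omega> (W - Rh W) + l2norm \<Omega> (Rh W - Z)"
    by (intro l2.N_diff_triangle H20_L2 Vh_L2 H R)
  moreover have "l2norm \<Omega> (W - Rh W) \<le> C2 * hh powr (2 * \<gamma>) * Hs_norm (2 + \<gamma>) \<Omega> W"
  proof -
    have "l2norm \<Omega> (\<lambda>x. W x - Rh W x) + hh powr \<gamma> * h_norm \<T> (\<lambda>x. W x - Rh W x) \<le> C2 * hh powr (2 * \<gamma>) * Hs_norm (2 + \<gamma>) \<Omega> W"
      using ritz_est H(1) W unfolding ritz_estimate_def by blast
    moreover have "0 \<le> hh powr \<gamma> * h_norm \<T> (\<lambda>x. W x - Rh W x)" by (intro mult_nonneg_nonneg h_norm_nonneg) simp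
    ultimately show ?thesis by (simp add: fun_diff_def)
  qed
  ultimately show ?thesis by simp
qed

text \<open>The exponent is split as \<open>2 = (2 - 2 * \<gamma>) + 2 * \<gamma>\<close>, where the
  first part is nonnegative because \<gamma> \<le> 1 and is paid for with the diameter of the
  domain.\<close>

lemma mesh_size_square: "hh powr 2 \<le> diameter (closure \<Omega>) powr (2 - 2 * \<gamma>) * hh powr (2 * \<gamma>)"
proof -
  have "hh powr 2 = hh powr ((2 - 2 * \<gamma>) + 2 * \<gamma>)" by simp
  also have "\<dots> = hh powr (2 - 2 * \<gamma>) * hh powr (2 * \<gamma>)" by (rule powr_add)
  also have "\<dots> \<le> diameter (closure \<Omega>) powr (2 - 2 * \<gamma>) * hh powr (2 * \<gamma>)"
    using mesh_size_bounds \<gamma> by (intro mult_right_mono powr_mono2) auto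
  finally show ?thesis .
qed

end

section \<open>Stability and error estimate\<close>

text \<open>
  The telescoping quantity is \<open>E n - 2 * l n (p n)\<close>. Subtracting the second term sums
  \<open>l n (p n - p (n - 1))\<close> by parts, so that only the increments of \<open>l\<close> in \<open>n\<close> enter.
\<close>

lemma newmark_stability:
  assumes X: "semi_inner X B N" and V: "semi_inner V A M" and VX: "V \<subseteq> X" and k: "k > 0"
    and \<theta>: "\<And>n. n \<le> Suc m \<Longrightarrow> \<theta> n \<in> V" and \<theta>0: "\<theta> 0 = 0"
    and l: "\<And>n a b v w. n \<le> m \<Longrightarrow> v \<in> V \<Longrightarrow> w \<in> V \<Longrightarrow> l n (a *\<^sub>R v + b *\<^sub>R w) = a * l n v + b * l n w"
    and start: "\<And>v. v \<in> V \<Longrightarrow> 2 / k * B ((1 / k) *\<^sub>R (\<theta> 1 - \<theta> 0)) v + A ((1 / 2) *\<^sub>R (\<theta> 1 + \<theta> 0)) v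
      = 2 / k * B (r 0) v + l 0 v"
    and step: "\<And>n v. 1 \<le> n \<Longrightarrow> n \<le> m \<Longrightarrow> v \<in> V \<Longrightarrow>
      B ((1 / k\<^sup>2) *\<^sub>R (\<theta> (n + 1) - 2 *\<^sub>R \<theta> n + \<theta> (n - 1))) v
        + A ((1 / 4) *\<^sub>R (\<theta> (n + 1) + 2 *\<^sub>R \<theta> n + \<theta> (n - 1))) v = B (r n) v + l n v"
    and r: "\<And>n. n \<le> m \<Longrightarrow> r n \<in> X \<and> N (r n) \<le> \<rho> n"
    and G: "0 \<le> G" "\<And>n v. n \<le> m \<Longrightarrow> v \<in> V \<Longrightarrow> \<bar>l n v\<bar> \<le> G * M v"
    and \<delta>: "\<And>n. 0 \<le> \<delta> n" "\<And>n v. 1 \<le> n \<Longrightarrow> n \<le> m \<Longrightarrow> v \<in> V \<Longrightarrow> \<bar>l n v - l (n - 1) v\<bar> \<le> \<delta> n * M v"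
  shows "N (\<theta> (Suc m)) \<le> real (Suc m) * k * (\<rho> 0 + 3 * G + (\<Sum>n=1..m. 2 * k * \<rho> n + 2 * \<delta> n))"
proof -
  interpret X: semi_inner X B N by fact
  interpret V: semi_inner V A M by fact
  \<comment> \<open>\<open>d\<close> and \<open>p\<close> are the difference quotients and the
    averages at half steps; the scheme is the increment equation for this pair.\<close>
  define d where "d n = (1 / k) *\<^sub>R (\<theta> (Suc n) - \<theta> n)" for n
  define p where "p n = (1 / 2) *\<^sub>R (\<theta> (Suc n) + \<theta> n)" for n
  define E where "E n = (N (d n))\<^sup>2 + (M (p n))\<^sup>2" for n
  \<comment> \<open>The data collected up to step \<open>n\<close>, relative to \<open>S\<close>.
    The single \<open>G\<close> belongs to the starting step, where half of the subtracted
    \<open>2 * l 0 (p 0)\<close> is left over.\<close>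
  define c where "c n = \<rho> 0 + G + (\<Sum>n=1..n. 2 * k * \<rho> n + 2 * \<delta> n)" for n
  have dp: "d n \<in> V" "p n \<in> V" "d n \<in> X" if "n \<le> m" for n
    using \<theta>[of n] \<theta>[of "Suc n"] that VX by (auto simp: d_def p_def)
  have \<rho>: "0 \<le> \<rho> n" if "n \<le> m" for n using r[OF that] X.N_nonneg[of "r n"] by linarith
  \<comment> \<open>At an index of maximal energy \<open>S^2\<close>, all \<open>d n\<close> and
    \<open>p n\<close> are bounded by \<open>S\<close>. Every estimate below is linear in
    \<open>S\<close>, so dividing by it at the end replaces a discrete Gronwall argument.\<close>
  obtain i where i: "i \<le> m" "\<And>n. n \<le> m \<Longrightarrow> E n \<le> E i"
  proof -
    have "finite (E ` {..m})" "E ` {..m} \<noteq> {}" by auto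
    then have "Max (E ` {..m}) \<in> E ` {..m}" "\<forall>n\<le>m. E n \<le> Max (E ` {..m})" by (auto intro: Max_in Max_ge)
    then show ?thesis using that by (metis (no_types, lifting) atMost_iff imageE)
  qed
  define S where "S = sqrt (E i)"
  have E0: "0 \<le> E n" for n by (simp add: E_def)
  have S: "0 \<le> S" "S\<^sup>2 = E i" using E0 by (auto simp: S_def)
  have dS: "N (d n) \<le> S" and pS: "M (p n) \<le> S" if "n \<le> m" for n
  proof -
    have "(N (d n))\<^sup>2 \<le> S\<^sup>2" "(M (p n))\<^sup>2 \<le> S\<^sup>2" using i(2)[OF that] zero_le_power2[of "N (d n)"] zero_le_power2[of "M (p n)"] 
      unfolding S(2) E_def[of n] by linarith+
    then show "N (d n) \<le> S" "M (p n) \<le> S" using S(1) power2_le_imp_le by blast+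
  qed
  have E_eq: "E n = B (d n) (d n) + A (p n) (p n)" if "n \<le> m" for n
    using dp[OF that] by (simp add: E_def X.N_square V.N_square)
  have base: "E 0 - 2 * l 0 (p 0) \<le> c 0 * S"
  proof -
    have z: "d 0 \<in> V" "p 0 \<in> V" "d 0 \<in> X" "r 0 \<in> X" using dp[of 0] r[of 0] by auto
    \<comment> \<open>Because \<open>\<theta> 0 = 0\<close>, the test vector
      \<open>k *\<^sub>R d 0\<close> is also \<open>2 *\<^sub>R p 0\<close>; the first form produces
      the kinetic and the second the potential energy. The summand with coefficient 0 fits the
      linearity assumption on \<open>l\<close>.\<close>
    have e: "2 *\<^sub>R p 0 + 0 *\<^sub>R p 0 = k *\<^sub>R d 0" "2 *\<^sub>R p 0 = k *\<^sub>R d 0" using k \<theta>0 by (auto simp: p_def d_def)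
    have "2 / k * B (d 0) (k *\<^sub>R d 0) + A (p 0) (2 *\<^sub>R p 0) = 2 / k * B (r 0) (k *\<^sub>R d 0) + l 0 (2 *\<^sub>R p 0 + 0 *\<^sub>R p 0)"
    proof -
      have "2 / k * B (d 0) v + A (p 0) v = 2 / k * B (r 0) v + l 0 v" if "v \<in> V" for v
        using start[OF that] by (simp add: d_def p_def)
      from this[of "k *\<^sub>R d 0"] show ?thesis using z unfolding e by simp
    qed
    then have "E 0 = B (r 0) (d 0) + l 0 (p 0)" 
      using z k l[of 0 "p 0" "p 0" 2 0] E_eq[of 0] by (simp add: X.B_linear V.B_linear)
    moreover have "B (r 0) (d 0) \<le> \<rho> 0 * S"
      using X.B_le_N[of "r 0" "d 0"] z mult_mono[OF _ dS[of 0], of "N (r 0)" "\<rho> 0"] r[of 0] \<rho>[of 0] by fastforce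
    moreover have "- l 0 (p 0) \<le> G * S"
      using G(2)[of 0 "p 0"] z mult_left_mono[OF pS[of 0] G(1)] by fastforce
    ultimately show ?thesis by (simp add: c_def algebra_simps)
  qed
  have main: "E n - 2 * l n (p n) \<le> c n * S" if "n \<le> m" for n
    using that
  proof (induction n)
    case 0
    show ?case by (rule base)
  next
    case (Suc n)
    have z: "d n \<in> V" "p n \<in> V" "d n \<in> X" "d (Suc n) \<in> V" "p (Suc n) \<in> V" "d (Suc n) \<in> X" "r (Suc n) \<in> X"
      using dp[of n] dp[of "Suc n"] r[of "Suc n"] Suc.prems by auto
    \<comment> \<open>Half of the difference of \<theta> at the two outer time levels. Written with
      \<open>p\<close> it telescopes the potential energy, written with \<open>d\<close> the kinetic
      one.\<close>
    define v where "v = p (Suc n) - p n"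
    have v: "v = (k / 2) *\<^sub>R (d (Suc n) + d n)" "v \<in> V"
      using k z(2,5) by (simp add: v_def p_def d_def algebra_simps) (simp add: v_def z(2,5))
    have e1: "(1 / k\<^sup>2) *\<^sub>R (\<theta> (Suc n + 1) - 2 *\<^sub>R \<theta> (Suc n) + \<theta> (Suc n - 1)) = (1 / k) *\<^sub>R (d (Suc n) - d n)"
      by (simp add: d_def algebra_simps power2_eq_square scaleR_2)
    have e2: "(1 / 4) *\<^sub>R (\<theta> (Suc n + 1) + 2 *\<^sub>R \<theta> (Suc n) + \<theta> (Suc n - 1)) = (1 / 2) *\<^sub>R (p (Suc n) + p n)"
      by (simp add: p_def algebra_simps scaleR_2 flip: scaleR_left_distrib)
    have "B ((1 / k) *\<^sub>R (d (Suc n) - d n)) ((k / 2) *\<^sub>R (d (Suc n) + d n)) + A ((1 / 2) *\<^sub>R (p (Suc n) + p n)) (p (Suc n) - p n)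
        = B (r (Suc n)) v + l (Suc n) v"
      using step[of "Suc n" v] Suc.prems v(2) unfolding e1 e2 by (simp add: v(1)[symmetric] v_def[symmetric])
    moreover have "B ((1 / k) *\<^sub>R (d (Suc n) - d n)) ((k / 2) *\<^sub>R (d (Suc n) + d n)) = (B (d (Suc n)) (d (Suc n)) - B (d n) (d n)) / 2"
      using z k X.sym[of "d n" "d (Suc n)"] by (simp add: X.B_linear field_simps)
    moreover have "A ((1 / 2) *\<^sub>R (p (Suc n) + p n)) (p (Suc n) - p n) = (A (p (Suc n)) (p (Suc n)) - A (p n) (p n)) / 2"
      using z V.sym[of "p n" "p (Suc n)"] by (simp add: V.B_linear field_simps)
    moreover have "l (Suc n) v = l (Suc n) (p (Suc n)) - l (Suc n) (p n)"
      using l[of "Suc n" "p (Suc n)" "p n" 1 "-1"] Suc.prems z by (simp add: v_def)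
    \<comment> \<open>Summation by parts: \<open>l (Suc n) v\<close> equals the increment of
      \<open>l n (p n)\<close> minus the increment of the functional at the fixed vector
      \<open>p n\<close>.\<close>
    ultimately have eq: "E (Suc n) - 2 * l (Suc n) (p (Suc n)) = E n - 2 * l n (p n) + 2 * B (r (Suc n)) v - 2 * (l (Suc n) (p n) - l n (p n))"
      using E_eq[of n] E_eq[of "Suc n"] Suc.prems by (simp add: field_simps)
    have arith: "e + 2 * b - 2 * q \<le> z + 2 * x + 2 * y" if "b \<le> x" "- q \<le> y" "e \<le> z" for b x q y e z :: real
      using that by linarith
    have "N v \<le> k * S"
    proof -
      have "N v = k / 2 * N (d (Suc n) + d n)" using v(1) z k by (simp add: X.N_scale)
      also have "\<dots> \<le> k / 2 * (S + S)"
        using k X.N_triangle[of "d (Suc n)" "d n"] z dS[of n] dS[of "Suc n"] Suc.prems by (intro mult_left_mono) auto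
      finally show ?thesis by simp
    qed
    then have "B (r (Suc n)) v \<le> \<rho> (Suc n) * (k * S)"
      using X.B_le_N[of "r (Suc n)" v] z v VX mult_mono[of "N (r (Suc n))" "\<rho> (Suc n)" "N v" "k * S"] r[of "Suc n"] \<rho>[of "Suc n"] Suc.prems
        X.N_nonneg[of v] by fastforce
    moreover have "- (l (Suc n) (p n) - l n (p n)) \<le> \<delta> (Suc n) * S"
      using \<delta>(2)[of "Suc n" "p n"] Suc.prems z mult_left_mono[OF pS[of n] \<delta>(1)[of "Suc n"]] by fastforce
    moreover have "E n - 2 * l n (p n) \<le> c n * S" using Suc by simp
    ultimately have "E (Suc n) - 2 * l (Suc n) (p (Suc n)) \<le> c n * S + 2 * (\<rho> (Suc n) * (k * S)) + 2 * (\<delta> (Suc n) * S)"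
      unfolding eq by (rule arith)
    also have "\<dots> = c (Suc n) * S" by (simp add: c_def algebra_simps)
    finally show ?case .
  qed
  \<comment> \<open>\<open>c i\<close> contains \<open>G\<close> once, and undoing the subtraction
    of \<open>2 * l i (p i)\<close> adds it twice more.\<close>
  define R where "R = \<rho> 0 + 3 * G + (\<Sum>n=1..m. 2 * k * \<rho> n + 2 * \<delta> n)"
  have R0: "0 \<le> R" unfolding R_def using \<rho> G(1) \<delta>(1) k by (intro add_nonneg_nonneg sum_nonneg mult_nonneg_nonneg) auto
  have "c i + 2 * G \<le> R"
  proof -
    have "(\<Sum>n=1..i. 2 * k * \<rho> n + 2 * \<delta> n) \<le> (\<Sum>n=1..m. 2 * k * \<rho> n + 2 * \<delta> n)"
      using i(1) \<rho> \<delta>(1) k by (intro sum_mono2 add_nonneg_nonneg mult_nonneg_nonneg) auto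
    then show ?thesis by (simp add: c_def R_def)
  qed
  moreover have "S\<^sup>2 \<le> (c i + 2 * G) * S"
  proof -
    have "l i (p i) \<le> G * S" using G(2)[of i "p i"] dp[OF i(1)] i(1) mult_left_mono[OF pS[OF i(1)] G(1)] by fastforce
    then show ?thesis using main[OF i(1)] S(2) by (simp add: algebra_simps)
  qed
  ultimately have "S\<^sup>2 \<le> R * S" using S(1) by (meson mult_right_mono order_trans)
  then have SR: "S \<le> R" using S(1) R0 by (cases "S = 0") (auto simp: power2_eq_square)
  \<comment> \<open>The energy controls difference quotients, not \<theta> itself in
    \<open>N\<close>; summing the increments from \<open>\<theta> 0 = 0\<close> recovers the
    norm.\<close>
  have "N (\<theta> n) \<le> real n * k * S" if "n \<le> Suc m" for n
    using that
  proof (induction n)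
    case 0
    show ?case by (simp add: \<theta>0)
  next
    case (Suc n)
    have t: "\<theta> n \<in> X" "d n \<in> X" using \<theta>[of n] dp[of n] Suc.prems VX by auto
    have "\<theta> (Suc n) = \<theta> n + k *\<^sub>R d n" using k by (simp add: d_def)
    then have "N (\<theta> (Suc n)) \<le> N (\<theta> n) + k * N (d n)" using X.N_triangle[of "\<theta> n" "k *\<^sub>R d n"] t k by (simp add: X.N_scale)
    also have "\<dots> \<le> real n * k * S + k * S" using Suc dS[of n] k by (intro add_mono mult_left_mono) auto
    finally show ?case by (simp add: algebra_simps)
  qed
  then have "N (\<theta> (Suc m)) \<le> real (Suc m) * k * S" by blast
  also have "\<dots> \<le> real (Suc m) * k * R" using SR k by (intro mult_left_mono) auto
  finally show ?thesis unfolding R_def .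
qed

text \<open>Consecutive windows have length \<open>2 * k\<close>, so each interval is counted at
  most twice and the sum telescopes into two primitives. For \<open>n = 0\<close> truncated
  subtraction reduces the window to the first interval.\<close>

lemma sum_window_integrals_le:
  fixes \<phi> :: "real \<Rightarrow> real"
  assumes k: "0 \<le> k" and m: "real (Suc m) * k \<le> T" and int: "\<phi> integrable_on {0..T}" and pos: "\<And>t. t \<in> {0..T} \<Longrightarrow> 0 \<le> \<phi> t"
  shows "(\<Sum>n\<le>m. integral {real (n - 1) * k..real (n + 1) * k} \<phi>) \<le> 2 * integral {0..T} \<phi>"
proof -
  define P where "P n = integral {0..real n * k} \<phi>" for n :: nat
  have le: "real n * k \<le> T" if "n \<le> Suc m" for n
  proof -
    have "real n * k \<le> real (Suc m) * k" using that k by (intro mult_right_mono) auto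
    then show ?thesis using m by linarith
  qed
  have P: "integral {real (n - 1) * k..real (n + 1) * k} \<phi> = P (n + 1) - P (n - 1)" if "n \<le> m" for n
  proof -
    have "integral {0..real (n - 1) * k} \<phi> + integral {real (n - 1) * k..real (n + 1) * k} \<phi> = integral {0..real (n + 1) * k} \<phi>"
      using le[of "n + 1"] that k
      by (intro Henstock_Kurzweil_Integration.integral_combine integrable_on_subinterval[OF int] mult_right_mono) (auto simp: )
    then show ?thesis by (simp add: P_def)
  qed
  have "(\<Sum>n\<le>j. P (n + 1) - P (n - 1)) = P (Suc j) + P j" for j by (induction j) (auto simp: P_def)
  then have eq: "(\<Sum>n\<le>m. integral {real (n - 1) * k..real (n + 1) * k} \<phi>) = P (Suc m) + P m" using P by simp
  have PT: "P n \<le> integral {0..T} \<phi>" if "n \<le> Suc m" for n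
    unfolding P_def using le[OF that] pos by (intro integral_subset_le integrable_on_subinterval[OF int] int) auto
  show ?thesis unfolding eq using add_mono[OF PT[of "Suc m"] PT[of m]] by simp
qed

text \<open>The average in step \<open>n\<close> of the scheme, where \<open>n = 0\<close> is the starting step.\<close>

definition avg :: "(nat \<Rightarrow> fn) \<Rightarrow> nat \<Rightarrow> fn" where
  "avg \<phi> n = (if n = 0 then (1 / 2) *\<^sub>R (\<phi> 1 + \<phi> 0) else (1 / 4) *\<^sub>R (\<phi> (n + 1) + 2 *\<^sub>R \<phi> n + \<phi> (n - 1)))"

section \<open>The error equation\<close>

locale fully_discrete = wave + discretization +
  fixes N :: nat and U :: "nat \<Rightarrow> fn"
  assumes N: "N \<ge> 1" and scheme: "implicit_scheme \<Omega> (T / real N) N Vh ah Rh u0 v0 f U"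
begin

definition k :: real where "k = T / real N"
definition tm :: "nat \<Rightarrow> real" where "tm n = real n * k"

lemma k_pos: "k > 0"
  using N T by (simp add: k_def)

lemma tm_in: "n \<le> N \<Longrightarrow> tm n \<in> {0..T}"
  using N T by (auto simp: tm_def k_def field_simps)

lemma tm_simps: "tm 0 = 0" "tm 1 = k" "tm (Suc 0) = k" "tm (n + 1) = tm n + k" "tm (Suc n) = tm n + k"
  "n \<ge> 1 \<Longrightarrow> tm (n - 1) = tm n - k" "Suc 0 \<le> n \<Longrightarrow> tm (n - Suc 0) = tm n - k"
  by (auto simp: tm_def algebra_simps of_nat_diff)

lemma u0_H20: "u0 \<in> H20 \<Omega>" and u_initial: "aeq \<Omega> (u 0) u0"
proof -
  show a: "aeq \<Omega> (u 0) u0" using sol by (simp add: weak_solution_def)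
  show "u0 \<in> H20 \<Omega>" by (rule H20_aeq[OF u_H20 a]) (use T in simp)
qed

text \<open>At \<open>n = 0\<close> the projection of \<open>u0\<close> is taken, since the scheme
  starts from it and \<open>Rh\<close> may treat \<open>u 0\<close> differently although the two
  agree almost everywhere.\<close>

definition Z :: "nat \<Rightarrow> fn" where "Z n = (if n = 0 then Rh u0 else Rh (u (tm n)))"
definition g :: "nat \<Rightarrow> fn" where "g n = f (tm n) - utt (tm n)"

lemma Z_represents: assumes n: "n \<le> N" shows "represents (u (tm n)) (Z n)"
proof (cases "n = 0")
  case True
  have "represents u0 (Rh u0)" by (rule represents_ritz[OF u0_H20])
  moreover have "hess_form \<Omega> (u 0) w = hess_form \<Omega> u0 w" for w by (rule hess_form_cong[OF u_initial aeq_refl])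
  moreover have "u 0 \<in> H20 \<Omega>" using u_H20[of 0] T by simp
  ultimately show ?thesis using True by (simp add: represents_def Z_def tm_simps)
next
  case False
  then show ?thesis using represents_ritz[OF u_H20[OF tm_in[OF n]]] by (simp add: Z_def)
qed

lemma in_spaces:
  assumes "n \<le> N"
  shows "Z n \<in> Vh" "Z n \<in> L2 \<Omega>" "U n \<in> Vh" "U n \<in> L2 \<Omega>" "g n \<in> L2 \<Omega>" "f (tm n) \<in> L2 \<Omega>" "utt (tm n) \<in> L2 \<Omega>" "u (tm n) \<in> L2 \<Omega>"
proof -
  show Z: "Z n \<in> Vh" using Z_represents[OF assms] by (simp add: represents_def)
  show U: "U n \<in> Vh" using scheme assms by (simp add: implicit_scheme_def Let_def)
  show "Z n \<in> L2 \<Omega>" "U n \<in> L2 \<Omega>" by (rule Vh_L2[OF Z], rule Vh_L2[OF U])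
  show f: "f (tm n) \<in> L2 \<Omega>" "utt (tm n) \<in> L2 \<Omega>"
    by (rule l2.cont_curve_in[OF f_cont tm_in[OF assms]], rule l2.cont_curve_in[OF utt_cont tm_in[OF assms]])
  show "g n \<in> L2 \<Omega>" unfolding g_def using f by auto
  show "u (tm n) \<in> L2 \<Omega>" by (rule H20_L2[OF u_H20[OF tm_in[OF assms]]])
qed

lemma avg_in:
  assumes n: "n < N"
  shows "avg Z n \<in> Vh" "avg g n \<in> L2 \<Omega>"
proof -
  have "n + 1 \<le> N" "n \<le> N" "n - 1 \<le> N" "1 \<le> N" "0 \<le> N" using n by auto
  note i = this[THEN in_spaces(1)] this[THEN in_spaces(5)]
  show "avg Z n \<in> Vh" "avg g n \<in> L2 \<Omega>" unfolding avg_def using i by auto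
qed

lemma ah_Z: "n \<le> N \<Longrightarrow> v \<in> Vh \<Longrightarrow> ah (Z n) v = ip \<Omega> (g n) (Q v)"
  using Z_represents[of n] hess_form_u[OF tm_in Q_H20] by (simp add: represents_def g_def)

text \<open>This form is visibly linear in \<open>v\<close>, as the stability estimate demands,
  without recourse to linearity of \<open>Q\<close>; \<open>defect_eq\<close> supplies the form that
  can be estimated.\<close>

definition defect :: "nat \<Rightarrow> fn \<Rightarrow> real" where "defect n v = ah (avg Z n) v - ip \<Omega> (avg g n) v"

lemma defect_eq:
  assumes n: "n < N" and v: "v \<in> Vh" shows "defect n v = ip \<Omega> (avg g n) (Q v - v)"
proof -
  have "n + 1 \<le> N" "n \<le> N" "n - 1 \<le> N" "1 \<le> N" "0 \<le> N" using n by auto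
  note i = this[THEN in_spaces(1)] this[THEN in_spaces(5)] this[THEN ah_Z, OF v]
  have q: "Q v \<in> L2 \<Omega>" "v \<in> L2 \<Omega>" using H20_L2[OF Q_H20[OF v]] Vh_L2[OF v] .
  have "ah (avg Z n) v = ip \<Omega> (avg g n) (Q v)"
    unfolding avg_def using i v q by (simp add: en.B_linear l2.B_linear)
  then show ?thesis using q avg_in[OF n] by (simp add: defect_def l2.diff_right)
qed

definition kap :: real where "kap = C1 * hh powr 2 / sqrt \<alpha>"

lemma kap_nonneg: "0 \<le> kap"
  using pos by (simp add: kap_def)

lemma ip_smoother_le:
  assumes w: "w \<in> L2 \<Omega>" and v: "v \<in> Vh" shows "\<bar>ip \<Omega> w (Q v - v)\<bar> \<le> kap * l2norm \<Omega> w * sqrt (ah v v)"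
proof -
  have q: "Q v \<in> L2 \<Omega>" "v \<in> L2 \<Omega>" using H20_L2[OF Q_H20[OF v]] Vh_L2[OF v] .
  have "\<bar>ip \<Omega> w (Q v - v)\<bar> \<le> l2norm \<Omega> w * l2norm \<Omega> (Q v - v)" using w q by (intro l2.Cauchy_Schwarz) auto
  also have "\<dots> \<le> l2norm \<Omega> w * (kap * sqrt (ah v v))"
    unfolding kap_def l2.N_diff_commute[OF q] by (intro mult_left_mono smoother_L2 v l2.N_nonneg w)
  also have "\<dots> = kap * l2norm \<Omega> w * sqrt (ah v v)" by simp
  finally show ?thesis .
qed

text \<open>The residual of the starting step is scaled by \<open>k / 2\<close>: the factor
  \<open>2 / k\<close> then stays outside and cancels against the test vector
  \<open>k *\<^sub>R d 0\<close> of the stability proof.\<close>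

definition res :: "nat \<Rightarrow> fn" where
  "res n = (if n = 0 then (1 / k) *\<^sub>R (Z 1 - Z 0) - ut 0 - (k / 2) *\<^sub>R ((1 / 2) *\<^sub>R (utt (tm 1) + utt (tm 0)))
    else (1 / k\<^sup>2) *\<^sub>R (Z (n + 1) - 2 *\<^sub>R Z n + Z (n - 1)) - (1 / 4) *\<^sub>R (utt (tm (n + 1)) + 2 *\<^sub>R utt (tm n) + utt (tm (n - 1))))"

text \<open>\<open>Z 0 - U 0\<close> vanishes only almost everywhere and is replaced by \<open>0\<close>.\<close>

definition err :: "nat \<Rightarrow> fn" where "err n = (if n = 0 then 0 else Z n - U n)"

text \<open>For \<open>n = 0\<close> both sides vanish, since \<open>U 0\<close> agrees almost
  everywhere with \<open>Rh u0\<close> and neither \<open>ip\<close> nor \<open>ah\<close>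
  distinguishes the two.\<close>

lemma err:
  assumes n: "n \<le> N"
  shows "err n \<in> Vh" and "v \<in> Vh \<Longrightarrow> ip \<Omega> (err n) v = ip \<Omega> (Z n) v - ip \<Omega> (U n) v"
    and "v \<in> Vh \<Longrightarrow> ah (err n) v = ah (Z n) v - ah (U n) v"
proof -
  note i = in_spaces[OF n]
  show "err n \<in> Vh" using i by (auto simp: err_def)
  have a: "aeq \<Omega> (U 0) (Rh u0)" using scheme by (simp add: implicit_scheme_def Let_def)
  have i0: "U 0 \<in> Vh" "Rh u0 \<in> Vh" using in_spaces(1,3)[of 0] by (simp_all add: Z_def)
  show "ip \<Omega> (err n) v = ip \<Omega> (Z n) v - ip \<Omega> (U n) v" if v: "v \<in> Vh"
    using i Vh_L2[OF v] ip_aeq[OF meas a aeq_refl, of v] by (auto simp: err_def Z_def l2.B_linear)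
  show "ah (err n) v = ah (Z n) v - ah (U n) v" if v: "v \<in> Vh"
    using i v ah_aeq[OF i0 v a] by (auto simp: err_def Z_def en.B_linear)
qed

text \<open>\<open>v0\<close> is exchanged for the value \<open>ut 0\<close> of the curve, from
  which the Taylor expansion of the starting step departs.\<close>

lemma scheme_start:
  assumes v: "v \<in> Vh"
  shows "2 / k * ip \<Omega> ((1 / k) *\<^sub>R (U 1 - U 0)) v + ah ((1 / 2) *\<^sub>R (U 1 + U 0)) v
    = ip \<Omega> ((1 / 2) *\<^sub>R (f (tm 1) + f (tm 0)) + (2 / k) *\<^sub>R ut 0) v"
proof -
  have "2 / k * ip \<Omega> (dt_half k U 0) v + ah (half_avg U 0) v
      = ip \<Omega> (\<lambda>x. half_avg (\<lambda>n. f (real n * k)) 0 x + 2 / k * v0 x) v"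
    using scheme v by (simp add: implicit_scheme_def Let_def k_def[symmetric])
  also have "dt_half k U 0 = (1 / k) *\<^sub>R (U 1 - U 0)" by (simp add: dt_half_def fun_eq_iff)
  also have "half_avg U 0 = (1 / 2) *\<^sub>R (U 1 + U 0)" by (simp add: half_avg_def fun_eq_iff)
  also have "ip \<Omega> (\<lambda>x. half_avg (\<lambda>n. f (real n * k)) 0 x + 2 / k * v0 x) v
      = ip \<Omega> ((1 / 2) *\<^sub>R (f (tm 1) + f (tm 0)) + (2 / k) *\<^sub>R ut 0) v"
  proof (rule ip_aeq[OF meas _ aeq_refl])
    have "aeq \<Omega> (ut 0) v0" using sol by (simp add: weak_solution_def)
    then show "aeq \<Omega> (\<lambda>x. half_avg (\<lambda>n. f (real n * k)) 0 x + 2 / k * v0 x) ((1 / 2) *\<^sub>R (f (tm 1) + f (tm 0)) + (2 / k) *\<^sub>R ut 0)"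
      unfolding aeq_def by eventually_elim (simp add: half_avg_def tm_def)
  qed
  finally show ?thesis .
qed

lemma scheme_step:
  assumes n: "1 \<le> n" "n < N" and v: "v \<in> Vh"
  shows "ip \<Omega> ((1 / k\<^sup>2) *\<^sub>R (U (n + 1) - 2 *\<^sub>R U n + U (n - 1))) v + ah ((1 / 4) *\<^sub>R (U (n + 1) + 2 *\<^sub>R U n + U (n - 1))) v
    = ip \<Omega> ((1 / 4) *\<^sub>R (f (tm (n + 1)) + 2 *\<^sub>R f (tm n) + f (tm (n - 1)))) v"
proof -
  have "n \<in> {1..N - 1}" using n by auto
  then have "ip \<Omega> (dtt k U n) v + ah (quarter_avg U n) v = ip \<Omega> (quarter_avg (\<lambda>n. f (real n * k)) n) v"
    using scheme v unfolding implicit_scheme_def Let_def k_def[symmetric] by blast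
  moreover have "dtt k U n = (1 / k\<^sup>2) *\<^sub>R (U (n + 1) - 2 *\<^sub>R U n + U (n - 1))" by (simp add: dtt_def fun_eq_iff)
  moreover have "quarter_avg \<phi> n = (1 / 4) *\<^sub>R (\<phi> (n + 1) + 2 *\<^sub>R \<phi> n + \<phi> (n - 1))" for \<phi> by (simp add: quarter_avg_def fun_eq_iff)
  ultimately show ?thesis by (simp add: tm_def)
qed

lemma ut0_L2: "ut 0 \<in> L2 \<Omega>"
  using l2.cont_curve_in[OF ut_cont, of 0] T by simp

text \<open>The energy term of \<open>Z\<close> equals the averaged \<open>f - utt\<close> plus the
  defect. On subtracting the scheme, \<open>f\<close> cancels and \<open>utt\<close> joins the
  difference quotients of \<open>Z\<close> in the residual.\<close>

lemma error_start:
  assumes v: "v \<in> Vh"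
  shows "2 / k * ip \<Omega> ((1 / k) *\<^sub>R (err 1 - err 0)) v + ah ((1 / 2) *\<^sub>R (err 1 + err 0)) v = 2 / k * ip \<Omega> (res 0) v + defect 0 v"
proof -
  have vL: "v \<in> L2 \<Omega>" by (rule Vh_L2[OF v])
  note s = in_spaces[OF N] in_spaces[OF le0] err(1)[OF N] err(1)[OF le0] Vh_L2[OF err(1)[OF N]] Vh_L2[OF err(1)[OF le0]] ut0_L2 v vL
  note e = err(2,3)[OF N v] err(2,3)[OF le0 v]
  have e1: "2 / k * (1 / k * (ip \<Omega> (U 1) v - ip \<Omega> (U 0) v)) + 1 / 2 * (ah (U 1) v + ah (U 0) v)
    = 1 / 2 * (ip \<Omega> (f (tm 1)) v + ip \<Omega> (f (tm 0)) v) + 2 / k * ip \<Omega> (ut 0) v"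
    using scheme_start[OF v] s by (simp only: en.B_linear l2.B_linear l2.X_closed en.X_closed)
  have e2: "2 / k * ip \<Omega> ((1 / k) *\<^sub>R (err 1 - err 0)) v + ah ((1 / 2) *\<^sub>R (err 1 + err 0)) v
    = 2 / k * (1 / k * ((ip \<Omega> (Z 1) v - ip \<Omega> (U 1) v) - (ip \<Omega> (Z 0) v - ip \<Omega> (U 0) v)))
      + 1 / 2 * ((ah (Z 1) v - ah (U 1) v) + (ah (Z 0) v - ah (U 0) v))"
    using s by (simp only: en.B_linear l2.B_linear l2.X_closed en.X_closed e)
  have e3: "defect 0 v = 1 / 2 * (ah (Z 1) v + ah (Z 0) v)
      - 1 / 2 * ((ip \<Omega> (f (tm 1)) v - ip \<Omega> (utt (tm 1)) v) + (ip \<Omega> (f (tm 0)) v - ip \<Omega> (utt (tm 0)) v))"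
    unfolding defect_def avg_def g_def using s by (simp only: en.B_linear l2.B_linear l2.X_closed en.X_closed if_True simp_thms)
  have e4: "ip \<Omega> (res 0) v = 1 / k * (ip \<Omega> (Z 1) v - ip \<Omega> (Z 0) v) - ip \<Omega> (ut 0) v
      - k / 2 * (1 / 2 * (ip \<Omega> (utt (tm 1)) v + ip \<Omega> (utt (tm 0)) v))"
    unfolding res_def using s by (simp only: l2.B_linear l2.X_closed if_True simp_thms)
  have c: "2 / k * (k / 2 * y) = y" for y using k_pos by simp
  show ?thesis unfolding e2 e3 e4 right_diff_distrib[of "2 / k"] c using e1 by (simp add: algebra_simps)
qed

lemma error_step:
  assumes n: "1 \<le> n" "n < N" and v: "v \<in> Vh"
  shows "ip \<Omega> ((1 / k\<^sup>2) *\<^sub>R (err (n + 1) - 2 *\<^sub>R err n + err (n - 1))) v + ah ((1 / 4) *\<^sub>R (err (n + 1) + 2 *\<^sub>R err n + err (n - 1))) v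
    = ip \<Omega> (res n) v + defect n v"
proof -
  have vL: "v \<in> L2 \<Omega>" by (rule Vh_L2[OF v])
  have ns: "n + 1 \<le> N" "n \<le> N" "n - 1 \<le> N" "n \<noteq> 0" using n by auto
  note s = ns(1-3)[THEN in_spaces(1)] ns(1-3)[THEN in_spaces(2)] ns(1-3)[THEN in_spaces(3)] ns(1-3)[THEN in_spaces(4)]
    ns(1-3)[THEN in_spaces(6)] ns(1-3)[THEN in_spaces(7)] ns(1-3)[THEN err(1)] ns(1-3)[THEN err(1), THEN Vh_L2] v vL
  note e = ns(1-3)[THEN err(2), OF v] ns(1-3)[THEN err(3), OF v]
  have "1 / k\<^sup>2 * (ip \<Omega> (U (n + 1)) v - 2 * ip \<Omega> (U n) v + ip \<Omega> (U (n - 1)) v) + 1 / 4 * (ah (U (n + 1)) v + 2 * ah (U n) v + ah (U (n - 1)) v)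
    = 1 / 4 * (ip \<Omega> (f (tm (n + 1))) v + 2 * ip \<Omega> (f (tm n)) v + ip \<Omega> (f (tm (n - 1))) v)"
    using scheme_step[OF n v] s by (simp only: en.B_linear l2.B_linear l2.X_closed en.X_closed)
  moreover have "ip \<Omega> ((1 / k\<^sup>2) *\<^sub>R (err (n + 1) - 2 *\<^sub>R err n + err (n - 1))) v + ah ((1 / 4) *\<^sub>R (err (n + 1) + 2 *\<^sub>R err n + err (n - 1))) v
    = 1 / k\<^sup>2 * ((ip \<Omega> (Z (n + 1)) v - ip \<Omega> (U (n + 1)) v) - 2 * (ip \<Omega> (Z n) v - ip \<Omega> (U n) v) + (ip \<Omega> (Z (n - 1)) v - ip \<Omega> (U (n - 1)) v))
      + 1 / 4 * ((ah (Z (n + 1)) v - ah (U (n + 1)) v) + 2 * (ah (Z n) v - ah (U n) v) + (ah (Z (n - 1)) v - ah (U (n - 1)) v))"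
    using s by (simp only: en.B_linear l2.B_linear l2.X_closed en.X_closed e)
  moreover have "defect n v = 1 / 4 * (ah (Z (n + 1)) v + 2 * ah (Z n) v + ah (Z (n - 1)) v)
      - 1 / 4 * ((ip \<Omega> (f (tm (n + 1))) v - ip \<Omega> (utt (tm (n + 1))) v) + 2 * (ip \<Omega> (f (tm n)) v - ip \<Omega> (utt (tm n)) v)
        + (ip \<Omega> (f (tm (n - 1))) v - ip \<Omega> (utt (tm (n - 1))) v))"
    unfolding defect_def avg_def g_def using s ns(4) by (simp only: en.B_linear l2.B_linear l2.X_closed en.X_closed if_False)
  moreover have "ip \<Omega> (res n) v = 1 / k\<^sup>2 * (ip \<Omega> (Z (n + 1)) v - 2 * ip \<Omega> (Z n) v + ip \<Omega> (Z (n - 1)) v)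
      - 1 / 4 * (ip \<Omega> (utt (tm (n + 1))) v + 2 * ip \<Omega> (utt (tm n)) v + ip \<Omega> (utt (tm (n - 1))) v)"
    unfolding res_def using s ns(4) by (simp only: l2.B_linear l2.X_closed if_False)
  ultimately show ?thesis by (simp add: algebra_simps)
qed

section \<open>Bounds for residuals and defects\<close>

abbreviation win :: "(real \<Rightarrow> real) \<Rightarrow> nat \<Rightarrow> real" where "win \<phi> n \<equiv> integral {tm (n - 1)..tm (n + 1)} \<phi>"
abbreviation H :: real where "H \<equiv> hh powr (2 * \<gamma>)"
abbreviation hsn :: "fn \<Rightarrow> real" where "hsn \<equiv> Hs_norm (2 + \<gamma>) \<Omega>"

lemma window: assumes "1 \<le> n" "n < N" shows "{tm n - k..tm n + k} \<subseteq> {0..T}" "{tm n - k..tm n + k} = {tm (n - 1)..tm (n + 1)}"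
proof -
  show e: "{tm n - k..tm n + k} = {tm (n - 1)..tm (n + 1)}" using assms by (simp add: tm_simps)
  have "tm (n - 1) \<in> {0..T}" "tm (n + 1) \<in> {0..T}" using assms by (auto intro!: tm_in simp del: atLeastAtMost_iff)
  then show "{tm n - k..tm n + k} \<subseteq> {0..T}" unfolding e by auto
qed

lemma u_Hs: "t \<in> {0..T} \<Longrightarrow> u t \<in> Hs (2 + \<gamma>) \<Omega>"
  by (rule semi_inner.cont_curve_in[OF hs u_Hs_cont])

text \<open>The residual is the Taylor remainder of \<open>u\<close> minus the Ritz error of the
  difference quotient \<open>?W\<close>. Estimating \<open>?W\<close> as a whole, through the
  derivative of \<open>u\<close>, avoids a negative power of \<open>k\<close>.\<close>

lemma res_start_bound: "res 0 \<in> L2 \<Omega>" "l2norm \<Omega> (res 0) \<le> C2 * H * Linf_norm T hsn ut + 2 * k\<^sup>2 * Linf_norm T (l2norm \<Omega>) uttt"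
proof -
  interpret hs: semi_inner "Hs (2 + \<gamma>) \<Omega>" "Hs_ip (2 + \<gamma>) \<Omega>" hsn by (rule hs)
  note s = in_spaces[OF N] in_spaces[OF le0] ut0_L2
  show L: "res 0 \<in> L2 \<Omega>" unfolding res_def using s by (simp only: l2.X_closed if_True simp_thms)
  let ?W = "(1 / k) *\<^sub>R u (tm 1) + (- 1 / k) *\<^sub>R u (tm 0)" and ?Z = "(1 / k) *\<^sub>R Z 1 + (- 1 / k) *\<^sub>R Z 0"
  let ?t = "(1 / k) *\<^sub>R (u k - u 0) - ut 0 - (k / 2) *\<^sub>R ((1 / 2) *\<^sub>R (utt k + utt 0))"
  have k1: "{0..k} \<subseteq> {0..T}" "k \<in> {0..T}" "0 \<in> {0..T}" using tm_in[OF N] T by (auto simp: tm_simps)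
  have uH: "u k \<in> Hs (2 + \<gamma>) \<Omega>" "u 0 \<in> Hs (2 + \<gamma>) \<Omega>" using u_Hs k1 by auto
  have e: "?W = (1 / k) *\<^sub>R (u k - u 0)" by (simp add: tm_simps algebra_simps)
  have WZ: "?W \<in> L2 \<Omega>" "?Z \<in> L2 \<Omega>" using s by auto
  have t: "?t \<in> L2 \<Omega>" using s by (auto simp: tm_simps)
  have "l2norm \<Omega> (?W - ?Z) \<le> C2 * H * hsn ?W"
    using uH by (intro represents_estimate represents_comb Z_represents N le0) (auto simp: tm_simps)
  moreover have "hsn ?W \<le> Linf_norm T hsn ut"
  proof -
    have "hsn (u k - u 0) \<le> (k - 0) * Linf_norm T hsn ut"
      using k1 k_pos by (intro hs.deriv_curve_bound_const[OF hs.deriv_curve_subset[OF u_Hs_deriv]] cont_curve_Linf(2)[OF T hs.semi_inner_axioms ut_Hs_cont]) auto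
    moreover have "hsn ((1 / k) *\<^sub>R (u k - u 0)) = 1 / k * hsn (u k - u 0)"
      using uH k_pos hs.N_scale[of "u k - u 0" "1 / k"] by simp
    ultimately show ?thesis unfolding e using k_pos by (simp add: pos_divide_le_eq mult.commute)
  qed
  then have "C2 * H * hsn ?W \<le> C2 * H * Linf_norm T hsn ut" using pos by (intro mult_left_mono) auto
  moreover have "l2norm \<Omega> ?t \<le> 2 * k\<^sup>2 * Linf_norm T (l2norm \<Omega>) uttt"
    using k1 by (intro l2.start_truncation_bound[OF u_deriv ut_deriv utt_deriv _ k_pos] cont_curve_Linf(2)[OF T l2.semi_inner_axioms uttt_cont]) auto
  moreover have "res 0 = ?t - (?W - ?Z)" by (simp add: res_def tm_simps algebra_simps)
  then have "l2norm \<Omega> (res 0) \<le> l2norm \<Omega> ?t + l2norm \<Omega> (?W - ?Z)"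
    using l2.N_triangle_diff[of ?t \<Omega> "?W - ?Z"] t WZ by simp
  ultimately show "l2norm \<Omega> (res 0) \<le> C2 * H * Linf_norm T hsn ut + 2 * k\<^sup>2 * Linf_norm T (l2norm \<Omega>) uttt" by linarith
qed

text \<open>Truncation error plus Ritz error of a second difference of \<open>u\<close>, which is
  \<open>k\<close> times a window integral of u_tt in the strong norm. The factor \<open>k\<close>
  is included on the left because stability sums \<open>k\<close> times the residuals, so that the
  windows add up to integrals over the whole time interval.\<close>

lemma res_bound:
  assumes n: "1 \<le> n" "n < N"
  shows "res n \<in> L2 \<Omega>"
    "k * l2norm \<Omega> (res n) \<le> C2 * H * win (\<lambda>t. hsn (utt t)) n + 2 * k\<^sup>2 * win (\<lambda>t. l2norm \<Omega> (utttt t)) n"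
proof -
  interpret hs: semi_inner "Hs (2 + \<gamma>) \<Omega>" "Hs_ip (2 + \<gamma>) \<Omega>" hsn by (rule hs)
  have ns: "n + 1 \<le> N" "n \<le> N" "n - 1 \<le> N" "n \<noteq> 0" using n by auto
  note s = ns(1-3)[THEN in_spaces(2)] ns(1-3)[THEN in_spaces(7)] ns(1-3)[THEN in_spaces(8)]
  show L: "res n \<in> L2 \<Omega>" unfolding res_def using s ns(4) by (simp only: l2.X_closed if_False)
  define W where "W = u (tm (n + 1)) - 2 *\<^sub>R u (tm n) + u (tm (n - 1))"
  define Y where "Y = Z (n + 1) - 2 *\<^sub>R Z n + Z (n - 1)"
  let ?t = "(1 / k\<^sup>2) *\<^sub>R W - (1 / 4) *\<^sub>R (utt (tm (n + 1)) + 2 *\<^sub>R utt (tm n) + utt (tm (n - 1)))"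
  have WY: "W \<in> L2 \<Omega>" "Y \<in> L2 \<Omega>" "?t \<in> L2 \<Omega>" using s by (auto simp: W_def Y_def)
  have c: "represents (1 *\<^sub>R (1 *\<^sub>R u (tm (n + 1)) + (- 2) *\<^sub>R u (tm n)) + 1 *\<^sub>R u (tm (n - 1))) (1 *\<^sub>R (1 *\<^sub>R Z (n + 1) + (- 2) *\<^sub>R Z n) + 1 *\<^sub>R Z (n - 1))"
    by (intro represents_comb Z_represents ns)
  have r: "represents W Y" using c by (simp add: W_def Y_def)
  have uH: "u (tm (n + 1)) \<in> Hs (2 + \<gamma>) \<Omega>" "u (tm n) \<in> Hs (2 + \<gamma>) \<Omega>" "u (tm (n - 1)) \<in> Hs (2 + \<gamma>) \<Omega>"
    by (intro u_Hs tm_in ns)+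
  have WH: "W \<in> Hs (2 + \<gamma>) \<Omega>" unfolding W_def using uH by auto
  have w: "W = u (tm n + k) - 2 *\<^sub>R u (tm n) + u (tm n - k)" using n by (simp add: W_def tm_simps)
  have "hsn W \<le> k * win (\<lambda>t. hsn (utt t)) n"
    unfolding w window(2)[OF n, symmetric] by (intro hs.second_difference_bound[OF u_Hs_deriv ut_Hs_deriv utt_Hs_cont window(1)[OF n]] less_imp_le k_pos)
  then have "C2 * H * hsn W \<le> C2 * H * (k * win (\<lambda>t. hsn (utt t)) n)" using pos by (intro mult_left_mono) auto
  then have a: "l2norm \<Omega> (W - Y) \<le> C2 * H * (k * win (\<lambda>t. hsn (utt t)) n)" using represents_estimate[OF r WH] by linarith
  have "tm (n + 1) = tm n + k" "tm (n - 1) = tm n - k" using n by (auto simp: tm_simps)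
  then have b: "l2norm \<Omega> ?t \<le> 2 * k * win (\<lambda>t. l2norm \<Omega> (utttt t)) n"
    using l2.truncation_bound[OF u_deriv ut_deriv utt_deriv uttt_deriv utttt_cont window(1)[OF n] k_pos] by (simp add: W_def)
  have "res n = ?t - (1 / k\<^sup>2) *\<^sub>R (W - Y)" by (simp only: res_def ns(4) if_False Y_def[symmetric]) (simp add: scaleR_right_diff_distrib)
  then have "l2norm \<Omega> (res n) \<le> l2norm \<Omega> ?t + 1 / k\<^sup>2 * l2norm \<Omega> (W - Y)"
    using l2.N_triangle_diff[of ?t \<Omega> "(1 / k\<^sup>2) *\<^sub>R (W - Y)"] WY by (simp add: l2.N_scale)
  also have "\<dots> \<le> 2 * k * win (\<lambda>t. l2norm \<Omega> (utttt t)) n + 1 / k\<^sup>2 * (C2 * H * (k * win (\<lambda>t. hsn (utt t)) n))"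
    by (intro add_mono mult_left_mono a b) auto
  finally have "k * l2norm \<Omega> (res n) \<le> k * (2 * k * win (\<lambda>t. l2norm \<Omega> (utttt t)) n + 1 / k\<^sup>2 * (C2 * H * (k * win (\<lambda>t. hsn (utt t)) n)))"
    using k_pos by (intro mult_left_mono) auto
  also have "\<dots> = C2 * H * win (\<lambda>t. hsn (utt t)) n + 2 * k\<^sup>2 * win (\<lambda>t. l2norm \<Omega> (utttt t)) n"
    using k_pos by (simp add: field_simps power2_eq_square)
  finally show "k * l2norm \<Omega> (res n) \<le> C2 * H * win (\<lambda>t. hsn (utt t)) n + 2 * k\<^sup>2 * win (\<lambda>t. l2norm \<Omega> (utttt t)) n" .
qed

text \<open>A majorant for the norm of the time derivative of \<open>f - utt\<close>, split because
  the final bound lists the two norms separately.\<close>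

abbreviation gt :: "real \<Rightarrow> real" where "gt \<equiv> \<lambda>t. l2norm \<Omega> (ft t) + l2norm \<Omega> (uttt t)"

lemma g_sup: assumes "n \<le> N" shows "l2norm \<Omega> (g n) \<le> Linf_norm T (l2norm \<Omega>) f + Linf_norm T (l2norm \<Omega>) utt"
proof -
  have "l2norm \<Omega> (g n) \<le> l2norm \<Omega> (f (tm n)) + l2norm \<Omega> (utt (tm n))"
    unfolding g_def by (intro l2.N_triangle_diff in_spaces assms)
  then show ?thesis
    using cont_curve_Linf(2)[OF T l2.semi_inner_axioms f_cont tm_in[OF assms]] cont_curve_Linf(2)[OF T l2.semi_inner_axioms utt_cont tm_in[OF assms]]
    by linarith
qed

lemma avg_g_sup: assumes n: "n < N" shows "l2norm \<Omega> (avg g n) \<le> Linf_norm T (l2norm \<Omega>) f + Linf_norm T (l2norm \<Omega>) utt"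
proof (cases "n = 0")
  case True
  note s = in_spaces(5)[OF N] in_spaces(5)[OF le0]
  have "l2norm \<Omega> (avg g n) \<le> 1 / 2 * (l2norm \<Omega> (g 1) + l2norm \<Omega> (g 0))"
    using True s l2.N_triangle[OF s] by (simp add: avg_def l2.N_scale)
  then show ?thesis using g_sup[OF N] g_sup[OF le0] by simp
next
  case False
  have ns: "n + 1 \<le> N" "n \<le> N" "n - 1 \<le> N" using n by auto
  note s = ns[THEN in_spaces(5)]
  have "l2norm \<Omega> (avg g n) = 1 / 4 * l2norm \<Omega> (g (n + 1) + 2 *\<^sub>R g n + g (n - 1))"
    unfolding avg_def using False s l2.N_scale[of "g (n + 1) + 2 *\<^sub>R g n + g (n - 1)" \<Omega> "1 / 4"] by simp
  moreover have x: "2 *\<^sub>R g n \<in> L2 \<Omega>" by (rule l2.X_closed(4)[OF s(2)])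
  moreover have "l2norm \<Omega> (2 *\<^sub>R g n) = 2 * l2norm \<Omega> (g n)" using l2.N_scale[OF s(2), of 2] by simp
  ultimately show ?thesis
    using l2.N_triangle[OF l2.X_closed(2)[OF s(1) x] s(3)] l2.N_triangle[OF s(1) x] ns[THEN g_sup] by linarith
qed

lemma gt_integrable: "{a..b} \<subseteq> {0..T} \<Longrightarrow> gt integrable_on {a..b}"
  by (rule integrable_add[OF l2.cont_curve_N_integrable[OF ft_cont] l2.cont_curve_N_integrable[OF uttt_cont]])

lemma gt_nonneg: "t \<in> {0..T} \<Longrightarrow> 0 \<le> gt t"
  by (intro add_nonneg_nonneg l2.N_nonneg l2.cont_curve_in[OF ft_cont] l2.cont_curve_in[OF uttt_cont])

lemma win_gt_nonneg: "n < N \<Longrightarrow> 0 \<le> win gt n"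
proof -
  assume n: "n < N"
  have "tm (n - 1) \<in> {0..T}" "tm (n + 1) \<in> {0..T}" using n by (auto intro!: tm_in simp del: atLeastAtMost_iff)
  then have "{tm (n - 1)..tm (n + 1)} \<subseteq> {0..T}" by auto
  then show ?thesis using gt_nonneg by (intro integral_nonneg gt_integrable) auto
qed

lemma g_increment: assumes n: "1 \<le> n" "n < N" shows "l2norm \<Omega> (g (n + 1) - g (n - 1)) \<le> win gt n"
proof -
  have sub: "{tm (n - 1)..tm (n + 1)} \<subseteq> {0..T}" "tm (n - 1) \<le> tm (n + 1)" 
    using window[OF n] by (simp only:) (use n k_pos in \<open>simp add: tm_simps\<close>)
  have d: "l2.deriv_curve \<Omega> {0..T} (\<lambda>t. f t - utt t) (\<lambda>t. ft t - uttt t)" by (rule l2.deriv_curve_diff[OF f_deriv utt_deriv])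
  have d': "l2.cont_curve \<Omega> {0..T} (\<lambda>t. ft t - uttt t)" by (rule l2.cont_curve_diff[OF ft_cont uttt_cont])
  have "l2norm \<Omega> (g (n + 1) - g (n - 1)) \<le> integral {tm (n - 1)..tm (n + 1)} (\<lambda>t. l2norm \<Omega> (ft t - uttt t))"
    using l2.deriv_curve_increment[OF d d' sub] by (simp add: g_def)
  also have "\<dots> \<le> win gt n"
  proof (rule integral_le)
    show "(\<lambda>t. l2norm \<Omega> (ft t - uttt t)) integrable_on {tm (n - 1)..tm (n + 1)}" by (rule l2.cont_curve_N_integrable[OF d' sub(1)])
    show "gt integrable_on {tm (n - 1)..tm (n + 1)}" by (rule gt_integrable[OF sub(1)])
    show "l2norm \<Omega> (ft t - uttt t) \<le> gt t" if "t \<in> {tm (n - 1)..tm (n + 1)}" for t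
      using that sub(1) by (intro l2.N_triangle_diff l2.cont_curve_in[OF ft_cont] l2.cont_curve_in[OF uttt_cont]) auto
  qed
  finally show ?thesis .
qed

text \<open>Neighbouring averages differ by a quarter of two increments of \<open>g\<close>, each
  over two steps. At \<open>n = 1\<close> the preceding average is the one of the starting step, and
  a single increment remains.\<close>

lemma avg_g_increment: assumes n: "1 \<le> n" "n < N" shows "l2norm \<Omega> (avg g n - avg g (n - 1)) \<le> win gt n + win gt (n - 1)"
proof (cases "n = 1")
  case True
  have s: "g 0 \<in> L2 \<Omega>" "g 1 \<in> L2 \<Omega>" "g 2 \<in> L2 \<Omega>" using n True by (auto intro!: in_spaces)
  have "avg g n - avg g (n - 1) = (1 / 4) *\<^sub>R (g (n + 1) - g (n - 1))"
    using True by (simp add: avg_def fun_eq_iff numeral_2_eq_2 add_divide_distrib)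
  then have "l2norm \<Omega> (avg g n - avg g (n - 1)) = 1 / 4 * l2norm \<Omega> (g (n + 1) - g (n - 1))"
    using s True by (simp add: l2.N_scale numeral_2_eq_2)
  moreover have "0 \<le> l2norm \<Omega> (g (n + 1) - g (n - 1))" using s True by (simp add: numeral_2_eq_2)
  ultimately show ?thesis using g_increment[OF n] win_gt_nonneg[of "n - 1"] n by linarith
next
  case False
  then have n2: "1 \<le> n - 1" "n - 1 < N" using n by auto
  have ns: "n + 1 \<le> N" "n \<le> N" "n - 1 \<le> N" "n - 1 - 1 \<le> N" using n by auto
  note s = ns[THEN in_spaces(5)]
  have e: "n - 1 + 1 = n" using n by simp
  have a: "l2norm \<Omega> (g (n + 1) - g (n - 1)) \<le> win gt n" by (rule g_increment[OF n])
  have b: "l2norm \<Omega> (g n - g (n - 1 - 1)) \<le> win gt (n - 1)" using g_increment[OF n2] unfolding e .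
  have "avg g n - avg g (n - 1) = (1 / 4) *\<^sub>R ((g (n + 1) - g (n - 1)) + (g n - g (n - 1 - 1)))"
  proof -
    define j where "j = n - 2"
    have j: "n = Suc (Suc j)" using n2 by (simp add: j_def)
    show ?thesis unfolding j avg_def by (simp add: fun_eq_iff field_simps)
  qed
  then have "l2norm \<Omega> (avg g n - avg g (n - 1)) = 1 / 4 * l2norm \<Omega> ((g (n + 1) - g (n - 1)) + (g n - g (n - 1 - 1)))"
    using s l2.N_scale[of "(g (n + 1) - g (n - 1)) + (g n - g (n - 1 - 1))" \<Omega> "1 / 4"] by (simp only: l2.X_closed)
  also have "\<dots> \<le> 1 / 4 * (l2norm \<Omega> (g (n + 1) - g (n - 1)) + l2norm \<Omega> (g n - g (n - 1 - 1)))"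
    using s by (intro mult_left_mono l2.N_triangle) auto
  finally have c: "l2norm \<Omega> (avg g n - avg g (n - 1)) \<le> 1 / 4 * (l2norm \<Omega> (g (n + 1) - g (n - 1)) + l2norm \<Omega> (g n - g (n - 1 - 1)))" .
  have arith: "x \<le> a + b" if "x \<le> 1 / 4 * (p + q)" "p \<le> a" "q \<le> b" "0 \<le> a" "0 \<le> b" for x p q a b :: real using that by (simp add: field_simps)
  show ?thesis by (rule arith[OF c a b win_gt_nonneg[OF n(2)] win_gt_nonneg[OF n2(2)]])
qed

lemma defect_bound:
  assumes "n < N" "v \<in> Vh"
  shows "\<bar>defect n v\<bar> \<le> kap * (Linf_norm T (l2norm \<Omega>) f + Linf_norm T (l2norm \<Omega>) utt) * sqrt (ah v v)"
proof -
  have "\<bar>defect n v\<bar> \<le> kap * l2norm \<Omega> (avg g n) * sqrt (ah v v)"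
    unfolding defect_eq[OF assms] by (rule ip_smoother_le[OF avg_in(2)[OF assms(1)] assms(2)])
  also have "\<dots> \<le> kap * (Linf_norm T (l2norm \<Omega>) f + Linf_norm T (l2norm \<Omega>) utt) * sqrt (ah v v)"
    using assms by (intro mult_right_mono mult_left_mono avg_g_sup kap_nonneg) (auto simp: en.pos)
  finally show ?thesis .
qed

text \<open>The payoff of the summation by parts: the increment falls on the averages of
  \<open>g\<close>, so no difference quotient of the discrete error is left to be smoothed.\<close>

lemma defect_increment:
  assumes n: "1 \<le> n" "n < N" and v: "v \<in> Vh"
  shows "\<bar>defect n v - defect (n - 1) v\<bar> \<le> kap * (win gt n + win gt (n - 1)) * sqrt (ah v v)"
proof -
  have n': "n - 1 < N" using n by simp
  have L: "avg g n \<in> L2 \<Omega>" "avg g (n - 1) \<in> L2 \<Omega>" "Q v - v \<in> L2 \<Omega>"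
    using avg_in n n' H20_L2[OF Q_H20[OF v]] Vh_L2[OF v] by auto
  have "defect n v - defect (n - 1) v = ip \<Omega> (avg g n - avg g (n - 1)) (Q v - v)"
    unfolding defect_eq[OF n(2) v] defect_eq[OF n' v] by (rule l2.diff_left[OF L, symmetric])
  then have "\<bar>defect n v - defect (n - 1) v\<bar> \<le> kap * l2norm \<Omega> (avg g n - avg g (n - 1)) * sqrt (ah v v)"
    using ip_smoother_le[of "avg g n - avg g (n - 1)" v] L v by (metis l2.X_closed(3))
  also have "\<dots> \<le> kap * (win gt n + win gt (n - 1)) * sqrt (ah v v)"
    using v by (intro mult_right_mono mult_left_mono avg_g_increment n kap_nonneg) (auto simp: en.pos)
  finally show ?thesis .
qed

definition kap' :: real where "kap' = C1 * diameter (closure \<Omega>) powr (2 - 2 * \<gamma>) / sqrt \<alpha>"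

lemma kap_le: "kap \<le> kap' * H"
proof -
  have "C1 / sqrt \<alpha> * hh powr 2 \<le> C1 / sqrt \<alpha> * (diameter (closure \<Omega>) powr (2 - 2 * \<gamma>) * H)"
    using pos by (intro mult_left_mono mesh_size_square) auto
  then show ?thesis by (simp add: kap_def kap'_def)
qed

lemma sum_windows_le:
  assumes m: "Suc m \<le> N" and int: "\<phi> integrable_on {0..T}" and nn: "\<And>t. t \<in> {0..T} \<Longrightarrow> 0 \<le> \<phi> t"
  shows "(\<Sum>n\<le>m. win \<phi> n) \<le> 2 * integral {0..T} \<phi>"
  using sum_window_integrals_le[OF less_imp_le[OF k_pos] _ int nn] tm_in[OF m] unfolding tm_def by simp

lemma discrete_error:
  assumes m: "Suc m \<le> N" "1 \<le> m"
  defines "a \<equiv> Linf_norm T hsn ut" and "b \<equiv> Linf_norm T (l2norm \<Omega>) uttt"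
    and "F \<equiv> Linf_norm T (l2norm \<Omega>) f + Linf_norm T (l2norm \<Omega>) utt"
    and "x \<equiv> integral {0..T} (\<lambda>t. hsn (utt t))" and "y \<equiv> integral {0..T} (\<lambda>t. l2norm \<Omega> (utttt t))"
    and "z \<equiv> integral {0..T} gt"
  shows "l2norm \<Omega> (Z (Suc m) - U (Suc m)) \<le> T * ((C2 * H * a + 2 * k\<^sup>2 * b) + 3 * (kap * F) + (4 * (C2 * H * x) + 8 * (k\<^sup>2 * y)) + 8 * (kap * z))"
proof -
  interpret hs: semi_inner "Hs (2 + \<gamma>) \<Omega>" "Hs_ip (2 + \<gamma>) \<Omega>" hsn by (rule hs)
  let ?u = "\<lambda>t. hsn (utt t)" and ?v = "\<lambda>t. l2norm \<Omega> (utttt t)"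
  \<comment> \<open>For \<open>n \<ge> 1\<close> the residual bound is available with the factor
    \<open>k\<close>, so it is divided out here and restored by the \<open>2 * k\<close> of the
    stability estimate.\<close>
  define \<rho> where "\<rho> n = (if n = 0 then C2 * H * a + 2 * k\<^sup>2 * b else (C2 * H * win ?u n + 2 * k\<^sup>2 * win ?v n) / k)" for n
  \<comment> \<open>Nonnegativity is demanded for every index, while the windows are only known to
    lie in the time interval for indices up to \<open>m\<close>; elsewhere 0 is used.\<close>
  define \<delta> where "\<delta> n = (if 1 \<le> n \<and> n \<le> m then kap * (win gt n + win gt (n - 1)) else 0)" for n
  have \<delta>0: "0 \<le> \<delta> n" for n
  proof (cases "1 \<le> n \<and> n \<le> m")
    case True
    have "0 \<le> kap * (win gt n + win gt (n - 1))"
      by (intro mult_nonneg_nonneg add_nonneg_nonneg kap_nonneg win_gt_nonneg) (use True m in auto)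
    then show ?thesis unfolding \<delta>_def using True by (simp only: if_True simp_thms)
  next
    case False
    then show ?thesis unfolding \<delta>_def by (simp only: if_False order_refl)
  qed
  have err_eq: "err (Suc m) = Z (Suc m) - U (Suc m)" by (simp add: err_def)
  have F0: "0 \<le> F" using g_sup[OF le0] l2.N_nonneg[OF in_spaces(5)[OF le0]] unfolding F_def by linarith
  have "l2norm \<Omega> (err (Suc m)) \<le> real (Suc m) * k * (\<rho> 0 + 3 * (kap * F) + (\<Sum>n=1..m. 2 * k * \<rho> n + 2 * \<delta> n))"
  proof (rule newmark_stability[where X = "L2 \<Omega>" and B = "ip \<Omega>" and N = "l2norm \<Omega>" and V = Vh and A = ah and M = "\<lambda>v. sqrt (ah v v)" and \<theta> = err and r = res and l = defect and \<rho> = \<rho> and \<delta> = \<delta> and G = "kap * F"])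
    show "semi_inner (L2 \<Omega>) (ip \<Omega>) (l2norm \<Omega>)" by (rule l2.semi_inner_axioms)
    show "semi_inner Vh ah (\<lambda>v. sqrt (ah v v))" by (rule en.semi_inner_axioms)
    show "Vh \<subseteq> L2 \<Omega>" using Vh_L2 by blast
    show "0 < k" by (rule k_pos)
    show "err n \<in> Vh" if "n \<le> Suc m" for n using that m by (intro err(1)) simp
    show "err 0 = 0" by (simp add: err_def)
    show "defect n (c *\<^sub>R v + d *\<^sub>R w) = c * defect n v + d * defect n w" if n: "n \<le> m" and v: "v \<in> Vh" and w: "w \<in> Vh" for n c d v w
    proof -
      have n': "n < N" using n m by simp
      show ?thesis unfolding defect_def using avg_in[OF n'] v w Vh_L2[OF v] Vh_L2[OF w]
        by (simp add: en.B_linear l2.B_linear algebra_simps)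
    qed
    show "2 / k * ip \<Omega> ((1 / k) *\<^sub>R (err 1 - err 0)) v + ah ((1 / 2) *\<^sub>R (err 1 + err 0)) v = 2 / k * ip \<Omega> (res 0) v + defect 0 v" if "v \<in> Vh" for v
      by (rule error_start[OF that])
    show "ip \<Omega> ((1 / k\<^sup>2) *\<^sub>R (err (n + 1) - 2 *\<^sub>R err n + err (n - 1))) v + ah ((1 / 4) *\<^sub>R (err (n + 1) + 2 *\<^sub>R err n + err (n - 1))) v
      = ip \<Omega> (res n) v + defect n v" if "1 \<le> n" "n \<le> m" "v \<in> Vh" for n v
      by (rule error_step) (use that m in auto)
    show "res n \<in> L2 \<Omega> \<and> l2norm \<Omega> (res n) \<le> \<rho> n" if n: "n \<le> m" for n
    proof (cases "n = 0")
      case True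
      show ?thesis using res_start_bound unfolding True \<rho>_def a_def b_def by simp
    next
      case False
      then have n': "1 \<le> n" "n < N" using n m by auto
      have "l2norm \<Omega> (res n) \<le> \<rho> n" using res_bound(2)[OF n'] k_pos False by (simp add: \<rho>_def pos_le_divide_eq mult.commute)
      then show ?thesis using res_bound(1)[OF n'] by simp
    qed
    show "0 \<le> kap * F" using kap_nonneg F0 by simp
    show "\<bar>defect n v\<bar> \<le> kap * F * sqrt (ah v v)" if "n \<le> m" "v \<in> Vh" for n v
      unfolding F_def using that m by (intro defect_bound) auto
    show "0 \<le> \<delta> n" for n by (rule \<delta>0)
    show "\<bar>defect n v - defect (n - 1) v\<bar> \<le> \<delta> n * sqrt (ah v v)" if n: "1 \<le> n" "n \<le> m" and v: "v \<in> Vh" for n v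
    proof -
      have n': "n < N" using n m by simp
      show ?thesis using defect_increment[OF n(1) n' v] n by (simp only: \<delta>_def if_True simp_thms)
    qed
  qed
  also have "\<dots> \<le> T * ((C2 * H * a + 2 * k\<^sup>2 * b) + 3 * (kap * F) + ((4 * (C2 * H * x) + 8 * (k\<^sup>2 * y)) + 8 * (kap * z)))"
  proof (rule mult_mono)
    show "real (Suc m) * k \<le> T" using tm_in[OF m(1)] by (simp add: tm_def)
    have ui: "?u integrable_on {0..T}" "?v integrable_on {0..T}"
      by (rule hs.cont_curve_N_integrable[OF utt_Hs_cont order_refl], rule l2.cont_curve_N_integrable[OF utttt_cont order_refl])
    have u0: "0 \<le> ?u t" "0 \<le> ?v t" if "t \<in> {0..T}" for t
      by (rule hs.N_nonneg[OF hs.cont_curve_in[OF utt_Hs_cont that]], rule l2.N_nonneg[OF l2.cont_curve_in[OF utttt_cont that]])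
    have nn: "0 \<le> win \<phi> n" if \<phi>: "\<phi> integrable_on {0..T}" "\<And>t. t \<in> {0..T} \<Longrightarrow> 0 \<le> \<phi> t" and n: "n \<le> m" for \<phi> n
    proof -
      have "tm (n - 1) \<in> {0..T}" "tm (n + 1) \<in> {0..T}" using n m by (auto intro!: tm_in simp del: atLeastAtMost_iff)
      then have "{tm (n - 1)..tm (n + 1)} \<subseteq> {0..T}" by auto
      then show ?thesis using \<phi>(2) by (intro integral_nonneg integrable_on_subinterval[OF \<phi>(1)]) auto
    qed
    \<comment> \<open>The shifted sum occurs because the increments of the averages involve two
      consecutive windows.\<close>
    have w: "(\<Sum>n=1..m. win \<phi> n) \<le> 2 * integral {0..T} \<phi>" "(\<Sum>n=1..m. win \<phi> (n - 1)) \<le> 2 * integral {0..T} \<phi>"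
      if \<phi>: "\<phi> integrable_on {0..T}" "\<And>t. t \<in> {0..T} \<Longrightarrow> 0 \<le> \<phi> t" for \<phi>
    proof -
      have s: "(\<Sum>n\<le>m. win \<phi> n) \<le> 2 * integral {0..T} \<phi>" by (rule sum_windows_le[OF m(1) \<phi>])
      have "(\<Sum>n=1..m. win \<phi> n) \<le> (\<Sum>n\<le>m. win \<phi> n)" by (rule sum_mono2[OF _ _ nn[OF \<phi>]]) auto
      then show "(\<Sum>n=1..m. win \<phi> n) \<le> 2 * integral {0..T} \<phi>" using s by (rule order_trans)
      have "(\<Sum>n=1..m. win \<phi> (n - 1)) = (\<Sum>n<m. win \<phi> n)"
        by (rule sum.reindex_bij_witness[of _ Suc "\<lambda>n. n - 1"]) auto
      also have "\<dots> \<le> (\<Sum>n\<le>m. win \<phi> n)" by (rule sum_mono2[OF _ _ nn[OF \<phi>]]) auto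
      finally show "(\<Sum>n=1..m. win \<phi> (n - 1)) \<le> 2 * integral {0..T} \<phi>" using s by (rule order_trans)
    qed
    have "(\<Sum>n=1..m. 2 * k * \<rho> n + 2 * \<delta> n)
      = (\<Sum>n=1..m. 2 * (C2 * H) * win ?u n + 4 * k\<^sup>2 * win ?v n + 2 * kap * win gt n + 2 * kap * win gt (n - 1))"
      using k_pos by (intro sum.cong refl) (auto simp: \<rho>_def \<delta>_def field_simps)
    also have "\<dots> = 2 * (C2 * H) * (\<Sum>n=1..m. win ?u n) + 4 * k\<^sup>2 * (\<Sum>n=1..m. win ?v n) + 2 * kap * (\<Sum>n=1..m. win gt n) + 2 * kap * (\<Sum>n=1..m. win gt (n - 1))"
      by (simp only: sum.distrib sum_distrib_left)
    \<comment> \<open>Each sum of windows doubles the integral, and the two sums of windows of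
      \<open>gt\<close> combine; this produces the factors 4, 8 and 8.\<close>
    also have "\<dots> \<le> 2 * (C2 * H) * (2 * x) + 4 * k\<^sup>2 * (2 * y) + 2 * kap * (2 * z) + 2 * kap * (2 * z)"
      unfolding x_def y_def z_def using pos kap_nonneg u0
      by (intro add_mono mult_left_mono w ui gt_integrable order_refl gt_nonneg) auto
    also have "\<dots> = (4 * (C2 * H * x) + 8 * (k\<^sup>2 * y)) + 8 * (kap * z)" by (simp add: algebra_simps)
    finally have s: "(\<Sum>n=1..m. 2 * k * \<rho> n + 2 * \<delta> n) \<le> (4 * (C2 * H * x) + 8 * (k\<^sup>2 * y)) + 8 * (kap * z)" .
    have \<rho>0: "\<rho> 0 = C2 * H * a + 2 * k\<^sup>2 * b" by (simp add: \<rho>_def)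
    show "\<rho> 0 + 3 * (kap * F) + (\<Sum>n=1..m. 2 * k * \<rho> n + 2 * \<delta> n)
      \<le> (C2 * H * a + 2 * k\<^sup>2 * b) + 3 * (kap * F) + ((4 * (C2 * H * x) + 8 * (k\<^sup>2 * y)) + 8 * (kap * z))"
      unfolding \<rho>0 by (rule add_left_mono[OF s])
    show "0 \<le> T" using T by simp
    have "0 \<le> \<rho> 0" using order_trans[OF l2.N_nonneg[OF res_start_bound(1)] res_start_bound(2)] by (simp add: \<rho>_def a_def b_def)
    moreover have "0 \<le> \<rho> n" if "n \<in> {1..m}" for n
    proof -
      have n: "n \<noteq> 0" "n \<le> m" using that by auto
      have "0 \<le> (C2 * H * win ?u n + 2 * k\<^sup>2 * win ?v n) / k"
        using pos k_pos by (intro divide_nonneg_pos add_nonneg_nonneg mult_nonneg_nonneg nn[OF ui(1) u0(1) n(2)] nn[OF ui(2) u0(2) n(2)]) auto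
      then show ?thesis unfolding \<rho>_def using n(1) by (simp only: if_False)
    qed
    ultimately show "0 \<le> \<rho> 0 + 3 * (kap * F) + (\<Sum>n=1..m. 2 * k * \<rho> n + 2 * \<delta> n)"
      using kap_nonneg F0 k_pos \<delta>0 by (intro add_nonneg_nonneg sum_nonneg mult_nonneg_nonneg) auto
  qed
  finally show ?thesis unfolding err_eq by (simp only: add.assoc)
qed

text \<open>The sum of all coefficients in the bound. The leading \<open>C2\<close> is the Ritz
  error at the final time; inside the factor \<open>T\<close> the terms belong, in this order, to
  the norms of u_t, of \<open>f\<close> and u_tt, of u_tt in the strong norm, of f_t and u_ttt, of
  u_ttt in the supremum norm, and of u_tttt.\<close>

definition err_const :: real where
  "err_const = C2 + T * (C2 + 3 * kap' + 4 * C2 * sqrt T + 8 * kap' * sqrt T + 2 + 8 * sqrt T)"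

lemma error_estimate:
  assumes m: "Suc m \<le> N" "1 \<le> m"
  shows "l2norm \<Omega> (u (tm (Suc m)) - U (Suc m)) \<le> err_const * (H * L_bound \<Omega> T \<gamma> f ft u ut utt uttt + k\<^sup>2 * M_bound \<Omega> T uttt utttt)"
proof -
  interpret hs: semi_inner "Hs (2 + \<gamma>) \<Omega>" "Hs_ip (2 + \<gamma>) \<Omega>" hsn by (rule hs)
  let ?l = "l2norm \<Omega>"
  define Fn where "Fn = Linf_norm T ?l f"
  define Wn where "Wn = Linf_norm T ?l utt"
  define Vn where "Vn = Linf_norm T hsn u"
  define An where "An = Linf_norm T hsn ut"
  define Bn where "Bn = Linf_norm T ?l uttt"
  define p where "p = L2_time_norm T ?l ft"
  define q where "q = L2_time_norm T ?l uttt"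
  define x where "x = L2_time_norm T hsn utt"
  define y where "y = L2_time_norm T ?l utttt"
  have zT: "0 \<in> {0..T}" using T by simp
  have nn: "0 \<le> Fn" "0 \<le> Wn" "0 \<le> Vn" "0 \<le> An" "0 \<le> Bn"
    unfolding Fn_def Wn_def Vn_def An_def Bn_def
    by (rule order_trans[OF l2.N_nonneg[OF l2.cont_curve_in[OF f_cont zT]] cont_curve_Linf(2)[OF T l2.semi_inner_axioms f_cont zT]],
        rule order_trans[OF l2.N_nonneg[OF l2.cont_curve_in[OF utt_cont zT]] cont_curve_Linf(2)[OF T l2.semi_inner_axioms utt_cont zT]],
        rule order_trans[OF hs.N_nonneg[OF hs.cont_curve_in[OF u_Hs_cont zT]] cont_curve_Linf(2)[OF T hs u_Hs_cont zT]],
        rule order_trans[OF hs.N_nonneg[OF hs.cont_curve_in[OF ut_Hs_cont zT]] cont_curve_Linf(2)[OF T hs ut_Hs_cont zT]],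
        rule order_trans[OF l2.N_nonneg[OF l2.cont_curve_in[OF uttt_cont zT]] cont_curve_Linf(2)[OF T l2.semi_inner_axioms uttt_cont zT]])
  have nn2: "0 \<le> p" "0 \<le> q" "0 \<le> x" "0 \<le> y" by (auto simp: p_def q_def x_def y_def L2_time_norm_def)
  have ints: "integral {0..T} (\<lambda>t. hsn (utt t)) \<le> sqrt T * x" "integral {0..T} (\<lambda>t. ?l (utttt t)) \<le> sqrt T * y"
    unfolding x_def y_def by (rule integral_le_L2_time_norm[OF T hs utt_Hs_cont], rule integral_le_L2_time_norm[OF T l2.semi_inner_axioms utttt_cont])
  have gi: "integral {0..T} gt \<le> sqrt T * (p + q)"
  proof -
    have "integral {0..T} gt = integral {0..T} (\<lambda>t. ?l (ft t)) + integral {0..T} (\<lambda>t. ?l (uttt t))"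
      by (rule integral_add[OF l2.cont_curve_N_integrable[OF ft_cont order_refl] l2.cont_curve_N_integrable[OF uttt_cont order_refl]])
    also have "\<dots> \<le> sqrt T * p + sqrt T * q" unfolding p_def q_def
      by (rule add_mono[OF integral_le_L2_time_norm[OF T l2.semi_inner_axioms ft_cont] integral_le_L2_time_norm[OF T l2.semi_inner_axioms uttt_cont]])
    finally show ?thesis by (simp add: distrib_left)
  qed
  have k0: "0 \<le> kap'" using pos by (simp add: kap'_def)
  have H0: "0 \<le> H" by simp
  have tin: "tm (Suc m) \<in> {0..T}" by (rule tm_in[OF m(1)])
  have "?l (u (tm (Suc m)) - Z (Suc m)) \<le> C2 * H * hsn (u (tm (Suc m)))"
    by (rule represents_estimate[OF Z_represents[OF m(1)] u_Hs[OF tin]])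
  also have "\<dots> \<le> C2 * H * Vn"
    unfolding Vn_def using pos by (intro mult_left_mono cont_curve_Linf(2)[OF T hs u_Hs_cont tin]) auto
  finally have e1: "?l (u (tm (Suc m)) - Z (Suc m)) \<le> C2 * H * Vn" .
  have "?l (Z (Suc m) - U (Suc m)) \<le> T * ((C2 * H * An + 2 * k\<^sup>2 * Bn) + 3 * (kap * (Fn + Wn))
      + (4 * (C2 * H * integral {0..T} (\<lambda>t. hsn (utt t))) + 8 * (k\<^sup>2 * integral {0..T} (\<lambda>t. ?l (utttt t)))) + 8 * (kap * integral {0..T} gt))"
    unfolding An_def Bn_def Fn_def Wn_def by (rule discrete_error[OF m])
  also have "\<dots> \<le> T * ((C2 * H * An + 2 * k\<^sup>2 * Bn) + 3 * (kap' * H * (Fn + Wn))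
      + (4 * (C2 * H * (sqrt T * x)) + 8 * (k\<^sup>2 * (sqrt T * y))) + 8 * (kap' * H * (sqrt T * (p + q))))"
  proof (intro mult_left_mono add_mono order_refl ints)
    show "kap * (Fn + Wn) \<le> kap' * H * (Fn + Wn)" using kap_le nn by (intro mult_right_mono) auto
    show "kap * integral {0..T} gt \<le> kap' * H * (sqrt T * (p + q))"
      using gi kap_le k0 gt_nonneg by (intro mult_mono integral_nonneg gt_integrable order_refl) auto
  qed (use pos T in auto)
  finally have e2: "?l (Z (Suc m) - U (Suc m)) \<le> T * ((C2 * H * An + 2 * k\<^sup>2 * Bn) + 3 * (kap' * H * (Fn + Wn))
      + (4 * (C2 * H * (sqrt T * x)) + 8 * (k\<^sup>2 * (sqrt T * y))) + 8 * (kap' * H * (sqrt T * (p + q))))" .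
  define c where "c = err_const"
  have sT: "0 \<le> sqrt T" "0 \<le> T" using T by auto
  have c: "C2 \<le> c" "T * C2 \<le> c" "T * (3 * kap') \<le> c" "T * (4 * C2 * sqrt T) \<le> c" "T * (8 * kap' * sqrt T) \<le> c" "T * 2 \<le> c" "T * (8 * sqrt T) \<le> c"
  proof -
    have n: "0 \<le> C2" "0 \<le> T * C2" "0 \<le> T * (3 * kap')" "0 \<le> T * (4 * C2 * sqrt T)" "0 \<le> T * (8 * kap' * sqrt T)" "0 \<le> T * 2" "0 \<le> T * (8 * sqrt T)"
      using pos k0 sT by auto
    have e: "c = C2 + (T * C2 + T * (3 * kap') + T * (4 * C2 * sqrt T) + T * (8 * kap' * sqrt T) + T * 2 + T * (8 * sqrt T))"
      unfolding c_def err_const_def by (simp only: distrib_left)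
    show "C2 \<le> c" "T * C2 \<le> c" "T * (3 * kap') \<le> c" "T * (4 * C2 * sqrt T) \<le> c" "T * (8 * kap' * sqrt T) \<le> c" "T * 2 \<le> c" "T * (8 * sqrt T) \<le> c"
      unfolding e using n by linarith+
  qed
  have "?l (u (tm (Suc m)) - U (Suc m)) \<le> ?l (u (tm (Suc m)) - Z (Suc m)) + ?l (Z (Suc m) - U (Suc m))"
    by (intro l2.N_diff_triangle in_spaces m)
  also have "\<dots> \<le> C2 * H * Vn + T * ((C2 * H * An + 2 * k\<^sup>2 * Bn) + 3 * (kap' * H * (Fn + Wn))
      + (4 * (C2 * H * (sqrt T * x)) + 8 * (k\<^sup>2 * (sqrt T * y))) + 8 * (kap' * H * (sqrt T * (p + q))))"
    by (rule add_mono[OF e1 e2])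
  also have "\<dots> = H * (C2 * Vn + (T * C2) * An + (T * (3 * kap')) * (Fn + Wn) + (T * (4 * C2 * sqrt T)) * x + (T * (8 * kap' * sqrt T)) * (p + q))
      + k\<^sup>2 * ((T * 2) * Bn + (T * (8 * sqrt T)) * y)"
    by (simp add: algebra_simps)
  also have "\<dots> \<le> H * (c * Vn + c * An + c * (Fn + Wn) + c * x + c * (p + q)) + k\<^sup>2 * (c * Bn + c * y)"
    using nn nn2 by (intro add_mono mult_left_mono mult_right_mono c) auto
  also have "\<dots> = c * (H * L_bound \<Omega> T \<gamma> f ft u ut utt uttt + k\<^sup>2 * M_bound \<Omega> T uttt utttt)"
    unfolding L_bound_def M_bound_def Fn_def Wn_def Vn_def An_def Bn_def p_def q_def x_def y_def by (simp add: algebra_simps)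
  finally show ?thesis unfolding c_def .
qed

end

theorem mainTheorem10:
  fixes \<Omega> :: "(real^2) set" and T \<gamma>\<^sub>0 \<alpha> \<beta> C1 C2 :: real
  assumes "lipschitz_domain \<Omega>" and "polygonal \<Omega>" and "T > 0"
    and "1/2 < \<gamma>\<^sub>0" and "\<gamma>\<^sub>0 \<le> 1" and "elliptic_regularity \<Omega> \<gamma>\<^sub>0"
    and "\<alpha> > 0" and "\<beta> > 0" and "C1 > 0" and "C2 > 0"
  shows "\<exists>C>0. \<forall>lam \<psi> u0 v0 f ft ftt fttt u ut.
    eigenbasis \<Omega> lam \<psi> \<and> data_regular \<Omega> T lam \<psi> u0 v0 f ft ftt fttt \<and>
    weak_solution \<Omega> T f u0 v0 u ut \<longrightarrow>
    (\<exists>utt uttt utttt. solution_regular \<Omega> T \<gamma>\<^sub>0 u ut utt uttt utttt \<and>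
      (\<forall>\<kappa> \<T> Vh ah IM J Rh N U.
        \<kappa> > 0 \<and> mesh_of \<Omega> \<T> \<and> shape_regular \<kappa> \<T> \<and>
        fin_dim_subspace Vh \<and> Vh \<subseteq> H2_mesh \<T> \<and> discrete_form \<Omega> \<T> \<alpha> \<beta> Vh ah \<and>
        morley_interpolation \<Omega> \<T> IM \<and> companion \<Omega> \<T> J \<and>
        smoother_estimate \<Omega> \<T> C1 Vh (J \<circ> IM) \<and>
        ritz_projection \<Omega> Vh ah (J \<circ> IM) Rh \<and> ritz_estimate \<Omega> \<T> \<gamma>\<^sub>0 C2 Rh \<and>
        N \<ge> 1 \<and> implicit_scheme \<Omega> (T / real N) N Vh ah Rh u0 v0 f U \<longrightarrow>
        (\<forall>m\<in>{1..N - 1}.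
          l2norm \<Omega> (\<lambda>x. u (real (m + 1) * (T / real N)) x - U (m + 1) x)
            \<le> C * (mesh_size \<T> powr (2 * \<gamma>\<^sub>0) * L_bound \<Omega> T \<gamma>\<^sub>0 f ft u ut utt uttt
                    + (T / real N)\<^sup>2 * M_bound \<Omega> T uttt utttt))))"
proof -
  \<comment> \<open>The constants \<open>kap'\<close> and \<open>err_const\<close> are repeated
    outside their context, because the witness must be fixed before the data and the mesh;
    \<open>kap'\<close> involves the mesh only through the diameter of the domain.\<close>
  define \<kappa>' where "\<kappa>' = C1 * diameter (closure \<Omega>) powr (2 - 2 * \<gamma>\<^sub>0) / sqrt \<alpha>"
  define C where "C = C2 + T * (C2 + 3 * \<kappa>' + 4 * C2 * sqrt T + 8 * \<kappa>' * sqrt T + 2 + 8 * sqrt T)"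
  have "0 \<le> \<kappa>'" unfolding \<kappa>'_def using assms by simp
  then have "0 \<le> T * (C2 + 3 * \<kappa>' + 4 * C2 * sqrt T + 8 * \<kappa>' * sqrt T + 2 + 8 * sqrt T)"
    using assms by (intro mult_nonneg_nonneg add_nonneg_nonneg) auto
  then have C: "C > 0" unfolding C_def using \<open>C2 > 0\<close> by linarith
  have dom: "open \<Omega>" "bounded \<Omega>" "\<Omega> \<noteq> {}" using assms(1) unfolding lipschitz_domain_def by blast+
  show ?thesis
  proof (intro exI[of _ C] conjI C allI impI, elim conjE)
    fix lam \<psi> u0 v0 f ft ftt fttt u ut
    assume eb: "eigenbasis \<Omega> lam \<psi>" and data: "data_regular \<Omega> T lam \<psi> u0 v0 f ft ftt fttt"
      and sol: "weak_solution \<Omega> T f u0 v0 u ut"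
    interpret wave \<Omega> lam \<psi> \<gamma>\<^sub>0 T u0 v0 f ft ftt fttt u ut
      by unfold_locales (use dom eb data sol assms in auto)
    show "\<exists>utt uttt utttt. solution_regular \<Omega> T \<gamma>\<^sub>0 u ut utt uttt utttt \<and>
      (\<forall>\<kappa> \<T> Vh ah IM J Rh N U.
        \<kappa> > 0 \<and> mesh_of \<Omega> \<T> \<and> shape_regular \<kappa> \<T> \<and>
        fin_dim_subspace Vh \<and> Vh \<subseteq> H2_mesh \<T> \<and> discrete_form \<Omega> \<T> \<alpha> \<beta> Vh ah \<and>
        morley_interpolation \<Omega> \<T> IM \<and> companion \<Omega> \<T> J \<and>
        smoother_estimate \<Omega> \<T> C1 Vh (J \<circ> IM) \<and>
        ritz_projection \<Omega> Vh ah (J \<circ> IM) Rh \<and> ritz_estimate \<Omega> \<T> \<gamma>\<^sub>0 C2 Rh \<and>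
        N \<ge> 1 \<and> implicit_scheme \<Omega> (T / real N) N Vh ah Rh u0 v0 f U \<longrightarrow>
        (\<forall>m\<in>{1..N - 1}.
          l2norm \<Omega> (\<lambda>x. u (real (m + 1) * (T / real N)) x - U (m + 1) x)
            \<le> C * (mesh_size \<T> powr (2 * \<gamma>\<^sub>0) * L_bound \<Omega> T \<gamma>\<^sub>0 f ft u ut utt uttt
                    + (T / real N)\<^sup>2 * M_bound \<Omega> T uttt utttt)))"
    proof (intro exI[of _ utt] exI[of _ uttt] exI[of _ utttt] conjI solution_is_regular allI impI ballI, elim conjE)
      fix \<kappa> :: real and \<T> Vh ah IM J Rh and N :: nat and U m
      assume m: "m \<in> {1..N - 1}"
      assume d: "mesh_of \<Omega> \<T>" "fin_dim_subspace Vh" "Vh \<subseteq> H2_mesh \<T>" "discrete_form \<Omega> \<T> \<alpha> \<beta> Vh ah"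
        "morley_interpolation \<Omega> \<T> IM" "companion \<Omega> \<T> J" "smoother_estimate \<Omega> \<T> C1 Vh (J \<circ> IM)"
        "ritz_projection \<Omega> Vh ah (J \<circ> IM) Rh" "ritz_estimate \<Omega> \<T> \<gamma>\<^sub>0 C2 Rh"
        "N \<ge> 1" "implicit_scheme \<Omega> (T / real N) N Vh ah Rh u0 v0 f U"
      interpret fully_discrete \<Omega> lam \<psi> \<gamma>\<^sub>0 T u0 v0 f ft ftt fttt u ut \<T> Vh ah IM J Rh \<alpha> \<beta> C1 C2 N U
        by unfold_locales (use dom d assms in auto)
      have "Suc m \<le> N" "1 \<le> m" using m d(10) by auto
      from error_estimate[OF this]
      show "l2norm \<Omega> (\<lambda>x. u (real (m + 1) * (T / real N)) x - U (m + 1) x)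
            \<le> C * (mesh_size \<T> powr (2 * \<gamma>\<^sub>0) * L_bound \<Omega> T \<gamma>\<^sub>0 f ft u ut utt uttt
                    + (T / real N)\<^sup>2 * M_bound \<Omega> T uttt utttt)"
        unfolding err_const_def kap'_def tm_def k_def C_def \<kappa>'_def fun_diff_def by simp
    qed
  qed
qed

end
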